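(* Let $\mu\in(-1,1)\setminus\{0\}$, let $P$ be the quantum Hopf fibration, let $\nabla$ be its canonical (Levi-Civita) bundle derivative extended to the affine horizontal forms algebra $\mathfrak{h}[\widetilde P]=\mathrm{hor}_P\otimes S(\mathbb{V})$ with translational part $\lambda(\theta)=\theta_\wedge$, let $\varrho_\nabla\colon\widetilde{\mathcal{A}}\to\mathfrak{h}[\widetilde P]$ be its curvature map, and let $\Upsilon$ be the bicovariant $*$-calculus over $\widetilde G$ associated to $\nabla$ (all described in the context). Then $$\varrho_\nabla(\xi^p\xi^{*q})=c_{pq}\,w\otimes\xi^p\xi^{*q}\qquad\text{for all integers }p,q\ge0\text{ with }p+q>0,$$ where $$w=\frac{\mu^3}{1-\mu^2}\,\eta_-\eta_+,\qquad c_{pq}=\prod_{i=1}^p\Bigl(1-\frac1{\mu^{2i+2}}\Bigr)\prod_{j=1}^q\bigl(1-\mu^{2j+2}\bigr).$$ In particular, the space $\Upsilon_{inv}$ is infinite-dimensional, with a natural basis $\{e_{pq}\mid p,q\ge0\}$, where $e_{00}=\zeta$ and $e_{pq}=\widehat\pi(\xi^p\xi^{*q})$ for $(p,q)\ne(0,0)$. The vector $\zeta$ is cyclic and separating for the $\circ$-action of $S(\mathbb{V})$ on $\Upsilon_{inv}$ (that is, $\zeta\circ S(\mathbb{V})=\Upsilon_{inv}$, and $\zeta\circ\vartheta=0$ with $\vartheta\in S(\mathbb{V})$ implies $\vartheta=0$).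
   Context: The structure group is $G=\mathrm U(1)$: $\mathcal{A}$ is the Hopf $*$-algebra generated by a single unitary $U$ with $\phi(U)=U\otimes U$ (so $\epsilon(U)=1$, $\kappa(U)=U^*=U^{-1}$). $\mathcal{B}$ is the $*$-algebra of the quantum $\mathrm{SU}(2)$ group, generated by $\alpha,\gamma$ with $\alpha\alpha^*+\mu^2\gamma\gamma^*=1$, $\alpha^*\alpha+\gamma^*\gamma=1$, $\alpha\gamma=\mu\gamma\alpha$, $\alpha\gamma^*=\mu\gamma^*\alpha$, $\gamma\gamma^*=\gamma^*\gamma$; its coproduct is $\phi(u_{ij})=\sum_ku_{ik}\otimes u_{kj}$ for $u=\begin{pmatrix}\alpha&-\mu\gamma^*\\ \gamma&\alpha^*\end{pmatrix}$. The projection $\mathcal{B}\to\mathcal{A}$, $\alpha\mapsto U$, $\gamma\mapsto0$, induces from the coproduct the right coaction $F\colon\mathcal{B}\to\mathcal{B}\otimes\mathcal{A}$, $F(\alpha)=\alpha\otimes U$, $F(\gamma)=\gamma\otimes U$; $P$ is the resulting quantum $\mathrm U(1)$-bundle over a quantum $2$-sphere. Horizontal forms. $\Phi$ is Woronowicz's $3$-dimensional left-covariant $*$-calculus on quantum $\mathrm{SU}(2)$, with $\Phi_{inv}$ spanned by $\eta_3=\pi(\alpha-\alpha^* )$, $\eta_+=\pi(\gamma)$, $\eta_-=\pi(\gamma^* )$, where $\pi(b)=\kappa(b^{(1)})d(b^{(2)})$, and right $\mathcal{B}$-module structure $\eta_3\circ\alpha=\mu^{-2}\eta_3$, $\eta_\pm\circ\alpha=\mu^{-1}\eta_\pm$,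 $\eta_3\circ\alpha^*=\mu^2\eta_3$, $\eta_\pm\circ\alpha^*=\mu\eta_\pm$, $\Phi_{inv}\circ\gamma=\Phi_{inv}\circ\gamma^*=\{0\}$. $\Phi^\wedge$ is its universal differential envelope, in which $\eta_\pm^2=\eta_3^2=0$, $\eta_+\eta_-=-\mu^2\eta_-\eta_+$, $\eta_3\eta_\pm=\mu^{\mp4}\eta_\pm\eta_3$. $\mathrm{hor}_P\subset\Phi^\wedge$ is the subalgebra generated by $\mathcal{B}$ and $\eta_+,\eta_-$. $\mathbb{V}$ is the span of $\eta_\pm$ with coaction $\varkappa(\eta_+)=\eta_+\otimes U^2$, $\varkappa(\eta_-)=\eta_-\otimes U^{-2}$, right $\mathcal{A}$-module structure $\eta_\pm\circ U=\mu^{-1}\eta_\pm$, and $\eta_+^*=\mu\eta_-$. Thus $\mathrm{hor}_P=\mathcal{B}\otimes\mathbb{V}^\wedge$ where $\mathbb{V}^\wedge$ is the algebra with relations $\eta_\pm^2=0$, $\eta_+\eta_-=-\mu^2\eta_-\eta_+$, with $\theta b=\sum_kb_k(\theta\circ c_k)$ for $F(b)=\sum_kb_k\otimes c_k$, $\theta\in\mathbb{V}$; $F^\wedge\colon\mathrm{hor}_P\to\mathrm{hor}_P\otimes\mathcal{A}$ extends $F$ and $\varkappa$. $\nabla\colon\mathrm{hor}_P\to\mathrm{hor}_P$ is the composition of $d\colon\Phi^\wedge\to\Phi^\wedge$ (restricted to $\mathrm{hor}_P$) with the projection $\Phi^\wedge\to\mathrm{hor}_P$ annihilating $\eta_3$;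 it is a hermitian $F^\wedge$-covariant antiderivation of degree $1$ (so $\nabla\alpha=-\mu\gamma^*\eta_+$, $\nabla\gamma=\alpha^*\eta_+$, $\nabla\alpha^*=-\mu\gamma\eta_-$, $\nabla\gamma^*=\alpha\eta_-$, $\nabla\eta_\pm=0$). Affine extension. $S(\mathbb{V})$ is the $*$-algebra generated by $\xi,\xi^*$ (corresponding to $\eta_+$ and $\mu\eta_-$, regarded as elements of a second copy of $\mathbb{V}$) with the single relation $\xi\xi^*=\mu^2\xi^*\xi$. $\widetilde{\mathcal{A}}$ is the Hopf $*$-algebra generated by the unitary $U$ and $\xi,\xi^*$ with $\xi\xi^*=\mu^2\xi^*\xi$, $\xi U=\mu^{-1}U\xi$, $\xi^*U=\mu^{-1}U\xi^*$, $\phi(U)=U\otimes U$, $\phi(\xi)=1\otimes\xi+\xi\otimes U^2$, $\epsilon(\xi)=0$; it represents the affine quantum group $\widetilde G$. $\mathfrak{h}[\widetilde P]=\mathrm{hor}_P\otimes S(\mathbb{V})$ is the $*$-algebra with product $(\psi\otimes\vartheta)(\varphi\otimes\eta)=\sum_k\psi\varphi_k\otimes(\vartheta\circ c_k)\eta$, $F^\wedge(\varphi)=\sum_k\varphi_k\otimes c_k$, where $\circ$ on $S(\mathbb{V})$ is multiplicative over the coproduct: $(\vartheta\eta)\circ a=(\vartheta\circ a^{(1)})(\eta\circ a^{(2)})$. $S(\mathbb{V})$ has horizontal degree $0$. $H\colon\mathfrak{h}[\widetilde P]\to\mathfrak{h}[\widetilde P]\otimes\widetilde{\mathcal{A}}$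 is the $*$-homomorphism extending $F^\wedge$ and $\phi{\restriction}S(\mathbb{V})$. The affine extension of $\nabla$ is the unique antiderivation $\nabla\colon\mathfrak{h}[\widetilde P]\to\mathfrak{h}[\widetilde P]$ of horizontal degree $1$ extending $\nabla$ on $\mathrm{hor}_P$ with $\nabla(\theta)=\theta_\wedge$ for $\theta\in\mathbb{V}\subset S(\mathbb{V})$, where $\theta_\wedge\in\mathbb{V}^\wedge\subset\mathrm{hor}_P$ is the same element regarded as a $1$-form. The curvature $\varrho_\nabla\colon\widetilde{\mathcal{A}}\to\mathfrak{h}[\widetilde P]$ is the unique linear map with $\nabla^2(\varphi)=-\sum_k\varphi_k\varrho_\nabla(c_k)$, $H(\varphi)=\sum_k\varphi_k\otimes c_k$, for all $\varphi\in\mathfrak{h}[\widetilde P]$. Calculus. $\Upsilon$ is the bicovariant first-order $*$-calculus over $\widetilde G$ based on the right ideal $\widetilde{\mathcal{R}}=\{a\in\widetilde{\mathcal{A}}:\epsilon(a)=0,\ \varrho_\nabla(a)=0\}$; $\Upsilon_{inv}=\ker(\epsilon)/\widetilde{\mathcal{R}}$, $\widehat\pi\colon\widetilde{\mathcal{A}}\to\Upsilon_{inv}$, $\widehat\pi(a)=[a-\epsilon(a)1]$, and $\circ$ is the right $\widetilde{\mathcal{A}}$-module structure $\widehat\pi(q)\circ\psi=\widehat\pi(q\psi)$ for $q\in\ker(\epsilon)$. $\zeta=\widehat\pi(U-U^* )$. *)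

theory Defs
  imports Complex_Main "HOL-Library.Poly_Mapping" "HOL-Library.FuncSet"
    "HOL-Algebra.Ideal" "HOL-Algebra.QuotRing" "HOL-Algebra.Module"
begin

section \<open>Complex vector spaces and algebras with carriers\<close>

text \<open>
  Vector spaces and (noncommutative) unital algebras over the complex numbers are records of the
  HOL-Algebra type \<^typ>\<open>(complex, 'a) module\<close>.  For a mere vector space the fields
  \<^const>\<open>mult\<close> and \<^const>\<open>one\<close> carry no information.
\<close>

definition complex_alg :: "(complex, complex) module" where
  "complex_alg = \<lparr>carrier = UNIV, mult = (*), one = 1, zero = 0, add = (+), smult = (*)\<rparr>"

definition linear_maps :: "(complex, 'a) module \<Rightarrow> (complex, 'b) module \<Rightarrow> ('a \<Rightarrow> 'b) set" where
  "linear_maps M N = {f. f \<in> carrier M \<rightarrow> carrier N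
     \<and> (\<forall>x\<in>carrier M. \<forall>y\<in>carrier M. f (x \<oplus>\<^bsub>M\<^esub> y) = f x \<oplus>\<^bsub>N\<^esub> f y)
     \<and> (\<forall>c. \<forall>x\<in>carrier M. f (c \<odot>\<^bsub>M\<^esub> x) = c \<odot>\<^bsub>N\<^esub> f x)}"

definition alg_homs :: "(complex, 'a) module \<Rightarrow> (complex, 'b) module \<Rightarrow> ('a \<Rightarrow> 'b) set" where
  "alg_homs M N = ring_hom M N \<inter> linear_maps M N"

text \<open>The algebra homomorphism determined by its values on a generating set, the values being
  given as a set of pairs (argument, value).\<close>

definition alg_ext ::
    "(complex, 'a) module \<Rightarrow> (complex, 'b) module \<Rightarrow> ('a \<times> 'b) set \<Rightarrow> 'a \<Rightarrow> 'b" where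
  "alg_ext M N V = (THE f. f \<in> alg_homs M N \<inter> extensional (carrier M) \<and> (\<forall>(x, y)\<in>V. f x = y))"

inductive_set subalg_gen :: "(complex, 'a) module \<Rightarrow> 'a set \<Rightarrow> 'a set"
  for M :: "(complex, 'a) module" and S :: "'a set" where
  gen: "x \<in> S \<Longrightarrow> x \<in> subalg_gen M S"
| one: "\<one>\<^bsub>M\<^esub> \<in> subalg_gen M S"
| add: "x \<in> subalg_gen M S \<Longrightarrow> y \<in> subalg_gen M S \<Longrightarrow> x \<oplus>\<^bsub>M\<^esub> y \<in> subalg_gen M S"
| mult: "x \<in> subalg_gen M S \<Longrightarrow> y \<in> subalg_gen M S \<Longrightarrow> x \<otimes>\<^bsub>M\<^esub> y \<in> subalg_gen M S"
| smult: "x \<in> subalg_gen M S \<Longrightarrow> c \<odot>\<^bsub>M\<^esub> x \<in> subalg_gen M S"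

definition lin_span :: "(complex, 'a) module \<Rightarrow> 'a set \<Rightarrow> 'a set" where
  "lin_span M S = {x. \<exists>K a. finite K \<and> K \<subseteq> S \<and> x = (\<Oplus>\<^bsub>M\<^esub>s\<in>K. a s \<odot>\<^bsub>M\<^esub> s)}"

definition finite_dimensional :: "(complex, 'a) module \<Rightarrow> bool" where
  "finite_dimensional M \<longleftrightarrow> (\<exists>K. finite K \<and> K \<subseteq> carrier M \<and> lin_span M K = carrier M)"

text \<open>A family is a basis if every vector is a linear combination of it in exactly one way.\<close>

definition basis_family :: "(complex, 'a) module \<Rightarrow> ('i \<Rightarrow> 'a) \<Rightarrow> bool" where
  "basis_family M e \<longleftrightarrow> (\<forall>i. e i \<in> carrier M) \<and>
     (\<forall>x\<in>carrier M. \<exists>!f :: 'i \<Rightarrow>\<^sub>0 complex.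
        x = (\<Oplus>\<^bsub>M\<^esub>i\<in>Poly_Mapping.keys f. Poly_Mapping.lookup f i \<odot>\<^bsub>M\<^esub> e i))"

text \<open>Quotient by a subspace; if the subspace is a two-sided ideal, this is the quotient algebra.\<close>

definition quot_mod :: "(complex, 'a) module \<Rightarrow> 'a set \<Rightarrow> (complex, 'a set) module" where
  "quot_mod M N = ring.extend (M Quot N)
     (module.fields (\<lambda>c X. \<Union>x\<in>X. N +>\<^bsub>M\<^esub> (c \<odot>\<^bsub>M\<^esub> x)))"

definition antiderivation ::
    "(complex, 'a) module \<Rightarrow> (nat \<Rightarrow> 'a set) \<Rightarrow> ('a \<Rightarrow> 'a) \<Rightarrow> bool" where
  "antiderivation M G D \<longleftrightarrow> D \<in> linear_maps M M
     \<and> (\<forall>k. D ` G k \<subseteq> G (Suc k))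
     \<and> (\<forall>k. \<forall>x\<in>G k. \<forall>y\<in>carrier M.
          D (x \<otimes>\<^bsub>M\<^esub> y) = (D x \<otimes>\<^bsub>M\<^esub> y) \<oplus>\<^bsub>M\<^esub> ((-1) ^ k \<odot>\<^bsub>M\<^esub> (x \<otimes>\<^bsub>M\<^esub> D y)))"


section \<open>Algebraic tensor products\<close>

definition free_pairs ::
    "(complex, 'a) module \<Rightarrow> (complex, 'b) module \<Rightarrow> (complex, ('a \<times> 'b) \<Rightarrow>\<^sub>0 complex) module" where
  "free_pairs M N = \<lparr>carrier = {f. Poly_Mapping.keys f \<subseteq> carrier M \<times> carrier N},
     mult = undefined, one = undefined, zero = 0, add = (+),
     smult = (\<lambda>c. Poly_Mapping.map ((*) c))\<rparr>"

definition bilinear_rels ::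
    "(complex, 'a) module \<Rightarrow> (complex, 'b) module \<Rightarrow> (('a \<times> 'b) \<Rightarrow>\<^sub>0 complex) set" where
  "bilinear_rels M N =
     {Poly_Mapping.single (x \<oplus>\<^bsub>M\<^esub> x', y) 1 - Poly_Mapping.single (x, y) 1
        - Poly_Mapping.single (x', y) 1
        | x x' y. x \<in> carrier M \<and> x' \<in> carrier M \<and> y \<in> carrier N}
   \<union> {Poly_Mapping.single (x, y \<oplus>\<^bsub>N\<^esub> y') 1 - Poly_Mapping.single (x, y) 1
        - Poly_Mapping.single (x, y') 1
        | x y y'. x \<in> carrier M \<and> y \<in> carrier N \<and> y' \<in> carrier N}
   \<union> {Poly_Mapping.single (c \<odot>\<^bsub>M\<^esub> x, y) 1 - Poly_Mapping.single (x, y) c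
        | c x y. x \<in> carrier M \<and> y \<in> carrier N}
   \<union> {Poly_Mapping.single (x, c \<odot>\<^bsub>N\<^esub> y) 1 - Poly_Mapping.single (x, y) c
        | c x y. x \<in> carrier M \<and> y \<in> carrier N}"

definition bilinear_null ::
    "(complex, 'a) module \<Rightarrow> (complex, 'b) module \<Rightarrow> (('a \<times> 'b) \<Rightarrow>\<^sub>0 complex) set" where
  "bilinear_null M N = lin_span (free_pairs M N) (bilinear_rels M N)"

definition tensor_space ::
    "(complex, 'a) module \<Rightarrow> (complex, 'b) module \<Rightarrow>
     (complex, (('a \<times> 'b) \<Rightarrow>\<^sub>0 complex) set) module" where
  "tensor_space M N = quot_mod (free_pairs M N) (bilinear_null M N)"

definition tens ::
    "(complex, 'a) module \<Rightarrow> (complex, 'b) module \<Rightarrow> 'a \<Rightarrow> 'b \<Rightarrow> (('a \<times> 'b) \<Rightarrow>\<^sub>0 complex) set" where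
  "tens M N x y = bilinear_null M N +>\<^bsub>free_pairs M N\<^esub> Poly_Mapping.single (x, y) 1"

text \<open>\<open>tens_sum L g X\<close> is \<open>\<Sum>\<^sub>k g x\<^sub>k y\<^sub>k\<close>, taken in \<open>L\<close>, for a decomposition
  \<open>X = \<Sum>\<^sub>k x\<^sub>k \<otimes> y\<^sub>k\<close>.  It is only used for \<open>g\<close> bilinear, when the choice of the decomposition
  does not matter.\<close>

definition tens_sum ::
    "(complex, 'c) module \<Rightarrow> ('a \<Rightarrow> 'b \<Rightarrow> 'c) \<Rightarrow> (('a \<times> 'b) \<Rightarrow>\<^sub>0 complex) set \<Rightarrow> 'c" where
  "tens_sum L g X = (let f = (SOME f. f \<in> X) in
     \<Oplus>\<^bsub>L\<^esub>p\<in>Poly_Mapping.keys f. Poly_Mapping.lookup f p \<odot>\<^bsub>L\<^esub> g (fst p) (snd p))"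

definition tensor_alg ::
    "(complex, 'a) module \<Rightarrow> (complex, 'b) module \<Rightarrow>
     (complex, (('a \<times> 'b) \<Rightarrow>\<^sub>0 complex) set) module" where
  "tensor_alg M N = (tensor_space M N)
     \<lparr>mult := (\<lambda>X Y. tens_sum (tensor_space M N) (\<lambda>x y.
                 tens_sum (tensor_space M N) (\<lambda>x' y'.
                   tens M N (x \<otimes>\<^bsub>M\<^esub> x') (y \<otimes>\<^bsub>N\<^esub> y')) Y) X),
      one := tens M N \<one>\<^bsub>M\<^esub> \<one>\<^bsub>N\<^esub>\<rparr>"


section \<open>Algebras presented by generators and relations\<close>

text \<open>The free *-algebra on generators \<open>'g\<close> is the monoid algebra of the words in the letters
  \<open>Gen g\<close>, \<open>Adj g\<close>; the latter is the adjoint of \<open>g\<close>.\<close>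

datatype 'g letter = Gen 'g | Adj 'g

datatype 'g word = Word (letters: "'g letter list")

instantiation word :: (type) monoid_add
begin
definition zero_word :: "'a word" where "zero_word = Word []"
definition plus_word :: "'a word \<Rightarrow> 'a word \<Rightarrow> 'a word" where
  "plus_word v w = Word (letters v @ letters w)"
instance by standard (auto simp: zero_word_def plus_word_def)
end

type_synonym 'g falg = "'g word \<Rightarrow>\<^sub>0 complex"

definition mon :: "'g letter list \<Rightarrow> 'g falg" where
  "mon xs = Poly_Mapping.single (Word xs) 1"

abbreviation gen :: "'g \<Rightarrow> 'g falg" where "gen g \<equiv> mon [Gen g]"
abbreviation adj :: "'g \<Rightarrow> 'g falg" where "adj g \<equiv> mon [Adj g]"

definition scal :: "complex \<Rightarrow> 'g falg" where
  "scal c = Poly_Mapping.single 0 c"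

abbreviation rscal :: "real \<Rightarrow> 'g falg" where "rscal r \<equiv> scal (complex_of_real r)"

primrec letter_star :: "'g letter \<Rightarrow> 'g letter" where
  "letter_star (Gen g) = Adj g"
| "letter_star (Adj g) = Gen g"

definition star :: "'g falg \<Rightarrow> 'g falg" where
  "star f = (\<Sum>w\<in>Poly_Mapping.keys f.
     scal (cnj (Poly_Mapping.lookup f w)) * mon (rev (map letter_star (letters w))))"

definition free_alg :: "(complex, 'g falg) module" where
  "free_alg = \<lparr>carrier = UNIV, mult = (*), one = 1, zero = 0, add = (+),
     smult = (\<lambda>c. Poly_Mapping.map ((*) c))\<rparr>"

text \<open>A *-algebra given by relations satisfies their adjoints as well.  On words in differentials
  \<^const>\<open>star\<close> lacks the sign of a graded involution; it is only applied to elements of degree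
  at most one, where there is no sign.\<close>

definition star_closure :: "'g falg set \<Rightarrow> 'g falg set" where
  "star_closure R = R \<union> star ` R"

definition presented :: "'g falg set \<Rightarrow> (complex, 'g falg set) module" where
  "presented R = quot_mod free_alg (Idl\<^bsub>free_alg\<^esub> R)"

definition cls :: "'g falg set \<Rightarrow> 'g falg \<Rightarrow> 'g falg set" where
  "cls R x = Idl\<^bsub>free_alg\<^esub> R +>\<^bsub>free_alg\<^esub> x"


section \<open>Woronowicz's calculus on quantum SU(2) and its universal differential envelope\<close>

text \<open>
  The universal differential envelope is the free differential algebra on \<open>\<alpha>, \<gamma>\<close> and their
  adjoints (with letters \<open>DAlpha\<close>, \<open>DGamma\<close> for \<open>d\<alpha>\<close>, \<open>d\<gamma>\<close>, and \<open>(d\<alpha>)\<^sup>* = d(\<alpha>\<^sup>*)\<close>) modulo the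
  differential ideal generated by the relations of the function algebra and of the first-order
  calculus.  The quadratic relations between left-invariant forms are consequences.  The
  quantum SU(2) algebra itself is the degree zero part.
\<close>

datatype phi_gen = Alpha | Gamma | DAlpha | DGamma

fun letter_deg :: "phi_gen letter \<Rightarrow> nat" where
  "letter_deg (Gen Alpha) = 0" | "letter_deg (Gen Gamma) = 0"
| "letter_deg (Adj Alpha) = 0" | "letter_deg (Adj Gamma) = 0"
| "letter_deg _ = 1"

definition word_deg :: "phi_gen word \<Rightarrow> nat" where
  "word_deg w = sum_list (map letter_deg (letters w))"

fun letter_d :: "phi_gen letter \<Rightarrow> phi_gen falg" where
  "letter_d (Gen Alpha) = gen DAlpha" | "letter_d (Gen Gamma) = gen DGamma"
| "letter_d (Adj Alpha) = adj DAlpha" | "letter_d (Adj Gamma) = adj DGamma"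
| "letter_d _ = 0"

primrec word_d :: "phi_gen letter list \<Rightarrow> phi_gen falg" where
  "word_d [] = 0"
| "word_d (x # xs) = letter_d x * mon xs + (-1) ^ letter_deg x * (mon [x] * word_d xs)"

definition free_d :: "phi_gen falg \<Rightarrow> phi_gen falg" where
  "free_d f = (\<Sum>w\<in>Poly_Mapping.keys f. scal (Poly_Mapping.lookup f w) * word_d (letters w))"

definition su2_rels :: "real \<Rightarrow> phi_gen falg set" where
  "su2_rels \<mu> =
     {gen Alpha * adj Alpha + rscal (\<mu>^2) * (gen Gamma * adj Gamma) - 1,
      adj Alpha * gen Alpha + adj Gamma * gen Gamma - 1,
      gen Alpha * gen Gamma - rscal \<mu> * (gen Gamma * gen Alpha),
      gen Alpha * adj Gamma - rscal \<mu> * (adj Gamma * gen Alpha),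
      gen Gamma * adj Gamma - adj Gamma * gen Gamma}"

text \<open>Indices range over 1 and 2.\<close>

definition fund :: "real \<Rightarrow> nat \<Rightarrow> nat \<Rightarrow> phi_gen falg" where
  "fund \<mu> i j =
     (if i = 1 then (if j = 1 then gen Alpha else - (rscal \<mu> * adj Gamma))
      else (if j = 1 then gen Gamma else adj Alpha))"

text \<open>\<open>\<pi>(b) = \<kappa>(b\<^sup>(\<^sup>1\<^sup>)) d(b\<^sup>(\<^sup>2\<^sup>))\<close> for a matrix entry \<open>b\<close>; here \<open>\<phi>(u\<^sub>i\<^sub>j) = \<Sum>\<^sub>k u\<^sub>i\<^sub>k \<otimes> u\<^sub>k\<^sub>j\<close>
  and \<open>\<kappa>(u\<^sub>i\<^sub>k) = u\<^sub>k\<^sub>i\<^sup>*\<close>.\<close>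

definition pi_fund :: "real \<Rightarrow> nat \<Rightarrow> nat \<Rightarrow> phi_gen falg" where
  "pi_fund \<mu> i j = (\<Sum>k\<in>{1, 2}. star (fund \<mu> k i) * free_d (fund \<mu> k j))"

definition free_eta3 :: "real \<Rightarrow> phi_gen falg" where
  "free_eta3 \<mu> = pi_fund \<mu> 1 1 - pi_fund \<mu> 2 2"

definition free_eta_plus :: "real \<Rightarrow> phi_gen falg" where
  "free_eta_plus \<mu> = pi_fund \<mu> 2 1"

text \<open>\<open>\<gamma>\<^sup>* = - \<mu>\<^sup>-\<^sup>1 u\<^sub>1\<^sub>2\<close>\<close>

definition free_eta_minus :: "real \<Rightarrow> phi_gen falg" where
  "free_eta_minus \<mu> = - (rscal (1 / \<mu>) * pi_fund \<mu> 1 2)"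

text \<open>The action of the matrix entries on a left-invariant form with \<open>\<theta> \<circ> \<alpha> = m \<theta>\<close>,
  \<open>\<theta> \<circ> \<alpha>\<^sup>* = m\<^sup>-\<^sup>1 \<theta>\<close>, \<open>\<theta> \<circ> \<gamma> = \<theta> \<circ> \<gamma>\<^sup>* = 0\<close>.\<close>

definition inv_act :: "real \<Rightarrow> nat \<Rightarrow> nat \<Rightarrow> real" where
  "inv_act m k j = (if k = 1 \<and> j = 1 then m else if k = 2 \<and> j = 2 then 1 / m else 0)"

text \<open>The bimodule relation \<open>\<theta> b = b\<^sup>(\<^sup>1\<^sup>) (\<theta> \<circ> b\<^sup>(\<^sup>2\<^sup>))\<close> for a matrix entry \<open>b\<close>.\<close>

definition bimodule_rels :: "real \<Rightarrow> phi_gen falg \<Rightarrow> real \<Rightarrow> phi_gen falg set" where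
  "bimodule_rels \<mu> \<theta> m =
     {\<theta> * fund \<mu> i j - (\<Sum>k\<in>{1, 2}. fund \<mu> i k * (rscal (inv_act m k j) * \<theta>))
        | i j. i \<in> {1, 2} \<and> j \<in> {1, 2}}"

text \<open>The last relation, \<open>\<pi>(\<alpha>\<^sup>*) = - \<mu>\<^sup>2 \<pi>(\<alpha>)\<close>, expresses that the left-invariant forms are spanned
  by \<open>\<eta>\<^sub>3, \<eta>\<^sub>+, \<eta>\<^sub>-\<close> with the given right module structure: apply
  \<open>\<pi>(ab) = \<epsilon>(a) \<pi>(b) + \<pi>(a) \<circ> b\<close> to \<open>\<alpha> \<alpha>\<^sup>* + \<mu>\<^sup>2 \<gamma> \<gamma>\<^sup>* = 1\<close>.\<close>

definition calculus_rels :: "real \<Rightarrow> phi_gen falg set" where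
  "calculus_rels \<mu> =
     bimodule_rels \<mu> (free_eta3 \<mu>) (1 / \<mu>^2)
   \<union> bimodule_rels \<mu> (free_eta_plus \<mu>) (1 / \<mu>)
   \<union> bimodule_rels \<mu> (free_eta_minus \<mu>) (1 / \<mu>)
   \<union> {pi_fund \<mu> 2 2 + rscal (\<mu>^2) * pi_fund \<mu> 1 1}"

definition phi_rels :: "real \<Rightarrow> phi_gen falg set" where
  "phi_rels \<mu> = (let R = star_closure (su2_rels \<mu> \<union> calculus_rels \<mu>) in R \<union> free_d ` R)"

definition Phi :: "real \<Rightarrow> (complex, phi_gen falg set) module" where
  "Phi \<mu> = presented (phi_rels \<mu>)"

definition Phi_deg :: "real \<Rightarrow> nat \<Rightarrow> phi_gen falg set set" where
  "Phi_deg \<mu> k = {cls (phi_rels \<mu>) f | f. \<forall>w\<in>Poly_Mapping.keys f. word_deg w = k}"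

definition Phi_d :: "real \<Rightarrow> phi_gen falg set \<Rightarrow> phi_gen falg set" where
  "Phi_d \<mu> X = (\<Union>x\<in>X. cls (phi_rels \<mu>) (free_d x))"

definition al :: "real \<Rightarrow> phi_gen falg set" where "al \<mu> = cls (phi_rels \<mu>) (gen Alpha)"
definition al_st :: "real \<Rightarrow> phi_gen falg set" where "al_st \<mu> = cls (phi_rels \<mu>) (adj Alpha)"
definition ga :: "real \<Rightarrow> phi_gen falg set" where "ga \<mu> = cls (phi_rels \<mu>) (gen Gamma)"
definition ga_st :: "real \<Rightarrow> phi_gen falg set" where "ga_st \<mu> = cls (phi_rels \<mu>) (adj Gamma)"
definition eta3 :: "real \<Rightarrow> phi_gen falg set" where "eta3 \<mu> = cls (phi_rels \<mu>) (free_eta3 \<mu>)"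
definition eta_plus :: "real \<Rightarrow> phi_gen falg set" where
  "eta_plus \<mu> = cls (phi_rels \<mu>) (free_eta_plus \<mu>)"
definition eta_minus :: "real \<Rightarrow> phi_gen falg set" where
  "eta_minus \<mu> = cls (phi_rels \<mu>) (free_eta_minus \<mu>)"


section \<open>Horizontal forms and the canonical bundle derivative\<close>

definition hor :: "real \<Rightarrow> (complex, phi_gen falg set) module" where
  "hor \<mu> = (Phi \<mu>)\<lparr>carrier :=
     subalg_gen (Phi \<mu>) {al \<mu>, al_st \<mu>, ga \<mu>, ga_st \<mu>, eta_plus \<mu>, eta_minus \<mu>}\<rparr>"

definition hor_deg :: "real \<Rightarrow> nat \<Rightarrow> phi_gen falg set set" where
  "hor_deg \<mu> k = carrier (hor \<mu>) \<inter> Phi_deg \<mu> k"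

definition hor_proj :: "real \<Rightarrow> phi_gen falg set \<Rightarrow> phi_gen falg set" where
  "hor_proj \<mu> = alg_ext (Phi \<mu>) (hor \<mu>)
     (insert (eta3 \<mu>, \<zero>\<^bsub>hor \<mu>\<^esub>) {(x, x) | x. x \<in> carrier (hor \<mu>)})"

definition hor_nabla :: "real \<Rightarrow> phi_gen falg set \<Rightarrow> phi_gen falg set" where
  "hor_nabla \<mu> x = hor_proj \<mu> (Phi_d \<mu> x)"

datatype u1_gen = U_gen

definition u1_rels :: "u1_gen falg set" where
  "u1_rels = star_closure {gen U_gen * adj U_gen - 1, adj U_gen * gen U_gen - 1}"

definition Ualg :: "(complex, u1_gen falg set) module" where
  "Ualg = presented u1_rels"

definition Uu :: "u1_gen falg set" where "Uu = cls u1_rels (gen U_gen)"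
definition Uu_st :: "u1_gen falg set" where "Uu_st = cls u1_rels (adj U_gen)"

definition Ualg_coprod :: "u1_gen falg set \<Rightarrow> ((u1_gen falg set \<times> u1_gen falg set) \<Rightarrow>\<^sub>0 complex) set" where
  "Ualg_coprod = alg_ext Ualg (tensor_alg Ualg Ualg)
     {(Uu, tens Ualg Ualg Uu Uu), (Uu_st, tens Ualg Ualg Uu_st Uu_st)}"

definition Ualg_counit :: "u1_gen falg set \<Rightarrow> complex" where
  "Ualg_counit = alg_ext Ualg complex_alg {(Uu, 1), (Uu_st, 1)}"

definition hor_coact ::
    "real \<Rightarrow> phi_gen falg set \<Rightarrow> ((phi_gen falg set \<times> u1_gen falg set) \<Rightarrow>\<^sub>0 complex) set" where
  "hor_coact \<mu> = alg_ext (hor \<mu>) (tensor_alg (hor \<mu>) Ualg)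
     {(al \<mu>, tens (hor \<mu>) Ualg (al \<mu>) Uu),
      (al_st \<mu>, tens (hor \<mu>) Ualg (al_st \<mu>) Uu_st),
      (ga \<mu>, tens (hor \<mu>) Ualg (ga \<mu>) Uu),
      (ga_st \<mu>, tens (hor \<mu>) Ualg (ga_st \<mu>) Uu_st),
      (eta_plus \<mu>, tens (hor \<mu>) Ualg (eta_plus \<mu>) (Uu [^]\<^bsub>Ualg\<^esub> (2::nat))),
      (eta_minus \<mu>, tens (hor \<mu>) Ualg (eta_minus \<mu>) (Uu_st [^]\<^bsub>Ualg\<^esub> (2::nat)))}"


section \<open>The affine extension\<close>

datatype s_gen = Xi_gen

definition s_rels :: "real \<Rightarrow> s_gen falg set" where
  "s_rels \<mu> = star_closure {gen Xi_gen * adj Xi_gen - rscal (\<mu>^2) * (adj Xi_gen * gen Xi_gen)}"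

definition Salg :: "real \<Rightarrow> (complex, s_gen falg set) module" where
  "Salg \<mu> = presented (s_rels \<mu>)"

definition xi :: "real \<Rightarrow> s_gen falg set" where "xi \<mu> = cls (s_rels \<mu>) (gen Xi_gen)"
definition xi_st :: "real \<Rightarrow> s_gen falg set" where "xi_st \<mu> = cls (s_rels \<mu>) (adj Xi_gen)"

text \<open>The right action of the Hopf algebra of U(1) on \<open>S(V)\<close>, multiplicative over the coproduct.\<close>

definition S_act :: "real \<Rightarrow> s_gen falg set \<Rightarrow> u1_gen falg set \<Rightarrow> s_gen falg set" where
  "S_act \<mu> = (THE f. f \<in> carrier (Salg \<mu>) \<rightarrow>\<^sub>E (carrier Ualg \<rightarrow>\<^sub>E carrier (Salg \<mu>))
     \<and> (\<forall>a\<in>carrier Ualg. (\<lambda>t. f t a) \<in> linear_maps (Salg \<mu>) (Salg \<mu>))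
     \<and> (\<forall>t\<in>carrier (Salg \<mu>). f t \<in> linear_maps Ualg (Salg \<mu>))
     \<and> (\<forall>t\<in>carrier (Salg \<mu>). f t \<one>\<^bsub>Ualg\<^esub> = t)
     \<and> (\<forall>t\<in>carrier (Salg \<mu>). \<forall>a\<in>carrier Ualg. \<forall>b\<in>carrier Ualg.
          f t (a \<otimes>\<^bsub>Ualg\<^esub> b) = f (f t a) b)
     \<and> (\<forall>a\<in>carrier Ualg. f \<one>\<^bsub>Salg \<mu>\<^esub> a = Ualg_counit a \<odot>\<^bsub>Salg \<mu>\<^esub> \<one>\<^bsub>Salg \<mu>\<^esub>)
     \<and> (\<forall>s\<in>carrier (Salg \<mu>). \<forall>t\<in>carrier (Salg \<mu>). \<forall>a\<in>carrier Ualg.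
          f (s \<otimes>\<^bsub>Salg \<mu>\<^esub> t) a =
            tens_sum (Salg \<mu>) (\<lambda>b c. f s b \<otimes>\<^bsub>Salg \<mu>\<^esub> f t c) (Ualg_coprod a))
     \<and> f (xi \<mu>) Uu = complex_of_real (1 / \<mu>) \<odot>\<^bsub>Salg \<mu>\<^esub> xi \<mu>
     \<and> f (xi_st \<mu>) Uu = complex_of_real (1 / \<mu>) \<odot>\<^bsub>Salg \<mu>\<^esub> xi_st \<mu>)"

datatype aff_gen = AffU | AffXi

definition aff_rels :: "real \<Rightarrow> aff_gen falg set" where
  "aff_rels \<mu> = star_closure
     {gen AffU * adj AffU - 1,
      adj AffU * gen AffU - 1,
      gen AffXi * adj AffXi - rscal (\<mu>^2) * (adj AffXi * gen AffXi),
      gen AffXi * gen AffU - rscal (1 / \<mu>) * (gen AffU * gen AffXi),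
      adj AffXi * gen AffU - rscal (1 / \<mu>) * (gen AffU * adj AffXi)}"

definition Aff :: "real \<Rightarrow> (complex, aff_gen falg set) module" where
  "Aff \<mu> = presented (aff_rels \<mu>)"

definition aU :: "real \<Rightarrow> aff_gen falg set" where "aU \<mu> = cls (aff_rels \<mu>) (gen AffU)"
definition aU_st :: "real \<Rightarrow> aff_gen falg set" where "aU_st \<mu> = cls (aff_rels \<mu>) (adj AffU)"
definition axi :: "real \<Rightarrow> aff_gen falg set" where "axi \<mu> = cls (aff_rels \<mu>) (gen AffXi)"
definition axi_st :: "real \<Rightarrow> aff_gen falg set" where "axi_st \<mu> = cls (aff_rels \<mu>) (adj AffXi)"

definition Aff_counit :: "real \<Rightarrow> aff_gen falg set \<Rightarrow> complex" where
  "Aff_counit \<mu> = alg_ext (Aff \<mu>) complex_alg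
     {(aU \<mu>, 1), (aU_st \<mu>, 1), (axi \<mu>, 0), (axi_st \<mu>, 0)}"

definition U_in_Aff :: "real \<Rightarrow> u1_gen falg set \<Rightarrow> aff_gen falg set" where
  "U_in_Aff \<mu> = alg_ext Ualg (Aff \<mu>) {(Uu, aU \<mu>), (Uu_st, aU_st \<mu>)}"

definition S_in_Aff :: "real \<Rightarrow> s_gen falg set \<Rightarrow> aff_gen falg set" where
  "S_in_Aff \<mu> = alg_ext (Salg \<mu>) (Aff \<mu>) {(xi \<mu>, axi \<mu>), (xi_st \<mu>, axi_st \<mu>)}"

text \<open>The restriction to \<open>S(V)\<close> of the coproduct of the affine quantum group, given by
  \<open>\<phi>(\<xi>) = 1 \<otimes> \<xi> + \<xi> \<otimes> U\<^sup>2\<close> and \<open>\<phi>(\<xi>\<^sup>*) = \<phi>(\<xi>)\<^sup>*\<close>.\<close>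

definition S_coprod ::
    "real \<Rightarrow> s_gen falg set \<Rightarrow> ((s_gen falg set \<times> aff_gen falg set) \<Rightarrow>\<^sub>0 complex) set" where
  "S_coprod \<mu> = alg_ext (Salg \<mu>) (tensor_alg (Salg \<mu>) (Aff \<mu>))
     {(xi \<mu>, tens (Salg \<mu>) (Aff \<mu>) \<one>\<^bsub>Salg \<mu>\<^esub> (axi \<mu>)
         \<oplus>\<^bsub>tensor_alg (Salg \<mu>) (Aff \<mu>)\<^esub>
         tens (Salg \<mu>) (Aff \<mu>) (xi \<mu>) (aU \<mu> [^]\<^bsub>Aff \<mu>\<^esub> (2::nat))),
      (xi_st \<mu>, tens (Salg \<mu>) (Aff \<mu>) \<one>\<^bsub>Salg \<mu>\<^esub> (axi_st \<mu>)
         \<oplus>\<^bsub>tensor_alg (Salg \<mu>) (Aff \<mu>)\<^esub>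
         tens (Salg \<mu>) (Aff \<mu>) (xi_st \<mu>) (aU_st \<mu> [^]\<^bsub>Aff \<mu>\<^esub> (2::nat)))}"

type_synonym hform = "((phi_gen falg set \<times> s_gen falg set) \<Rightarrow>\<^sub>0 complex) set"

definition ht :: "real \<Rightarrow> phi_gen falg set \<Rightarrow> s_gen falg set \<Rightarrow> hform" where
  "ht \<mu> = tens (hor \<mu>) (Salg \<mu>)"

text \<open>The product is \<open>(\<psi> \<otimes> \<theta>)(\<phi> \<otimes> \<eta>) = \<Sum>\<^sub>k \<psi> \<phi>\<^sub>k \<otimes> (\<theta> \<circ> c\<^sub>k) \<eta>\<close>, where \<open>\<Sum>\<^sub>k \<phi>\<^sub>k \<otimes> c\<^sub>k\<close> is the
  coaction on \<open>\<phi>\<close>.\<close>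

definition hP :: "real \<Rightarrow> (complex, hform) module" where
  "hP \<mu> = (let T = tensor_space (hor \<mu>) (Salg \<mu>) in
     T\<lparr>mult := (\<lambda>X Y. tens_sum T (\<lambda>\<psi> \<theta>. tens_sum T (\<lambda>\<phi> \<eta>.
                 tens_sum T (\<lambda>\<phi>k ck.
                   ht \<mu> (\<psi> \<otimes>\<^bsub>hor \<mu>\<^esub> \<phi>k) (S_act \<mu> \<theta> ck \<otimes>\<^bsub>Salg \<mu>\<^esub> \<eta>))
                 (hor_coact \<mu> \<phi>)) Y) X),
       one := ht \<mu> \<one>\<^bsub>hor \<mu>\<^esub> \<one>\<^bsub>Salg \<mu>\<^esub>\<rparr>)"

definition hP_deg :: "real \<Rightarrow> nat \<Rightarrow> hform set" where
  "hP_deg \<mu> k = lin_span (hP \<mu>) {ht \<mu> x t | x t. x \<in> hor_deg \<mu> k \<and> t \<in> carrier (Salg \<mu>)}"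

text \<open>Compatibility with the *-structures is automatic: the prescribed values on generators and on
  their adjoints correspond to each other.\<close>

definition affine_coaction ::
    "real \<Rightarrow> (hform \<Rightarrow> ((hform \<times> aff_gen falg set) \<Rightarrow>\<^sub>0 complex) set) \<Rightarrow> bool" where
  "affine_coaction \<mu> H \<longleftrightarrow> H \<in> alg_homs (hP \<mu>) (tensor_alg (hP \<mu>) (Aff \<mu>))
     \<and> (\<forall>x\<in>carrier (hor \<mu>). H (ht \<mu> x \<one>\<^bsub>Salg \<mu>\<^esub>) =
          tens_sum (tensor_alg (hP \<mu>) (Aff \<mu>))
            (\<lambda>y c. tens (hP \<mu>) (Aff \<mu>) (ht \<mu> y \<one>\<^bsub>Salg \<mu>\<^esub>) (U_in_Aff \<mu> c)) (hor_coact \<mu> x))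
     \<and> (\<forall>t\<in>carrier (Salg \<mu>). H (ht \<mu> \<one>\<^bsub>hor \<mu>\<^esub> t) =
          tens_sum (tensor_alg (hP \<mu>) (Aff \<mu>))
            (\<lambda>s a. tens (hP \<mu>) (Aff \<mu>) (ht \<mu> \<one>\<^bsub>hor \<mu>\<^esub> s) a) (S_coprod \<mu> t))"

text \<open>Recall that \<open>\<xi>\<close> and \<open>\<xi>\<^sup>*\<close> are the copies of \<open>\<eta>\<^sub>+\<close> and \<open>\<mu> \<eta>\<^sub>-\<close> in \<open>S(V)\<close>.\<close>

definition affine_derivative :: "real \<Rightarrow> (hform \<Rightarrow> hform) \<Rightarrow> bool" where
  "affine_derivative \<mu> D \<longleftrightarrow> antiderivation (hP \<mu>) (hP_deg \<mu>) D
     \<and> (\<forall>x\<in>carrier (hor \<mu>). D (ht \<mu> x \<one>\<^bsub>Salg \<mu>\<^esub>) = ht \<mu> (hor_nabla \<mu> x) \<one>\<^bsub>Salg \<mu>\<^esub>)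
     \<and> D (ht \<mu> \<one>\<^bsub>hor \<mu>\<^esub> (xi \<mu>)) = ht \<mu> (eta_plus \<mu>) \<one>\<^bsub>Salg \<mu>\<^esub>
     \<and> D (ht \<mu> \<one>\<^bsub>hor \<mu>\<^esub> (xi_st \<mu>)) =
          ht \<mu> (complex_of_real \<mu> \<odot>\<^bsub>hor \<mu>\<^esub> eta_minus \<mu>) \<one>\<^bsub>Salg \<mu>\<^esub>"

definition curvature_map ::
    "real \<Rightarrow> (hform \<Rightarrow> ((hform \<times> aff_gen falg set) \<Rightarrow>\<^sub>0 complex) set) \<Rightarrow> (hform \<Rightarrow> hform)
      \<Rightarrow> (aff_gen falg set \<Rightarrow> hform) \<Rightarrow> bool" where
  "curvature_map \<mu> H D \<rho> \<longleftrightarrow> \<rho> \<in> linear_maps (Aff \<mu>) (hP \<mu>)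
     \<and> (\<forall>x\<in>carrier (hP \<mu>).
          D (D x) = \<ominus>\<^bsub>hP \<mu>\<^esub> tens_sum (hP \<mu>) (\<lambda>y c. y \<otimes>\<^bsub>hP \<mu>\<^esub> \<rho> c) (H x))"


section \<open>The associated calculus on the affine quantum group\<close>

definition counit_ker :: "real \<Rightarrow> (complex, aff_gen falg set) module" where
  "counit_ker \<mu> = (Aff \<mu>)\<lparr>carrier := {a \<in> carrier (Aff \<mu>). Aff_counit \<mu> a = 0}\<rparr>"

definition calc_ideal ::
    "real \<Rightarrow> (aff_gen falg set \<Rightarrow> hform) \<Rightarrow> aff_gen falg set set" where
  "calc_ideal \<mu> \<rho> = {a \<in> carrier (Aff \<mu>). Aff_counit \<mu> a = 0 \<and> \<rho> a = \<zero>\<^bsub>hP \<mu>\<^esub>}"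

definition Ups_inv ::
    "real \<Rightarrow> (aff_gen falg set \<Rightarrow> hform) \<Rightarrow> (complex, aff_gen falg set set) module" where
  "Ups_inv \<mu> \<rho> = quot_mod (counit_ker \<mu>) (calc_ideal \<mu> \<rho>)"

definition pi_hat ::
    "real \<Rightarrow> (aff_gen falg set \<Rightarrow> hform) \<Rightarrow> aff_gen falg set \<Rightarrow> aff_gen falg set set" where
  "pi_hat \<mu> \<rho> a =
     calc_ideal \<mu> \<rho> +>\<^bsub>Aff \<mu>\<^esub> (a \<ominus>\<^bsub>Aff \<mu>\<^esub> (Aff_counit \<mu> a \<odot>\<^bsub>Aff \<mu>\<^esub> \<one>\<^bsub>Aff \<mu>\<^esub>))"

definition Ups_act ::
    "real \<Rightarrow> (aff_gen falg set \<Rightarrow> hform) \<Rightarrow> aff_gen falg set set \<Rightarrow> aff_gen falg set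
      \<Rightarrow> aff_gen falg set set" where
  "Ups_act \<mu> \<rho> X a = (\<Union>q\<in>X. pi_hat \<mu> \<rho> (q \<otimes>\<^bsub>Aff \<mu>\<^esub> a))"

definition zeta :: "real \<Rightarrow> (aff_gen falg set \<Rightarrow> hform) \<Rightarrow> aff_gen falg set set" where
  "zeta \<mu> \<rho> = pi_hat \<mu> \<rho> (aU \<mu> \<ominus>\<^bsub>Aff \<mu>\<^esub> aU_st \<mu>)"

end

theory Submission imports Defs begin

text \<open>
  Write \<open>\<Omega>\<^sub>b(x) = \<Sum>\<^sub>k x\<^sub>k \<rho>(b c\<^sub>k)\<close> for \<open>H(x) = \<Sum>\<^sub>k x\<^sub>k \<otimes> c\<^sub>k\<close>, so that \<open>\<Omega>\<^sub>1 = - \<nabla>\<^sup>2\<close> and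
  \<open>\<Omega>\<^sub>b(1) = \<rho>(b)\<close>.  Multiplicativity of \<open>H\<close> gives \<open>\<Omega>\<^sub>b(y x) = y \<Omega>\<^bsub>b U\<^esub>(x)\<close> for \<open>y \<in> {\<alpha>, \<gamma>}\<close>, similarly with
  \<open>U\<^sup>-\<^sup>1\<close> for the adjoints, and \<open>\<Omega>\<^sub>b(\<xi> x) = \<Omega>\<^bsub>b \<xi>\<^esub>(x) + \<xi> \<Omega>\<^bsub>b U U\<^esub>(x)\<close>.  On the generators \<open>\<nabla>\<^sup>2\<close> is a multiple
  of right multiplication by \<open>\<omega> = \<eta>\<^sub>-\<eta>\<^sub>+\<close>, and it is a derivation on forms of degree zero; cancelling \<open>y\<close> by
  unitarity yields \<open>\<Omega>\<^sub>b\<close> for all powers \<open>b\<close> of \<open>U\<close>, and the second rule then yields it for all monomials.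
  The result is \<open>\<rho>(U\<^sup>n \<xi>\<^sup>p \<xi>\<^sup>*\<^sup>q) = W (\<mu>\<^sup>-\<^sup>2\<^sup>n c\<^sub>p\<^sub>q - \<delta>) \<omega> \<otimes> \<xi>\<^sup>p \<xi>\<^sup>*\<^sup>q\<close> with \<open>\<delta> = 1\<close> if \<open>p = q = 0\<close> and \<open>0\<close> otherwise.
  Since \<open>c\<^sub>p\<^sub>q \<noteq> 0\<close>, the coefficients of \<open>\<rho>\<close> are coordinates on the invariant forms, in which \<open>U - U\<^sup>*\<close> and the
  monomials, and also the translates of \<open>\<zeta>\<close> by monomials, are multiples of the unit vectors.

  That \<open>\<omega> \<noteq> 0\<close> is seen in a four-dimensional representation, and the quadratic relations between
  \<open>\<eta>\<^sub>+\<close> and \<open>\<eta>\<^sub>-\<close> follow by differentiating their bimodule relations.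
\<close>

text \<open>\<open>hor_proj\<close>, \<open>hor_coact\<close>, \<open>S_act\<close> and the counits
  are definite descriptions, so each becomes usable only after an explicit map with the prescribed
  values has been built. For \<open>hor_proj\<close> this is the main obstacle: \<open>Phi\<close>
  is known only by generators, relations and the differentials of the relations, and sending
  \<open>eta3\<close> to zero gives a homomorphism only if all of these, together with their
  adjoints, go to zero. This is where the quadratic relations enter: they make the differentials of
  the bimodule relations vanish.

  The constants solve recursions. If \<Omega>_b + \<nabla>^2 is left multiplication by r \<omega>
  for b = U^n, then for U^(n+1) it is left multiplication by (r/\<mu>^2 + \<mu>) \<omega>. The fixed
  point of this affine map is -W with W = \<mu>^3/(1-\<mu>^2), and starting from r = 0 gives
  W(\<mu>^(-2n) - 1). A further factor \<xi> or its adjoint subtracts a multiple of the value at n +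
  2 or n - 2. The first such difference removes the constant -W, while \<mu>^(-2n) is an eigenvector
  of all of them; the eigenvalues are the factors of c_pq.\<close>

abbreviation keys :: "('k \<Rightarrow>\<^sub>0 'v::zero) \<Rightarrow> 'k set" where "keys \<equiv> Poly_Mapping.keys"
abbreviation lookup :: "('k \<Rightarrow>\<^sub>0 'v::zero) \<Rightarrow> 'k \<Rightarrow> 'v" where "lookup \<equiv> Poly_Mapping.lookup"

section \<open>Complex vector spaces and algebras\<close>

text \<open>Scalars are the type \<open>complex\<close> instead of the carrier of a ring record, so
  the laws of \<open>smult\<close> are added directly to \<open>abelian_group\<close>;
  \<open>mult\<close> and \<open>one\<close> stay unconstrained until \<open>calg\<close>.\<close>

locale cvec = abelian_group M for M :: "(complex, 'a) module" (structure) +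
  assumes smult_closed [simp, intro]: "x \<in> carrier M \<Longrightarrow> c \<odot> x \<in> carrier M"
    and smult_add_left: "x \<in> carrier M \<Longrightarrow> (a + b) \<odot> x = a \<odot> x \<oplus> b \<odot> x"
    and smult_add_right: "x \<in> carrier M \<Longrightarrow> y \<in> carrier M \<Longrightarrow> c \<odot> (x \<oplus> y) = c \<odot> x \<oplus> c \<odot> y"
    and smult_smult: "x \<in> carrier M \<Longrightarrow> a \<odot> (b \<odot> x) = (a * b) \<odot> x"
    and smult_one [simp]: "x \<in> carrier M \<Longrightarrow> 1 \<odot> x = x"
begin

lemma smult_zero_left [simp]:
  assumes "x \<in> carrier M" shows "0 \<odot> x = \<zero>"
proof -
  have "0 \<odot> x \<oplus> 0 \<odot> x = 0 \<odot> x \<oplus> \<zero>"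
    using smult_add_left[OF assms, of 0 0] assms by simp
  then show ?thesis using assms by (simp del: r_zero)
qed

lemma smult_zero_right [simp]: "c \<odot> \<zero> = \<zero>"
proof -
  have "c \<odot> \<zero> \<oplus> c \<odot> \<zero> = c \<odot> \<zero> \<oplus> \<zero>"
    using smult_add_right[of \<zero> \<zero> c] by simp
  then show ?thesis by (simp del: r_zero)
qed

lemma smult_minus_one: "x \<in> carrier M \<Longrightarrow> (- 1) \<odot> x = \<ominus> x"
  using smult_add_left[of x "-1" 1] by (simp add: minus_equality)

lemma smult_uminus_left: "x \<in> carrier M \<Longrightarrow> (- c) \<odot> x = \<ominus> (c \<odot> x)"
  using smult_smult[of x "-1" c] by (simp add: smult_minus_one)

lemma smult_uminus_right: "x \<in> carrier M \<Longrightarrow> c \<odot> (\<ominus> x) = \<ominus> (c \<odot> x)"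
  using smult_smult[of x c "-1"] by (simp add: smult_minus_one smult_uminus_left)

lemma finsum_smult:
  "f \<in> A \<rightarrow> carrier M \<Longrightarrow> c \<odot> (\<Oplus>i\<in>A. f i) = (\<Oplus>i\<in>A. c \<odot> f i)"
proof (induction A rule: infinite_finite_induct)
  case (insert x F)
  then show ?case by (simp add: smult_add_right Pi_def)
qed simp_all

lemma minus_eq_zero_iff:
  "x \<in> carrier M \<Longrightarrow> y \<in> carrier M \<Longrightarrow> x \<ominus> y = \<zero> \<longleftrightarrow> x = y"
  by (metis a_minus_def add.inv_closed local.minus_minus minus_equality r_neg)

end

locale calg = cvec M + ring M for M :: "(complex, 'a) module" (structure) +
  assumes smult_mult_left: "x \<in> carrier M \<Longrightarrow> y \<in> carrier M \<Longrightarrow> (c \<odot> x) \<otimes> y = c \<odot> (x \<otimes> y)"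
    and smult_mult_right: "x \<in> carrier M \<Longrightarrow> y \<in> carrier M \<Longrightarrow> x \<otimes> (c \<odot> y) = c \<odot> (x \<otimes> y)"

text \<open>Identities pass along a surjection that respects the operations. With a coset map this
  yields quotients, with the identity map it yields records in which the product has been
  replaced.\<close>

lemma cvec_image:
  assumes "cvec M" and im: "f ` carrier M = carrier Q"
    and add: "\<And>x y. x \<in> carrier M \<Longrightarrow> y \<in> carrier M \<Longrightarrow> f x \<oplus>\<^bsub>Q\<^esub> f y = f (x \<oplus>\<^bsub>M\<^esub> y)"
    and smult: "\<And>c x. x \<in> carrier M \<Longrightarrow> c \<odot>\<^bsub>Q\<^esub> f x = f (c \<odot>\<^bsub>M\<^esub> x)"
    and zero: "\<zero>\<^bsub>Q\<^esub> = f \<zero>\<^bsub>M\<^esub>"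
  shows "cvec Q"
proof -
  interpret cvec M by fact
  have inM: "x \<in> carrier Q \<longleftrightarrow> (\<exists>y\<in>carrier M. x = f y)" for x using im by auto
  interpret Q: abelian_group Q
  proof (rule abelian_groupI, goal_cases)
    case (6 x)
    then obtain y where y: "y \<in> carrier M" "x = f y" by (auto simp: inM)
    show ?case
      by (rule bexI[of _ "f (\<ominus>\<^bsub>M\<^esub> y)"]) (use y in \<open>auto simp: inM add zero l_neg\<close>)
  qed (auto simp: inM add zero a_ac intro!: arg_cong[of _ _ f])
  show ?thesis
    by unfold_locales
      (auto simp: inM add smult smult_add_left smult_add_right smult_smult)
qed

lemma calg_image:
  assumes "calg M" and im: "f ` carrier M = carrier Q"
    and add: "\<And>x y. x \<in> carrier M \<Longrightarrow> y \<in> carrier M \<Longrightarrow> f x \<oplus>\<^bsub>Q\<^esub> f y = f (x \<oplus>\<^bsub>M\<^esub> y)"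
    and smult: "\<And>c x. x \<in> carrier M \<Longrightarrow> c \<odot>\<^bsub>Q\<^esub> f x = f (c \<odot>\<^bsub>M\<^esub> x)"
    and zero: "\<zero>\<^bsub>Q\<^esub> = f \<zero>\<^bsub>M\<^esub>"
    and mult: "\<And>x y. x \<in> carrier M \<Longrightarrow> y \<in> carrier M \<Longrightarrow> f x \<otimes>\<^bsub>Q\<^esub> f y = f (x \<otimes>\<^bsub>M\<^esub> y)"
    and one: "\<one>\<^bsub>Q\<^esub> = f \<one>\<^bsub>M\<^esub>"
  shows "calg Q"
proof -
  interpret calg M by fact
  have inM: "x \<in> carrier Q \<longleftrightarrow> (\<exists>y\<in>carrier M. x = f y)" for x using im by auto
  interpret Q: cvec Q by (rule cvec_image) (use assms in \<open>auto intro: cvec_axioms\<close>)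
  interpret Q: ring Q
    by (rule ringI[OF Q.abelian_group_axioms]; (rule monoidI)?)
      (auto simp: inM add mult one m_assoc l_distr r_distr)
  show ?thesis
    by unfold_locales (auto simp: inM smult mult smult_mult_left smult_mult_right)
qed


subsection \<open>Linear combinations\<close>

text \<open>The expression occurring in \<open>basis_family\<close> and \<open>tens_sum\<close>,
  taken as a function of the coefficient family so that it can be treated as a linear map.\<close>

definition pm_sum :: "(complex, 'a) module \<Rightarrow> ('k \<Rightarrow> 'a) \<Rightarrow> ('k \<Rightarrow>\<^sub>0 complex) \<Rightarrow> 'a" where
  "pm_sum M \<phi> f = (\<Oplus>\<^bsub>M\<^esub>k\<in>Poly_Mapping.keys f. Poly_Mapping.lookup f k \<odot>\<^bsub>M\<^esub> \<phi> k)"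

lemma map_times_eq: "lookup (Poly_Mapping.map ((*) c) f) k = (c::complex) * lookup f k"
  by (simp add: Poly_Mapping.map.rep_eq when_def)

lemma keys_map_times: "keys (Poly_Mapping.map ((*) (c::complex)) f) \<subseteq> keys f"
  by (auto simp: in_keys_iff map_times_eq)

context cvec begin

lemma pm_sum_superset:
  assumes "finite A" "keys f \<subseteq> A" "\<phi> \<in> A \<rightarrow> carrier M"
  shows "pm_sum M \<phi> f = (\<Oplus>k\<in>A. lookup f k \<odot> \<phi> k)"
  unfolding pm_sum_def
  by (rule add.finprod_mono_neutral_cong_left)
    (use assms in \<open>auto simp: in_keys_iff Pi_def\<close>)

lemma pm_sum_closed [intro]: "\<phi> \<in> keys f \<rightarrow> carrier M \<Longrightarrow> pm_sum M \<phi> f \<in> carrier M"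
  unfolding pm_sum_def by (auto intro!: finsum_closed)

lemma pm_sum_add:
  assumes "\<phi> \<in> keys f \<union> keys g \<rightarrow> carrier M"
  shows "pm_sum M \<phi> (f + g) = pm_sum M \<phi> f \<oplus> pm_sum M \<phi> g"
proof -
  let ?A = "keys f \<union> keys g"
  have "pm_sum M \<phi> (f + g) = (\<Oplus>k\<in>?A. lookup (f + g) k \<odot> \<phi> k)"
    by (rule pm_sum_superset) (use assms Poly_Mapping.keys_add[of f g] in auto)
  also have "\<dots> = (\<Oplus>k\<in>?A. lookup f k \<odot> \<phi> k \<oplus> lookup g k \<odot> \<phi> k)"
    by (rule add.finprod_cong') (use assms in \<open>auto simp: lookup_add smult_add_left Pi_def\<close>)
  also have "\<dots> = (\<Oplus>k\<in>?A. lookup f k \<odot> \<phi> k) \<oplus> (\<Oplus>k\<in>?A. lookup g k \<odot> \<phi> k)"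
    by (rule finsum_addf) (use assms in auto)
  also have "\<dots> = pm_sum M \<phi> f \<oplus> pm_sum M \<phi> g"
    by (subst (1 2) pm_sum_superset[of ?A]) (use assms in auto)
  finally show ?thesis .
qed

lemma pm_sum_smult:
  assumes "\<phi> \<in> keys f \<rightarrow> carrier M"
  shows "pm_sum M \<phi> (Poly_Mapping.map ((*) c) f) = c \<odot> pm_sum M \<phi> f"
proof -
  have "pm_sum M \<phi> (Poly_Mapping.map ((*) c) f)
      = (\<Oplus>k\<in>keys f. lookup (Poly_Mapping.map ((*) c) f) k \<odot> \<phi> k)"
    by (rule pm_sum_superset) (use assms keys_map_times[of c f] in auto)
  also have "\<dots> = (\<Oplus>k\<in>keys f. c \<odot> (lookup f k \<odot> \<phi> k))"
    by (rule add.finprod_cong') (use assms in \<open>auto simp: map_times_eq smult_smult Pi_def\<close>)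
  also have "\<dots> = c \<odot> pm_sum M \<phi> f"
    unfolding pm_sum_def by (rule finsum_smult[symmetric]) (use assms in auto)
  finally show ?thesis .
qed

lemma pm_sum_diff:
  assumes "\<phi> \<in> keys f \<union> keys g \<rightarrow> carrier M"
  shows "pm_sum M \<phi> (f - g) = pm_sum M \<phi> f \<ominus> pm_sum M \<phi> g"
proof -
  have neg: "- g = Poly_Mapping.map ((*) (- 1)) g"
    by (rule poly_mapping_eqI) (simp add: map_times_eq)
  have "pm_sum M \<phi> (f + Poly_Mapping.map ((*) (- 1)) g)
      = pm_sum M \<phi> f \<oplus> pm_sum M \<phi> (Poly_Mapping.map ((*) (- 1)) g)"
    by (rule pm_sum_add) (use assms keys_map_times[of "-1" g] in auto)
  also have "pm_sum M \<phi> (Poly_Mapping.map ((*) (- 1)) g) = (- 1) \<odot> pm_sum M \<phi> g"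
    by (rule pm_sum_smult) (use assms in auto)
  also have "\<dots> = \<ominus> pm_sum M \<phi> g"
    by (rule smult_minus_one) (use assms in auto)
  finally show ?thesis
    unfolding neg[symmetric] a_minus_def by (simp only: add_uminus_conv_diff)
qed

lemma pm_sum_single: "\<phi> k \<in> carrier M \<Longrightarrow> pm_sum M \<phi> (Poly_Mapping.single k c) = c \<odot> \<phi> k"
  by (cases "c = 0") (auto simp: pm_sum_def Poly_Mapping.keys_single)

lemma pm_sum_zero [simp]: "pm_sum M \<phi> 0 = \<zero>"
  by (simp add: pm_sum_def)

end

text \<open>A finitely supported family is the sum of its one-point parts. The bound on the support
  is carried through the induction because the rule for sums asks for it.\<close>

lemma pm_induct [consumes 1, case_names zero add single]:
  assumes "keys f \<subseteq> S" "P 0" "\<And>f g. keys f \<union> keys g \<subseteq> S \<Longrightarrow> P f \<Longrightarrow> P g \<Longrightarrow> P (f + g)"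
    "\<And>k c. k \<in> S \<Longrightarrow> P (Poly_Mapping.single k c)"
  shows "P (f :: 'k \<Rightarrow>\<^sub>0 'v::comm_monoid_add)"
proof -
  have exp: "(\<Sum>k\<in>A. Poly_Mapping.single k (lookup f k)) = f" if "finite A" "keys f \<subseteq> A" for A
  proof (rule poly_mapping_eqI)
    fix k
    have "lookup (\<Sum>k\<in>A. Poly_Mapping.single k (lookup f k)) k
       = (\<Sum>i\<in>A. if i = k then lookup f k else 0)"
      unfolding lookup_sum by (rule sum.cong) (auto simp: lookup_single when_def)
    also have "\<dots> = lookup f k" using that by (auto simp: in_keys_iff)
    finally show "lookup (\<Sum>k\<in>A. Poly_Mapping.single k (lookup f k)) k = lookup f k" .
  qed
  have "keys (\<Sum>k\<in>A. Poly_Mapping.single k (lookup f k)) \<subseteq> S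
      \<and> P (\<Sum>k\<in>A. Poly_Mapping.single k (lookup f k))" if "finite A" "A \<subseteq> S" for A
    using that
  proof (induction A rule: finite_induct)
    case (insert x F)
    then have 1: "keys (\<Sum>k\<in>F. Poly_Mapping.single k (lookup f k)) \<subseteq> S"
      "keys (Poly_Mapping.single x (lookup f x)) \<subseteq> S"
      by (auto simp: Poly_Mapping.keys_single split: if_splits)
    then show ?case
      using insert assms(3)[of "Poly_Mapping.single x (lookup f x)" "\<Sum>k\<in>F. Poly_Mapping.single k (lookup f k)"]
        assms(4) Poly_Mapping.keys_add[of "Poly_Mapping.single x (lookup f x)" "\<Sum>k\<in>F. Poly_Mapping.single k (lookup f k)"]
      by auto
  qed (simp add: assms)
  from this[of "keys f"] exp[of "keys f"] assms(1) show ?thesis by simp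
qed

lemma ex_pm:
  assumes "finite K"
  shows "\<exists>f. keys f \<subseteq> K \<and> (\<forall>k\<in>K. lookup f k = (a k :: complex))"
proof (intro exI conjI ballI)
  let ?f = "\<Sum>s\<in>K. Poly_Mapping.single s (a s)"
  have *: "lookup ?f k = (if k \<in> K then a k else 0)" for k
  proof -
    have "lookup ?f k = (\<Sum>i\<in>K. if i = k then a k else 0)"
      unfolding lookup_sum by (rule sum.cong) (auto simp: lookup_single when_def)
    then show ?thesis using assms by simp
  qed
  show "keys ?f \<subseteq> K" by (auto simp: in_keys_iff * split: if_splits)
  show "lookup ?f k = a k" if "k \<in> K" for k using that by (simp add: *)
qed

context cvec begin

lemma lin_span_eq:
  assumes "S \<subseteq> carrier M"
  shows "lin_span M S = {pm_sum M (\<lambda>s. s) f | f. keys f \<subseteq> S}"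
proof (intro equalityI subsetI)
  fix x assume "x \<in> lin_span M S"
  then obtain K a where K: "finite K" "K \<subseteq> S" "x = (\<Oplus>s\<in>K. a s \<odot> s)"
    by (auto simp: lin_span_def)
  obtain f where f: "keys f \<subseteq> K" "\<forall>k\<in>K. lookup f k = a k" using ex_pm[OF K(1), of a] by blast
  have "x = pm_sum M (\<lambda>s. s) f"
    unfolding K(3) using K f assms
    by (subst pm_sum_superset[of K]) (auto intro!: add.finprod_cong')
  then show "x \<in> {pm_sum M (\<lambda>s. s) f | f. keys f \<subseteq> S}" using f K by blast
next
  fix x assume "x \<in> {pm_sum M (\<lambda>s. s) f | f. keys f \<subseteq> S}"
  then obtain f where "keys f \<subseteq> S" "x = pm_sum M (\<lambda>s. s) f" by blast
  then show "x \<in> lin_span M S"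
    unfolding lin_span_def pm_sum_def by (intro CollectI exI[of _ "keys f"] exI[of _ "lookup f"]) auto
qed

lemma lin_span_closed: "S \<subseteq> carrier M \<Longrightarrow> lin_span M S \<subseteq> carrier M"
  by (auto simp: lin_span_eq intro!: pm_sum_closed)

lemma lin_span_base:
  assumes "S \<subseteq> carrier M" "x \<in> S" shows "x \<in> lin_span M S"
  unfolding lin_span_eq[OF assms(1)]
  by (rule CollectI, rule exI[of _ "Poly_Mapping.single x 1"])
    (use assms in \<open>auto simp: pm_sum_single Poly_Mapping.keys_single\<close>)

lemma lin_span_zero: "S \<subseteq> carrier M \<Longrightarrow> \<zero> \<in> lin_span M S"
  by (force simp: lin_span_eq intro: exI[of _ 0])

lemma lin_span_add:
  assumes "S \<subseteq> carrier M" "x \<in> lin_span M S" "y \<in> lin_span M S"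
  shows "x \<oplus> y \<in> lin_span M S"
proof -
  obtain f g where "keys f \<subseteq> S" "keys g \<subseteq> S" "x = pm_sum M (\<lambda>s. s) f" "y = pm_sum M (\<lambda>s. s) g"
    using assms by (auto simp: lin_span_eq)
  then show ?thesis
    using assms(1) Poly_Mapping.keys_add[of f g]
    by (auto simp: lin_span_eq intro!: exI[of _ "f + g"] pm_sum_add[symmetric])
qed

lemma lin_span_smult:
  assumes "S \<subseteq> carrier M" "x \<in> lin_span M S"
  shows "c \<odot> x \<in> lin_span M S"
proof -
  obtain f where "keys f \<subseteq> S" "x = pm_sum M (\<lambda>s. s) f"
    using assms by (auto simp: lin_span_eq)
  then show ?thesis
    using assms(1) keys_map_times[of c f]
    by (auto simp: lin_span_eq intro!: exI[of _ "Poly_Mapping.map ((*) c) f"] pm_sum_smult[symmetric])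
qed

lemma lin_span_induct [consumes 2, case_names zero add smult]:
  assumes "x \<in> lin_span M S" "S \<subseteq> carrier M" "P \<zero>"
    "\<And>x y. x \<in> carrier M \<Longrightarrow> y \<in> carrier M \<Longrightarrow> P x \<Longrightarrow> P y \<Longrightarrow> P (x \<oplus> y)"
    "\<And>c x. x \<in> S \<Longrightarrow> P (c \<odot> x)"
  shows "P x"
proof -
  have "P (pm_sum M (\<lambda>s. s) f)" if "keys f \<subseteq> S" for f
    using that
  proof (induction rule: pm_induct)
    case (add f g)
    then show ?case
      using assms(2) by (subst pm_sum_add) (auto intro!: assms(4) pm_sum_closed)
  next
    case (single k c)
    then show ?case using assms by (subst pm_sum_single) auto
  qed (use that assms in auto)
  then show ?thesis using assms by (auto simp: lin_span_eq)
qed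

end


subsection \<open>Linear maps and homomorphisms\<close>

lemma linear_mapsD:
  assumes "f \<in> linear_maps M N"
  shows "x \<in> carrier M \<Longrightarrow> f x \<in> carrier N"
    and "x \<in> carrier M \<Longrightarrow> y \<in> carrier M \<Longrightarrow> f (x \<oplus>\<^bsub>M\<^esub> y) = f x \<oplus>\<^bsub>N\<^esub> f y"
    and "x \<in> carrier M \<Longrightarrow> f (c \<odot>\<^bsub>M\<^esub> x) = c \<odot>\<^bsub>N\<^esub> f x"
  using assms by (auto simp: linear_maps_def)

lemma linear_mapsI:
  assumes "\<And>x. x \<in> carrier M \<Longrightarrow> f x \<in> carrier N"
    and "\<And>x y. x \<in> carrier M \<Longrightarrow> y \<in> carrier M \<Longrightarrow> f (x \<oplus>\<^bsub>M\<^esub> y) = f x \<oplus>\<^bsub>N\<^esub> f y"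
    and "\<And>c x. x \<in> carrier M \<Longrightarrow> f (c \<odot>\<^bsub>M\<^esub> x) = c \<odot>\<^bsub>N\<^esub> f x"
  shows "f \<in> linear_maps M N"
  using assms by (auto simp: linear_maps_def)

lemma linear_maps_zero:
  assumes "f \<in> linear_maps M N" "cvec M" "cvec N"
  shows "f \<zero>\<^bsub>M\<^esub> = \<zero>\<^bsub>N\<^esub>"
proof -
  interpret M: cvec M by fact
  interpret N: cvec N by fact
  have "f (0 \<odot>\<^bsub>M\<^esub> \<zero>\<^bsub>M\<^esub>) = 0 \<odot>\<^bsub>N\<^esub> f \<zero>\<^bsub>M\<^esub>"
    by (rule linear_mapsD(3)[OF assms(1)]) simp
  then show ?thesis using linear_mapsD(1)[OF assms(1)] by simp
qed

lemma linear_maps_uminus: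
  assumes "f \<in> linear_maps M N" "cvec M" "cvec N" "x \<in> carrier M"
  shows "f (\<ominus>\<^bsub>M\<^esub> x) = \<ominus>\<^bsub>N\<^esub> f x"
  using linear_mapsD(3)[OF assms(1) assms(4), of "-1"] linear_mapsD(1)[OF assms(1) assms(4)]
  by (simp add: cvec.smult_minus_one[OF assms(2)] cvec.smult_minus_one[OF assms(3)] assms(4))

lemma linear_maps_minus:
  assumes "f \<in> linear_maps M N" "cvec M" "cvec N" "x \<in> carrier M" "y \<in> carrier M"
  shows "f (x \<ominus>\<^bsub>M\<^esub> y) = f x \<ominus>\<^bsub>N\<^esub> f y"
proof -
  interpret M: cvec M by fact
  show ?thesis
    using assms by (simp add: a_minus_def linear_mapsD(2)[OF assms(1)] linear_maps_uminus)
qed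

lemma linear_maps_pm_sum:
  assumes "f \<in> linear_maps M N" "cvec M" "cvec N" "\<phi> \<in> keys g \<rightarrow> carrier M"
  shows "f (pm_sum M \<phi> g) = pm_sum N (\<lambda>k. f (\<phi> k)) g"
proof -
  interpret M: cvec M by fact
  interpret N: cvec N by fact
  have "f (pm_sum M \<phi> h) = pm_sum N (\<lambda>k. f (\<phi> k)) h" if "keys h \<subseteq> keys g" for h
    using that
  proof (induction rule: pm_induct)
    case (add h k)
    moreover have "\<phi> \<in> keys h \<union> keys k \<rightarrow> carrier M" using add assms(4) by auto
    moreover from this have "(\<lambda>k. f (\<phi> k)) \<in> keys h \<union> keys k \<rightarrow> carrier N"
      using linear_mapsD(1)[OF assms(1)] by blast
    ultimately show ?case
      by (simp add: M.pm_sum_add N.pm_sum_add linear_mapsD(2)[OF assms(1)] M.pm_sum_closed)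
  next
    case (single k c)
    then have "\<phi> k \<in> carrier M" using assms(4) by auto
    then show ?case
      by (simp add: M.pm_sum_single N.pm_sum_single linear_mapsD(1,3)[OF assms(1)])
  qed (auto simp: linear_maps_zero[OF assms(1-3)])
  then show ?thesis by simp
qed

lemma alg_homsD:
  assumes "f \<in> alg_homs M N"
  shows "x \<in> carrier M \<Longrightarrow> f x \<in> carrier N"
    and "x \<in> carrier M \<Longrightarrow> y \<in> carrier M \<Longrightarrow> f (x \<oplus>\<^bsub>M\<^esub> y) = f x \<oplus>\<^bsub>N\<^esub> f y"
    and "x \<in> carrier M \<Longrightarrow> f (c \<odot>\<^bsub>M\<^esub> x) = c \<odot>\<^bsub>N\<^esub> f x"
    and "x \<in> carrier M \<Longrightarrow> y \<in> carrier M \<Longrightarrow> f (x \<otimes>\<^bsub>M\<^esub> y) = f x \<otimes>\<^bsub>N\<^esub> f y"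
    and "f \<one>\<^bsub>M\<^esub> = \<one>\<^bsub>N\<^esub>"
  using assms by (auto simp: alg_homs_def linear_maps_def ring_hom_def)

lemma alg_homsI:
  assumes "\<And>x. x \<in> carrier M \<Longrightarrow> f x \<in> carrier N"
    and "\<And>x y. x \<in> carrier M \<Longrightarrow> y \<in> carrier M \<Longrightarrow> f (x \<oplus>\<^bsub>M\<^esub> y) = f x \<oplus>\<^bsub>N\<^esub> f y"
    and "\<And>c x. x \<in> carrier M \<Longrightarrow> f (c \<odot>\<^bsub>M\<^esub> x) = c \<odot>\<^bsub>N\<^esub> f x"
    and "\<And>x y. x \<in> carrier M \<Longrightarrow> y \<in> carrier M \<Longrightarrow> f (x \<otimes>\<^bsub>M\<^esub> y) = f x \<otimes>\<^bsub>N\<^esub> f y"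
    and "f \<one>\<^bsub>M\<^esub> = \<one>\<^bsub>N\<^esub>"
  shows "f \<in> alg_homs M N"
  using assms by (auto simp: alg_homs_def linear_maps_def ring_hom_def)

lemma alg_homs_linear: "f \<in> alg_homs M N \<Longrightarrow> f \<in> linear_maps M N"
  by (simp add: alg_homs_def)

lemma alg_homs_comp:
  "f \<in> alg_homs M N \<Longrightarrow> g \<in> alg_homs N L \<Longrightarrow> (\<lambda>x. g (f x)) \<in> alg_homs M L"
  by (rule alg_homsI) (simp_all add: alg_homsD)

lemma subalg_gen_closed:
  assumes "calg M" "S \<subseteq> carrier M" shows "subalg_gen M S \<subseteq> carrier M"
proof
  interpret calg M by fact
  fix x assume "x \<in> subalg_gen M S"
  then show "x \<in> carrier M" by induction (use assms in auto)
qed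

lemma alg_homs_eq_on_gen:
  assumes "calg M" "S \<subseteq> carrier M" "f \<in> alg_homs M N" "g \<in> alg_homs M N"
    "\<And>x. x \<in> S \<Longrightarrow> f x = g x" "x \<in> subalg_gen M S"
  shows "f x = g x"
proof -
  have sub: "subalg_gen M S \<subseteq> carrier M" by (rule subalg_gen_closed) fact+
  show ?thesis
    using assms(6)
    by induction (use sub assms alg_homsD[OF assms(3)] alg_homsD[OF assms(4)] in \<open>auto simp: subset_iff\<close>)
qed

text \<open>One homomorphism with the prescribed values resolves the definite description: agreement
  on generators gives uniqueness on the carrier, and \<open>extensional\<close> fixes the values
  outside it, which is why the result is a restriction.\<close>

lemma alg_ext_eq:
  assumes "calg M" "f \<in> alg_homs M N" "\<And>x y. (x, y) \<in> V \<Longrightarrow> x \<in> carrier M \<and> f x = y"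
    and gen: "carrier M \<subseteq> subalg_gen M (fst ` V)"
  shows "alg_ext M N V = restrict f (carrier M)"
  unfolding alg_ext_def
proof (rule the_equality)
  interpret calg M by fact
  have "restrict f (carrier M) \<in> alg_homs M N"
    using alg_homsD[OF assms(2)] by (intro alg_homsI) auto
  then show *: "restrict f (carrier M) \<in> alg_homs M N \<inter> extensional (carrier M)
      \<and> (\<forall>(x, y)\<in>V. restrict f (carrier M) x = y)"
    using assms(3) by auto
  fix g assume g: "g \<in> alg_homs M N \<inter> extensional (carrier M) \<and> (\<forall>(x, y)\<in>V. g x = y)"
  show "g = restrict f (carrier M)"
  proof (rule extensionalityI[of _ "carrier M"])
    fix x assume x: "x \<in> carrier M"
    have "g x = f x"
      by (rule alg_homs_eq_on_gen[of M "fst ` V" g N f]) (use assms g gen x in auto)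
    then show "g x = restrict f (carrier M) x" using x by simp
  qed (use g in auto)
qed


subsection \<open>Quotients\<close>

lemma image_constant_eq: "a \<in> A \<Longrightarrow> (\<And>x. x \<in> A \<Longrightarrow> f x = b) \<Longrightarrow> f ` A = {b}"
  by blast

locale csub = cvec M for M :: "(complex, 'a) module" (structure) +
  fixes N :: "'a set"
  assumes N_sub: "N \<subseteq> carrier M" and N_zero: "\<zero> \<in> N"
    and N_add: "x \<in> N \<Longrightarrow> y \<in> N \<Longrightarrow> x \<oplus> y \<in> N"
    and N_smult: "x \<in> N \<Longrightarrow> c \<odot> x \<in> N"
begin

lemma N_abelian_subgroup: "abelian_subgroup N M"
proof (rule abelian_subgroupI3[OF _ abelian_group_axioms], rule additive_subgroupI, rule add.subgroupI)
  show "\<ominus> x \<in> N" if "x \<in> N" for x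
    using that N_smult[of x "-1"] N_sub smult_minus_one by auto
qed (use N_sub N_zero N_add in auto)

sublocale abelian_subgroup N M by (rule N_abelian_subgroup)

lemma quot_simps [simp]:
  "carrier (quot_mod M N) = (\<lambda>x. N +> x) ` carrier M"
  "zero (quot_mod M N) = N"
  "one (quot_mod M N) = N +> \<one>"
  "add (quot_mod M N) = set_add M"
  "mult (quot_mod M N) = rcoset_mult M N"
  "module.smult (quot_mod M N) c X = (\<Union>x\<in>X. N +> (c \<odot> x))"
  by (auto simp: quot_mod_def ring.defs module.defs FactRing_simps A_RCOSETS_def' a_r_coset_def')

lemma coset_eq_iff: "x \<in> carrier M \<Longrightarrow> y \<in> carrier M \<Longrightarrow> N +> x = N +> y \<longleftrightarrow> x \<ominus> y \<in> N"
  by (metis a_minus_def a_rcos_module a_rcos_self a_repr_independence')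

lemma coset_eq_N_iff: "x \<in> carrier M \<Longrightarrow> N +> x = N \<longleftrightarrow> x \<in> N"
  by (metis a_coset_join2 a_rcos_self a_subgroup)

lemma coset_zero [simp]: "N +> \<zero> = N"
  by (simp add: coset_eq_N_iff N_zero)

lemma coset_memD: "y \<in> N +> x \<Longrightarrow> x \<in> carrier M \<Longrightarrow> y \<in> carrier M \<and> N +> y = N +> x"
  by (metis a_repr_independence' a_elemrcos_carrier)

lemma coset_self: "x \<in> carrier M \<Longrightarrow> x \<in> N +> x"
  by (rule a_rcos_self)

text \<open>Two representatives differ by an element of N, and so do their multiples. The union over
  representatives in \<open>quot_mod\<close> is therefore a union of copies of one coset.\<close>

lemma coset_smult:
  assumes "x \<in> carrier M" shows "(\<Union>y\<in>N +> x. N +> (c \<odot> y)) = N +> (c \<odot> x)"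
proof -
  have "N +> (c \<odot> y) = N +> (c \<odot> x)" if "y \<in> N +> x" for y
  proof -
    have y: "y \<in> carrier M" "N +> y = N +> x" using coset_memD[OF that assms] by auto
    then have "y \<ominus> x \<in> N" using coset_eq_iff assms by simp
    then have "c \<odot> (y \<ominus> x) \<in> N" by (rule N_smult)
    also have "c \<odot> (y \<ominus> x) = c \<odot> y \<ominus> c \<odot> x"
      using y assms by (simp add: a_minus_def smult_add_right smult_uminus_right)
    finally show ?thesis using y assms coset_eq_iff by simp
  qed
  then have "(\<lambda>y. N +> (c \<odot> y)) ` (N +> x) = {N +> (c \<odot> x)}"
    by (intro image_constant_eq[OF coset_self[OF assms]])
  from arg_cong[OF this, of Union] show ?thesis by (simp only: Sup_insert Sup_empty sup_bot_right)
qed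

lemma cvec_quot: "cvec (quot_mod M N)"
  by (rule cvec_image[OF cvec_axioms, of "\<lambda>x. N +> x"])
    (auto simp: coset_smult a_rcos_sum a_coset_join2 coset_eq_N_iff N_zero)

lemma quot_linear: "(\<lambda>x. N +> x) \<in> linear_maps M (quot_mod M N)"
  by (rule linear_mapsI) (auto simp: coset_smult a_rcos_sum)

end

lemma calg_quot:
  assumes "calg M" "ideal N M"
  shows "csub M N" "calg (quot_mod M N)" "(\<lambda>x. N +>\<^bsub>M\<^esub> x) \<in> alg_homs M (quot_mod M N)"
proof -
  interpret calg M by fact
  interpret I: ideal N M by fact
  show csub: "csub M N"
  proof (unfold_locales, goal_cases)
    case (4 x c)
    then have x: "x \<in> carrier M" using I.a_subset by blast
    then have "c \<odot>\<^bsub>M\<^esub> x = (c \<odot>\<^bsub>M\<^esub> \<one>\<^bsub>M\<^esub>) \<otimes>\<^bsub>M\<^esub> x" by (simp add: smult_mult_left)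
    then show ?case using I.I_l_closed[OF 4, of "c \<odot>\<^bsub>M\<^esub> \<one>\<^bsub>M\<^esub>"] by simp
  qed (use I.a_subset in simp_all)
  note Q = csub.coset_smult[OF csub] abelian_subgroup.a_rcos_sum[OF csub.N_abelian_subgroup[OF csub]] csub.quot_simps[OF csub] csub.coset_zero[OF csub]
  show "calg (quot_mod M N)"
    apply (rule calg_image[OF \<open>calg M\<close>, of "\<lambda>x. N +>\<^bsub>M\<^esub> x"])
    subgoal by (simp add: Q(2-))
    subgoal by (simp add: Q(2-))
    subgoal by (simp add: Q)
    subgoal by (simp add: Q(2-))
    subgoal by (simp add: Q(2-) I.rcoset_mult_add)
    subgoal by (simp add: Q(2-))
    done
  show "(\<lambda>x. N +>\<^bsub>M\<^esub> x) \<in> alg_homs M (quot_mod M N)"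
    apply (rule alg_homsI)
    subgoal by (simp add: Q(2-))
    subgoal by (simp add: Q(2-))
    subgoal by (simp add: Q)
    subgoal by (simp add: Q(2-) I.rcoset_mult_add)
    subgoal by (simp add: Q(2-))
    done
qed

section \<open>Free and presented algebras\<close>

lemma mon_Nil [simp]: "mon [] = 1"
  by (simp add: mon_def zero_word_def[symmetric])

lemma mon_mult: "mon xs * mon ys = mon (xs @ ys)"
  by (simp add: mon_def mult_single plus_word_def)

lemma mon_Cons: "mon (x # xs) = mon [x] * mon xs"
  by (simp add: mon_mult)

lemma scal_mult: "scal a * scal b = scal (a * b)"
  by (simp add: scal_def mult_single)

lemma scal_add: "scal (a + b) = scal a + scal b"
  by (simp add: scal_def single_add)

lemma scal_simps [simp]: "scal 0 = 0" "scal 1 = 1"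
  by (simp_all add: scal_def)

lemma scal_uminus: "scal (- a) = - scal a"
  by (simp add: scal_def single_uminus)

lemma map_times_scal: "Poly_Mapping.map ((*) c) f = scal c * f"
  by (simp add: scal_def mult_map_scale_conv_mult)

lemma single_scal_mon: "Poly_Mapping.single w c = scal c * mon (letters w)"
  by (cases w) (simp add: scal_def mon_def mult_single plus_word_def zero_word_def)

lemma falg_induct [case_names add mon]:
  assumes "\<And>f g. P f \<Longrightarrow> P g \<Longrightarrow> P (f + g)" "\<And>c xs. P (scal c * mon xs)"
  shows "P (f :: 'g falg)"
proof -
  have "keys f \<subseteq> UNIV" by simp
  then show ?thesis
  proof (induction rule: pm_induct)
    case zero
    show ?case using assms(2)[of 0 "[]"] by simp
  qed (auto simp: assms single_scal_mon)
qed

lemma scal_commute: "x * scal c = scal c * (x :: 'g falg)"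
proof (induction x rule: falg_induct)
  case (mon d xs)
  have 1: "mon xs * scal c = scal c * mon xs"
    by (simp add: mon_def scal_def mult_single)
  have "scal d * mon xs * scal c = scal d * scal c * mon xs"
    by (simp only: mult.assoc 1)
  also have "scal d * scal c = scal c * scal d" by (simp add: scal_mult mult.commute)
  finally show ?case by (simp only: mult.assoc)
qed (simp add: distrib_left distrib_right)

lemma free_alg_simps [simp]:
  "carrier free_alg = UNIV" "mult free_alg = (*)" "one free_alg = 1"
  "zero free_alg = 0" "add free_alg = (+)" "module.smult free_alg c f = scal c * f"
  by (simp_all add: free_alg_def map_times_scal)

lemma calg_free_alg: "calg (free_alg :: (complex, 'g falg) module)"
proof -
  interpret abelian_group "free_alg :: (complex, 'g falg) module"
    by (rule abelian_groupI) (auto simp: ac_simps intro: exI[of _ "- x" for x] right_minus)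
  interpret ring "free_alg :: (complex, 'g falg) module"
    by (rule ringI[OF abelian_group_axioms]; (rule monoidI)?) (simp_all add: algebra_simps)
  show ?thesis
  proof unfold_locales
    fix c and x y :: "'g falg"
    show "x \<otimes>\<^bsub>free_alg\<^esub> (c \<odot>\<^bsub>free_alg\<^esub> y) = c \<odot>\<^bsub>free_alg\<^esub> (x \<otimes>\<^bsub>free_alg\<^esub> y)"
      by (simp only: free_alg_simps mult.assoc[symmetric] scal_commute)
  qed (simp_all add: distrib_left distrib_right scal_add scal_mult mult.assoc[symmetric])
qed

lemma free_alg_uminus [simp]: "\<ominus>\<^bsub>free_alg\<^esub> (x :: 'g falg) = - x"
proof -
  interpret calg "free_alg :: (complex, 'g falg) module" by (rule calg_free_alg)
  show ?thesis by (rule minus_equality) auto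
qed

lemma free_alg_minus [simp]: "(x :: 'g falg) \<ominus>\<^bsub>free_alg\<^esub> y = x - y"
  by (simp add: a_minus_def)

lemma free_idealI:
  fixes J :: "'g falg set"
  assumes "0 \<in> J" "\<And>x y. x \<in> J \<Longrightarrow> y \<in> J \<Longrightarrow> x + y \<in> J"
    "\<And>x y. x \<in> J \<Longrightarrow> y * x \<in> J" "\<And>x y. x \<in> J \<Longrightarrow> x * y \<in> J"
  shows "ideal J free_alg"
proof -
  interpret calg "free_alg :: (complex, 'g falg) module" by (rule calg_free_alg)
  show ?thesis
  proof (rule idealI[OF ring_axioms])
    show "subgroup J (add_monoid free_alg)"
      by (rule add.subgroupI) (use assms assms(3)[of _ "-1"] in auto)
  qed (use assms in auto)
qed

abbreviation rel_ideal :: "'g falg set \<Rightarrow> 'g falg set" where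
  "rel_ideal R \<equiv> Idl\<^bsub>free_alg\<^esub> R"

lemma rel_ideal_ideal: "ideal (rel_ideal (R :: 'g falg set)) free_alg"
proof -
  interpret calg "free_alg :: (complex, 'g falg) module" by (rule calg_free_alg)
  show ?thesis by (rule genideal_ideal) simp
qed

lemma rel_ideal_base: "x \<in> R \<Longrightarrow> x \<in> rel_ideal (R :: 'g falg set)"
proof -
  interpret calg "free_alg :: (complex, 'g falg) module" by (rule calg_free_alg)
  show "x \<in> R \<Longrightarrow> x \<in> rel_ideal R" using genideal_self[of R] by auto
qed

lemma rel_ideal_least:
  assumes "ideal J free_alg" "R \<subseteq> J" shows "rel_ideal (R :: 'g falg set) \<subseteq> J"
proof -
  interpret calg "free_alg :: (complex, 'g falg) module" by (rule calg_free_alg)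
  show ?thesis using assms genideal_minimal by blast
qed

lemma ideal_free_simps:
  fixes J :: "'g falg set"
  assumes "ideal J free_alg"
  shows "0 \<in> J" "x \<in> J \<Longrightarrow> y \<in> J \<Longrightarrow> x + y \<in> J" "x \<in> J \<Longrightarrow> y \<in> J \<Longrightarrow> x - y \<in> J"
    "x \<in> J \<Longrightarrow> - x \<in> J" "x \<in> J \<Longrightarrow> y * x \<in> J" "x \<in> J \<Longrightarrow> x * y \<in> J"
proof -
  interpret ideal J free_alg by fact
  show "0 \<in> J" using additive_subgroup.zero_closed[OF is_additive_subgroup] by simp
  show *: "x \<in> J \<Longrightarrow> y \<in> J \<Longrightarrow> x + y \<in> J" "x \<in> J \<Longrightarrow> y * x \<in> J" "x \<in> J \<Longrightarrow> x * y \<in> J" for x y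
    using additive_subgroup.a_closed[OF is_additive_subgroup, of x y] I_l_closed[of x y] I_r_closed[of x y] by simp_all
  show "x \<in> J \<Longrightarrow> - x \<in> J" for x using *(2)[of x "-1"] by simp
  then show "x \<in> J \<Longrightarrow> y \<in> J \<Longrightarrow> x - y \<in> J" using *(1)[of x "- y"] by simp
qed

lemma
  shows calg_presented: "calg (presented R)"
    and cls_hom: "cls R \<in> alg_homs free_alg (presented R)"
  using calg_quot(2,3)[OF calg_free_alg rel_ideal_ideal, of R]
  by (simp_all add: presented_def cls_def[abs_def])

lemma presented_carrier: "carrier (presented R) = range (cls R)"
proof -
  interpret csub free_alg "rel_ideal R" by (rule calg_quot(1)[OF calg_free_alg rel_ideal_ideal])
  show ?thesis by (simp add: presented_def cls_def)
qed

lemma cls_eq_iff: "cls R x = cls R y \<longleftrightarrow> x - y \<in> rel_ideal R"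
proof -
  interpret csub free_alg "rel_ideal R" by (rule calg_quot(1)[OF calg_free_alg rel_ideal_ideal])
  show ?thesis using coset_eq_iff[of x y] by (simp add: cls_def)
qed

lemma cls_mem_iff: "y \<in> cls R x \<longleftrightarrow> cls R y = cls R x"
proof -
  interpret csub free_alg "rel_ideal R" by (rule calg_quot(1)[OF calg_free_alg rel_ideal_ideal])
  show ?thesis using coset_memD[of y x] coset_self[of y] by (auto simp: cls_def)
qed

lemma cls_simps:
  "cls R x \<oplus>\<^bsub>presented R\<^esub> cls R y = cls R (x + y)"
  "cls R x \<otimes>\<^bsub>presented R\<^esub> cls R y = cls R (x * y)"
  "c \<odot>\<^bsub>presented R\<^esub> cls R x = cls R (scal c * x)"
  "\<one>\<^bsub>presented R\<^esub> = cls R 1" "\<zero>\<^bsub>presented R\<^esub> = cls R 0"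
  "cls R x \<in> carrier (presented R)"
  using alg_homsD[OF cls_hom[of R]]
    linear_maps_zero[OF alg_homs_linear[OF cls_hom[of R]]] calg_free_alg calg_presented[of R]
  by (auto simp: calg_def)

lemma cls_minus: "\<ominus>\<^bsub>presented R\<^esub> cls R x = cls R (- x)"
  "cls R x \<ominus>\<^bsub>presented R\<^esub> cls R y = cls R (x - y)"
  using linear_maps_uminus[OF alg_homs_linear[OF cls_hom[of R]], of x]
    linear_maps_minus[OF alg_homs_linear[OF cls_hom[of R]], of x y] calg_free_alg calg_presented[of R]
  by (auto simp: calg_def)

lemma cls_eqI: "x - y \<in> R \<Longrightarrow> cls R x = cls R y"
  by (simp add: cls_eq_iff rel_ideal_base)

lemma presented_induct [consumes 1, case_names one add smult letter]:
  assumes "X \<in> carrier (presented R)" "P (\<one>\<^bsub>presented R\<^esub>)"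
    "\<And>X Y. X \<in> carrier (presented R) \<Longrightarrow> Y \<in> carrier (presented R) \<Longrightarrow> P X \<Longrightarrow> P Y
        \<Longrightarrow> P (X \<oplus>\<^bsub>presented R\<^esub> Y)"
    "\<And>c X. X \<in> carrier (presented R) \<Longrightarrow> P X \<Longrightarrow> P (c \<odot>\<^bsub>presented R\<^esub> X)"
    "\<And>l X. X \<in> carrier (presented R) \<Longrightarrow> P X \<Longrightarrow> P (cls R (mon [l]) \<otimes>\<^bsub>presented R\<^esub> X)"
  shows "P X"
proof -
  have mon': "P (cls R (mon xs))" for xs
  proof (induction xs)
    case (Cons a xs)
    then show ?case using assms(5)[of "cls R (mon xs)" a] by (simp add: cls_simps mon_Cons[of a xs])
  qed (use assms in \<open>simp add: cls_simps\<close>)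
  have "P (cls R x)" for x
  proof (induction x rule: falg_induct)
    case (add f g)
    then show ?case using assms(3)[of "cls R f" "cls R g"] by (simp add: cls_simps)
  next
    case (mon c xs)
    show ?case using assms(4)[of "cls R (mon xs)" c, OF _ mon'] by (simp add: cls_simps)
  qed
  then show ?thesis using assms(1) by (auto simp: presented_carrier)
qed

lemma presented_gen:
  assumes "range (\<lambda>l. cls R (mon [l])) \<subseteq> S"
  shows "carrier (presented R) \<subseteq> subalg_gen (presented R) S"
proof
  fix X assume "X \<in> carrier (presented R)"
  then show "X \<in> subalg_gen (presented R) S"
    by (induction rule: presented_induct) (use assms in \<open>auto intro: subalg_gen.intros\<close>)
qed

section \<open>Homomorphisms out of free and presented algebras\<close>

primrec wprod :: "(complex, 'a) module \<Rightarrow> ('l \<Rightarrow> 'a) \<Rightarrow> 'l list \<Rightarrow> 'a" where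
  "wprod M \<phi> [] = \<one>\<^bsub>M\<^esub>"
| "wprod M \<phi> (x # xs) = \<phi> x \<otimes>\<^bsub>M\<^esub> wprod M \<phi> xs"

definition fhom :: "(complex, 'a) module \<Rightarrow> ('g letter \<Rightarrow> 'a) \<Rightarrow> 'g falg \<Rightarrow> 'a" where
  "fhom M \<phi> f = pm_sum M (\<lambda>w. wprod M \<phi> (letters w)) f"

locale letter_map = calg M for M :: "(complex, 'a) module" +
  fixes \<phi> :: "'g letter \<Rightarrow> 'a"
  assumes phi_closed [simp, intro]: "\<phi> l \<in> carrier M"
begin

lemma wprod_closed [simp, intro]: "wprod M \<phi> xs \<in> carrier M"
  by (induction xs) auto

lemma wprod_append: "wprod M \<phi> (xs @ ys) = wprod M \<phi> xs \<otimes>\<^bsub>M\<^esub> wprod M \<phi> ys"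
  by (induction xs) (auto simp: m_assoc)

lemma fhom_closed [simp, intro]: "fhom M \<phi> f \<in> carrier M"
  by (auto simp: fhom_def)

lemma fhom_add: "fhom M \<phi> (f + g) = fhom M \<phi> f \<oplus>\<^bsub>M\<^esub> fhom M \<phi> g"
  unfolding fhom_def by (rule pm_sum_add) auto

lemma fhom_scal: "fhom M \<phi> (scal c * f) = c \<odot>\<^bsub>M\<^esub> fhom M \<phi> f"
  unfolding fhom_def map_times_scal[symmetric] by (rule pm_sum_smult) auto

lemma fhom_mon: "fhom M \<phi> (mon xs) = wprod M \<phi> xs"
  by (simp add: fhom_def mon_def pm_sum_single)

lemma fhom_mult: "fhom M \<phi> (f * g) = fhom M \<phi> f \<otimes>\<^bsub>M\<^esub> fhom M \<phi> g"
proof (induction f rule: falg_induct)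
  case (add f h)
  then show ?case by (simp add: distrib_right fhom_add l_distr)
next
  case (mon c xs)
  show ?case
  proof (induction g rule: falg_induct)
    case (add f h)
    then show ?case by (simp add: distrib_left fhom_add r_distr)
  next
    case (mon d ys)
    have "scal c * mon xs * (scal d * mon ys) = scal c * (scal d * mon (xs @ ys))"
      by (simp only: mult.assoc[symmetric] scal_commute[of "mon xs" d]
          mon_mult[symmetric] mult.assoc[of "scal c" "mon xs" "scal d"])
    then show ?case
      by (simp add: fhom_scal fhom_mon wprod_append smult_mult_left smult_mult_right
          smult_smult mult.commute)
  qed
qed

lemma fhom_one: "fhom M \<phi> 1 = \<one>\<^bsub>M\<^esub>"
  using fhom_mon[of "[]"] by simp

lemma fhom_scalar: "fhom M \<phi> (scal c) = c \<odot>\<^bsub>M\<^esub> \<one>\<^bsub>M\<^esub>"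
  using fhom_scal[of c 1] by (simp add: fhom_one)

lemma fhom_letter: "fhom M \<phi> (mon [l]) = \<phi> l"
  by (simp add: fhom_mon)

lemma fhom_zero: "fhom M \<phi> 0 = \<zero>\<^bsub>M\<^esub>"
  using fhom_scal[of 0 1] by (simp add: fhom_one)

lemma fhom_uminus: "fhom M \<phi> (- f) = \<ominus>\<^bsub>M\<^esub> fhom M \<phi> f"
  using fhom_scal[of "-1" f] by (simp add: smult_minus_one scal_uminus)

lemma fhom_minus: "fhom M \<phi> (f - g) = fhom M \<phi> f \<ominus>\<^bsub>M\<^esub> fhom M \<phi> g"
  using fhom_add[of f "- g"] by (simp add: fhom_uminus a_minus_def)

lemmas fhom_simps = fhom_add fhom_scalar smult_mult_left fhom_mult fhom_one fhom_letter fhom_zero fhom_uminus fhom_minus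

lemma fhom_kernel: "ideal {f. fhom M \<phi> f = \<zero>\<^bsub>M\<^esub>} free_alg"
  by (rule free_idealI) (auto simp: fhom_simps)

lemma fhom_unique:
  assumes "f \<in> alg_homs free_alg M" "\<And>l. f (mon [l]) = \<phi> l"
  shows "f x = fhom M \<phi> x"
proof (induction x rule: falg_induct)
  case (mon c xs)
  have "f (mon xs) = fhom M \<phi> (mon xs)"
  proof (induction xs)
    case (Cons a xs)
    then show ?case
      using alg_homsD[OF assms(1)] by (simp add: mon_Cons[of a xs] fhom_simps assms(2))
  qed (use alg_homsD[OF assms(1)] in \<open>simp add: fhom_one\<close>)
  then show ?case using alg_homsD(3)[OF assms(1), of "mon xs" c] by (simp add: fhom_scal)
qed (use alg_homsD[OF assms(1)] in \<open>simp add: fhom_add\<close>)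

end

definition phom :: "(complex, 'a) module \<Rightarrow> ('g letter \<Rightarrow> 'a) \<Rightarrow> 'g falg set \<Rightarrow> 'a" where
  "phom M \<phi> X = fhom M \<phi> (SOME x. x \<in> X)"

locale presented_map = letter_map M \<phi> for M :: "(complex, 'a) module" and \<phi> :: "'g letter \<Rightarrow> 'a" +
  fixes R :: "'g falg set"
  assumes rels: "r \<in> R \<Longrightarrow> fhom M \<phi> r = \<zero>\<^bsub>M\<^esub>"
begin

lemma fhom_rel_ideal: "x \<in> rel_ideal R \<Longrightarrow> fhom M \<phi> x = \<zero>\<^bsub>M\<^esub>"
  using rel_ideal_least[OF fhom_kernel, of R] rels by auto

text \<open>The representative picked by \<open>SOME\<close> differs from x by an element of the
  relation ideal, and the kernel of \<open>fhom\<close> is an ideal containing the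
  relations.\<close>

lemma phom_cls: "phom M \<phi> (cls R x) = fhom M \<phi> x"
proof -
  have "x \<in> cls R x" by (simp add: cls_mem_iff)
  then have "(SOME y. y \<in> cls R x) \<in> cls R x" by (rule someI)
  then have "(SOME y. y \<in> cls R x) - x \<in> rel_ideal R" by (simp add: cls_mem_iff cls_eq_iff)
  from fhom_rel_ideal[OF this] show ?thesis
    by (simp add: phom_def fhom_minus minus_eq_zero_iff)
qed

lemma phom_hom: "phom M \<phi> \<in> alg_homs (presented R) M"
  by (rule alg_homsI) (auto simp: presented_carrier cls_simps phom_cls fhom_simps)

lemma alg_ext_presented:
  assumes "\<And>x y. (x, y) \<in> V \<Longrightarrow> \<exists>l. x = cls R (mon [l]) \<and> y = \<phi> l"
    and "\<And>l. cls R (mon [l]) \<in> fst ` V"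
  shows "alg_ext (presented R) M V = restrict (phom M \<phi>) (carrier (presented R))"
proof (rule alg_ext_eq[OF calg_presented phom_hom])
  show "x \<in> carrier (presented R) \<and> phom M \<phi> x = y" if "(x, y) \<in> V" for x y
    using assms(1)[OF that] by (auto simp: cls_simps phom_cls fhom_letter)
  show "carrier (presented R) \<subseteq> subalg_gen (presented R) (fst ` V)"
    by (rule presented_gen) (use assms(2) in auto)
qed

end

section \<open>Tensor products\<close>

definition bilin ::
    "(complex, 'a) module \<Rightarrow> (complex, 'b) module \<Rightarrow> (complex, 'c) module \<Rightarrow> ('a \<Rightarrow> 'b \<Rightarrow> 'c) \<Rightarrow> bool" where
  "bilin M N L g \<longleftrightarrow> (\<forall>x\<in>carrier M. g x \<in> linear_maps N L)
     \<and> (\<forall>y\<in>carrier N. (\<lambda>x. g x y) \<in> linear_maps M L)"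

lemma bilinI:
  assumes "\<And>x y. x \<in> carrier M \<Longrightarrow> y \<in> carrier N \<Longrightarrow> g x y \<in> carrier L"
    "\<And>x x' y. x \<in> carrier M \<Longrightarrow> x' \<in> carrier M \<Longrightarrow> y \<in> carrier N \<Longrightarrow>
       g (x \<oplus>\<^bsub>M\<^esub> x') y = g x y \<oplus>\<^bsub>L\<^esub> g x' y"
    "\<And>x y y'. x \<in> carrier M \<Longrightarrow> y \<in> carrier N \<Longrightarrow> y' \<in> carrier N \<Longrightarrow>
       g x (y \<oplus>\<^bsub>N\<^esub> y') = g x y \<oplus>\<^bsub>L\<^esub> g x y'"
    "\<And>c x y. x \<in> carrier M \<Longrightarrow> y \<in> carrier N \<Longrightarrow> g (c \<odot>\<^bsub>M\<^esub> x) y = c \<odot>\<^bsub>L\<^esub> g x y"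
    "\<And>c x y. x \<in> carrier M \<Longrightarrow> y \<in> carrier N \<Longrightarrow> g x (c \<odot>\<^bsub>N\<^esub> y) = c \<odot>\<^bsub>L\<^esub> g x y"
  shows "bilin M N L g"
  using assms by (simp add: bilin_def linear_maps_def)

lemma bilinD:
  assumes "bilin M N L g"
  shows "x \<in> carrier M \<Longrightarrow> y \<in> carrier N \<Longrightarrow> g x y \<in> carrier L"
    "x \<in> carrier M \<Longrightarrow> x' \<in> carrier M \<Longrightarrow> y \<in> carrier N \<Longrightarrow>
       g (x \<oplus>\<^bsub>M\<^esub> x') y = g x y \<oplus>\<^bsub>L\<^esub> g x' y"
    "x \<in> carrier M \<Longrightarrow> y \<in> carrier N \<Longrightarrow> y' \<in> carrier N \<Longrightarrow>
       g x (y \<oplus>\<^bsub>N\<^esub> y') = g x y \<oplus>\<^bsub>L\<^esub> g x y'"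
    "x \<in> carrier M \<Longrightarrow> y \<in> carrier N \<Longrightarrow> g (c \<odot>\<^bsub>M\<^esub> x) y = c \<odot>\<^bsub>L\<^esub> g x y"
    "x \<in> carrier M \<Longrightarrow> y \<in> carrier N \<Longrightarrow> g x (c \<odot>\<^bsub>N\<^esub> y) = c \<odot>\<^bsub>L\<^esub> g x y"
  using assms by (auto simp: bilin_def linear_maps_def)

lemma linear_maps_comp:
  "f \<in> linear_maps M N \<Longrightarrow> g \<in> linear_maps N L \<Longrightarrow> (\<lambda>x. g (f x)) \<in> linear_maps M L"
  by (rule linear_mapsI) (simp_all add: linear_mapsD)

lemma bilin_comp_left:
  assumes "bilin M N L g" "f \<in> linear_maps L K"
  shows "bilin M N K (\<lambda>x y. f (g x y))"
  by (rule bilinI) (simp_all add: linear_mapsD[OF assms(2)] bilinD[OF assms(1)])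

lemma bilin_comp_right:
  assumes "bilin M N L g" "f \<in> linear_maps M' M" "h \<in> linear_maps N' N"
  shows "bilin M' N' L (\<lambda>x y. g (f x) (h y))"
  by (rule bilinI) (simp_all add: linear_mapsD[OF assms(2)] linear_mapsD[OF assms(3)] bilinD[OF assms(1)])

lemma linear_maps_id: "(\<lambda>x. x) \<in> linear_maps M M"
  by (rule linear_mapsI) auto

lemma free_pairs_simps [simp]:
  "carrier (free_pairs M N) = {f. keys f \<subseteq> carrier M \<times> carrier N}"
  "zero (free_pairs M N) = 0" "add (free_pairs M N) = (+)"
  "module.smult (free_pairs M N) = (\<lambda>c. Poly_Mapping.map ((*) c))"
  by (simp_all add: free_pairs_def)

lemma cvec_free_pairs: "cvec (free_pairs M N)"
proof -
  interpret abelian_group "free_pairs M N"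
  proof (rule abelian_groupI, goal_cases)
    case (1 x y)
    then show ?case using Poly_Mapping.keys_add[of x y] by auto
  next
    case (6 x)
    then show ?case by (intro bexI[of _ "- x"]) (auto simp: in_keys_iff subset_iff)
  qed (auto simp: ac_simps)
  show ?thesis
  proof (unfold_locales, goal_cases)
    case (1 x c)
    then show ?case using keys_map_times[of c x] by auto
  qed (auto intro!: poly_mapping_eqI simp: map_times_eq lookup_add algebra_simps)
qed

lemma free_pairs_minus:
  assumes "x \<in> carrier (free_pairs M N)" "y \<in> carrier (free_pairs M N)"
  shows "x \<ominus>\<^bsub>free_pairs M N\<^esub> y = x - y"
proof -
  interpret cvec "free_pairs M N" by (rule cvec_free_pairs)
  have "keys (- y) \<subseteq> keys y" by (auto simp: in_keys_iff)
  then have "- y \<in> carrier (free_pairs M N)" using assms by auto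
  then have "\<ominus>\<^bsub>free_pairs M N\<^esub> y = - y"
    by (intro minus_equality) (use assms in simp_all)
  then show ?thesis by (simp add: a_minus_def)
qed

locale tensor = M: cvec M + N: cvec N
  for M :: "(complex, 'a) module" and N :: "(complex, 'b) module"
begin

abbreviation "T \<equiv> tensor_space M N"
abbreviation "F \<equiv> free_pairs M N"

sublocale F: cvec F by (rule cvec_free_pairs)

lemma rels_closed: "bilinear_rels M N \<subseteq> carrier F"
proof -
  have *: "Poly_Mapping.single (x, y) c \<in> carrier F"
    if "x \<in> carrier M" "y \<in> carrier N" for x y c
    using that by (simp add: Poly_Mapping.keys_single)
  have diff: "f - g \<in> carrier F" if "f \<in> carrier F" "g \<in> carrier F" for f g
    using F.minus_closed[OF that] that by (simp only: free_pairs_minus)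
  show ?thesis
    unfolding bilinear_rels_def
    by (intro Un_least subsetI) (elim CollectE exE conjE, simp only:, intro diff *; simp)+
qed

sublocale Q: csub F "bilinear_null M N"
  unfolding bilinear_null_def
  by unfold_locales
    (use rels_closed in \<open>auto intro: F.lin_span_zero F.lin_span_add F.lin_span_smult
      simp del: free_pairs_simps dest: subsetD[OF F.lin_span_closed]\<close>)

sublocale T: cvec T
  unfolding tensor_space_def by (rule Q.cvec_quot)

abbreviation tn (infixl "\<otimes>\<^sub>t" 70) where "tn \<equiv> tens M N"

abbreviation "cs f \<equiv> bilinear_null M N +>\<^bsub>F\<^esub> f"

lemma T_carrier: "carrier T = cs ` carrier F"
  by (simp only: tensor_space_def Q.quot_simps)

lemma cs_linear: "cs \<in> linear_maps F T"
  unfolding tensor_space_def by (rule Q.quot_linear)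

lemma single_closed: "x \<in> carrier M \<Longrightarrow> y \<in> carrier N \<Longrightarrow> Poly_Mapping.single (x, y) c \<in> carrier F"
  by (simp add: Poly_Mapping.keys_single)

lemma cs_null: "f \<in> bilinear_rels M N \<Longrightarrow> f \<in> bilinear_null M N"
  unfolding bilinear_null_def by (rule F.lin_span_base[OF rels_closed])

lemma single_smult: "Poly_Mapping.single (x, y) c = c \<odot>\<^bsub>F\<^esub> Poly_Mapping.single (x, y) 1"
  by (rule poly_mapping_eqI) (simp add: map_times_eq lookup_single when_def)

lemma cs_single: "x \<in> carrier M \<Longrightarrow> y \<in> carrier N \<Longrightarrow> cs (Poly_Mapping.single (x, y) c) = c \<odot>\<^bsub>T\<^esub> (x \<otimes>\<^sub>t y)"
  by (subst single_smult)
    (simp only: linear_mapsD(3)[OF cs_linear] single_closed tens_def)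

lemma tens_closed [simp, intro]: "x \<in> carrier M \<Longrightarrow> y \<in> carrier N \<Longrightarrow> x \<otimes>\<^sub>t y \<in> carrier T"
  unfolding tens_def by (intro linear_mapsD(1)[OF cs_linear] single_closed)

lemma cs_diff:
  "f \<in> carrier F \<Longrightarrow> g \<in> carrier F \<Longrightarrow> cs (f - g) = cs f \<ominus>\<^bsub>T\<^esub> cs g"
  using linear_maps_minus[OF cs_linear F.cvec_axioms T.cvec_axioms, of f g]
  by (simp only: free_pairs_minus)

lemma cs_zero: "f \<in> bilinear_null M N \<Longrightarrow> cs f = \<zero>\<^bsub>T\<^esub>"
  using Q.coset_eq_N_iff[of f] Q.N_sub by (simp add: tensor_space_def subset_iff)

lemma single_diff_closed: "f \<in> carrier F \<Longrightarrow> g \<in> carrier F \<Longrightarrow> f - g \<in> carrier F"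
  using F.minus_closed[of f g] by (simp only: free_pairs_minus)

lemma T_diff_eq: 
  "a \<in> carrier T \<Longrightarrow> b \<in> carrier T \<Longrightarrow> c \<in> carrier T \<Longrightarrow> a \<ominus>\<^bsub>T\<^esub> b \<ominus>\<^bsub>T\<^esub> c = \<zero>\<^bsub>T\<^esub> \<Longrightarrow> a = b \<oplus>\<^bsub>T\<^esub> c"
  using T.minus_eq_zero_iff[of a "b \<oplus>\<^bsub>T\<^esub> c"] by (simp add: a_minus_def T.minus_add T.a_assoc)

lemma tens_add_left:
  assumes "x \<in> carrier M" "x' \<in> carrier M" "y \<in> carrier N"
  shows "(x \<oplus>\<^bsub>M\<^esub> x') \<otimes>\<^sub>t y = x \<otimes>\<^sub>t y \<oplus>\<^bsub>T\<^esub> x' \<otimes>\<^sub>t y"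
proof -
  have "cs (Poly_Mapping.single (x \<oplus>\<^bsub>M\<^esub> x', y) 1 - Poly_Mapping.single (x, y) 1
      - Poly_Mapping.single (x', y) 1) = \<zero>\<^bsub>T\<^esub>"
    by (rule cs_zero, rule cs_null) (use assms in \<open>auto simp: bilinear_rels_def\<close>)
  then have "(x \<oplus>\<^bsub>M\<^esub> x') \<otimes>\<^sub>t y \<ominus>\<^bsub>T\<^esub> x \<otimes>\<^sub>t y \<ominus>\<^bsub>T\<^esub> x' \<otimes>\<^sub>t y = \<zero>\<^bsub>T\<^esub>"
    using assms by (simp only: cs_diff single_diff_closed single_closed M.add.m_closed tens_def)
  then show ?thesis using assms by (intro T_diff_eq) auto
qed

lemma tens_add_right:
  assumes "x \<in> carrier M" "y \<in> carrier N" "y' \<in> carrier N"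
  shows "x \<otimes>\<^sub>t (y \<oplus>\<^bsub>N\<^esub> y') = x \<otimes>\<^sub>t y \<oplus>\<^bsub>T\<^esub> x \<otimes>\<^sub>t y'"
proof -
  have "cs (Poly_Mapping.single (x, y \<oplus>\<^bsub>N\<^esub> y') 1 - Poly_Mapping.single (x, y) 1
      - Poly_Mapping.single (x, y') 1) = \<zero>\<^bsub>T\<^esub>"
    by (rule cs_zero, rule cs_null) (use assms in \<open>auto simp: bilinear_rels_def\<close>)
  then have "x \<otimes>\<^sub>t (y \<oplus>\<^bsub>N\<^esub> y') \<ominus>\<^bsub>T\<^esub> x \<otimes>\<^sub>t y \<ominus>\<^bsub>T\<^esub> x \<otimes>\<^sub>t y' = \<zero>\<^bsub>T\<^esub>"
    using assms by (simp only: cs_diff single_diff_closed single_closed N.add.m_closed tens_def)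
  then show ?thesis using assms by (intro T_diff_eq) auto
qed

lemma tens_smult_left:
  assumes "x \<in> carrier M" "y \<in> carrier N"
  shows "(c \<odot>\<^bsub>M\<^esub> x) \<otimes>\<^sub>t y = c \<odot>\<^bsub>T\<^esub> (x \<otimes>\<^sub>t y)"
proof -
  have "cs (Poly_Mapping.single (c \<odot>\<^bsub>M\<^esub> x, y) 1 - Poly_Mapping.single (x, y) c) = \<zero>\<^bsub>T\<^esub>"
    by (rule cs_zero, rule cs_null) (use assms in \<open>auto simp: bilinear_rels_def\<close>)
  then have "(c \<odot>\<^bsub>M\<^esub> x) \<otimes>\<^sub>t y \<ominus>\<^bsub>T\<^esub> c \<odot>\<^bsub>T\<^esub> (x \<otimes>\<^sub>t y) = \<zero>\<^bsub>T\<^esub>"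
    using assms by (simp only: cs_diff single_closed M.smult_closed cs_single T.smult_one tens_closed)
  then show ?thesis using assms by (subst (asm) T.minus_eq_zero_iff) auto
qed

lemma tens_smult_right:
  assumes "x \<in> carrier M" "y \<in> carrier N"
  shows "x \<otimes>\<^sub>t (c \<odot>\<^bsub>N\<^esub> y) = c \<odot>\<^bsub>T\<^esub> (x \<otimes>\<^sub>t y)"
proof -
  have "cs (Poly_Mapping.single (x, c \<odot>\<^bsub>N\<^esub> y) 1 - Poly_Mapping.single (x, y) c) = \<zero>\<^bsub>T\<^esub>"
    by (rule cs_zero, rule cs_null) (use assms in \<open>auto simp: bilinear_rels_def\<close>)
  then have "x \<otimes>\<^sub>t (c \<odot>\<^bsub>N\<^esub> y) \<ominus>\<^bsub>T\<^esub> c \<odot>\<^bsub>T\<^esub> (x \<otimes>\<^sub>t y) = \<zero>\<^bsub>T\<^esub>"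
    using assms by (simp only: cs_diff single_closed N.smult_closed cs_single T.smult_one tens_closed)
  then show ?thesis using assms by (subst (asm) T.minus_eq_zero_iff) auto
qed

lemma bilin_tens: "bilin M N T tn"
  by (rule bilinI) (auto simp: tens_add_left tens_add_right tens_smult_left tens_smult_right)

text \<open>A coefficient in front of a pure tensor can be absorbed into its left factor, so no case
  for scalar multiples is required.\<close>

lemma tensor_induct [consumes 1, case_names zero add tens]:
  assumes "X \<in> carrier T" "P \<zero>\<^bsub>T\<^esub>"
    "\<And>X Y. X \<in> carrier T \<Longrightarrow> Y \<in> carrier T \<Longrightarrow> P X \<Longrightarrow> P Y \<Longrightarrow> P (X \<oplus>\<^bsub>T\<^esub> Y)"
    "\<And>x y. x \<in> carrier M \<Longrightarrow> y \<in> carrier N \<Longrightarrow> P (x \<otimes>\<^sub>t y)"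
  shows "P X"
proof -
  have "P (cs f)" if "keys f \<subseteq> carrier M \<times> carrier N" for f
    using that
  proof (induction rule: pm_induct)
    case zero
    show ?case
      using linear_maps_zero[OF cs_linear F.cvec_axioms T.cvec_axioms] assms(2) by simp
  next
    case (add f g)
    then have fg: "f \<in> carrier F" "g \<in> carrier F" by auto
    have "cs (f \<oplus>\<^bsub>F\<^esub> g) = cs f \<oplus>\<^bsub>T\<^esub> cs g" by (rule linear_mapsD(2)[OF cs_linear fg])
    moreover have "P (cs f \<oplus>\<^bsub>T\<^esub> cs g)"
      using add fg linear_mapsD(1)[OF cs_linear] assms(3) by blast
    ultimately show ?case by simp
  next
    case (single k c)
    obtain x y where k: "k = (x, y)" by force
    then have xy: "x \<in> carrier M" "y \<in> carrier N" using single by auto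
    have "P ((c \<odot>\<^bsub>M\<^esub> x) \<otimes>\<^sub>t y)" using xy assms(4) by simp
    then show ?case by (simp only: k cs_single[OF xy] tens_smult_left[OF xy])
  qed
  then show ?thesis using assms(1) unfolding T_carrier by auto
qed

lemma linear_maps_eq_on_tens:
  assumes "f \<in> linear_maps T L" "g \<in> linear_maps T L" "cvec L" "X \<in> carrier T"
    "\<And>x y. x \<in> carrier M \<Longrightarrow> y \<in> carrier N \<Longrightarrow> f (x \<otimes>\<^sub>t y) = g (x \<otimes>\<^sub>t y)"
  shows "f X = g X"
  using assms(4)
  by (induction rule: tensor_induct)
    (simp_all add: linear_maps_zero[OF assms(1) T.cvec_axioms assms(3)]
      linear_maps_zero[OF assms(2) T.cvec_axioms assms(3)] assms(5)
      linear_mapsD(2)[OF assms(1)] linear_mapsD(2)[OF assms(2)])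

section \<open>The linear map on the tensor product induced by a bilinear map\<close>

context
  fixes L :: "(complex, 'c) module" and g
  assumes L: "cvec L" and g: "bilin M N L g"
begin

interpretation L: cvec L by (rule L)

abbreviation (input) "lf \<equiv> pm_sum L (\<lambda>p. g (fst p) (snd p))"

lemma g_Pi: "f \<in> carrier F \<Longrightarrow> (\<lambda>p. g (fst p) (snd p)) \<in> keys f \<rightarrow> carrier L"
  using bilinD(1)[OF g] by auto

lemma lf_linear: "lf \<in> linear_maps F L"
proof (rule linear_mapsI)
  show "lf x \<in> carrier L" if "x \<in> carrier F" for x by (rule L.pm_sum_closed[OF g_Pi[OF that]])
  show "lf (x \<oplus>\<^bsub>F\<^esub> y) = lf x \<oplus>\<^bsub>L\<^esub> lf y" if "x \<in> carrier F" "y \<in> carrier F" for x y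
    unfolding free_pairs_simps by (rule L.pm_sum_add) (use g_Pi that in blast)
  show "lf (c \<odot>\<^bsub>F\<^esub> x) = c \<odot>\<^bsub>L\<^esub> lf x" if "x \<in> carrier F" for c x
    unfolding free_pairs_simps by (rule L.pm_sum_smult) (use g_Pi that in blast)
qed

lemma lf_diff: "x \<in> carrier F \<Longrightarrow> y \<in> carrier F \<Longrightarrow> lf (x - y) = lf x \<ominus>\<^bsub>L\<^esub> lf y"
  by (rule L.pm_sum_diff) (use g_Pi in blast)

lemma lf_single: "x \<in> carrier M \<Longrightarrow> y \<in> carrier N \<Longrightarrow> lf (Poly_Mapping.single (x, y) c) = c \<odot>\<^bsub>L\<^esub> g x y"
  by (subst L.pm_sum_single) (auto simp: bilinD(1)[OF g])

lemma L_cancel: "x \<in> carrier L \<Longrightarrow> y \<in> carrier L \<Longrightarrow> x \<oplus>\<^bsub>L\<^esub> y \<ominus>\<^bsub>L\<^esub> x \<ominus>\<^bsub>L\<^esub> y = \<zero>\<^bsub>L\<^esub>"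
  using L.r_neg[of "x \<oplus>\<^bsub>L\<^esub> y"] by (simp add: a_minus_def L.minus_add L.a_assoc)

lemma lf_rels: "f \<in> bilinear_rels M N \<Longrightarrow> lf f = \<zero>\<^bsub>L\<^esub>"
  unfolding bilinear_rels_def
  by (elim UnE CollectE exE conjE; simp only: lf_diff lf_single single_closed single_diff_closed
      M.add.m_closed N.add.m_closed M.smult_closed N.smult_closed bilinD[OF g] L.smult_one L_cancel
      L.smult_closed L.minus_eq_zero_iff L.add.m_closed)

lemma lf_null:
  assumes "f \<in> bilinear_null M N" shows "lf f = \<zero>\<^bsub>L\<^esub>"
proof (rule F.lin_span_induct[OF assms[unfolded bilinear_null_def] rels_closed])
  show "lf \<zero>\<^bsub>F\<^esub> = \<zero>\<^bsub>L\<^esub>"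
    by (rule linear_maps_zero[OF lf_linear F.cvec_axioms L.cvec_axioms])
  show "lf (x \<oplus>\<^bsub>F\<^esub> y) = \<zero>\<^bsub>L\<^esub>"
    if "x \<in> carrier F" "y \<in> carrier F" "lf x = \<zero>\<^bsub>L\<^esub>" "lf y = \<zero>\<^bsub>L\<^esub>" for x y
    using linear_mapsD(2)[OF lf_linear that(1,2)] that(3,4) by simp
  show "lf (c \<odot>\<^bsub>F\<^esub> x) = \<zero>\<^bsub>L\<^esub>" if "x \<in> bilinear_rels M N" for c x
    using linear_mapsD(3)[OF lf_linear subsetD[OF rels_closed that], of c] lf_rels[OF that]
    by simp
qed

text \<open>Independence of the decomposition selected by \<open>SOME\<close>: two decompositions
  differ by an element of \<open>bilinear_null\<close>, on which the linear extension of a bilinear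
  map vanishes.\<close>

lemma tens_sum_cs:
  assumes "f \<in> carrier F" shows "tens_sum L g (cs f) = lf f"
proof -
  have "(SOME h. h \<in> cs f) \<in> cs f" by (rule someI[of _ f]) (rule Q.coset_self[OF assms])
  then have h: "(SOME h. h \<in> cs f) \<in> carrier F" "cs (SOME h. h \<in> cs f) = cs f"
    using Q.coset_memD assms by blast+
  have "(SOME h. h \<in> cs f) - f \<in> bilinear_null M N"
    using h Q.coset_eq_iff[OF h(1) assms] assms by (simp only: free_pairs_minus)
  then have "lf (SOME h. h \<in> cs f) \<ominus>\<^bsub>L\<^esub> lf f = \<zero>\<^bsub>L\<^esub>"
    by (simp only: lf_null lf_diff[OF h(1) assms, symmetric])
  then have "lf (SOME h. h \<in> cs f) = lf f"
    by (simp only: L.minus_eq_zero_iff linear_mapsD(1)[OF lf_linear] h(1) assms)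
  then show ?thesis by (simp add: tens_sum_def Let_def pm_sum_def)
qed

lemma tens_sum_linear: "tens_sum L g \<in> linear_maps T L"
proof (rule linear_mapsI)
  show "tens_sum L g X \<in> carrier L" if "X \<in> carrier T" for X
    using that linear_mapsD(1)[OF lf_linear] unfolding T_carrier by (auto simp only: tens_sum_cs)
  fix X Y assume XY: "X \<in> carrier T" "Y \<in> carrier T"
  then obtain x y where x: "x \<in> carrier F" "X = cs x" "y \<in> carrier F" "Y = cs y"
    unfolding T_carrier by blast
  show "tens_sum L g (X \<oplus>\<^bsub>T\<^esub> Y) = tens_sum L g X \<oplus>\<^bsub>L\<^esub> tens_sum L g Y"
    using x by (simp only: linear_mapsD(2)[OF cs_linear, symmetric] tens_sum_cs F.add.m_closed
        linear_mapsD(2)[OF lf_linear])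
next
  fix c X assume "X \<in> carrier T"
  then obtain x where x: "x \<in> carrier F" "X = cs x"
    unfolding T_carrier by blast
  show "tens_sum L g (c \<odot>\<^bsub>T\<^esub> X) = c \<odot>\<^bsub>L\<^esub> tens_sum L g X"
    using x by (simp only: linear_mapsD(3)[OF cs_linear, symmetric] tens_sum_cs F.smult_closed
        linear_mapsD(3)[OF lf_linear])
qed

lemma tens_sum_tens: "x \<in> carrier M \<Longrightarrow> y \<in> carrier N \<Longrightarrow> tens_sum L g (x \<otimes>\<^sub>t y) = g x y"
  unfolding tens_def by (simp only: tens_sum_cs single_closed lf_single L.smult_one bilinD(1)[OF g])

end

text \<open>Needed to nest \<open>tens_sum\<close>: the outer sum of a product only makes sense if
  the inner one is linear in the variables of the outer one.\<close>

lemma tens_sum_linear_param: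
  assumes "cvec L" "cvec K" "\<And>k. k \<in> carrier K \<Longrightarrow> bilin M N L (g k)"
    "\<And>x y. x \<in> carrier M \<Longrightarrow> y \<in> carrier N \<Longrightarrow> (\<lambda>k. g k x y) \<in> linear_maps K L"
    "X \<in> carrier T"
  shows "(\<lambda>k. tens_sum L (g k) X) \<in> linear_maps K L"
proof -
  interpret L: cvec L by fact
  interpret K: cvec K by fact
  note lin = tens_sum_linear[OF assms(1) assms(3)] and tn = tens_sum_tens[OF assms(1) assms(3)]
  show ?thesis
  proof (rule linear_mapsI)
    show "tens_sum L (g k) X \<in> carrier L" if "k \<in> carrier K" for k
      using linear_mapsD(1)[OF lin[OF that]] assms by blast
    fix k k' assume k: "k \<in> carrier K" "k' \<in> carrier K"
    show "tens_sum L (g (k \<oplus>\<^bsub>K\<^esub> k')) X = tens_sum L (g k) X \<oplus>\<^bsub>L\<^esub> tens_sum L (g k') X"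
    proof (rule linear_maps_eq_on_tens[OF lin _ assms(1,5)])
      show "(\<lambda>X. tens_sum L (g k) X \<oplus>\<^bsub>L\<^esub> tens_sum L (g k') X) \<in> linear_maps T L"
        by (rule linear_mapsI)
          (simp_all add: linear_mapsD[OF lin] k L.a_ac L.smult_add_right)
    qed (simp_all add: k tn linear_mapsD(2)[OF assms(4)])
  next
    fix c k assume k: "k \<in> carrier K"
    show "tens_sum L (g (c \<odot>\<^bsub>K\<^esub> k)) X = c \<odot>\<^bsub>L\<^esub> tens_sum L (g k) X"
    proof (rule linear_maps_eq_on_tens[OF lin _ assms(1,5)])
      show "(\<lambda>X. c \<odot>\<^bsub>L\<^esub> tens_sum L (g k) X) \<in> linear_maps T L"
        by (rule linear_mapsI)
          (simp_all add: linear_mapsD[OF lin] k L.smult_smult mult.commute L.smult_add_right)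
    qed (simp_all add: k tn linear_mapsD(3)[OF assms(4)])
  qed
qed

lemma linear_maps_eq_on_tens2:
  assumes "bilin T T L f" "bilin T T L g" "cvec L" "X \<in> carrier T" "Y \<in> carrier T"
    "\<And>x y x' y'. x \<in> carrier M \<Longrightarrow> y \<in> carrier N \<Longrightarrow> x' \<in> carrier M \<Longrightarrow> y' \<in> carrier N
       \<Longrightarrow> f (x \<otimes>\<^sub>t y) (x' \<otimes>\<^sub>t y') = g (x \<otimes>\<^sub>t y) (x' \<otimes>\<^sub>t y')"
  shows "f X Y = g X Y"
proof -
  have f: "f X \<in> linear_maps T L" "(\<lambda>Y. f Y X) \<in> linear_maps T L"
    and g: "g X \<in> linear_maps T L" "(\<lambda>Y. g Y X) \<in> linear_maps T L" if "X \<in> carrier T" for X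
    using assms(1,2) that by (simp_all add: bilin_def)
  have "f (x \<otimes>\<^sub>t y) Y = g (x \<otimes>\<^sub>t y) Y" if "x \<in> carrier M" "y \<in> carrier N" for x y
    by (rule linear_maps_eq_on_tens[OF f(1) g(1) assms(3,5) assms(6)]) (use that in simp_all)
  then show ?thesis
    by (rule linear_maps_eq_on_tens[OF f(2)[OF assms(5)] g(2)[OF assms(5)] assms(3,4)])
qed

text \<open>The common shape of the products of \<open>tensor_alg\<close> and \<open>hP\<close>,
  with \<open>q x y x' y'\<close> as the product of two pure tensors. Both algebras are then
  obtained from \<open>qmul_calg\<close>.\<close>

definition "qmul q X Y = tens_sum T (\<lambda>x y. tens_sum T (q x y) Y) X"

context
  fixes q :: "'a \<Rightarrow> 'b \<Rightarrow> 'a \<Rightarrow> 'b \<Rightarrow> (('a \<times> 'b) \<Rightarrow>\<^sub>0 complex) set"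
  assumes q1: "\<And>x y. x \<in> carrier M \<Longrightarrow> y \<in> carrier N \<Longrightarrow> bilin M N T (q x y)"
    and q2: "\<And>x y. x \<in> carrier M \<Longrightarrow> y \<in> carrier N \<Longrightarrow> bilin M N T (\<lambda>x' y'. q x' y' x y)"
begin

abbreviation (input) "qm \<equiv> qmul q"

lemma qmul_inner: "Y \<in> carrier T \<Longrightarrow> bilin M N T (\<lambda>x y. tens_sum T (q x y) Y)"
  unfolding bilin_def
proof (intro conjI ballI)
  fix x assume Y: "Y \<in> carrier T" and x: "x \<in> carrier M"
  show "(\<lambda>y. tens_sum T (q x y) Y) \<in> linear_maps N T"
    by (rule tens_sum_linear_param[OF T.cvec_axioms N.cvec_axioms]) (use Y x q1 q2 in \<open>auto simp: bilin_def\<close>)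
next
  fix y assume Y: "Y \<in> carrier T" and y: "y \<in> carrier N"
  show "(\<lambda>x. tens_sum T (q x y) Y) \<in> linear_maps M T"
    by (rule tens_sum_linear_param[OF T.cvec_axioms M.cvec_axioms]) (use Y y q1 q2 in \<open>auto simp: bilin_def\<close>)
qed

lemma qmul_tens:
  assumes "x \<in> carrier M" "y \<in> carrier N" "x' \<in> carrier M" "y' \<in> carrier N"
  shows "qm (x \<otimes>\<^sub>t y) (x' \<otimes>\<^sub>t y') = q x y x' y'"
  using assms by (simp add: qmul_def tens_sum_tens[OF T.cvec_axioms qmul_inner]
      tens_sum_tens[OF T.cvec_axioms q1])

lemma qmul_bilin: "bilin T T T qm"
  unfolding bilin_def
proof (intro conjI ballI)
  fix Y assume Y: "Y \<in> carrier T"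
  show "(\<lambda>X. qm X Y) \<in> linear_maps T T"
    unfolding qmul_def using tens_sum_linear[OF T.cvec_axioms qmul_inner[OF Y]] .
next
  fix X assume X: "X \<in> carrier T"
  show "qm X \<in> linear_maps T T"
    unfolding qmul_def[abs_def]
  proof (rule tens_sum_linear_param[OF T.cvec_axioms T.cvec_axioms qmul_inner _ X])
    show "(\<lambda>Y. tens_sum T (q x y) Y) \<in> linear_maps T T" if "x \<in> carrier M" "y \<in> carrier N" for x y
      using tens_sum_linear[OF T.cvec_axioms q1[OF that]] .
  qed
qed

text \<open>The unit and associativity laws are linear in every argument, so they extend from pure
  tensors one argument at a time.\<close>

lemma qmul_calg:
  assumes e: "e \<in> carrier T"
    and e1: "\<And>x y. x \<in> carrier M \<Longrightarrow> y \<in> carrier N \<Longrightarrow> qm e (x \<otimes>\<^sub>t y) = x \<otimes>\<^sub>t y"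
    and e2: "\<And>x y. x \<in> carrier M \<Longrightarrow> y \<in> carrier N \<Longrightarrow> qm (x \<otimes>\<^sub>t y) e = x \<otimes>\<^sub>t y"
    and assoc: "\<And>x y x' y' x'' y''. x \<in> carrier M \<Longrightarrow> y \<in> carrier N \<Longrightarrow> x' \<in> carrier M
       \<Longrightarrow> y' \<in> carrier N \<Longrightarrow> x'' \<in> carrier M \<Longrightarrow> y'' \<in> carrier N \<Longrightarrow>
       qm (qm (x \<otimes>\<^sub>t y) (x' \<otimes>\<^sub>t y')) (x'' \<otimes>\<^sub>t y'') = qm (x \<otimes>\<^sub>t y) (qm (x' \<otimes>\<^sub>t y') (x'' \<otimes>\<^sub>t y''))"
  shows "calg (T\<lparr>mult := qm, one := e\<rparr>)"
proof -
  note B = bilinD[OF qmul_bilin]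
  have B1: "qm X \<in> linear_maps T T" "(\<lambda>Y. qm Y X) \<in> linear_maps T T" if "X \<in> carrier T" for X
    using qmul_bilin that by (auto simp: bilin_def)
  have A1: "qm (qm (x \<otimes>\<^sub>t y) (x' \<otimes>\<^sub>t y')) Z = qm (x \<otimes>\<^sub>t y) (qm (x' \<otimes>\<^sub>t y') Z)"
    if "x \<in> carrier M" "y \<in> carrier N" "x' \<in> carrier M" "y' \<in> carrier N" "Z \<in> carrier T"
    for x y x' y' Z
    by (rule linear_maps_eq_on_tens[OF B1(1)[OF B(1)] linear_maps_comp[OF B1(1) B1(1)]
        T.cvec_axioms that(5) assoc]) (use that in simp_all)
  have assoc': "qm (qm X Y) Z = qm X (qm Y Z)"
    if Z: "X \<in> carrier T" "Y \<in> carrier T" "Z \<in> carrier T" for X Y Z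
    by (rule linear_maps_eq_on_tens2[OF bilin_comp_left[OF qmul_bilin B1(2)[OF Z(3)]]
        bilin_comp_right[OF qmul_bilin linear_maps_id B1(2)[OF Z(3)]] T.cvec_axioms Z(1,2)])
      (rule A1; use Z in simp)
  have E1: "qm e X = X" if "X \<in> carrier T" for X
    by (rule linear_maps_eq_on_tens[OF B1(1)[OF e] linear_maps_id[of T] T.cvec_axioms that]) (rule e1)
  have E2: "qm X e = X" if "X \<in> carrier T" for X
    by (rule linear_maps_eq_on_tens[OF B1(2)[OF e] linear_maps_id[of T] T.cvec_axioms that]) (rule e2)
  let ?A = "T\<lparr>mult := qm, one := e\<rparr>"
  interpret A: cvec ?A
    by (rule cvec_image[OF T.cvec_axioms, of "\<lambda>x. x"]) auto
  interpret A: ring ?A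
    by (rule ringI[OF A.abelian_group_axioms]; (rule monoidI)?)
      (simp_all add: e E1 E2 B assoc')
  show ?thesis
    by unfold_locales (simp_all add: B)
qed

end

end

subsection \<open>The tensor product algebra\<close>

locale tensor2 = MA: calg M + NA: calg N
  for M :: "(complex, 'a) module" and N :: "(complex, 'b) module"
begin

sublocale tensor M N by unfold_locales

abbreviation "TA \<equiv> tensor_alg M N"

lemma tq1: "x \<in> carrier M \<Longrightarrow> y \<in> carrier N \<Longrightarrow> bilin M N T (\<lambda>x' y'. (x \<otimes>\<^bsub>M\<^esub> x') \<otimes>\<^sub>t (y \<otimes>\<^bsub>N\<^esub> y'))"
  by (rule bilinI)
    (simp_all add: MA.r_distr NA.r_distr MA.smult_mult_right NA.smult_mult_right bilinD[OF bilin_tens])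

lemma tq2: "x \<in> carrier M \<Longrightarrow> y \<in> carrier N \<Longrightarrow> bilin M N T (\<lambda>x' y'. (x' \<otimes>\<^bsub>M\<^esub> x) \<otimes>\<^sub>t (y' \<otimes>\<^bsub>N\<^esub> y))"
  by (rule bilinI)
    (simp_all add: MA.l_distr NA.l_distr MA.smult_mult_left NA.smult_mult_left bilinD[OF bilin_tens])

lemma TA_eq: "TA = T\<lparr>mult := qmul (\<lambda>x y x' y'. (x \<otimes>\<^bsub>M\<^esub> x') \<otimes>\<^sub>t (y \<otimes>\<^bsub>N\<^esub> y')), one := \<one>\<^bsub>M\<^esub> \<otimes>\<^sub>t \<one>\<^bsub>N\<^esub>\<rparr>"
  by (simp add: tensor_alg_def qmul_def[abs_def])

lemma TA_simps [simp]:
  "carrier TA = carrier T" "add TA = add T" "zero TA = zero T" "module.smult TA = module.smult T"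
  "one TA = \<one>\<^bsub>M\<^esub> \<otimes>\<^sub>t \<one>\<^bsub>N\<^esub>"
  by (simp_all add: tensor_alg_def)

lemma TA_mult: "x \<in> carrier M \<Longrightarrow> y \<in> carrier N \<Longrightarrow> x' \<in> carrier M \<Longrightarrow> y' \<in> carrier N \<Longrightarrow>
    (x \<otimes>\<^sub>t y) \<otimes>\<^bsub>TA\<^esub> (x' \<otimes>\<^sub>t y') = (x \<otimes>\<^bsub>M\<^esub> x') \<otimes>\<^sub>t (y \<otimes>\<^bsub>N\<^esub> y')"
  by (simp add: TA_eq qmul_tens[OF tq1 tq2])

sublocale TA: calg TA
  unfolding TA_eq
  by (rule qmul_calg[OF tq1 tq2])
    (simp_all add: qmul_tens[OF tq1 tq2] MA.m_assoc NA.m_assoc)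

end


section \<open>Standard algebras\<close>

subsection \<open>Integer powers of an invertible element\<close>

text \<open>The inverse is passed as a separate argument because in the presented algebras it is a
  generator of its own, the adjoint of U.\<close>

definition upow :: "(complex, 'a) module \<Rightarrow> 'a \<Rightarrow> 'a \<Rightarrow> int \<Rightarrow> 'a" where
  "upow M u v n = (if n \<ge> 0 then u [^]\<^bsub>M\<^esub> nat n else v [^]\<^bsub>M\<^esub> nat (- n))"

lemma upow_simps [simp]: "upow M u v 0 = u [^]\<^bsub>M\<^esub> (0::nat)"
  by (simp add: upow_def)

locale inverse_pair = calg M for M :: "(complex, 'a) module" (structure) +
  fixes u v :: 'a
  assumes u_closed [simp, intro]: "u \<in> carrier M" and v_closed [simp, intro]: "v \<in> carrier M"
    and uv: "u \<otimes> v = \<one>" and vu: "v \<otimes> u = \<one>"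
begin

abbreviation "up \<equiv> upow M u v"

lemma up_closed [simp, intro]: "up n \<in> carrier M"
  by (simp add: upow_def del: pow_nat)

lemma up_0: "up 0 = \<one>" by simp

lemma up_1: "up 1 = u" by (simp add: upow_def)

lemma up_2: "up 2 = u [^] (2::nat)" by (simp add: upow_def)

lemma up_m1: "up (- 1) = v" by (simp add: upow_def)

lemma up_m2: "up (- 2) = v [^] (2::nat)" by (simp add: upow_def)

lemma v_u_cancel: "x \<in> carrier M \<Longrightarrow> v \<otimes> (u \<otimes> x) = x"
  by (simp add: m_assoc[symmetric] vu)

lemma u_v_cancel: "x \<in> carrier M \<Longrightarrow> u \<otimes> (v \<otimes> x) = x"
  by (simp add: m_assoc[symmetric] uv)

lemma u_up: "u \<otimes> up n = up (n + 1)"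
proof (cases n rule: int_cases)
  case (nonneg m)
  then have True: "0 \<le> n" and "nat (n + 1) = Suc (nat n)" by simp_all
  then show ?thesis using True nat_pow_Suc2[of u "nat n"] by (simp add: upow_def del: nat_pow_Suc)
next
  case k: (neg k)
  have n: "nat (- n) = Suc k" "\<not> n \<ge> 0" using k by auto
  have up_n: "up n = v [^] Suc k" using n by (simp only: upow_def if_False)
  have up_n1: "up (n + 1) = v [^] k"
    by (cases "k = 0") (simp_all add: upow_def k del: pow_nat)
  have "v [^] Suc k = v \<otimes> v [^] k" by (rule nat_pow_Suc2) simp
  then have "u \<otimes> v [^] Suc k = v [^] k" by (simp add: u_v_cancel del: nat_pow_Suc)
  then show ?thesis by (simp only: up_n up_n1)
qed

lemma v_up: "v \<otimes> up n = up (n - 1)"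
  using u_up[of "n - 1"] v_u_cancel[of "up (n - 1)"] by simp

lemma up_add: "up (m + n) = up m \<otimes> up n"
proof (induction m rule: int_induct[where k = 0])
  case (step1 i)
  have "up (i + 1 + n) = u \<otimes> up (i + n)" by (simp only: u_up ac_simps)
  also have "\<dots> = u \<otimes> (up i \<otimes> up n)" by (simp only: step1)
  finally have "up (i + 1 + n) = u \<otimes> (up i \<otimes> up n)" .
  then show ?case by (simp add: m_assoc[symmetric] u_up)
next
  case (step2 i)
  have "i + n - 1 = i - 1 + n" by simp
  then have "up (i - 1 + n) = v \<otimes> up (i + n)" by (simp only: v_up)
  also have "\<dots> = v \<otimes> (up i \<otimes> up n)" by (simp only: step2)
  finally have "up (i - 1 + n) = v \<otimes> (up i \<otimes> up n)" .
  then show ?case by (simp add: m_assoc[symmetric] v_up)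
qed simp

lemma up_hom:
  assumes "f \<in> alg_homs M N" "inverse_pair N (f u) (f v)"
  shows "f (up n) = upow N (f u) (f v) n"
proof -
  interpret N: inverse_pair N "f u" "f v" by fact
  note D = alg_homsD[OF assms(1)]
  show ?thesis
  proof (induction n rule: int_induct[where k = 0])
    case (step1 i)
    then have "f (u \<otimes> up i) = upow N (f u) (f v) (i + 1)"
      by (simp add: D N.u_up)
    then show ?case by (simp only: u_up)
  next
    case (step2 i)
    then have "f (v \<otimes> up i) = upow N (f u) (f v) (i - 1)"
      by (simp add: D N.v_up)
    then show ?case by (simp only: v_up)
  qed (simp add: D)
qed

end


subsection \<open>Spanning sets and the adjoint\<close>

text \<open>If left multiplication by letters keeps S inside its span, the span is a left ideal; as
  it contains the unit, it is everything.\<close>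

lemma presented_span:
  assumes "S \<subseteq> carrier (presented R)" "\<one>\<^bsub>presented R\<^esub> \<in> S"
    "\<And>l s. s \<in> S \<Longrightarrow> cls R (mon [l]) \<otimes>\<^bsub>presented R\<^esub> s \<in> lin_span (presented R) S"
  shows "carrier (presented R) = lin_span (presented R) S"
proof
  interpret calg "presented R" by (rule calg_presented)
  note sp = lin_span_add[OF assms(1)] lin_span_smult[OF assms(1)] lin_span_zero[OF assms(1)]
  have mult: "cls R (mon [l]) \<otimes>\<^bsub>presented R\<^esub> X \<in> lin_span (presented R) S"
    if "X \<in> lin_span (presented R) S" for l X
    by (rule lin_span_induct[OF that assms(1)])
      (use assms sp in \<open>auto simp: cls_simps(6) r_distr smult_mult_right subset_iff\<close>)
  show "carrier (presented R) \<subseteq> lin_span (presented R) S"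
  proof
    fix X assume "X \<in> carrier (presented R)"
    then show "X \<in> lin_span (presented R) S"
      by (induction rule: presented_induct)
        (use sp mult lin_span_base[OF assms(1,2)] in auto)
  qed
qed (use assms cvec.lin_span_closed calg_presented calg_def in blast)

lemma linear_maps_eq_on_span:
  assumes "cvec M" "cvec N" "f \<in> linear_maps M N" "g \<in> linear_maps M N"
    "S \<subseteq> carrier M" "carrier M = lin_span M S" "x \<in> carrier M" "\<And>s. s \<in> S \<Longrightarrow> f s = g s"
  shows "f x = g x"
proof -
  interpret M: cvec M by fact
  have "x \<in> lin_span M S" using assms by simp
  then show ?thesis
    by (rule M.lin_span_induct[OF _ assms(5)])
      (use assms in \<open>auto simp: linear_maps_zero[OF assms(3)] linear_maps_zero[OF assms(4)]
        linear_mapsD[OF assms(3)] linear_mapsD[OF assms(4)] subset_iff\<close>)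
qed

section \<open>The adjoint on the free algebra\<close>

lemma star_add: "star (f + g) = star f + star g"
  unfolding star_def
  by (rule setsum_keys_plus_distrib) (simp_all add: scal_add distrib_right)

lemma star_scal_mon: "star (scal c * mon xs) = scal (cnj c) * mon (rev (map letter_star xs))"
proof -
  have "scal c * mon xs = Poly_Mapping.single (Word xs) c" by (simp add: single_scal_mon)
  then show ?thesis by (cases "c = 0") (simp_all add: star_def)
qed

lemma scal_left_commute: "x * (scal c * y) = scal c * (x * (y :: 'g falg))"
  by (simp only: mult.assoc[symmetric] scal_commute[of x])

lemma star_mult: "star (f * g) = star g * star f"
proof (induction f rule: falg_induct)
  case (mon c xs)
  show ?case
  proof (induction g rule: falg_induct)
    case (mon d ys)
    have "scal c * mon xs * (scal d * mon ys) = scal (c * d) * mon (xs @ ys)"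
      by (simp only: mult.assoc[symmetric] scal_commute[of "mon xs" d]
          mon_mult[symmetric] mult.assoc[of "scal c" "mon xs" "scal d"] scal_mult)
    then have "star (scal c * mon xs * (scal d * mon ys))
        = scal (cnj d) * scal (cnj c) * (mon (rev (map letter_star ys)) * mon (rev (map letter_star xs)))"
      by (simp add: star_scal_mon mon_mult scal_mult mult.commute[of "cnj c"])
    also have "\<dots> = scal (cnj d) * mon (rev (map letter_star ys)) * (scal (cnj c) * mon (rev (map letter_star xs)))"
      by (simp only: mult.assoc scal_left_commute[of "mon (rev (map letter_star ys))"])
    finally show ?case by (simp add: star_scal_mon)
  qed (simp add: distrib_left distrib_right star_add)
qed (simp add: distrib_left distrib_right star_add)

lemma star_scal: "star (scal c) = scal (cnj c)"
  using star_scal_mon[of c "[]"] by simp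

lemma star_letter: "star (mon [l]) = mon [letter_star l]"
  using star_scal_mon[of 1 "[l]"] by simp

lemma star_one: "star 1 = 1"
  using star_scal[of 1] by simp

lemma star_uminus: "star (- f) = - star (f :: 'g falg)"
proof -
  have "star (- 1 :: 'g falg) = - 1" using star_scal[of "-1"] by (simp add: scal_uminus)
  then show ?thesis using star_mult[of "- 1" f] by simp
qed

lemma star_diff: "star (f - g) = star f - star g"
  using star_add[of f "- g"] by (simp add: star_uminus)

lemmas star_simps = star_add star_mult star_scal star_letter star_one star_uminus star_diff

section \<open>The complex numbers as a target algebra\<close>

lemma calg_complex: "calg complex_alg"
proof -
  interpret abelian_group complex_alg
    by (rule abelian_groupI) (auto simp: complex_alg_def algebra_simps intro: exI[of _ "- x" for x] right_minus)
  interpret ring complex_alg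
    by (rule ringI[OF abelian_group_axioms]; (rule monoidI)?) (auto simp: complex_alg_def algebra_simps)
  show ?thesis by unfold_locales (auto simp: complex_alg_def algebra_simps)
qed

lemma complex_alg_simps [simp]:
  "carrier complex_alg = UNIV" "mult complex_alg = (*)" "one complex_alg = 1"
  "zero complex_alg = 0" "add complex_alg = (+)" "module.smult complex_alg = (*)"
  by (simp_all add: complex_alg_def)

lemma complex_alg_minus [simp]: "\<ominus>\<^bsub>complex_alg\<^esub> x = - x" "x \<ominus>\<^bsub>complex_alg\<^esub> y = x - y"
proof -
  interpret calg complex_alg by (rule calg_complex)
  show "\<ominus>\<^bsub>complex_alg\<^esub> x = - x" for x by (rule minus_equality) auto
  then show "x \<ominus>\<^bsub>complex_alg\<^esub> y = x - y" by (simp add: a_minus_def)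
qed

lemma complex_alg_pow [simp]: "x [^]\<^bsub>complex_alg\<^esub> (n::nat) = x ^ n"
proof -
  interpret calg complex_alg by (rule calg_complex)
  show ?thesis by (induction n) auto
qed

lemma complex_alg_upow: "z \<noteq> 0 \<Longrightarrow> upow complex_alg z (1 / z) n = z powi n"
  by (auto simp: upow_def power_int_def field_simps power_one_over)


subsection \<open>Endomorphism algebras\<close>

text \<open>Maps are restricted to the carrier, so that equality in the algebra is equality of
  functions. Representations of presented algebras by operators take values here; applying the
  operators to one vector then separates elements.\<close>

definition end_alg :: "(complex, 'a) module \<Rightarrow> (complex, 'a \<Rightarrow> 'a) module" where
  "end_alg M = \<lparr>carrier = linear_maps M M \<inter> extensional (carrier M),
     mult = (\<lambda>f g. \<lambda>x\<in>carrier M. f (g x)), one = (\<lambda>x\<in>carrier M. x),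
     zero = (\<lambda>x\<in>carrier M. \<zero>\<^bsub>M\<^esub>), add = (\<lambda>f g. \<lambda>x\<in>carrier M. f x \<oplus>\<^bsub>M\<^esub> g x),
     smult = (\<lambda>c f. \<lambda>x\<in>carrier M. c \<odot>\<^bsub>M\<^esub> f x)\<rparr>"

context cvec begin

lemma linear_restrict: "f \<in> linear_maps M M \<Longrightarrow> restrict f (carrier M) \<in> linear_maps M M"
  by (rule linear_mapsI) (simp_all add: linear_mapsD)

lemma end_alg_closed:
  "f \<in> linear_maps M M \<Longrightarrow> restrict f (carrier M) \<in> carrier (end_alg M)"
  by (simp add: end_alg_def linear_restrict)

lemma end_alg_eqI:
  assumes "f \<in> carrier (end_alg M)" "g \<in> carrier (end_alg M)" "\<And>x. x \<in> carrier M \<Longrightarrow> f x = g x"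
  shows "f = g"
  using assms by (intro extensionalityI[of f "carrier M" g]) (auto simp: end_alg_def)

lemma end_alg_apply [simp]:
  "x \<in> carrier M \<Longrightarrow> mult (end_alg M) f g x = f (g x)"
  "x \<in> carrier M \<Longrightarrow> one (end_alg M) x = x"
  "x \<in> carrier M \<Longrightarrow> zero (end_alg M) x = \<zero>"
  "x \<in> carrier M \<Longrightarrow> add (end_alg M) f g x = f x \<oplus> g x"
  "x \<in> carrier M \<Longrightarrow> module.smult (end_alg M) c f x = c \<odot> f x"
  by (simp_all add: end_alg_def)

lemma end_algD:
  assumes "f \<in> carrier (end_alg M)"
  shows "x \<in> carrier M \<Longrightarrow> f x \<in> carrier M"
    "x \<in> carrier M \<Longrightarrow> y \<in> carrier M \<Longrightarrow> f (x \<oplus> y) = f x \<oplus> f y"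
    "x \<in> carrier M \<Longrightarrow> f (c \<odot> x) = c \<odot> f x"
    "f \<in> linear_maps M M"
  using assms by (auto simp: end_alg_def linear_mapsD)

lemma end_alg_const: "one (end_alg M) \<in> carrier (end_alg M)" "zero (end_alg M) \<in> carrier (end_alg M)"
proof -
  have "(\<lambda>x. x) \<in> linear_maps M M" "(\<lambda>x. \<zero>) \<in> linear_maps M M"
    by (auto simp: linear_maps_def)
  from this[THEN end_alg_closed] show "one (end_alg M) \<in> carrier (end_alg M)" "zero (end_alg M) \<in> carrier (end_alg M)"
    by (simp_all add: end_alg_def)
qed

lemma end_alg_smult:
  assumes f: "f \<in> carrier (end_alg M)"
  shows "module.smult (end_alg M) c f \<in> carrier (end_alg M)"
proof -
  have "(\<lambda>x. c \<odot> f x) \<in> linear_maps M M"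
    by (auto simp: linear_maps_def end_algD[OF f] smult_add_right smult_smult mult.commute)
  from end_alg_closed[OF this] show ?thesis by (simp add: end_alg_def)
qed

lemma end_alg_ops:
  assumes f: "f \<in> carrier (end_alg M)" and g: "g \<in> carrier (end_alg M)"
  shows "mult (end_alg M) f g \<in> carrier (end_alg M)" "add (end_alg M) f g \<in> carrier (end_alg M)"
proof -
  note D = end_algD[OF f] end_algD[OF g]
  have "(\<lambda>x. f (g x)) \<in> linear_maps M M" "(\<lambda>x. f x \<oplus> g x) \<in> linear_maps M M"
    by (auto simp: linear_maps_def D a_ac smult_add_right)
  from this[THEN end_alg_closed] show "mult (end_alg M) f g \<in> carrier (end_alg M)" "add (end_alg M) f g \<in> carrier (end_alg M)"
    by (simp_all add: end_alg_def)
qed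

lemma calg_end: "calg (end_alg M)"
proof -
  let ?E = "end_alg M"
  note z = end_alg_const
  have grp3: "(f \<oplus>\<^bsub>?E\<^esub> g) \<oplus>\<^bsub>?E\<^esub> h = f \<oplus>\<^bsub>?E\<^esub> (g \<oplus>\<^bsub>?E\<^esub> h)"
    "(f \<otimes>\<^bsub>?E\<^esub> g) \<otimes>\<^bsub>?E\<^esub> h = f \<otimes>\<^bsub>?E\<^esub> (g \<otimes>\<^bsub>?E\<^esub> h)"
    if fgh: "f \<in> carrier ?E" "g \<in> carrier ?E" "h \<in> carrier ?E" for f g h
    by (rule end_alg_eqI; simp add: end_alg_ops fgh a_ac
        end_algD(1)[OF fgh(1)] end_algD(1)[OF fgh(2)] end_algD(1)[OF fgh(3)])+
  have grp2: "f \<oplus>\<^bsub>?E\<^esub> g = g \<oplus>\<^bsub>?E\<^esub> f" if fg: "f \<in> carrier ?E" "g \<in> carrier ?E" for f g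
    by (rule end_alg_eqI; simp add: end_alg_ops fg a_ac end_algD(1)[OF fg(1)] end_algD(1)[OF fg(2)])
  have grp1: "\<zero>\<^bsub>?E\<^esub> \<oplus>\<^bsub>?E\<^esub> f = f" "((- 1) \<odot>\<^bsub>?E\<^esub> f) \<oplus>\<^bsub>?E\<^esub> f = \<zero>\<^bsub>?E\<^esub>"
    "\<one>\<^bsub>?E\<^esub> \<otimes>\<^bsub>?E\<^esub> f = f" "f \<otimes>\<^bsub>?E\<^esub> \<one>\<^bsub>?E\<^esub> = f" "1 \<odot>\<^bsub>?E\<^esub> f = f"
    if f: "f \<in> carrier ?E" for f
    by (rule end_alg_eqI; simp add: end_alg_ops end_alg_smult z f smult_minus_one l_neg
        end_algD(1)[OF f])+
  interpret E: abelian_group ?E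
  proof (rule abelian_groupI)
    show "\<exists>g\<in>carrier ?E. g \<oplus>\<^bsub>?E\<^esub> f = \<zero>\<^bsub>?E\<^esub>" if "f \<in> carrier ?E" for f
      using grp1(2)[OF that] end_alg_smult[OF that] by blast
  qed (fact end_alg_ops z grp1 grp2 grp3)+
  interpret E: ring ?E
  proof (rule ringI[OF E.abelian_group_axioms])
    show "Group.monoid ?E"
      by (rule monoidI) (fact end_alg_ops z grp1 grp2 grp3)+
    fix f g h assume fgh: "f \<in> carrier ?E" "g \<in> carrier ?E" "h \<in> carrier ?E"
    note D = end_algD(1)[OF fgh(1)] end_algD(1)[OF fgh(2)] end_algD(1-3)[OF fgh(3)]
    show "(f \<oplus>\<^bsub>?E\<^esub> g) \<otimes>\<^bsub>?E\<^esub> h = f \<otimes>\<^bsub>?E\<^esub> h \<oplus>\<^bsub>?E\<^esub> g \<otimes>\<^bsub>?E\<^esub> h"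
      "h \<otimes>\<^bsub>?E\<^esub> (f \<oplus>\<^bsub>?E\<^esub> g) = h \<otimes>\<^bsub>?E\<^esub> f \<oplus>\<^bsub>?E\<^esub> h \<otimes>\<^bsub>?E\<^esub> g"
      by (rule end_alg_eqI; simp add: end_alg_ops fgh D)+
  qed
  have ax: "(a + b) \<odot>\<^bsub>?E\<^esub> f = a \<odot>\<^bsub>?E\<^esub> f \<oplus>\<^bsub>?E\<^esub> b \<odot>\<^bsub>?E\<^esub> f"
    "c \<odot>\<^bsub>?E\<^esub> (f \<oplus>\<^bsub>?E\<^esub> g) = c \<odot>\<^bsub>?E\<^esub> f \<oplus>\<^bsub>?E\<^esub> c \<odot>\<^bsub>?E\<^esub> g"
    "a \<odot>\<^bsub>?E\<^esub> (b \<odot>\<^bsub>?E\<^esub> f) = (a * b) \<odot>\<^bsub>?E\<^esub> f"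
    "(c \<odot>\<^bsub>?E\<^esub> f) \<otimes>\<^bsub>?E\<^esub> g = c \<odot>\<^bsub>?E\<^esub> (f \<otimes>\<^bsub>?E\<^esub> g)"
    "f \<otimes>\<^bsub>?E\<^esub> (c \<odot>\<^bsub>?E\<^esub> g) = c \<odot>\<^bsub>?E\<^esub> (f \<otimes>\<^bsub>?E\<^esub> g)"
    if fg: "f \<in> carrier ?E" "g \<in> carrier ?E" for a b c f g
    by (rule end_alg_eqI; simp add: end_alg_ops end_alg_smult fg end_algD(1-3)[OF fg(1)]
        end_algD(1)[OF fg(2)] smult_add_left smult_add_right smult_smult)+
  show ?thesis
    by unfold_locales (assumption | rule ax grp1 end_alg_smult)+
qed

end

definition fun_vec :: "(complex, 'x \<Rightarrow> complex) module" where
  "fun_vec = \<lparr>carrier = UNIV, mult = undefined, one = undefined, zero = (\<lambda>_. 0),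
     add = (\<lambda>f g x. f x + g x), smult = (\<lambda>c f x. c * f x)\<rparr>"

lemma fun_vec_simps [simp]:
  "carrier fun_vec = UNIV" "zero fun_vec = (\<lambda>_. 0)" "add fun_vec = (\<lambda>f g x. f x + g x)"
  "module.smult fun_vec = (\<lambda>c f x. c * f x)"
  by (simp_all add: fun_vec_def)

lemma cvec_fun_vec: "cvec (fun_vec :: (complex, 'x \<Rightarrow> complex) module)"
proof -
  interpret abelian_group "fun_vec :: (complex, 'x \<Rightarrow> complex) module"
  proof (rule abelian_groupI, goal_cases)
    case (6 f)
    show ?case by (rule bexI[of _ "\<lambda>x. - f x"]) auto
  qed (auto simp: algebra_simps)
  show ?thesis by unfold_locales (auto simp: algebra_simps)
qed

subsection \<open>The algebra of U(1)\<close>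

lemma star_closure_base: "x \<in> R \<Longrightarrow> x \<in> star_closure R" "x \<in> R \<Longrightarrow> star x \<in> star_closure R"
  by (auto simp: star_closure_def)

lemma star_closureE: "r \<in> star_closure R \<Longrightarrow> (r \<in> R \<Longrightarrow> P) \<Longrightarrow> (\<And>x. x \<in> R \<Longrightarrow> r = star x \<Longrightarrow> P) \<Longrightarrow> P"
  by (auto simp: star_closure_def)

lemma calg_Ualg: "calg Ualg"
  by (simp add: Ualg_def calg_presented)

lemma Ualg_pair: "inverse_pair Ualg Uu Uu_st"
proof -
  interpret calg Ualg by (rule calg_Ualg)
  show ?thesis
  proof unfold_locales
    show "Uu \<otimes>\<^bsub>Ualg\<^esub> Uu_st = \<one>\<^bsub>Ualg\<^esub>" "Uu_st \<otimes>\<^bsub>Ualg\<^esub> Uu = \<one>\<^bsub>Ualg\<^esub>"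
      by (auto simp: Ualg_def Uu_def Uu_st_def cls_simps u1_rels_def
          intro!: cls_eqI star_closure_base(1))
  qed (simp_all add: Ualg_def Uu_def Uu_st_def cls_simps)
qed

interpretation Ua: inverse_pair Ualg Uu Uu_st by (rule Ualg_pair)

abbreviation uu :: "int \<Rightarrow> u1_gen falg set" where "uu \<equiv> upow Ualg Uu Uu_st"

lemma Ualg_span: "carrier Ualg = lin_span Ualg (range uu)"
  unfolding Ualg_def
proof (rule presented_span)
  fix l s assume "s \<in> range (upow (presented u1_rels) Uu Uu_st)"
  then obtain n where s: "s = uu n" by (auto simp: Ualg_def)
  have "cls u1_rels (mon [l]) \<otimes>\<^bsub>Ualg\<^esub> s \<in> range uu"
  proof (cases l)
    case (Gen x)
    then show ?thesis using Ua.u_up[of n] by (cases x) (simp add: s Uu_def[symmetric])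
  next
    case (Adj x)
    then show ?thesis using Ua.v_up[of n] by (cases x) (simp add: s Uu_st_def[symmetric])
  qed
  then show "cls u1_rels (mon [l]) \<otimes>\<^bsub>presented u1_rels\<^esub> s
      \<in> lin_span (presented u1_rels) (range (upow (presented u1_rels) Uu Uu_st))"
    unfolding Ualg_def[symmetric] by (rule Ua.lin_span_base[rotated]) auto
next
  show "\<one>\<^bsub>presented u1_rels\<^esub> \<in> range (upow (presented u1_rels) Uu Uu_st)"
    using Ua.up_0 unfolding Ualg_def by (metis rangeI)
qed (use Ua.up_closed in \<open>auto simp: Ualg_def\<close>)

lemma Ualg_linear_eq:
  assumes "cvec N" "f \<in> linear_maps Ualg N" "g \<in> linear_maps Ualg N" "\<And>n. f (uu n) = g (uu n)"
    "a \<in> carrier Ualg"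
  shows "f a = g a"
  by (rule linear_maps_eq_on_span[OF Ua.cvec_axioms assms(1-3) _ Ualg_span assms(5)])
    (use assms(4) in auto)

definition uhom :: "(complex, 'a) module \<Rightarrow> 'a \<Rightarrow> 'a \<Rightarrow> u1_gen falg set \<Rightarrow> 'a" where
  "uhom M u v = phom M (\<lambda>l. case l of Gen _ \<Rightarrow> u | Adj _ \<Rightarrow> v)"

context inverse_pair begin

lemma uhom_presented: "presented_map M (\<lambda>l. case l of Gen _ \<Rightarrow> u | Adj _ \<Rightarrow> v) u1_rels"
proof -
  interpret letter_map M "\<lambda>l :: u1_gen letter. case l of Gen _ \<Rightarrow> u | Adj _ \<Rightarrow> v"
    by unfold_locales (auto split: letter.split)
  show ?thesis
    by unfold_locales
      (auto simp: u1_rels_def fhom_simps star_simps uv vu minus_eq_zero_iff elim!: star_closureE)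
qed

lemma uhom_hom: "uhom M u v \<in> alg_homs Ualg M"
  unfolding uhom_def Ualg_def by (rule presented_map.phom_hom[OF uhom_presented])

lemma uhom_gen [simp]: "uhom M u v Uu = u" "uhom M u v Uu_st = v"
proof -
  interpret presented_map M "\<lambda>l :: u1_gen letter. case l of Gen _ \<Rightarrow> u | Adj _ \<Rightarrow> v" u1_rels
    by (rule uhom_presented)
  show "uhom M u v Uu = u" "uhom M u v Uu_st = v"
    by (simp_all add: uhom_def Uu_def Uu_st_def phom_cls fhom_letter)
qed

lemma uhom_uu: "uhom M u v (uu n) = up n"
  using Ua.up_hom[OF uhom_hom, of n] inverse_pair_axioms by simp

lemma alg_ext_U: "alg_ext Ualg M {(Uu, u), (Uu_st, v)} = restrict (uhom M u v) (carrier Ualg)"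
proof -
  interpret presented_map M "\<lambda>l :: u1_gen letter. case l of Gen _ \<Rightarrow> u | Adj _ \<Rightarrow> v" u1_rels
    by (rule uhom_presented)
  show ?thesis
    unfolding Ualg_def uhom_def
  proof (rule alg_ext_presented)
    show "cls u1_rels (mon [l]) \<in> fst ` {(Uu, u), (Uu_st, v)}" for l
    proof (cases l)
      case (Gen x) then show ?thesis by (cases x) (simp add: Uu_def)
    next
      case (Adj x) then show ?thesis by (cases x) (simp add: Uu_st_def)
    qed
    show "\<exists>l. x = cls u1_rels (mon [l]) \<and> y = (case l of Gen _ \<Rightarrow> u | Adj _ \<Rightarrow> v)"
      if "(x, y) \<in> {(Uu, u), (Uu_st, v)}" for x y
      using that by (auto simp: Uu_def Uu_st_def intro: exI[of _ "Gen U_gen"] exI[of _ "Adj U_gen"])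
  qed
qed

end

lemma Ualg_counit_eq: "Ualg_counit = restrict (uhom complex_alg 1 1) (carrier Ualg)"
  and Ualg_counit_uu [simp]: "Ualg_counit (uu n) = 1"
proof -
  interpret calg complex_alg by (rule calg_complex)
  interpret inverse_pair complex_alg 1 1 by unfold_locales simp_all
  show *: "Ualg_counit = restrict (uhom complex_alg 1 1) (carrier Ualg)"
    unfolding Ualg_counit_def by (rule alg_ext_U)
  show "Ualg_counit (uu n) = 1"
    using complex_alg_upow[of 1 n] by (simp add: * uhom_uu)
qed

lemma Ualg_counit_linear: "Ualg_counit \<in> linear_maps Ualg complex_alg"
proof -
  interpret calg complex_alg by (rule calg_complex)
  interpret inverse_pair complex_alg 1 1 by unfold_locales simp_all
  show ?thesis
    using alg_homsD[OF uhom_hom] by (auto simp: Ualg_counit_eq intro!: linear_mapsI)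
qed

context tensor2 begin

lemma tens_pow: "x \<in> carrier M \<Longrightarrow> y \<in> carrier N \<Longrightarrow>
    (x \<otimes>\<^sub>t y) [^]\<^bsub>TA\<^esub> (n::nat) = (x [^]\<^bsub>M\<^esub> n) \<otimes>\<^sub>t (y [^]\<^bsub>N\<^esub> n)"
  by (induction n) (simp_all add: TA_mult)

lemma tens_upow: "x \<in> carrier M \<Longrightarrow> y \<in> carrier N \<Longrightarrow> x' \<in> carrier M \<Longrightarrow> y' \<in> carrier N \<Longrightarrow>
    upow TA (x \<otimes>\<^sub>t y) (x' \<otimes>\<^sub>t y') n = (upow M x x' n) \<otimes>\<^sub>t (upow N y y' n)"
  by (simp add: upow_def tens_pow del: pow_nat)

end

interpretation UU: tensor2 Ualg Ualg by unfold_locales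

lemma Ualg_coprod_uu [simp]: "Ualg_coprod (uu n) = tens Ualg Ualg (uu n) (uu n)"
  and Ualg_coprod_linear: "Ualg_coprod \<in> linear_maps Ualg (tensor_space Ualg Ualg)"
proof -
  interpret inverse_pair "tensor_alg Ualg Ualg" "tens Ualg Ualg Uu Uu" "tens Ualg Ualg Uu_st Uu_st"
    by unfold_locales (simp_all add: UU.TA_mult Ua.uv Ua.vu)
  have *: "Ualg_coprod = restrict (uhom (tensor_alg Ualg Ualg) (tens Ualg Ualg Uu Uu) (tens Ualg Ualg Uu_st Uu_st)) (carrier Ualg)"
    unfolding Ualg_coprod_def by (rule alg_ext_U)
  show "Ualg_coprod (uu n) = tens Ualg Ualg (uu n) (uu n)"
    by (simp add: * uhom_uu UU.tens_upow)
  show "Ualg_coprod \<in> linear_maps Ualg (tensor_space Ualg Ualg)"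
    using alg_homsD[OF uhom_hom] by (auto simp: * intro!: linear_mapsI)
qed


subsection \<open>The algebra S(V)\<close>

locale muq =
  fixes \<mu> :: real
  assumes mu_gt: "- 1 < \<mu>" and mu_lt: "\<mu> < 1" and mu_nz [simp]: "\<mu> \<noteq> 0"
begin

abbreviation m :: complex where "m \<equiv> complex_of_real \<mu>"

lemma m_nz [simp]: "m \<noteq> 0" by simp

lemma mu_pow_lt1: "n > 0 \<Longrightarrow> \<bar>\<mu> ^ n\<bar> < 1"
  using mu_gt mu_lt power_strict_decreasing[of 0 n "\<bar>\<mu>\<bar>"] by (simp add: power_abs abs_less_iff)

lemma mu_pow_ne1: "n > 0 \<Longrightarrow> \<mu> ^ n \<noteq> 1"
  using mu_pow_lt1[of n] by auto

end

lemma powi_shift: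
  fixes z :: complex
  assumes "z \<noteq> 0"
  shows "1 / z * z powi (- i) = z powi (- (i + 1))" "z * z powi (- i) = z powi (- (i - 1))"
  using power_int_add[of z "- 1" "- i"] power_int_add[of z 1 "- i"] assms
  by (simp_all add: field_simps)

text \<open>The images of \<open>xi\<close> and \<open>xi_st\<close> under a homomorphism are
  exactly such pairs. The locale is instantiated in S(V) itself (also with rescaled generators), in
  shift operators, in the affine quantum group and in the target of the coproduct.\<close>

locale s_pair = calg M + muq \<mu> for M :: "(complex, 'a) module" (structure) and \<mu> +
  fixes x y :: 'a
  assumes x_closed [simp, intro]: "x \<in> carrier M" and y_closed [simp, intro]: "y \<in> carrier M"
    and xy: "x \<otimes> y = m\<^sup>2 \<odot> (y \<otimes> x)"

lemma (in calg) comm_pow: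
  assumes "x \<in> carrier M" "y \<in> carrier M" "y \<otimes> x = c \<odot> (x \<otimes> y)"
  shows "y \<otimes> x [^] (n::nat) = c ^ n \<odot> (x [^] n \<otimes> y)"
proof (induction n)
  case (Suc n)
  have "y \<otimes> x [^] Suc n = (y \<otimes> x [^] n) \<otimes> x" using assms by (simp add: m_assoc)
  also have "\<dots> = c ^ n \<odot> (x [^] n \<otimes> (y \<otimes> x))" using assms by (simp add: Suc smult_mult_left m_assoc)
  also have "\<dots> = c ^ Suc n \<odot> (x [^] Suc n \<otimes> y)"
    using assms by (simp add: smult_mult_right smult_smult m_assoc mult.commute)
  finally show ?case .
qed (use assms in simp)

definition shom :: "(complex, 'a) module \<Rightarrow> 'a \<Rightarrow> 'a \<Rightarrow> s_gen falg set \<Rightarrow> 'a" where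
  "shom M x y = phom M (\<lambda>l. case l of Gen _ \<Rightarrow> x | Adj _ \<Rightarrow> y)"

context s_pair begin

lemma yx: "y \<otimes> x = (1 / m\<^sup>2) \<odot> (x \<otimes> y)"
  by (simp add: xy smult_smult)

text \<open>The relation of S(V) is its own adjoint, so the star closure imposes nothing beyond
  \<open>xy\<close>.\<close>

lemma shom_presented: "presented_map M (\<lambda>l. case l of Gen _ \<Rightarrow> x | Adj _ \<Rightarrow> y) (s_rels \<mu>)"
proof -
  interpret letter_map M "\<lambda>l :: s_gen letter. case l of Gen _ \<Rightarrow> x | Adj _ \<Rightarrow> y"
    by unfold_locales (auto split: letter.split)
  show ?thesis
    by unfold_locales
      (auto simp: s_rels_def fhom_simps star_simps xy minus_eq_zero_iff smult_mult_right elim!: star_closureE)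
qed

lemma shom_hom: "shom M x y \<in> alg_homs (Salg \<mu>) M"
  unfolding shom_def Salg_def by (rule presented_map.phom_hom[OF shom_presented])

lemma shom_gen [simp]: "shom M x y (xi \<mu>) = x" "shom M x y (xi_st \<mu>) = y"
proof -
  interpret presented_map M "\<lambda>l :: s_gen letter. case l of Gen _ \<Rightarrow> x | Adj _ \<Rightarrow> y" "s_rels \<mu>"
    by (rule shom_presented)
  show "shom M x y (xi \<mu>) = x" "shom M x y (xi_st \<mu>) = y"
    by (simp_all add: shom_def xi_def xi_st_def phom_cls fhom_letter)
qed

lemma alg_ext_S: "alg_ext (Salg \<mu>) M {(xi \<mu>, x), (xi_st \<mu>, y)} = restrict (shom M x y) (carrier (Salg \<mu>))"
proof -
  interpret presented_map M "\<lambda>l :: s_gen letter. case l of Gen _ \<Rightarrow> x | Adj _ \<Rightarrow> y" "s_rels \<mu>"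
    by (rule shom_presented)
  show ?thesis
    unfolding Salg_def shom_def
  proof (rule alg_ext_presented)
    show "cls (s_rels \<mu>) (mon [l]) \<in> fst ` {(xi \<mu>, x), (xi_st \<mu>, y)}" for l
    proof (cases l)
      case (Gen x) then show ?thesis by (cases x) (simp add: xi_def)
    next
      case (Adj x) then show ?thesis by (cases x) (simp add: xi_st_def)
    qed
    show "\<exists>l. a = cls (s_rels \<mu>) (mon [l]) \<and> b = (case l of Gen _ \<Rightarrow> x | Adj _ \<Rightarrow> y)"
      if "(a, b) \<in> {(xi \<mu>, x), (xi_st \<mu>, y)}" for a b
      using that by (auto simp: xi_def xi_st_def intro: exI[of _ "Gen Xi_gen"] exI[of _ "Adj Xi_gen"])
  qed
qed

lemma shom_unique:
  assumes "f \<in> alg_homs (Salg \<mu>) M" "f (xi \<mu>) = x" "f (xi_st \<mu>) = y" "t \<in> carrier (Salg \<mu>)"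
  shows "f t = shom M x y t"
proof (rule alg_homs_eq_on_gen[OF _ _ assms(1) shom_hom])
  show "calg (Salg \<mu>)" by (simp add: Salg_def calg_presented)
  show "range (\<lambda>l. cls (s_rels \<mu>) (mon [l])) \<subseteq> carrier (Salg \<mu>)" by (auto simp: Salg_def cls_simps)
  show "t \<in> subalg_gen (Salg \<mu>) (range (\<lambda>l. cls (s_rels \<mu>) (mon [l])))"
    using presented_gen[of "s_rels \<mu>"] assms(4) by (auto simp: Salg_def)
  fix z assume "z \<in> range (\<lambda>l. cls (s_rels \<mu>) (mon [l]))"
  then obtain l where z: "z = cls (s_rels \<mu>) (mon [l])" by auto
  show "f z = shom M x y z"
  proof (cases l)
    case (Gen a) then show ?thesis using assms shom_gen by (cases a) (simp add: z xi_def)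
  next
    case (Adj a) then show ?thesis using assms shom_gen by (cases a) (simp add: z xi_st_def)
  qed
qed

end

context muq begin

abbreviation "SA \<equiv> Salg \<mu>"
abbreviation "X \<equiv> xi \<mu>"
abbreviation "Y \<equiv> xi_st \<mu>"

sublocale S: s_pair SA \<mu> X Y
proof -
  interpret calg SA by (simp add: Salg_def calg_presented)
  show "s_pair SA \<mu> X Y"
  proof unfold_locales
    show "X \<otimes>\<^bsub>SA\<^esub> Y = m\<^sup>2 \<odot>\<^bsub>SA\<^esub> (Y \<otimes>\<^bsub>SA\<^esub> X)"
      by (auto simp: Salg_def xi_def xi_st_def cls_simps s_rels_def mult.assoc
          intro!: cls_eqI star_closure_base(1))
  qed (simp_all add: Salg_def xi_def xi_st_def cls_simps)
qed

definition smon :: "nat \<times> nat \<Rightarrow> s_gen falg set" where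
  "smon pq = (X [^]\<^bsub>SA\<^esub> fst pq) \<otimes>\<^bsub>SA\<^esub> (Y [^]\<^bsub>SA\<^esub> snd pq)"

lemma smon_closed [simp, intro]: "smon pq \<in> carrier SA"
  by (simp add: smon_def)

lemma X_smon: "X \<otimes>\<^bsub>SA\<^esub> smon (p, q) = smon (Suc p, q)"
  by (simp add: smon_def S.m_assoc[symmetric] S.nat_pow_Suc2[symmetric] del: S.nat_pow_Suc)

lemma Y_smon: "Y \<otimes>\<^bsub>SA\<^esub> smon (p, q) = (1 / m\<^sup>2) ^ p \<odot>\<^bsub>SA\<^esub> smon (p, Suc q)"
proof -
  have "Y \<otimes>\<^bsub>SA\<^esub> smon (p, q) = (Y \<otimes>\<^bsub>SA\<^esub> X [^]\<^bsub>SA\<^esub> p) \<otimes>\<^bsub>SA\<^esub> Y [^]\<^bsub>SA\<^esub> q"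
    by (simp add: smon_def S.m_assoc)
  also have "\<dots> = (1 / m\<^sup>2) ^ p \<odot>\<^bsub>SA\<^esub> (X [^]\<^bsub>SA\<^esub> p \<otimes>\<^bsub>SA\<^esub> (Y \<otimes>\<^bsub>SA\<^esub> Y [^]\<^bsub>SA\<^esub> q))"
    by (simp add: S.comm_pow[OF _ _ S.yx] S.smult_mult_left S.m_assoc)
  finally show ?thesis by (simp add: smon_def S.nat_pow_Suc2[symmetric] del: S.nat_pow_Suc)
qed

lemma S_span: "carrier SA = lin_span SA (range smon)"
  unfolding Salg_def
proof (rule presented_span)
  fix l s assume "s \<in> range smon"
  then obtain p q where s: "s = smon (p, q)" by auto
  have sp: "range smon \<subseteq> carrier SA" by auto
  have "cls (s_rels \<mu>) (mon [l]) \<otimes>\<^bsub>SA\<^esub> s \<in> lin_span SA (range smon)"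
  proof (cases l)
    case (Gen x)
    then show ?thesis
      using X_smon[of p q] S.lin_span_base[OF sp] by (cases x) (simp add: s xi_def[symmetric])
  next
    case (Adj x)
    then show ?thesis
      using Y_smon[of p q] S.lin_span_base[OF sp] S.lin_span_smult[OF sp]
      by (cases x) (simp add: s xi_st_def[symmetric])
  qed
  then show "cls (s_rels \<mu>) (mon [l]) \<otimes>\<^bsub>presented (s_rels \<mu>)\<^esub> s \<in> lin_span (presented (s_rels \<mu>)) (range smon)"
    by (simp add: Salg_def)
next
  show "\<one>\<^bsub>presented (s_rels \<mu>)\<^esub> \<in> range smon"
    using S.one_closed by (intro range_eqI[of _ _ "(0, 0)"]) (simp add: smon_def Salg_def[symmetric])
qed (use smon_closed in \<open>auto simp: Salg_def\<close>)

lemma S_linear_eq: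
  assumes "cvec N" "f \<in> linear_maps SA N" "g \<in> linear_maps SA N" "\<And>p q. f (smon (p, q)) = g (smon (p, q))"
    "t \<in> carrier SA"
  shows "f t = g t"
  by (rule linear_maps_eq_on_span[OF S.cvec_axioms assms(1-3) _ S_span assms(5)])
    (use assms(4) in auto)

text \<open>Linear independence of the monomials: they act on the functions on pairs of exponents as
  shifts, and moving the function supported at the origin recovers the exponents.\<close>

definition shift_p :: "(nat \<times> nat \<Rightarrow> complex) \<Rightarrow> nat \<times> nat \<Rightarrow> complex" where
  "shift_p v = (\<lambda>(p, q). if p = 0 then 0 else v (p - 1, q))"

definition shift_q :: "(nat \<times> nat \<Rightarrow> complex) \<Rightarrow> nat \<times> nat \<Rightarrow> complex" where
  "shift_q v = (\<lambda>(p, q). if q = 0 then 0 else (1 / m\<^sup>2) ^ p * v (p, q - 1))"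

abbreviation "EF \<equiv> end_alg (fun_vec :: (complex, nat \<times> nat \<Rightarrow> complex) module)"

sublocale EF: s_pair EF \<mu> shift_p shift_q
proof -
  interpret F: cvec "fun_vec :: (complex, nat \<times> nat \<Rightarrow> complex) module" by (rule cvec_fun_vec)
  interpret calg EF by (rule F.calg_end)
  show "s_pair EF \<mu> shift_p shift_q"
  proof unfold_locales
    show c: "shift_p \<in> carrier EF" "shift_q \<in> carrier EF"
      by (auto simp: end_alg_def linear_maps_def shift_p_def shift_q_def fun_eq_iff algebra_simps)
    show "shift_p \<otimes>\<^bsub>EF\<^esub> shift_q = m\<^sup>2 \<odot>\<^bsub>EF\<^esub> (shift_q \<otimes>\<^bsub>EF\<^esub> shift_p)"
    proof (rule F.end_alg_eqI)
      fix v :: "nat \<times> nat \<Rightarrow> complex"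
      have "shift_p (shift_q v) (p, q) = m\<^sup>2 * shift_q (shift_p v) (p, q)" for p q
        by (cases p) (simp_all add: shift_p_def shift_q_def)
      then show "(shift_p \<otimes>\<^bsub>EF\<^esub> shift_q) v = (m\<^sup>2 \<odot>\<^bsub>EF\<^esub> (shift_q \<otimes>\<^bsub>EF\<^esub> shift_p)) v"
        by (auto simp: fun_eq_iff)
    qed (use c in auto)
  qed
qed

definition delta :: "nat \<times> nat \<Rightarrow> nat \<times> nat \<Rightarrow> complex" where
  "delta a b = (if a = b then 1 else 0)"

definition scoef :: "s_gen falg set \<Rightarrow> nat \<times> nat \<Rightarrow> complex" where
  "scoef t = shom EF shift_p shift_q t (delta (0, 0))"

lemma scoef_linear: "scoef \<in> linear_maps SA fun_vec"
  by (rule linear_mapsI)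
    (simp_all add: scoef_def[abs_def] alg_homsD[OF EF.shom_hom] cvec.end_alg_apply[OF cvec_fun_vec])

lemma scoef_X: "t \<in> carrier SA \<Longrightarrow> scoef (X \<otimes>\<^bsub>SA\<^esub> t) = shift_p (scoef t)"
  "t \<in> carrier SA \<Longrightarrow> scoef (Y \<otimes>\<^bsub>SA\<^esub> t) = shift_q (scoef t)"
  by (simp_all add: scoef_def alg_homsD[OF EF.shom_hom] cvec.end_alg_apply[OF cvec_fun_vec])

lemma scoef_smon: "scoef (smon pq) = delta pq"
proof -
  have "scoef (smon (p, q)) = delta (p, q)" for p q
  proof (induction p)
    case 0
    show ?case
    proof (induction q)
      case 0
      show ?case
        by (simp add: smon_def scoef_def alg_homsD(5)[OF EF.shom_hom] cvec.end_alg_apply[OF cvec_fun_vec])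
    next
      case (Suc q)
      have "scoef (smon (0, Suc q)) = shift_q (delta (0, q))"
        using scoef_X(2)[of "smon (0, q)"] Suc by (simp add: Y_smon)
      then show ?case by (auto simp: shift_q_def delta_def fun_eq_iff)
    qed
  next
    case (Suc p)
    have "scoef (smon (Suc p, q)) = shift_p (delta (p, q))"
      using scoef_X(1)[of "smon (p, q)"] Suc by (simp add: X_smon)
    then show ?case by (auto simp: shift_p_def delta_def fun_eq_iff)
  qed
  then show ?thesis by (cases pq) simp
qed

lemma scoef_pm_sum: "scoef (pm_sum SA smon f) = lookup f"
proof -
  interpret F: cvec "fun_vec :: (complex, nat \<times> nat \<Rightarrow> complex) module" by (rule cvec_fun_vec)
  have "scoef (pm_sum SA smon f) = pm_sum fun_vec delta f"
    using linear_maps_pm_sum[OF scoef_linear S.cvec_axioms F.cvec_axioms, of smon f]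
    by (simp add: scoef_smon)
  also have "keys f \<subseteq> UNIV" by simp
  then have "pm_sum fun_vec delta f = lookup f"
  proof (induction rule: pm_induct)
    case (add f g)
    then show ?case by (simp add: F.pm_sum_add lookup_add fun_eq_iff)
  next
    case (single k c)
    then show ?case by (auto simp: F.pm_sum_single fun_eq_iff delta_def lookup_single when_def)
  qed auto
  finally show ?thesis .
qed

lemma S_expand: "t \<in> carrier SA \<Longrightarrow> \<exists>f. t = pm_sum SA smon f \<and> scoef t = lookup f"
proof -
  assume "t \<in> carrier SA"
  then have "t \<in> lin_span SA (range smon)" using S_span by simp
  then have "\<exists>f. t = pm_sum SA smon f"
  proof (rule S.lin_span_induct)
    show "\<exists>f. \<zero>\<^bsub>SA\<^esub> = pm_sum SA smon f" by (rule exI[of _ 0]) simp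
    show "\<exists>f. x \<oplus>\<^bsub>SA\<^esub> y = pm_sum SA smon f"
      if "\<exists>f. x = pm_sum SA smon f" "\<exists>f. y = pm_sum SA smon f" for x y
      using that S.pm_sum_add[of smon] by (metis smon_closed Pi_I)
    show "\<exists>f. c \<odot>\<^bsub>SA\<^esub> x = pm_sum SA smon f" if "x \<in> range smon" for c x
      using that S.pm_sum_single[of smon] by (metis smon_closed imageE)
  qed auto
  then show ?thesis using scoef_pm_sum by blast
qed

lemma scoef_inj: "t \<in> carrier SA \<Longrightarrow> scoef t = (\<lambda>_. 0) \<Longrightarrow> t = \<zero>\<^bsub>SA\<^esub>"
  using S_expand[of t] S.pm_sum_zero[of smon] by (metis poly_mapping_eqI lookup_zero)


subsection \<open>The action of U(1) on S(V)\<close>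

text \<open>The scaling by degree: a monomial of total degree d is multiplied by z^d. Since U
  multiplies both generators by 1/\<mu>, its action is \<open>sg (1 / m)\<close>, and U^n acts by
  \<open>sg (m powi (- n))\<close>.\<close>

definition sg :: "complex \<Rightarrow> s_gen falg set \<Rightarrow> s_gen falg set" where
  "sg z = shom SA (z \<odot>\<^bsub>SA\<^esub> X) (z \<odot>\<^bsub>SA\<^esub> Y)"

lemma sg_pair: "s_pair SA \<mu> (z \<odot>\<^bsub>SA\<^esub> X) (z \<odot>\<^bsub>SA\<^esub> Y)"
  by unfold_locales
    (simp_all add: S.smult_mult_left S.smult_mult_right S.smult_smult S.xy mult_ac)

lemma sg_hom: "sg z \<in> alg_homs SA SA"
  unfolding sg_def by (rule s_pair.shom_hom[OF sg_pair])

lemmas sgD = alg_homsD[OF sg_hom]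

lemma sg_gen [simp]: "sg z X = z \<odot>\<^bsub>SA\<^esub> X" "sg z Y = z \<odot>\<^bsub>SA\<^esub> Y"
  unfolding sg_def by (rule s_pair.shom_gen[OF sg_pair])+

lemma sg_unique: "f \<in> alg_homs SA SA \<Longrightarrow> f X = z \<odot>\<^bsub>SA\<^esub> X \<Longrightarrow> f Y = z \<odot>\<^bsub>SA\<^esub> Y \<Longrightarrow> t \<in> carrier SA \<Longrightarrow> f t = sg z t"
  unfolding sg_def by (rule s_pair.shom_unique[OF sg_pair])

lemma sg_sg: "t \<in> carrier SA \<Longrightarrow> sg z (sg w t) = sg (z * w) t"
  by (rule sg_unique[OF alg_homs_comp[OF sg_hom sg_hom]]) (simp_all add: sgD S.smult_smult mult.commute)

lemma sg_1: "t \<in> carrier SA \<Longrightarrow> sg 1 t = t"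
  by (rule sg_unique[symmetric]) (simp_all add: alg_homsI)

abbreviation "ES \<equiv> end_alg SA"
abbreviation "su \<equiv> restrict (sg (1 / m)) (carrier SA)"
abbreviation "sv \<equiv> restrict (sg m) (carrier SA)"

sublocale ES: inverse_pair ES su sv
proof -
  interpret calg ES by (rule S.calg_end)
  have c: "su \<in> carrier ES" "sv \<in> carrier ES"
    using alg_homs_linear[OF sg_hom] by (simp_all add: S.end_alg_closed)
  show "inverse_pair ES su sv"
  proof unfold_locales
    show "su \<otimes>\<^bsub>ES\<^esub> sv = \<one>\<^bsub>ES\<^esub>" "sv \<otimes>\<^bsub>ES\<^esub> su = \<one>\<^bsub>ES\<^esub>"
      by (rule S.end_alg_eqI; simp add: c sgD sg_sg sg_1)+
  qed (fact c)+
qed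

lemma ES_up: "t \<in> carrier SA \<Longrightarrow> ES.up n t = sg (m powi (- n)) t"
proof (induction n rule: int_induct[where k = 0])
  case base
  then show ?case by (simp add: sg_1)
next
  case (step1 i)
  have "ES.up (i + 1) t = (su \<otimes>\<^bsub>ES\<^esub> ES.up i) t" by (simp only: ES.u_up)
  also have "\<dots> = sg (1 / m) (sg (m powi (- i)) t)"
    by (simp only: S.end_alg_apply(1) step1.IH step1.prems restrict_apply' sgD(1))
  finally show ?case by (simp only: sg_sg step1.prems powi_shift(1)[OF m_nz])
next
  case (step2 i)
  have "ES.up (i - 1) t = (sv \<otimes>\<^bsub>ES\<^esub> ES.up i) t" by (simp only: ES.v_up)
  also have "\<dots> = sg m (sg (m powi (- i)) t)"
    by (simp only: S.end_alg_apply(1) step2.IH step2.prems restrict_apply' sgD(1))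
  finally show ?case by (simp only: sg_sg step2.prems powi_shift(2)[OF m_nz])
qed

text \<open>A homomorphism into an endomorphism algebra naturally gives a left action; here it is
  also a right action because the algebra generated by U is commutative.\<close>

definition sact :: "s_gen falg set \<Rightarrow> u1_gen falg set \<Rightarrow> s_gen falg set" where
  "sact = (\<lambda>t\<in>carrier SA. \<lambda>a\<in>carrier Ualg. uhom ES su sv a t)"

lemma sact_uu: "t \<in> carrier SA \<Longrightarrow> sact t (uu n) = sg (m powi (- n)) t"
  by (simp add: sact_def ES.uhom_uu ES_up)

lemma sact_bilin: "bilin SA Ualg SA sact"
proof -
  note H = alg_homsD[OF ES.uhom_hom]
  show ?thesis
  proof (rule bilinI)
    fix t t' a a' c assume t: "t \<in> carrier SA" "t' \<in> carrier SA" and a: "a \<in> carrier Ualg" "a' \<in> carrier Ualg"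
    note D = S.end_algD(1-3)[OF H(1)[OF a(1)]]
    show "sact t a \<in> carrier SA" "sact (t \<oplus>\<^bsub>SA\<^esub> t') a = sact t a \<oplus>\<^bsub>SA\<^esub> sact t' a"
      "sact (c \<odot>\<^bsub>SA\<^esub> t) a = c \<odot>\<^bsub>SA\<^esub> sact t a"
      "sact t (a \<oplus>\<^bsub>Ualg\<^esub> a') = sact t a \<oplus>\<^bsub>SA\<^esub> sact t a'"
      "sact t (c \<odot>\<^bsub>Ualg\<^esub> a) = c \<odot>\<^bsub>SA\<^esub> sact t a"
      using t a by (simp_all add: sact_def D H)
  qed
qed

lemma sact_mem: "sact \<in> carrier SA \<rightarrow>\<^sub>E (carrier Ualg \<rightarrow>\<^sub>E carrier SA)"
  using bilinD(1)[OF sact_bilin] by (auto simp: sact_def)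

lemma bilin_linear: "bilin M N L g \<Longrightarrow> x \<in> carrier M \<Longrightarrow> g x \<in> linear_maps N L"
  "bilin M N L g \<Longrightarrow> y \<in> carrier N \<Longrightarrow> (\<lambda>x. g x y) \<in> linear_maps M L"
  by (auto simp: bilin_def)

end

context muq begin

text \<open>Each identity is linear in the elements of \<open>Ualg\<close>, hence reduces to powers
  of U. These are group-like and act by the automorphisms \<open>sg\<close>, which gives
  multiplicativity over the coproduct.\<close>

lemma sact_props:
  shows "a \<in> carrier Ualg \<Longrightarrow> (\<lambda>t. sact t a) \<in> linear_maps SA SA"
    and "t \<in> carrier SA \<Longrightarrow> sact t \<in> linear_maps Ualg SA"
    and "t \<in> carrier SA \<Longrightarrow> sact t \<one>\<^bsub>Ualg\<^esub> = t"
    and "t \<in> carrier SA \<Longrightarrow> a \<in> carrier Ualg \<Longrightarrow> b \<in> carrier Ualg \<Longrightarrow> sact t (a \<otimes>\<^bsub>Ualg\<^esub> b) = sact (sact t a) b"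
    and "a \<in> carrier Ualg \<Longrightarrow> sact \<one>\<^bsub>SA\<^esub> a = Ualg_counit a \<odot>\<^bsub>SA\<^esub> \<one>\<^bsub>SA\<^esub>"
    and "s \<in> carrier SA \<Longrightarrow> t \<in> carrier SA \<Longrightarrow> a \<in> carrier Ualg \<Longrightarrow>
      sact (s \<otimes>\<^bsub>SA\<^esub> t) a = tens_sum SA (\<lambda>b c. sact s b \<otimes>\<^bsub>SA\<^esub> sact t c) (Ualg_coprod a)"
    and "sact X Uu = complex_of_real (1 / \<mu>) \<odot>\<^bsub>SA\<^esub> X" "sact Y Uu = complex_of_real (1 / \<mu>) \<odot>\<^bsub>SA\<^esub> Y"
proof -
  note B = bilinD[OF sact_bilin]
  show lin1: "(\<lambda>t. sact t a) \<in> linear_maps SA SA" if "a \<in> carrier Ualg" for a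
    using bilin_linear(2)[OF sact_bilin that] .
  show lin2: "sact t \<in> linear_maps Ualg SA" if "t \<in> carrier SA" for t
    using bilin_linear(1)[OF sact_bilin that] .
  show "sact t \<one>\<^bsub>Ualg\<^esub> = t" if "t \<in> carrier SA" for t
    using sact_uu[OF that, of 0] that by (simp add: sg_1)
  have 1: "sact t (a \<otimes>\<^bsub>Ualg\<^esub> uu n) = sact (sact t a) (uu n)" if t: "t \<in> carrier SA" and a: "a \<in> carrier Ualg" for t a n
  proof (rule Ualg_linear_eq[OF S.cvec_axioms _ _ _ a])
    show "(\<lambda>a. sact t (a \<otimes>\<^bsub>Ualg\<^esub> uu n)) \<in> linear_maps Ualg SA"
      by (rule linear_mapsI) (simp_all add: t B Ua.l_distr Ua.smult_mult_left)
    show "(\<lambda>a. sact (sact t a) (uu n)) \<in> linear_maps Ualg SA"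
      by (rule linear_mapsI) (simp_all add: t B)
    fix k
    have "sact t (uu k \<otimes>\<^bsub>Ualg\<^esub> uu n) = sg (m powi (- (k + n))) t"
      by (simp only: Ua.up_add[symmetric] sact_uu t)
    also have "m powi (- (k + n)) = m powi (- n) * m powi (- k)"
    proof -
      have "- (k + n) = - n + - k" by simp
      then show ?thesis by (simp only: power_int_add[OF disjI1[OF m_nz]])
    qed
    finally show "sact t (uu k \<otimes>\<^bsub>Ualg\<^esub> uu n) = sact (sact t (uu k)) (uu n)"
      by (simp only: sact_uu t sgD(1) sg_sg)
  qed
  show "sact t (a \<otimes>\<^bsub>Ualg\<^esub> b) = sact (sact t a) b"
    if t: "t \<in> carrier SA" and a: "a \<in> carrier Ualg" and b: "b \<in> carrier Ualg" for t a b
  proof (rule Ualg_linear_eq[OF S.cvec_axioms _ _ _ b])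
    show "(\<lambda>b. sact t (a \<otimes>\<^bsub>Ualg\<^esub> b)) \<in> linear_maps Ualg SA"
      by (rule linear_mapsI) (simp_all add: t a B Ua.r_distr Ua.smult_mult_right)
    show "sact (sact t a) \<in> linear_maps Ualg SA" by (intro lin2 B t a)
  qed (rule 1[OF t a])
  show "sact \<one>\<^bsub>SA\<^esub> a = Ualg_counit a \<odot>\<^bsub>SA\<^esub> \<one>\<^bsub>SA\<^esub>" if a: "a \<in> carrier Ualg" for a
  proof (rule Ualg_linear_eq[OF S.cvec_axioms _ _ _ a])
    show "sact \<one>\<^bsub>SA\<^esub> \<in> linear_maps Ualg SA" by (rule lin2) simp
    show "(\<lambda>a. Ualg_counit a \<odot>\<^bsub>SA\<^esub> \<one>\<^bsub>SA\<^esub>) \<in> linear_maps Ualg SA"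
      by (rule linear_mapsI)
        (simp_all add: linear_mapsD[OF Ualg_counit_linear] S.smult_add_left S.smult_smult)
  qed (simp add: sact_uu sgD)
  show "sact (s \<otimes>\<^bsub>SA\<^esub> t) a = tens_sum SA (\<lambda>b c. sact s b \<otimes>\<^bsub>SA\<^esub> sact t c) (Ualg_coprod a)"
    if s: "s \<in> carrier SA" and t: "t \<in> carrier SA" and a: "a \<in> carrier Ualg" for s t a
  proof -
    have bl: "bilin Ualg Ualg SA (\<lambda>b c. sact s b \<otimes>\<^bsub>SA\<^esub> sact t c)"
      by (rule bilinI)
        (simp_all add: s t B S.l_distr S.r_distr S.smult_mult_left S.smult_mult_right)
    show ?thesis
    proof (rule Ualg_linear_eq[OF S.cvec_axioms _ _ _ a])
      show "sact (s \<otimes>\<^bsub>SA\<^esub> t) \<in> linear_maps Ualg SA" by (rule lin2) (simp add: s t)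
      show "(\<lambda>a. tens_sum SA (\<lambda>b c. sact s b \<otimes>\<^bsub>SA\<^esub> sact t c) (Ualg_coprod a)) \<in> linear_maps Ualg SA"
        by (rule linear_maps_comp[OF Ualg_coprod_linear UU.tens_sum_linear[OF S.cvec_axioms bl]])
      show "sact (s \<otimes>\<^bsub>SA\<^esub> t) (uu n) = tens_sum SA (\<lambda>b c. sact s b \<otimes>\<^bsub>SA\<^esub> sact t c) (Ualg_coprod (uu n))" for n
        by (simp only: Ualg_coprod_uu UU.tens_sum_tens[OF S.cvec_axioms bl] Ua.up_closed sact_uu s t
            S.m_closed sgD)
    qed
  qed
  have "sact t Uu = sg (1 / m) t" if "t \<in> carrier SA" for t
    using sact_uu[OF that, of 1] by (simp add: Ua.up_1 power_int_minus inverse_eq_divide)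
  then show "sact X Uu = complex_of_real (1 / \<mu>) \<odot>\<^bsub>SA\<^esub> X" "sact Y Uu = complex_of_real (1 / \<mu>) \<odot>\<^bsub>SA\<^esub> Y"
    by simp_all
qed

text \<open>For uniqueness, let f satisfy the defining conditions. Since U is group-like,
  \<open>\<lambda>t. f t Uu\<close> is an algebra endomorphism and its values on \<open>X\<close>
  and \<open>Y\<close> identify it as \<open>sg (1 / m)\<close>. The action law makes the adjoint of
  U act as the inverse, then fixes all powers, and these span \<open>Ualg\<close>.\<close>

lemma S_act_eq: "S_act \<mu> = sact"
  unfolding S_act_def
proof (rule the_equality, intro conjI ballI)
  fix f
  assume f: "f \<in> carrier SA \<rightarrow>\<^sub>E (carrier Ualg \<rightarrow>\<^sub>E carrier SA)
     \<and> (\<forall>a\<in>carrier Ualg. (\<lambda>t. f t a) \<in> linear_maps SA SA)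
     \<and> (\<forall>t\<in>carrier SA. f t \<in> linear_maps Ualg SA)
     \<and> (\<forall>t\<in>carrier SA. f t \<one>\<^bsub>Ualg\<^esub> = t)
     \<and> (\<forall>t\<in>carrier SA. \<forall>a\<in>carrier Ualg. \<forall>b\<in>carrier Ualg. f t (a \<otimes>\<^bsub>Ualg\<^esub> b) = f (f t a) b)
     \<and> (\<forall>a\<in>carrier Ualg. f \<one>\<^bsub>SA\<^esub> a = Ualg_counit a \<odot>\<^bsub>SA\<^esub> \<one>\<^bsub>SA\<^esub>)
     \<and> (\<forall>s\<in>carrier SA. \<forall>t\<in>carrier SA. \<forall>a\<in>carrier Ualg.
          f (s \<otimes>\<^bsub>SA\<^esub> t) a = tens_sum SA (\<lambda>b c. f s b \<otimes>\<^bsub>SA\<^esub> f t c) (Ualg_coprod a))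
     \<and> f X Uu = complex_of_real (1 / \<mu>) \<odot>\<^bsub>SA\<^esub> X
     \<and> f Y Uu = complex_of_real (1 / \<mu>) \<odot>\<^bsub>SA\<^esub> Y"
  then have mem: "f \<in> carrier SA \<rightarrow>\<^sub>E (carrier Ualg \<rightarrow>\<^sub>E carrier SA)"
    and l1: "\<And>a. a \<in> carrier Ualg \<Longrightarrow> (\<lambda>t. f t a) \<in> linear_maps SA SA"
    and l2: "\<And>t. t \<in> carrier SA \<Longrightarrow> f t \<in> linear_maps Ualg SA"
    and one: "\<And>t. t \<in> carrier SA \<Longrightarrow> f t \<one>\<^bsub>Ualg\<^esub> = t"
    and act: "\<And>t a b. t \<in> carrier SA \<Longrightarrow> a \<in> carrier Ualg \<Longrightarrow> b \<in> carrier Ualg \<Longrightarrow> f t (a \<otimes>\<^bsub>Ualg\<^esub> b) = f (f t a) b"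
    and cou: "\<And>a. a \<in> carrier Ualg \<Longrightarrow> f \<one>\<^bsub>SA\<^esub> a = Ualg_counit a \<odot>\<^bsub>SA\<^esub> \<one>\<^bsub>SA\<^esub>"
    and cop: "\<And>s t a. s \<in> carrier SA \<Longrightarrow> t \<in> carrier SA \<Longrightarrow> a \<in> carrier Ualg \<Longrightarrow>
          f (s \<otimes>\<^bsub>SA\<^esub> t) a = tens_sum SA (\<lambda>b c. f s b \<otimes>\<^bsub>SA\<^esub> f t c) (Ualg_coprod a)"
    and XY: "f X Uu = complex_of_real (1 / \<mu>) \<odot>\<^bsub>SA\<^esub> X" "f Y Uu = complex_of_real (1 / \<mu>) \<odot>\<^bsub>SA\<^esub> Y"
    by simp_all
  have bf: "bilin SA Ualg SA f" using l1 l2 by (simp add: bilin_def)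
  note B = bilinD[OF bf]
  have U: "f t Uu = sg (1 / m) t" if t: "t \<in> carrier SA" for t
  proof (rule sg_unique[OF _ _ _ t])
    show "(\<lambda>t. f t Uu) \<in> alg_homs SA SA"
    proof (rule alg_homsI)
      show "f \<one>\<^bsub>SA\<^esub> Uu = \<one>\<^bsub>SA\<^esub>"
        using cou[of Uu] Ualg_counit_uu[of 1] by (simp add: Ua.up_1)
      fix s t assume st: "s \<in> carrier SA" "t \<in> carrier SA"
      have bl: "bilin Ualg Ualg SA (\<lambda>b c. f s b \<otimes>\<^bsub>SA\<^esub> f t c)"
        by (rule bilinI)
          (simp_all add: st B S.l_distr S.r_distr S.smult_mult_left S.smult_mult_right)
      show "f (s \<otimes>\<^bsub>SA\<^esub> t) Uu = f s Uu \<otimes>\<^bsub>SA\<^esub> f t Uu"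
        using cop[OF st, of Uu] UU.tens_sum_tens[OF S.cvec_axioms bl, of Uu Uu] Ualg_coprod_uu[of 1]
        by (simp add: Ua.up_1)
    qed (simp_all add: B)
  qed (use XY in simp_all)
  have V: "f t Uu_st = sg m t" if t: "t \<in> carrier SA" for t
  proof -
    have "sg (1 / m) (f t Uu_st) = t"
      using act[OF t, of Uu_st Uu] one[OF t] U[of "f t Uu_st"] B(1)[OF t] by (simp add: Ua.vu)
    then have "sg m (sg (1 / m) (f t Uu_st)) = sg m t" by simp
    then show ?thesis using t B(1)[OF t, of Uu_st] by (simp add: sg_sg sg_1)
  qed
  have n: "f t (uu n) = sg (m powi (- n)) t" if t: "t \<in> carrier SA" for t n
  proof (induction n rule: int_induct[where k = 0])
    case base
    then show ?case using one[OF t] t by (simp add: sg_1)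
  next
    case (step1 i)
    have "f t (uu (i + 1)) = f (f t (uu i)) Uu"
      using act[OF t, of "uu i" Uu] Ua.up_add[of i 1] by (simp add: Ua.up_1)
    also have "\<dots> = sg (1 / m) (sg (m powi (- i)) t)" by (simp only: step1 U sgD(1) t)
    finally show ?case by (simp only: sg_sg t powi_shift(1)[OF m_nz])
  next
    case (step2 i)
    have "f t (uu (i - 1)) = f (f t (uu i)) Uu_st"
      using act[OF t, of "uu i" Uu_st] Ua.up_add[of i "- 1"] by (simp add: Ua.up_m1)
    also have "\<dots> = sg m (sg (m powi (- i)) t)" by (simp only: step2 V sgD(1) t)
    finally show ?case by (simp only: sg_sg t powi_shift(2)[OF m_nz])
  qed
  have eq: "f t a = sact t a" if t: "t \<in> carrier SA" and a: "a \<in> carrier Ualg" for t a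
    by (rule Ualg_linear_eq[OF S.cvec_axioms l2[OF t] sact_props(2)[OF t] _ a]) (simp only: n[OF t] sact_uu[OF t])
  show "f = sact"
  proof (rule PiE_ext[OF mem sact_mem])
    fix t assume t: "t \<in> carrier SA"
    show "f t = sact t"
      by (rule PiE_ext[of "f t" "carrier Ualg" "\<lambda>_. carrier SA"])
        (use PiE_mem[OF mem t] PiE_mem[OF sact_mem t] eq[OF t] in auto)
  qed
qed (simp_all add: sact_mem sact_props del: of_real_divide)


subsection \<open>The affine quantum group\<close>

abbreviation "AA \<equiv> Aff \<mu>"
abbreviation "aX \<equiv> axi \<mu>"
abbreviation "aY \<equiv> axi_st \<mu>"

lemma calg_Aff: "calg AA"
  by (simp add: Aff_def calg_presented)

lemmas aff_defs = Aff_def aU_def aU_st_def axi_def axi_st_def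

sublocale A: inverse_pair AA "aU \<mu>" "aU_st \<mu>"
proof -
  interpret calg AA by (rule calg_Aff)
  show "inverse_pair AA (aU \<mu>) (aU_st \<mu>)"
  proof unfold_locales
    show "aU \<mu> \<otimes>\<^bsub>AA\<^esub> aU_st \<mu> = \<one>\<^bsub>AA\<^esub>" "aU_st \<mu> \<otimes>\<^bsub>AA\<^esub> aU \<mu> = \<one>\<^bsub>AA\<^esub>"
      by (auto simp: aff_defs cls_simps aff_rels_def intro!: cls_eqI star_closure_base(1))
  qed (simp_all add: aff_defs cls_simps)
qed

sublocale AS: s_pair AA \<mu> aX aY
proof unfold_locales
  show "aX \<otimes>\<^bsub>AA\<^esub> aY = m\<^sup>2 \<odot>\<^bsub>AA\<^esub> (aY \<otimes>\<^bsub>AA\<^esub> aX)"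
    by (auto simp: aff_defs cls_simps aff_rels_def mult.assoc intro!: cls_eqI star_closure_base(1))
qed (simp_all add: aff_defs cls_simps)

abbreviation "au \<equiv> A.up"

lemma aXU: "aX \<otimes>\<^bsub>AA\<^esub> aU \<mu> = (1 / m) \<odot>\<^bsub>AA\<^esub> (aU \<mu> \<otimes>\<^bsub>AA\<^esub> aX)"
  "aY \<otimes>\<^bsub>AA\<^esub> aU \<mu> = (1 / m) \<odot>\<^bsub>AA\<^esub> (aU \<mu> \<otimes>\<^bsub>AA\<^esub> aY)"
  by (auto simp: aff_defs cls_simps aff_rels_def mult.assoc intro!: cls_eqI star_closure_base(1))

text \<open>Multiplying the relation with U on both sides by its inverse gives the relation with the
  inverse; the integer powers follow by induction in both directions.\<close>

lemma inverse_comm: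
  assumes "z \<in> carrier AA" "z \<otimes>\<^bsub>AA\<^esub> aU \<mu> = (1 / m) \<odot>\<^bsub>AA\<^esub> (aU \<mu> \<otimes>\<^bsub>AA\<^esub> z)"
  shows "z \<otimes>\<^bsub>AA\<^esub> au n = m powi (- n) \<odot>\<^bsub>AA\<^esub> (au n \<otimes>\<^bsub>AA\<^esub> z)"
proof -
  have V: "z \<otimes>\<^bsub>AA\<^esub> aU_st \<mu> = m \<odot>\<^bsub>AA\<^esub> (aU_st \<mu> \<otimes>\<^bsub>AA\<^esub> z)"
  proof -
    have "m \<odot>\<^bsub>AA\<^esub> (aU_st \<mu> \<otimes>\<^bsub>AA\<^esub> (z \<otimes>\<^bsub>AA\<^esub> aU \<mu>) \<otimes>\<^bsub>AA\<^esub> aU_st \<mu>) = z \<otimes>\<^bsub>AA\<^esub> aU_st \<mu>"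
      unfolding assms(2) using assms(1)
      by (simp add: A.smult_mult_left A.smult_mult_right A.smult_smult A.m_assoc A.v_u_cancel)
    moreover have "m \<odot>\<^bsub>AA\<^esub> (aU_st \<mu> \<otimes>\<^bsub>AA\<^esub> (z \<otimes>\<^bsub>AA\<^esub> aU \<mu>) \<otimes>\<^bsub>AA\<^esub> aU_st \<mu>) = m \<odot>\<^bsub>AA\<^esub> (aU_st \<mu> \<otimes>\<^bsub>AA\<^esub> z)"
      using assms(1) by (simp add: A.m_assoc A.uv)
    ultimately show ?thesis by simp
  qed
  show ?thesis
  proof (induction n rule: int_induct[where k = 0])
    case (step1 i)
    have "z \<otimes>\<^bsub>AA\<^esub> au (i + 1) = (z \<otimes>\<^bsub>AA\<^esub> aU \<mu>) \<otimes>\<^bsub>AA\<^esub> au i"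
      using assms(1) by (simp only: A.u_up[symmetric] A.m_assoc A.up_closed A.u_closed)
    also have "\<dots> = (1 / m) \<odot>\<^bsub>AA\<^esub> (aU \<mu> \<otimes>\<^bsub>AA\<^esub> (z \<otimes>\<^bsub>AA\<^esub> au i))"
      using assms(1) by (simp only: assms(2) A.smult_mult_left A.m_assoc A.up_closed A.u_closed A.m_closed)
    also have "\<dots> = (1 / m * m powi (- i)) \<odot>\<^bsub>AA\<^esub> (au (i + 1) \<otimes>\<^bsub>AA\<^esub> z)"
      using assms(1) by (simp only: step1 A.smult_mult_right A.smult_smult A.up_closed A.u_closed A.m_closed
          A.m_assoc[symmetric] A.u_up)
    finally show ?case by (simp only: powi_shift(1)[OF m_nz])
  next
    case (step2 i)
    have "z \<otimes>\<^bsub>AA\<^esub> au (i - 1) = (z \<otimes>\<^bsub>AA\<^esub> aU_st \<mu>) \<otimes>\<^bsub>AA\<^esub> au i"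
      using assms(1) by (simp only: A.v_up[symmetric] A.m_assoc A.up_closed A.v_closed)
    also have "\<dots> = m \<odot>\<^bsub>AA\<^esub> (aU_st \<mu> \<otimes>\<^bsub>AA\<^esub> (z \<otimes>\<^bsub>AA\<^esub> au i))"
      using assms(1) by (simp only: V A.smult_mult_left A.m_assoc A.up_closed A.v_closed A.m_closed)
    also have "\<dots> = (m * m powi (- i)) \<odot>\<^bsub>AA\<^esub> (au (i - 1) \<otimes>\<^bsub>AA\<^esub> z)"
      using assms(1) by (simp only: step2 A.smult_mult_right A.smult_smult A.up_closed A.v_closed A.m_closed
          A.m_assoc[symmetric] A.v_up)
    finally show ?case by (simp only: powi_shift(2)[OF m_nz])
  qed (use assms in simp)
qed

lemmas aX_au = inverse_comm[OF AS.x_closed aXU(1)] and aY_au = inverse_comm[OF AS.y_closed aXU(2)]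

definition amon :: "int \<Rightarrow> nat \<Rightarrow> nat \<Rightarrow> aff_gen falg set" where
  "amon n p q = au n \<otimes>\<^bsub>AA\<^esub> ((aX [^]\<^bsub>AA\<^esub> p) \<otimes>\<^bsub>AA\<^esub> (aY [^]\<^bsub>AA\<^esub> q))"

lemma amon_closed [simp, intro]: "amon n p q \<in> carrier AA"
  by (simp add: amon_def)

lemma u_amon: "au k \<otimes>\<^bsub>AA\<^esub> amon n p q = amon (k + n) p q"
  by (simp add: amon_def A.m_assoc[symmetric] A.up_add)

lemma aX_amon0: "aX \<otimes>\<^bsub>AA\<^esub> amon n p q = m powi (- n) \<odot>\<^bsub>AA\<^esub> amon n (Suc p) q"
proof -
  have "aX \<otimes>\<^bsub>AA\<^esub> amon n p q = (aX \<otimes>\<^bsub>AA\<^esub> au n) \<otimes>\<^bsub>AA\<^esub> ((aX [^]\<^bsub>AA\<^esub> p) \<otimes>\<^bsub>AA\<^esub> (aY [^]\<^bsub>AA\<^esub> q))"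
    by (simp add: amon_def A.m_assoc)
  also have "\<dots> = m powi (- n) \<odot>\<^bsub>AA\<^esub> (au n \<otimes>\<^bsub>AA\<^esub> ((aX \<otimes>\<^bsub>AA\<^esub> aX [^]\<^bsub>AA\<^esub> p) \<otimes>\<^bsub>AA\<^esub> (aY [^]\<^bsub>AA\<^esub> q)))"
    by (simp add: aX_au A.smult_mult_left A.m_assoc)
  finally show ?thesis by (simp add: amon_def A.nat_pow_Suc2[symmetric] del: A.nat_pow_Suc)
qed

lemma aY_amon0: "aY \<otimes>\<^bsub>AA\<^esub> amon n p q = (m powi (- n) * (1 / m\<^sup>2) ^ p) \<odot>\<^bsub>AA\<^esub> amon n p (Suc q)"
proof -
  have "aY \<otimes>\<^bsub>AA\<^esub> amon n p q = (aY \<otimes>\<^bsub>AA\<^esub> au n) \<otimes>\<^bsub>AA\<^esub> ((aX [^]\<^bsub>AA\<^esub> p) \<otimes>\<^bsub>AA\<^esub> (aY [^]\<^bsub>AA\<^esub> q))"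
    by (simp add: amon_def A.m_assoc)
  also have "\<dots> = m powi (- n) \<odot>\<^bsub>AA\<^esub> (au n \<otimes>\<^bsub>AA\<^esub> ((aY \<otimes>\<^bsub>AA\<^esub> aX [^]\<^bsub>AA\<^esub> p) \<otimes>\<^bsub>AA\<^esub> (aY [^]\<^bsub>AA\<^esub> q)))"
    by (simp add: aY_au A.smult_mult_left A.m_assoc)
  also have "\<dots> = (m powi (- n) * (1 / m\<^sup>2) ^ p) \<odot>\<^bsub>AA\<^esub> (au n \<otimes>\<^bsub>AA\<^esub> ((aX [^]\<^bsub>AA\<^esub> p) \<otimes>\<^bsub>AA\<^esub> (aY \<otimes>\<^bsub>AA\<^esub> aY [^]\<^bsub>AA\<^esub> q)))"
    by (simp add: A.comm_pow[OF _ _ AS.yx] A.smult_mult_left A.smult_mult_right A.smult_smult A.m_assoc)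
  finally show ?thesis by (simp add: amon_def A.nat_pow_Suc2[symmetric] del: A.nat_pow_Suc)
qed

lemma amon_aX: "amon n p q \<otimes>\<^bsub>AA\<^esub> aX = (1 / m\<^sup>2) ^ q \<odot>\<^bsub>AA\<^esub> amon n (Suc p) q"
proof -
  have yx': "aY [^]\<^bsub>AA\<^esub> q \<otimes>\<^bsub>AA\<^esub> aX = (1 / m\<^sup>2) ^ q \<odot>\<^bsub>AA\<^esub> (aX \<otimes>\<^bsub>AA\<^esub> aY [^]\<^bsub>AA\<^esub> q)"
    using A.comm_pow[OF AS.y_closed AS.x_closed AS.xy, of q]
    by (simp add: A.smult_smult power_one_over)
  have "amon n p q \<otimes>\<^bsub>AA\<^esub> aX = au n \<otimes>\<^bsub>AA\<^esub> ((aX [^]\<^bsub>AA\<^esub> p) \<otimes>\<^bsub>AA\<^esub> (aY [^]\<^bsub>AA\<^esub> q \<otimes>\<^bsub>AA\<^esub> aX))"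
    by (simp add: amon_def A.m_assoc)
  also have "\<dots> = (1 / m\<^sup>2) ^ q \<odot>\<^bsub>AA\<^esub> (au n \<otimes>\<^bsub>AA\<^esub> ((aX [^]\<^bsub>AA\<^esub> p \<otimes>\<^bsub>AA\<^esub> aX) \<otimes>\<^bsub>AA\<^esub> aY [^]\<^bsub>AA\<^esub> q))"
    by (simp add: yx' A.smult_mult_right A.m_assoc)
  finally show ?thesis by (simp add: amon_def)
qed

lemma amon_aY: "amon n p q \<otimes>\<^bsub>AA\<^esub> aY = amon n p (Suc q)"
  by (simp add: amon_def A.m_assoc)

lemma au_amon: "amon n p q \<otimes>\<^bsub>AA\<^esub> au k = (m powi (- k)) ^ (p + q) \<odot>\<^bsub>AA\<^esub> amon (n + k) p q"
proof -
  have pw: "z [^]\<^bsub>AA\<^esub> (i::nat) \<otimes>\<^bsub>AA\<^esub> au k = (m powi (- k)) ^ i \<odot>\<^bsub>AA\<^esub> (au k \<otimes>\<^bsub>AA\<^esub> z [^]\<^bsub>AA\<^esub> i)"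
    if z: "z \<in> carrier AA" "z \<otimes>\<^bsub>AA\<^esub> au k = m powi (- k) \<odot>\<^bsub>AA\<^esub> (au k \<otimes>\<^bsub>AA\<^esub> z)" for z i
  proof (induction i)
    case (Suc i)
    have "z [^]\<^bsub>AA\<^esub> Suc i \<otimes>\<^bsub>AA\<^esub> au k = z [^]\<^bsub>AA\<^esub> i \<otimes>\<^bsub>AA\<^esub> (z \<otimes>\<^bsub>AA\<^esub> au k)" using z(1) by (simp add: A.m_assoc)
    also have "\<dots> = m powi (- k) \<odot>\<^bsub>AA\<^esub> ((z [^]\<^bsub>AA\<^esub> i \<otimes>\<^bsub>AA\<^esub> au k) \<otimes>\<^bsub>AA\<^esub> z)"
      unfolding z(2) using z(1) by (simp add: A.m_assoc A.smult_mult_right)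
    finally show ?case unfolding Suc using z(1) by (simp add: A.m_assoc A.smult_mult_left A.smult_smult)
  qed (use z in simp)
  have "amon n p q \<otimes>\<^bsub>AA\<^esub> au k = au n \<otimes>\<^bsub>AA\<^esub> (aX [^]\<^bsub>AA\<^esub> p \<otimes>\<^bsub>AA\<^esub> (aY [^]\<^bsub>AA\<^esub> q \<otimes>\<^bsub>AA\<^esub> au k))"
    by (simp add: amon_def A.m_assoc)
  also have "\<dots> = (m powi (- k)) ^ q \<odot>\<^bsub>AA\<^esub> (au n \<otimes>\<^bsub>AA\<^esub> ((aX [^]\<^bsub>AA\<^esub> p \<otimes>\<^bsub>AA\<^esub> au k) \<otimes>\<^bsub>AA\<^esub> aY [^]\<^bsub>AA\<^esub> q))"
    unfolding pw[OF AS.y_closed aY_au] by (simp add: A.m_assoc A.smult_mult_right)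
  also have "\<dots> = ((m powi (- k)) ^ q * (m powi (- k)) ^ p) \<odot>\<^bsub>AA\<^esub> (au n \<otimes>\<^bsub>AA\<^esub> (au k \<otimes>\<^bsub>AA\<^esub> (aX [^]\<^bsub>AA\<^esub> p \<otimes>\<^bsub>AA\<^esub> aY [^]\<^bsub>AA\<^esub> q)))"
    unfolding pw[OF AS.x_closed aX_au]
    by (simp add: A.m_assoc A.smult_mult_right A.smult_mult_left A.smult_smult)
  finally show ?thesis by (simp add: amon_def A.up_add A.m_assoc power_add mult.commute)
qed

lemma A_span: "carrier AA = lin_span AA (range (\<lambda>(n, p, q). amon n p q))" (is "_ = lin_span AA ?S")
proof -
  have sp: "?S \<subseteq> carrier AA" by auto
  have mem: "amon n p q \<in> ?S" for n p q by (rule range_eqI[of _ _ "(n, p, q)"]) simp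
  note base = A.lin_span_base[OF sp mem] A.lin_span_smult[OF sp A.lin_span_base[OF sp mem]]
  show ?thesis
    unfolding Aff_def
  proof (rule presented_span, unfold Aff_def[symmetric])
    show "?S \<subseteq> carrier AA" by (rule sp)
    show "\<one>\<^bsub>AA\<^esub> \<in> ?S" using mem[of 0 0 0] by (simp add: amon_def)
    fix l s assume "s \<in> ?S"
    then obtain n p q where s: "s = amon n p q" by auto
    show "cls (aff_rels \<mu>) (mon [l]) \<otimes>\<^bsub>AA\<^esub> s \<in> lin_span AA ?S"
    proof (cases l)
      case (Gen g)
      then show ?thesis
        using aX_amon0[of n p q] u_amon[of 1 n p q] base
        by (cases g) (simp_all add: s A.up_1 aU_def[symmetric] axi_def[symmetric])
    next
      case (Adj g)
      then show ?thesis
        using aY_amon0[of n p q] u_amon[of "-1" n p q] base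
        by (cases g) (simp_all add: s A.up_m1 aU_st_def[symmetric] axi_st_def[symmetric])
    qed
  qed
qed

lemma A_linear_eq:
  assumes "cvec N" "f \<in> linear_maps AA N" "g \<in> linear_maps AA N" "\<And>n p q. f (amon n p q) = g (amon n p q)"
    "a \<in> carrier AA"
  shows "f a = g a"
  by (rule linear_maps_eq_on_span[OF A.cvec_axioms assms(1-3) _ A_span assms(5)])
    (use assms(4) in auto)

definition aff_letter :: "aff_gen letter \<Rightarrow> complex" where
  "aff_letter l = (if l = Gen AffU \<or> l = Adj AffU then 1 else 0)"

lemma counit_presented: "presented_map complex_alg aff_letter (aff_rels \<mu>)"
proof -
  interpret calg complex_alg by (rule calg_complex)
  interpret letter_map complex_alg aff_letter by unfold_locales simp
  show ?thesis
    by unfold_locales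
      (auto simp: aff_rels_def fhom_simps star_simps aff_letter_def elim!: star_closureE)
qed

lemma Aff_counit_eq: "Aff_counit \<mu> = restrict (phom complex_alg aff_letter) (carrier AA)"
proof -
  interpret presented_map complex_alg aff_letter "aff_rels \<mu>" by (rule counit_presented)
  show ?thesis
    unfolding Aff_counit_def Aff_def
  proof (rule alg_ext_presented)
    let ?V = "{(aU \<mu>, 1), (aU_st \<mu>, 1), (axi \<mu>, 0), (axi_st \<mu>, 0 :: complex)}"
    show "cls (aff_rels \<mu>) (mon [l]) \<in> fst ` ?V" for l
    proof (cases l)
      case (Gen x) then show ?thesis by (cases x) (simp_all add: aU_def axi_def)
    next
      case (Adj x) then show ?thesis by (cases x) (simp_all add: aU_st_def axi_st_def)
    qed
    show "\<exists>l. a = cls (aff_rels \<mu>) (mon [l]) \<and> b = aff_letter l" if "(a, b) \<in> ?V" for a b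
      using that
      by (auto simp: aU_def aU_st_def axi_def axi_st_def aff_letter_def
          intro: exI[of _ "Gen AffU"] exI[of _ "Adj AffU"] exI[of _ "Gen AffXi"] exI[of _ "Adj AffXi"])
  qed
qed

lemma counit_hom: "Aff_counit \<mu> \<in> alg_homs AA complex_alg"
proof -
  interpret presented_map complex_alg aff_letter "aff_rels \<mu>" by (rule counit_presented)
  note D = alg_homsD[OF phom_hom, folded Aff_def]
  show ?thesis by (rule alg_homsI) (simp_all add: Aff_counit_eq D A.m_closed)
qed

lemmas counitD = alg_homsD[OF counit_hom, simplified]

lemma counit_gen [simp]: "Aff_counit \<mu> (aU \<mu>) = 1" "Aff_counit \<mu> (aU_st \<mu>) = 1"
  "Aff_counit \<mu> aX = 0" "Aff_counit \<mu> aY = 0"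
proof -
  interpret presented_map complex_alg aff_letter "aff_rels \<mu>" by (rule counit_presented)
  show "Aff_counit \<mu> (aU \<mu>) = 1" "Aff_counit \<mu> (aU_st \<mu>) = 1"
  "Aff_counit \<mu> aX = 0" "Aff_counit \<mu> aY = 0"
    by (simp_all add: Aff_counit_eq)
      (simp_all add: aU_def aU_st_def axi_def axi_st_def phom_cls fhom_letter aff_letter_def)
qed

lemma counit_amon: "Aff_counit \<mu> (amon n p q) = (if p = 0 \<and> q = 0 then 1 else 0)"
proof -
  interpret C: calg complex_alg by (rule calg_complex)
  have "inverse_pair complex_alg (Aff_counit \<mu> (aU \<mu>)) (Aff_counit \<mu> (aU_st \<mu>))"
    by unfold_locales simp_all
  from A.up_hom[OF counit_hom this] have "Aff_counit \<mu> (au n) = 1"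
    using complex_alg_upow[of 1 n] by simp
  moreover have "Aff_counit \<mu> (z [^]\<^bsub>AA\<^esub> k) = Aff_counit \<mu> z ^ k" if "z \<in> carrier AA" for z and k :: nat
    by (induction k) (use that in \<open>simp_all add: counitD\<close>)
  ultimately show ?thesis by (simp add: amon_def counitD power_0_left)
qed

lemma U_in_Aff_uu: "U_in_Aff \<mu> (uu n) = au n"
  by (simp add: U_in_Aff_def A.alg_ext_U A.uhom_uu)

lemma U_in_Aff_linear: "U_in_Aff \<mu> \<in> linear_maps Ualg AA"
  using alg_homsD[OF A.uhom_hom] by (auto simp: U_in_Aff_def A.alg_ext_U intro!: linear_mapsI)

lemma S_in_Aff_hom: "S_in_Aff \<mu> \<in> alg_homs SA AA"
proof -
  note D = alg_homsD[OF AS.shom_hom]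
  show ?thesis
    by (rule alg_homsI) (simp_all add: S_in_Aff_def AS.alg_ext_S D)
qed

lemma S_in_Aff_gen [simp]: "S_in_Aff \<mu> X = aX" "S_in_Aff \<mu> Y = aY"
  by (simp_all add: S_in_Aff_def AS.alg_ext_S)

lemma S_in_Aff_smon: "S_in_Aff \<mu> (smon (p, q)) = amon 0 p q"
proof -
  have "S_in_Aff \<mu> (z [^]\<^bsub>SA\<^esub> k) = S_in_Aff \<mu> z [^]\<^bsub>AA\<^esub> k" if "z \<in> carrier SA" for z and k :: nat
    by (induction k) (use that in \<open>simp_all add: alg_homsD[OF S_in_Aff_hom]\<close>)
  then show ?thesis by (simp add: smon_def amon_def alg_homsD[OF S_in_Aff_hom])
qed

sublocale SAT: tensor2 SA AA by unfold_locales

abbreviation "cX \<equiv> tens SA AA \<one>\<^bsub>SA\<^esub> aX \<oplus>\<^bsub>tensor_alg SA AA\<^esub> tens SA AA X (au 2)"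
abbreviation "cY \<equiv> tens SA AA \<one>\<^bsub>SA\<^esub> aY \<oplus>\<^bsub>tensor_alg SA AA\<^esub> tens SA AA Y (au (- 2))"

text \<open>Exchanging the factors produces \<mu>^2 in all four terms of the product: in the two
  extreme terms by the relation between \<xi> and its adjoint, in the two mixed terms by moving U^2
  or U^(-2) past one generator.\<close>

sublocale SC: s_pair "tensor_alg SA AA" \<mu> cX cY
proof unfold_locales
  have 1: "aX \<otimes>\<^bsub>AA\<^esub> au (- 2) = m\<^sup>2 \<odot>\<^bsub>AA\<^esub> (au (- 2) \<otimes>\<^bsub>AA\<^esub> aX)"
    using aX_au[of "-2"] by simp
  have 2: "au 2 \<otimes>\<^bsub>AA\<^esub> aY = m\<^sup>2 \<odot>\<^bsub>AA\<^esub> (aY \<otimes>\<^bsub>AA\<^esub> au 2)"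
    using aY_au[of 2] by (simp add: A.smult_smult power_int_minus)
  have 3: "au 2 \<otimes>\<^bsub>AA\<^esub> au (- 2) = \<one>\<^bsub>AA\<^esub>" "au (- 2) \<otimes>\<^bsub>AA\<^esub> au 2 = \<one>\<^bsub>AA\<^esub>"
    using A.up_add[of 2 "-2"] A.up_add[of "-2" 2] by simp_all
  note B = bilinD[OF SAT.bilin_tens]
  show "cX \<otimes>\<^bsub>tensor_alg SA AA\<^esub> cY = m\<^sup>2 \<odot>\<^bsub>tensor_alg SA AA\<^esub> (cY \<otimes>\<^bsub>tensor_alg SA AA\<^esub> cX)"
    by (simp add: SAT.TA.l_distr[simplified] SAT.TA.r_distr[simplified] SAT.TA_mult 1 2 3 AS.xy S.xy B
        SAT.T.smult_add_right SAT.T.a_ac)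
qed simp_all

lemma S_coprod_hom: "S_coprod \<mu> \<in> alg_homs SA (tensor_alg SA AA)"
  and S_coprod_gen: "S_coprod \<mu> X = cX" "S_coprod \<mu> Y = cY"
proof -
  have eq: "S_coprod \<mu> = restrict (shom (tensor_alg SA AA) cX cY) (carrier SA)"
    unfolding S_coprod_def A.up_2[symmetric] A.up_m2[symmetric] by (rule SC.alg_ext_S)
  note D = alg_homsD[OF SC.shom_hom]
  show "S_coprod \<mu> \<in> alg_homs SA (tensor_alg SA AA)"
    by (rule alg_homsI) (simp_all add: eq D[simplified] S.m_closed)
  show "S_coprod \<mu> X = cX" "S_coprod \<mu> Y = cY"
    unfolding eq by (simp_all only: restrict_apply' S.x_closed S.y_closed SC.shom_gen)
qed

end

section \<open>The differential on the free algebra\<close>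

lemma free_d_add: "free_d (f + g) = free_d f + free_d g"
  unfolding free_d_def
  by (rule setsum_keys_plus_distrib) (simp_all add: scal_add distrib_right)

lemma free_d_scal_mon: "free_d (scal c * mon xs) = scal c * word_d xs"
proof -
  have "scal c * mon xs = Poly_Mapping.single (Word xs) c" by (simp add: single_scal_mon)
  then show ?thesis by (cases "c = 0") (simp_all add: free_d_def)
qed

text \<open>The letters' part of the grading automorphism \<open>par\<close>, which is (-1)^k in
  degree k. With it the graded Leibniz rule holds without any homogeneity assumption.\<close>

definition par_letter :: "phi_gen letter \<Rightarrow> phi_gen falg" where
  "par_letter l = (-1) ^ letter_deg l * mon [l]"

definition par :: "phi_gen falg \<Rightarrow> phi_gen falg" where
  "par = fhom free_alg par_letter"

interpretation par: letter_map free_alg par_letter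
  by (intro letter_map.intro calg_free_alg letter_map_axioms.intro) simp

lemma par_simps:
  "par (f + g) = par f + par g" "par (f * g) = par f * par g" "par (- f) = - par f"
  "par (f - g) = par f - par g" "par (scal c) = scal c" "par 1 = 1" "par 0 = 0"
  "par (mon [l]) = (-1) ^ letter_deg l * mon [l]"
  unfolding par_def using par.fhom_simps[simplified] by (simp_all add: par_letter_def)

lemma word_d_append: "word_d (xs @ ys) = word_d xs * mon ys + par (mon xs) * word_d ys"
proof (induction xs)
  case (Cons x xs)
  then show ?case
    by (simp add: mon_Cons[of x "xs @ ys"] mon_Cons[of x xs] mon_mult[symmetric] par_simps algebra_simps)
qed (simp add: par_simps)

lemma free_d_scal_mult: "free_d (scal c * f) = scal c * free_d f"
proof (induction f rule: falg_induct)
  case (mon d xs)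
  have "free_d (scal c * (scal d * mon xs)) = free_d (scal (c * d) * mon xs)"
    by (simp add: mult.assoc[symmetric] scal_mult)
  then show ?case by (simp add: free_d_scal_mon mult.assoc[symmetric] scal_mult)
qed (simp add: distrib_left free_d_add)

lemma free_d_mon: "free_d (mon xs) = word_d xs"
  using free_d_scal_mon[of 1 xs] by simp

lemma free_d_mult: "free_d (f * g) = free_d f * g + par f * free_d g"
proof (induction f rule: falg_induct)
  case (mon c xs)
  have "free_d (mon xs * g) = free_d (mon xs) * g + par (mon xs) * free_d g"
  proof (induction g rule: falg_induct)
    case (mon d ys)
    have "free_d (mon xs * (scal d * mon ys)) = scal d * word_d (xs @ ys)"
      by (simp only: scal_left_commute[of "mon xs"] mon_mult free_d_scal_mon)
    then show ?case
      by (simp add: word_d_append free_d_mon free_d_scal_mon distrib_left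
          scal_left_commute[of "word_d xs"] scal_left_commute[of "par (mon xs)"])
  qed (simp add: distrib_left free_d_add)
  then have "free_d (scal c * (mon xs * g)) = scal c * (free_d (mon xs) * g + par (mon xs) * free_d g)"
    by (simp only: free_d_scal_mult)
  then show ?case
    by (simp add: mult.assoc par_simps free_d_scal_mult distrib_left)
qed (simp add: distrib_right free_d_add par_simps)

lemma free_d_scal: "free_d (scal c) = 0"
  using free_d_scal_mon[of c "[]"] by simp

lemma free_d_uminus: "free_d (- f) = - free_d f"
  using free_d_scal_mult[of "-1" f] by (simp add: scal_uminus)

lemma free_d_diff: "free_d (f - g) = free_d f - free_d g"
  using free_d_add[of f "- g"] by (simp add: free_d_uminus)

lemma free_d_letter: "free_d (mon [l]) = letter_d l"
  by (simp add: free_d_mon)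

lemma free_d_one: "free_d 1 = 0"
  using free_d_scal[of 1] by simp

lemma free_d_zero: "free_d 0 = 0"
  using free_d_scal[of 0] by simp

lemmas free_d_simps = free_d_add free_d_scal_mult free_d_mult free_d_scal free_d_uminus free_d_diff
  free_d_letter free_d_one free_d_zero

lemma letter_cases:
  "P (Gen Alpha) \<Longrightarrow> P (Gen Gamma) \<Longrightarrow> P (Adj Alpha) \<Longrightarrow> P (Adj Gamma)
    \<Longrightarrow> P (Gen DAlpha) \<Longrightarrow> P (Gen DGamma) \<Longrightarrow> P (Adj DAlpha) \<Longrightarrow> P (Adj DGamma) \<Longrightarrow> P l"
  by (cases l; metis phi_gen.exhaust)

lemma letter_d_d: "free_d (letter_d l) = 0"
  by (rule letter_cases[of _ l]) (simp_all add: free_d_simps)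

lemma par_letter_d: "par (letter_d l) = - ((-1) ^ letter_deg l * letter_d l)"
  by (rule letter_cases[of _ l]) (simp_all add: par_simps)

lemma neg_power_simps: "free_d ((-1) ^ k) = 0" "par ((-1) ^ k) = (-1) ^ k"
  by (cases "even k"; simp add: free_d_one free_d_uminus par_simps)+

lemma free_d_d: "free_d (free_d f) = 0"
proof (induction f rule: falg_induct)
  case (mon c xs)
  have "free_d (word_d xs) = 0"
  proof (induction xs)
    case (Cons x xs)
    show ?case
      by (simp add: free_d_add free_d_mult free_d_mon letter_d_d  free_d_letter
          par_letter_d par_simps Cons mult.assoc neg_power_simps)
  qed (simp add: free_d_zero)
  then show ?case by (simp add: free_d_scal_mult free_d_mon)
qed (simp add: free_d_add)

lemma par_free_d: "par (free_d f) = - free_d (par f)"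
proof (induction f rule: falg_induct)
  case (mon c xs)
  have "par (word_d xs) = - free_d (par (mon xs))"
  proof (induction xs)
    case (Cons x xs)
    show ?case
      by (simp add: mon_Cons[of x xs] par_simps free_d_mult  free_d_letter par_letter_d
 Cons mult.assoc neg_power_simps distrib_left)
  qed (simp add: par_simps free_d_one)
  then show ?case by (simp add: free_d_scal_mult free_d_mon par_simps)
qed (simp add: free_d_add par_simps)


section \<open>Quotients of the free algebra as a type\<close>

text \<open>One type containing every quotient of the free algebra: the product of the quotients by all
  ideals.  The quotient by a single ideal sits in it as a non-unital subalgebra, which makes
  type-based simplification available for computations modulo a parameter-dependent ideal.\<close>

lemma ideal_diff:
  fixes J :: "'g falg set"
  assumes "ideal J free_alg"
  shows "a - a' \<in> J \<Longrightarrow> b - b' \<in> J \<Longrightarrow> a + b - (a' + b') \<in> J"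
    "a - a' \<in> J \<Longrightarrow> b - b' \<in> J \<Longrightarrow> a - b - (a' - b') \<in> J"
    "a - a' \<in> J \<Longrightarrow> - a - - a' \<in> J"
    "a - a' \<in> J \<Longrightarrow> b - b' \<in> J \<Longrightarrow> a * b - a' * b' \<in> J"
    "a - a' \<in> J \<Longrightarrow> c * a - c * a' \<in> J"
proof -
  note I = ideal_free_simps[OF assms]
  show "a - a' \<in> J \<Longrightarrow> b - b' \<in> J \<Longrightarrow> a + b - (a' + b') \<in> J"
    using I(2)[of "a - a'" "b - b'"] by (simp add: algebra_simps)
  show "a - a' \<in> J \<Longrightarrow> b - b' \<in> J \<Longrightarrow> a - b - (a' - b') \<in> J"
    using I(3)[of "a - a'" "b - b'"] by (simp add: algebra_simps)
  show "a - a' \<in> J \<Longrightarrow> - a - - a' \<in> J"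
    using I(4)[of "a - a'"] by simp
  show "a - a' \<in> J \<Longrightarrow> b - b' \<in> J \<Longrightarrow> a * b - a' * b' \<in> J"
    using I(2)[OF I(6)[of "a - a'" b] I(5)[of "b - b'" a']] by (simp add: algebra_simps)
  show "a - a' \<in> J \<Longrightarrow> c * a - c * a' \<in> J"
    using I(5)[of "a - a'" c] by (simp add: algebra_simps)
qed

quotient_type phiq = "phi_gen falg set \<Rightarrow> phi_gen falg" /
  "\<lambda>f g. \<forall>J. ideal J free_alg \<longrightarrow> f J - g J \<in> J"
proof (rule equivpI)
  show "reflp (\<lambda>f g. \<forall>J. ideal J free_alg \<longrightarrow> f J - g J \<in> (J :: phi_gen falg set))"
    by (rule reflpI) (simp add: ideal_free_simps)
  show "symp (\<lambda>f g. \<forall>J. ideal J free_alg \<longrightarrow> f J - g J \<in> (J :: phi_gen falg set))"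
    by (rule sympI) (metis ideal_free_simps(4) minus_diff_eq)
  show "transp (\<lambda>f g. \<forall>J. ideal J free_alg \<longrightarrow> f J - g J \<in> (J :: phi_gen falg set))"
  proof (rule transpI, intro allI impI)
    fix f g h :: "phi_gen falg set \<Rightarrow> phi_gen falg" and J :: "phi_gen falg set"
    assume 1: "\<forall>J. ideal J free_alg \<longrightarrow> f J - g J \<in> J" "\<forall>J. ideal J free_alg \<longrightarrow> g J - h J \<in> J"
      and J: "ideal J free_alg"
    then have "(f J - g J) + (g J - h J) \<in> J" using ideal_free_simps(2)[OF J] by blast
    then show "f J - h J \<in> J" by simp
  qed
qed

text \<open>All structure constants are rational expressions in the real number \<mu>, so real
  scalars suffice. The class carries no unit because \<open>emb I 1\<close>, the unit of a single
  quotient, is only an idempotent of the whole type.\<close>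

instantiation phiq :: real_algebra
begin

lift_definition zero_phiq :: phiq is "\<lambda>_. 0" .

lift_definition plus_phiq :: "phiq \<Rightarrow> phiq \<Rightarrow> phiq" is "\<lambda>f g J. f J + g J"
  by (simp only: ideal_diff)

lift_definition uminus_phiq :: "phiq \<Rightarrow> phiq" is "\<lambda>f J. - f J"
  by (simp only: ideal_diff)

lift_definition minus_phiq :: "phiq \<Rightarrow> phiq \<Rightarrow> phiq" is "\<lambda>f g J. f J - g J"
  by (simp only: ideal_diff)

lift_definition times_phiq :: "phiq \<Rightarrow> phiq \<Rightarrow> phiq" is "\<lambda>f g J. f J * g J"
  by (simp only: ideal_diff)

lift_definition scaleR_phiq :: "real \<Rightarrow> phiq \<Rightarrow> phiq" is "\<lambda>r f J. rscal r * f J"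
  by (simp only: ideal_diff)

instance
proof
  fix x y z :: phiq and r s :: real
  show "x + y + z = x + (y + z)" by transfer (simp add: ideal_free_simps algebra_simps)
  show "x + y = y + x" by transfer (simp add: ideal_free_simps algebra_simps)
  show "0 + x = x" by transfer (simp add: ideal_free_simps)
  show "- x + x = 0" by transfer (simp add: ideal_free_simps)
  show "x - y = x + - y" by transfer (simp add: ideal_free_simps)
  show "r *\<^sub>R (x + y) = r *\<^sub>R x + r *\<^sub>R y" by transfer (simp add: ideal_free_simps algebra_simps)
  show "(r + s) *\<^sub>R x = r *\<^sub>R x + s *\<^sub>R x" by transfer (simp add: ideal_free_simps algebra_simps scal_add)
  show "r *\<^sub>R s *\<^sub>R x = (r * s) *\<^sub>R x"
    by transfer (simp add: ideal_free_simps scal_mult mult.assoc[symmetric])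
  show "1 *\<^sub>R x = x" by transfer (simp add: ideal_free_simps)
  show "x * y * z = x * (y * z)" by transfer (simp add: ideal_free_simps algebra_simps)
  show "(x + y) * z = x * z + y * z" by transfer (simp add: ideal_free_simps algebra_simps)
  show "x * (y + z) = x * y + x * z" by transfer (simp add: ideal_free_simps algebra_simps)
  show "r *\<^sub>R x * y = r *\<^sub>R (x * y)" by transfer (simp add: ideal_free_simps algebra_simps)
  show "x * r *\<^sub>R y = r *\<^sub>R (x * y)"
    by transfer (simp only: scal_left_commute diff_self, simp add: ideal_free_simps)
qed

end

definition emb :: "phi_gen falg set \<Rightarrow> phi_gen falg \<Rightarrow> phiq" where
  "emb I x = abs_phiq (\<lambda>J. if J = I then x else 0)"

lemma emb_simps:
  "emb I (x + y) = emb I x + emb I y" "emb I (x - y) = emb I x - emb I y" "emb I (- x) = - emb I x"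
  "emb I (x * y) = emb I x * emb I y" "emb I 0 = 0" "emb I (rscal r * x) = r *\<^sub>R emb I x"
  unfolding emb_def plus_phiq.abs_eq minus_phiq.abs_eq uminus_phiq.abs_eq times_phiq.abs_eq
    scaleR_phiq.abs_eq zero_phiq_def
  by (rule arg_cong[of _ _ abs_phiq]; auto simp: fun_eq_iff)+

lemma emb_eq_0_iff: "ideal I free_alg \<Longrightarrow> emb I x = 0 \<longleftrightarrow> x \<in> I"
  by (auto simp: emb_def zero_phiq_def phiq.abs_eq_iff ideal_free_simps)

section \<open>The quadratic relations between left-invariant forms\<close>

lemma vec_zeroI:
  assumes "\<And>f :: 'a::real_vector \<Rightarrow> real. linear f \<Longrightarrow> f x = 0"
  shows "x = 0"
proof (rule ccontr)
  assume "x \<noteq> 0"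
  then have "independent {x}" by simp
  then obtain g :: "'a \<Rightarrow> real" where "linear g" "\<forall>y\<in>{x}. g y = 1"
    using linear_independent_extend[of "{x}" "\<lambda>_. 1 :: real"] by auto
  then show False using assms[of g] by simp
qed

text \<open>Testing with linear functionals turns an identity between combinations of monomials into
  a scalar identity, in which the coefficients can be simplified by field arithmetic.\<close>

lemma vec_eqI:
  assumes "\<And>f :: 'a::real_vector \<Rightarrow> real. linear f \<Longrightarrow> f x = f y"
  shows "x = y"
  using vec_zeroI[of "x - y"] assms by (simp add: linear_diff)

lemmas linear_simps = linear_add linear_diff linear_scale linear_neg linear_0

lemma assoc_rule: "u * v = (w :: 'a::semigroup_mult) \<Longrightarrow> u * (v * x) = w * x"
  by (simp add: mult.assoc[symmetric])

lemmas expand_simps = mult.assoc distrib_left distrib_right left_diff_distrib right_diff_distrib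
  mult_scaleR_left mult_scaleR_right scaleR_right_distrib scaleR_right_diff_distrib

text \<open>The idempotent \<open>e\<close> stands for the unit. The relations are oriented as
  rewrite rules: \<open>g\<close> and \<open>g'\<close> move to the left of \<open>a\<close> and
  \<open>a'\<close>, and products of \<open>a\<close> with \<open>a'\<close> disappear, so that
  words acquire a normal form.\<close>

locale su2_rel =
  fixes \<mu> :: real and e a a' g g' :: "'q::real_algebra"
  assumes mu_nz: "\<mu> \<noteq> 0"
    and unit: "e * e = e" "e * a = a" "a * e = a" "e * a' = a'" "a' * e = a'"
      "e * g = g" "g * e = g" "e * g' = g'" "g' * e = g'"
    and su2: "a * a' = e - \<mu>\<^sup>2 *\<^sub>R (g * g')" "a' * a = e - g * g'" "a * g = \<mu> *\<^sub>R (g * a)"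
      "a * g' = \<mu> *\<^sub>R (g' * a)" "a' * g = (1 / \<mu>) *\<^sub>R (g * a')" "a' * g' = (1 / \<mu>) *\<^sub>R (g' * a')"
      "g' * g = g * g'"
begin

lemmas nfB = unit su2 unit[THEN assoc_rule] su2[THEN assoc_rule]

text \<open>Differentiating the bimodule relations of \<open>\<eta>\<^sub>\<plusminus>\<close> gives equations of the following shape in which
  \<open>B\<close> is a quadratic expression in \<open>\<eta>\<^sub>\<plusminus>\<close> and \<open>A\<close> involves \<open>\<eta>\<^sub>3\<close>; unitarity separates the two.\<close>

lemma cancel1:
  assumes "a * A = g' * B" "g * A = - ((1 / \<mu>) *\<^sub>R (a' * B))" "e * A = A" "e * B = B"
  shows "A = 0 \<and> B = 0"
proof -
  have "A = a' * (a * A) + g' * (g * A)"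
    using assms(3) by (simp add: nfB expand_simps)
  also have "\<dots> = 0" unfolding assms(1,2) by (simp add: nfB expand_simps)
  finally have A: "A = 0" .
  then have *: "g' * B = 0" "a' * B = 0" using assms(1,2) mu_nz by simp_all
  have "B = a * (a' * B) + \<mu>\<^sup>2 *\<^sub>R (g * (g' * B))"
    using assms(4) by (simp add: nfB expand_simps)
  then show ?thesis using A by (simp add: *)
qed

lemma cancel2:
  assumes "a' * A = g * B" "g' * A = - ((1 / \<mu>) *\<^sub>R (a * B))" "e * A = A" "e * B = B"
  shows "A = 0 \<and> B = 0"
proof -
  have "A = a * (a' * A) + \<mu>\<^sup>2 *\<^sub>R (g * (g' * A))"
    using assms(3) by (simp add: nfB expand_simps)
  also have "\<dots> = 0" unfolding assms(1,2) by (simp add: nfB expand_simps power2_eq_square mu_nz)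
  finally have A: "A = 0" .
  then have *: "g * B = 0" "a * B = 0" using assms(1,2) mu_nz by simp_all
  have "B = a' * (a * B) + g' * (g * B)"
    using assms(4) by (simp add: nfB expand_simps)
  then show ?thesis using A by (simp add: *)
qed

text \<open>A form acting on the left by \<open>\<theta> \<circ> \<alpha> = k \<theta>\<close>.\<close>

definition "form k t \<longleftrightarrow> e * t = t \<and> t * e = t \<and> t * a = k *\<^sub>R (a * t) \<and> t * a' = (1 / k) *\<^sub>R (a' * t)
  \<and> t * g = k *\<^sub>R (g * t) \<and> t * g' = (1 / k) *\<^sub>R (g' * t)"

lemma form_simps:
  assumes "form k t"
  shows "e * t = t" "t * e = t" "t * a = k *\<^sub>R (a * t)" "t * a' = (1 / k) *\<^sub>R (a' * t)"
    "t * g = k *\<^sub>R (g * t)" "t * g' = (1 / k) *\<^sub>R (g' * t)"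
  using assms by (auto simp: form_def)

end

text \<open>\<open>d_defs\<close> is the formula d(b) = b^(1) \<pi>(b^(2)) for the four generators,
  where \<pi> takes the value \<open>\<kappa> *\<^sub>R n3\<close> at \<alpha> and
  \<open>- (\<mu>\<^sup>2 * \<kappa>) *\<^sub>R n3\<close> at the adjoint of \<alpha>.\<close>

locale calculus_rel = su2_rel +
  fixes n3 np nm da da' dg dg' :: 'a and \<kappa> :: real
  assumes forms: "form (1 / \<mu>\<^sup>2) n3" "form (1 / \<mu>) np" "form (1 / \<mu>) nm"
    and d_defs: "da = \<kappa> *\<^sub>R (a * n3) - \<mu> *\<^sub>R (g' * np)" "dg = \<kappa> *\<^sub>R (g * n3) + a' * np"
      "dg' = a * nm - (\<mu>\<^sup>2 * \<kappa>) *\<^sub>R (g' * n3)" "da' = - (\<mu> *\<^sub>R (g * nm)) - (\<mu>\<^sup>2 * \<kappa>) *\<^sub>R (a' * n3)"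
begin

text \<open>The differential of the relation t b = k b t for a form t of degree one and a function
  b; the degree of t accounts for the minus sign in front of \<open>t * db\<close>.\<close>

definition "d_rel t dt k b db \<longleftrightarrow> dt * b - t * db - k *\<^sub>R (db * t + b * dt) = 0"

lemmas nf = nfB form_simps[OF forms(1)] form_simps[OF forms(2)] form_simps[OF forms(3)]
  form_simps[OF forms(1), THEN assoc_rule] form_simps[OF forms(2), THEN assoc_rule]
  form_simps[OF forms(3), THEN assoc_rule]

lemma np_squared:
  assumes dnp: "dnp = - (\<mu> *\<^sub>R (dg * da)) + da * dg"
    and r: "d_rel np dnp (1 / \<mu>) a da" "d_rel np dnp (1 / \<mu>) g dg"
  shows "np * np = 0"
proof -
  \<comment> \<open>Both are read off from the normal form of the differentiated relations: A
    gathers the terms containing \<open>n3\<close>, B those in \<open>np\<close> alone. The factor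
    \<open>1 + \<mu>\<^sup>2\<close> in B is nonzero for real \<mu>, so B = 0 gives the
    claim.\<close>
  define A where "A = \<kappa> *\<^sub>R ((1 / \<mu> ^ 3) *\<^sub>R (np * n3) + \<mu> *\<^sub>R (n3 * np))"
  define B where "B = (1 + \<mu>\<^sup>2) *\<^sub>R (np * np)"
  have "dnp * a - np * da - (1 / \<mu>) *\<^sub>R (da * np + a * dnp) = g' * B - a * A"
    unfolding dnp d_defs A_def B_def
    by (rule vec_eqI, simp add: nf expand_simps linear_simps)
      (simp add: field_simps power2_eq_square power3_eq_cube power4_eq_xxxx mu_nz)
  with r(1) have 1: "a * A = g' * B" by (simp add: d_rel_def)
  have "dnp * g - np * dg - (1 / \<mu>) *\<^sub>R (dg * np + g * dnp) = - (g * A) - (1 / \<mu>) *\<^sub>R (a' * B)"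
    unfolding dnp d_defs A_def B_def
    by (rule vec_eqI, simp add: nf expand_simps linear_simps)
      (simp add: field_simps power2_eq_square power3_eq_cube power4_eq_xxxx mu_nz)
  with r(2) have "- (g * A) = (1 / \<mu>) *\<^sub>R (a' * B)" by (simp add: d_rel_def)
  then have 2: "g * A = - ((1 / \<mu>) *\<^sub>R (a' * B))" by (metis minus_minus)
  have "e * A = A" "e * B = B" by (simp_all add: A_def B_def nf expand_simps)
  from cancel1[OF 1 2 this] have "B = 0" by simp
  then show ?thesis using mu_nz by (simp add: B_def add_nonneg_eq_0_iff)
qed

lemma np_nm:
  assumes dnm: "dnm = da' * dg' - (1 / \<mu>) *\<^sub>R (dg' * da')"
    and r: "d_rel nm dnm (1 / \<mu>) a da" "d_rel nm dnm (1 / \<mu>) g dg"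
  shows "np * nm = - (\<mu>\<^sup>2 *\<^sub>R (nm * np))"
proof -
  define A where "A = \<kappa> *\<^sub>R ((1 / \<mu> ^ 3) *\<^sub>R (n3 * nm) + \<mu> *\<^sub>R (nm * n3))"
  define B where "B = \<mu>\<^sup>2 *\<^sub>R (nm * np) + np * nm"
  have "dnm * a - nm * da - (1 / \<mu>) *\<^sub>R (da * nm + a * dnm) = g' * B - a * A"
    unfolding dnm d_defs A_def B_def
    by (rule vec_eqI, simp add: nf expand_simps linear_simps)
      (simp add: field_simps power2_eq_square power3_eq_cube power4_eq_xxxx mu_nz)
  with r(1) have 1: "a * A = g' * B" by (simp add: d_rel_def)
  have "dnm * g - nm * dg - (1 / \<mu>) *\<^sub>R (dg * nm + g * dnm) = - (g * A) - (1 / \<mu>) *\<^sub>R (a' * B)"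
    unfolding dnm d_defs A_def B_def
    by (rule vec_eqI, simp add: nf expand_simps linear_simps)
      (simp add: field_simps power2_eq_square power3_eq_cube power4_eq_xxxx mu_nz)
  with r(2) have "- (g * A) = (1 / \<mu>) *\<^sub>R (a' * B)" by (simp add: d_rel_def)
  then have 2: "g * A = - ((1 / \<mu>) *\<^sub>R (a' * B))" by (metis minus_minus)
  have "e * A = A" "e * B = B" by (simp_all add: A_def B_def nf expand_simps)
  from cancel1[OF 1 2 this] have "B = 0" by simp
  then show ?thesis by (simp add: B_def eq_neg_iff_add_eq_0 add.commute)
qed

text \<open>The relations of \<open>nm\<close> with \<alpha> and \<gamma> produce the mixed relation
  \<open>np_nm\<close>; those with the adjoints produce the square. Accordingly the weight is \<mu>
  instead of its inverse, and the other column of the unitary matrix is used in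
  \<open>cancel2\<close>.\<close>

lemma nm_squared:
  assumes dnm: "dnm = da' * dg' - (1 / \<mu>) *\<^sub>R (dg' * da')"
    and r: "d_rel nm dnm \<mu> a' da'" "d_rel nm dnm \<mu> g' dg'"
  shows "nm * nm = 0"
proof -
  define A where "A = - (\<kappa> *\<^sub>R (\<mu> *\<^sub>R (n3 * nm) + (\<mu> * \<mu>\<^sup>2 * \<mu>\<^sup>2) *\<^sub>R (nm * n3)))"
  define B where "B = (1 + \<mu>\<^sup>2) *\<^sub>R (nm * nm)"
  have "dnm * a' - nm * da' - \<mu> *\<^sub>R (da' * nm + a' * dnm) = g * B - a' * A"
    unfolding dnm d_defs A_def B_def
    by (rule vec_eqI, simp add: nf expand_simps linear_simps)
      (simp add: field_simps power2_eq_square power3_eq_cube power4_eq_xxxx mu_nz)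
  with r(1) have 1: "a' * A = g * B" by (simp add: d_rel_def)
  have "dnm * g' - nm * dg' - \<mu> *\<^sub>R (dg' * nm + g' * dnm) = - (g' * A) - (1 / \<mu>) *\<^sub>R (a * B)"
    unfolding dnm d_defs A_def B_def
    by (rule vec_eqI, simp add: nf expand_simps linear_simps)
      (simp add: field_simps power2_eq_square power3_eq_cube power4_eq_xxxx mu_nz)
  with r(2) have "- (g' * A) = (1 / \<mu>) *\<^sub>R (a * B)" by (simp add: d_rel_def)
  then have 2: "g' * A = - ((1 / \<mu>) *\<^sub>R (a * B))" by (metis minus_minus)
  have "e * A = A" "e * B = B" by (simp_all add: A_def B_def nf expand_simps)
  from cancel2[OF 1 2 this] have "B = 0" by simp
  then show ?thesis using mu_nz by (simp add: B_def add_nonneg_eq_0_iff)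
qed

end


section \<open>Killing the vertical form\<close>

lemma par_eta:
  "par (free_eta_plus \<mu>) = - free_eta_plus \<mu>" "par (free_eta_minus \<mu>) = - free_eta_minus \<mu>"
  "par (free_eta3 \<mu>) = - free_eta3 \<mu>"
  "par (star (free_eta_plus \<mu>)) = - star (free_eta_plus \<mu>)"
  "par (star (free_eta_minus \<mu>)) = - star (free_eta_minus \<mu>)"
  "par (star (free_eta3 \<mu>)) = - star (free_eta3 \<mu>)"
  by (simp_all add: free_eta_plus_def free_eta_minus_def free_eta3_def pi_fund_def fund_def
      star_simps free_d_simps par_simps left_diff_distrib right_diff_distrib)

text \<open>Any map h of the free algebra that kills \<open>eta3\<close> and replaces differentials
  by their horizontal parts annihilates all relations of the envelope. Stated abstractly because it
  is applied twice: to the operators that detect the volume form and to the substitution behind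
  \<open>hor_proj\<close>.\<close>

locale hor_hom = su2_rel \<mu> e a a' g g' for \<mu> :: real and e a a' g g' :: "'q::real_algebra" +
  fixes np nm :: 'q and h :: "phi_gen falg \<Rightarrow> 'q"
  assumes forms: "form (1 / \<mu>) np" "form (1 / \<mu>) nm"
    and quad: "np * np = 0" "nm * nm = 0" "np * nm = - (\<mu>\<^sup>2 *\<^sub>R (nm * np))"
    and h_alg: "h (x + y) = h x + h y" "h (x * y) = h x * h y" "h (rscal r) = r *\<^sub>R e" "h 1 = e"
    and h_letter: "h (gen Alpha) = a" "h (gen Gamma) = g" "h (adj Alpha) = a'" "h (adj Gamma) = g'"
      "h (gen DAlpha) = - (\<mu> *\<^sub>R (g' * np))" "h (gen DGamma) = a' * np"
      "h (adj DAlpha) = - (\<mu> *\<^sub>R (g * nm))" "h (adj DGamma) = a * nm"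
begin

lemmas nf = nfB form_simps[OF forms(1)] form_simps[OF forms(2)]
  form_simps[OF forms(1), THEN assoc_rule] form_simps[OF forms(2), THEN assoc_rule]
  quad quad[THEN assoc_rule]

lemma h_0: "h 0 = 0" using h_alg(1)[of 0 0] by simp

lemma h_uminus: "h (- x) = - h x" using h_alg(1)[of x "- x"] by (simp add: h_0 add_eq_0_iff2)

lemma h_diff: "h (x - y) = h x - h y" using h_alg(1)[of x "- y"] by (simp add: h_uminus)

lemmas h_simps = h_alg h_0 h_uminus h_diff h_letter

abbreviation "all_zero r \<equiv> h r = 0 \<and> h (star r) = 0 \<and> h (free_d r) = 0 \<and> h (free_d (star r)) = 0"

lemmas h_compute = star_simps free_d_simps par_simps h_simps nf expand_simps

lemma su2_zero: "r \<in> su2_rels \<mu> \<Longrightarrow> all_zero r"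
  unfolding su2_rels_def
  by (elim insertE emptyE)
    (simp_all add: h_compute mu_nz power2_eq_square del: of_real_power of_real_mult)

lemma h_eta:
  "h (free_eta_plus \<mu>) = np" "h (free_eta_minus \<mu>) = nm" "h (free_eta3 \<mu>) = 0"
  "h (star (free_eta_plus \<mu>)) = \<mu> *\<^sub>R nm" "h (star (free_eta_minus \<mu>)) = (1 / \<mu>) *\<^sub>R np" "h (star (free_eta3 \<mu>)) = 0"
  "h (free_d (free_eta_plus \<mu>)) = 0" "h (free_d (free_eta_minus \<mu>)) = 0"
  "h (free_d (star (free_eta_plus \<mu>))) = 0" "h (free_d (star (free_eta_minus \<mu>))) = 0"
  by (simp_all add: free_eta_plus_def free_eta_minus_def free_eta3_def pi_fund_def fund_def
     h_compute mu_nz power2_eq_square del: of_real_power of_real_mult of_real_divide)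

text \<open>The form \<open>eta3\<close> is killed but its differential is not; this is the source
  of the curvature. The bimodule relations of \<open>eta3\<close> nevertheless differentiate to zero
  because \<open>nm * np\<close> commutes with the functions with weight
  \<open>1 / \<mu>\<^sup>2\<close>, the same as that of \<open>eta3\<close>.\<close>

lemma h_deta3:
  "h (free_d (free_eta3 \<mu>)) = (\<mu> + \<mu> * \<mu> * \<mu>) *\<^sub>R (nm * np)"
  "h (free_d (star (free_eta3 \<mu>))) = - ((\<mu> + \<mu> * \<mu> * \<mu>) *\<^sub>R (nm * np))"
  by (simp_all add: free_eta3_def pi_fund_def fund_def h_compute mu_nz power2_eq_square
      scaleR_left_distrib del: of_real_power of_real_mult of_real_divide)

lemma h_last:
  "all_zero (pi_fund \<mu> 2 2 + rscal (\<mu>\<^sup>2) * pi_fund \<mu> 1 1)"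
  by (simp add: pi_fund_def fund_def h_compute mu_nz power2_eq_square
      del: of_real_power of_real_mult of_real_divide)

lemmas bimodule_simps = bimodule_rels_def fund_def inv_act_def h_compute h_eta h_deta3 par_eta
  mu_nz power2_eq_square

lemma bimodule_zero_plus: "r \<in> bimodule_rels \<mu> (free_eta_plus \<mu>) (1 / \<mu>) \<Longrightarrow> all_zero r"
  by (auto simp: bimodule_simps simp del: of_real_power of_real_mult of_real_divide)

lemma bimodule_zero_minus: "r \<in> bimodule_rels \<mu> (free_eta_minus \<mu>) (1 / \<mu>) \<Longrightarrow> all_zero r"
  by (auto simp: bimodule_simps simp del: of_real_power of_real_mult of_real_divide)

lemma bimodule_zero_3: "r \<in> bimodule_rels \<mu> (free_eta3 \<mu>) (1 / \<mu>\<^sup>2) \<Longrightarrow> all_zero r"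
  by (auto simp: bimodule_simps simp del: of_real_power of_real_mult of_real_divide)
    (simp_all add: field_simps mu_nz)

lemma h_phi_rels: "r \<in> phi_rels \<mu> \<Longrightarrow> h r = 0"
proof -
  have "all_zero r" if "r \<in> su2_rels \<mu> \<union> calculus_rels \<mu>" for r
    using that su2_zero bimodule_zero_plus bimodule_zero_minus bimodule_zero_3 h_last
    unfolding calculus_rels_def by blast
  then show "r \<in> phi_rels \<mu> \<Longrightarrow> h r = 0"
    by (auto simp: phi_rels_def Let_def star_closure_def)
qed

end

section \<open>The abstract relations hold in the differential envelope\<close>

lemma phi_rels_mem:
  "r \<in> su2_rels \<mu> \<union> calculus_rels \<mu> \<Longrightarrow> r \<in> phi_rels \<mu>"
  "r \<in> su2_rels \<mu> \<union> calculus_rels \<mu> \<Longrightarrow> star r \<in> phi_rels \<mu>"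
  "r \<in> su2_rels \<mu> \<union> calculus_rels \<mu> \<Longrightarrow> free_d r \<in> phi_rels \<mu>"
  by (auto simp: phi_rels_def star_closure_def Let_def)

lemma bimodule_rels_mem:
  "i \<in> {1, 2} \<Longrightarrow> j \<in> {1, 2} \<Longrightarrow>
    t * fund \<mu> i j - (\<Sum>l\<in>{1, 2}. fund \<mu> i l * (rscal (inv_act k l j) * t)) \<in> bimodule_rels \<mu> t k"
  by (auto simp: bimodule_rels_def)

locale phi_ideal = muq \<mu> for \<mu> +
  fixes J :: "phi_gen falg set"
  assumes J_ideal: "ideal J free_alg" and J_rels: "phi_rels \<mu> \<subseteq> J"
begin

abbreviation "h \<equiv> emb J"
abbreviation "e \<equiv> h 1"
abbreviation "a \<equiv> h (gen Alpha)"
abbreviation "a' \<equiv> h (adj Alpha)"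
abbreviation "g \<equiv> h (gen Gamma)"
abbreviation "g' \<equiv> h (adj Gamma)"

lemma h_scal: "h (rscal r) = r *\<^sub>R e"
  using emb_simps(6)[of J r 1] by simp

lemma h_rel: "r \<in> phi_rels \<mu> \<Longrightarrow> h r = 0"
  using emb_eq_0_iff[OF J_ideal] J_rels by blast

lemma h_unit: "e * h x = h x" "h x * e = h x"
  by (simp_all add: emb_simps(4)[symmetric])

lemma h_unit2: "e * (h x * y) = h x * y" "h x * (e * y) = h x * y"
  by (simp_all add: mult.assoc[symmetric] h_unit)

lemmas hs = emb_simps(1-5) h_scal h_unit h_unit2 mult.assoc

sublocale su2_rel \<mu> e a a' g g'
proof
  note R = phi_rels_mem(1)[OF UnI1, THEN h_rel] and S = phi_rels_mem(2)[OF UnI1, THEN h_rel]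
  have "h (gen Alpha * adj Alpha + rscal (\<mu>^2) * (gen Gamma * adj Gamma) - 1) = 0"
    "h (adj Alpha * gen Alpha + adj Gamma * gen Gamma - 1) = 0"
    "h (gen Alpha * gen Gamma - rscal \<mu> * (gen Gamma * gen Alpha)) = 0"
    "h (gen Alpha * adj Gamma - rscal \<mu> * (adj Gamma * gen Alpha)) = 0"
    "h (gen Gamma * adj Gamma - adj Gamma * gen Gamma) = 0"
    by (rule R, simp add: su2_rels_def)+
  note r = this[simplified hs mult_scaleR_left]
  have "h (star (gen Alpha * gen Gamma - rscal \<mu> * (gen Gamma * gen Alpha))) = 0"
    "h (star (gen Alpha * adj Gamma - rscal \<mu> * (adj Gamma * gen Alpha))) = 0"
    by (rule S, simp add: su2_rels_def)+
  note s = this[simplified star_simps hs mult_scaleR_right letter_star.simps complex_cnj_complex_of_real]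
  show "g' * g = g * g'" using r(5) by simp
  then show "a * a' = e - \<mu>\<^sup>2 *\<^sub>R (g * g')" "a' * a = e - g * g'" using r(1,2) by (simp_all add: algebra_simps)
  show "a * g = \<mu> *\<^sub>R (g * a)" "a * g' = \<mu> *\<^sub>R (g' * a)" using r(3,4) by simp_all
  show "a' * g = (1 / \<mu>) *\<^sub>R (g * a')" "a' * g' = (1 / \<mu>) *\<^sub>R (g' * a')"
    using s by (simp_all add: hs)
qed (simp_all add: h_unit)

lemma form_eta:
  assumes "bimodule_rels \<mu> t k \<subseteq> calculus_rels \<mu>" "k \<noteq> 0"
  shows "form k (h t)"
proof -
  have "h r = 0" if "r \<in> bimodule_rels \<mu> t k" for r
    using that assms(1) phi_rels_mem(1)[THEN h_rel] by blast
  from this[OF bimodule_rels_mem] have *: "h (t * fund \<mu> i j - (\<Sum>l\<in>{1, 2}. fund \<mu> i l * (rscal (inv_act k l j) * t))) = 0"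
    if "i \<in> {1, 2}" "j \<in> {1, 2}" for i j using that by blast
  have "\<mu> *\<^sub>R (h t * g' - (1 / k) *\<^sub>R (g' * h t)) = 0"
    using *[of 1 2] assms(2)
    by (simp add: fund_def inv_act_def hs mult_scaleR_left mult_scaleR_right h_unit scaleR_right_diff_distrib
        del: of_real_power of_real_mult of_real_divide)
  then have "h t * g' = (1 / k) *\<^sub>R (g' * h t)" by simp
  then show ?thesis
    using *[of 1 1] *[of 2 1] *[of 2 2] assms(2)
    by (simp add: form_def fund_def inv_act_def hs mult_scaleR_left mult_scaleR_right h_unit
        del: of_real_power of_real_mult of_real_divide)
qed

abbreviation "n3 \<equiv> h (free_eta3 \<mu>)"
abbreviation "np \<equiv> h (free_eta_plus \<mu>)"
abbreviation "nm \<equiv> h (free_eta_minus \<mu>)"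
abbreviation "da \<equiv> h (gen DAlpha)"
abbreviation "dg \<equiv> h (gen DGamma)"
abbreviation "da' \<equiv> h (adj DAlpha)"
abbreviation "dg' \<equiv> h (adj DGamma)"

lemma pi_values:
  "h (pi_fund \<mu> 1 1) = a' * da + g' * dg"
  "h (pi_fund \<mu> 2 2) = \<mu>\<^sup>2 *\<^sub>R (g * dg') + a * da'"
  "np = - (\<mu> *\<^sub>R (g * da)) + a * dg"
  "nm = a' * dg' - (1 / \<mu>) *\<^sub>R (g' * da')"
  by (simp_all add: pi_fund_def free_eta_plus_def free_eta_minus_def fund_def star_simps free_d_simps
      par_simps hs power2_eq_square expand_simps del: of_real_power of_real_mult of_real_divide)

text \<open>The last relation of the calculus, \<pi>(u_22) = -\<mu>^2 \<pi>(u_11), turns the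
  definition of \<eta>_3 into \<eta>_3 = (1 + \<mu>^2) \<pi>(\<alpha>). Hence \<pi>(\<alpha>) =
  \<kappa> \<eta>_3.\<close>

definition "\<kappa> = 1 / (1 + \<mu>\<^sup>2)"

lemma eta3_pi: "\<kappa> *\<^sub>R n3 = h (pi_fund \<mu> 1 1)" "(\<mu>\<^sup>2 * \<kappa>) *\<^sub>R n3 = - h (pi_fund \<mu> 2 2)"
proof -
  have "h (pi_fund \<mu> 2 2 + rscal (\<mu>\<^sup>2) * pi_fund \<mu> 1 1) = 0"
    by (rule phi_rels_mem(1)[THEN h_rel]) (simp add: calculus_rels_def)
  then have p: "h (pi_fund \<mu> 2 2) = - (\<mu>\<^sup>2 *\<^sub>R h (pi_fund \<mu> 1 1))"
    by (simp add: hs eq_neg_iff_add_eq_0 del: of_real_power)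
  have k: "1 + \<mu>\<^sup>2 \<noteq> 0" by (simp add: add_nonneg_eq_0_iff)
  have "n3 = (1 + \<mu>\<^sup>2) *\<^sub>R h (pi_fund \<mu> 1 1)"
    by (simp add: free_eta3_def hs p scaleR_left_distrib)
  then show "\<kappa> *\<^sub>R n3 = h (pi_fund \<mu> 1 1)" "(\<mu>\<^sup>2 * \<kappa>) *\<^sub>R n3 = - h (pi_fund \<mu> 2 2)"
    using k by (simp_all add: \<kappa>_def p)
qed

sublocale calculus_rel \<mu> e a a' g g' n3 np nm da da' dg dg' \<kappa>
proof
  show f: "form (1 / \<mu>\<^sup>2) n3" "form (1 / \<mu>) np" "form (1 / \<mu>) nm"
    by (rule form_eta; auto simp: calculus_rels_def)+
  note nb = nfB nfB[simplified mult.assoc] h_unit2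
  have "\<kappa> *\<^sub>R (a * n3) = a * h (pi_fund \<mu> 1 1)" by (simp only: eta3_pi(1)[symmetric] mult_scaleR_right)
  then show "da = \<kappa> *\<^sub>R (a * n3) - \<mu> *\<^sub>R (g' * np)"
    by (simp add: pi_values pi_values(1)[unfolded One_nat_def] nfB expand_simps h_unit power2_eq_square)
  have "\<kappa> *\<^sub>R (g * n3) = g * h (pi_fund \<mu> 1 1)" by (simp only: eta3_pi(1)[symmetric] mult_scaleR_right)
  then show "dg = \<kappa> *\<^sub>R (g * n3) + a' * np"
    by (simp add: pi_values pi_values(1)[unfolded One_nat_def] nfB expand_simps h_unit mu_nz)
  have "(\<mu>\<^sup>2 * \<kappa>) *\<^sub>R (g' * n3) = - (g' * h (pi_fund \<mu> 2 2))"
    by (simp only: mult_minus_right[symmetric] eta3_pi(2)[symmetric] mult_scaleR_right)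
  then show "dg' = a * nm - (\<mu>\<^sup>2 * \<kappa>) *\<^sub>R (g' * n3)"
    by (simp add: pi_values pi_values(1)[unfolded One_nat_def] nfB expand_simps h_unit mu_nz)
  have "(\<mu>\<^sup>2 * \<kappa>) *\<^sub>R (a' * n3) = - (a' * h (pi_fund \<mu> 2 2))"
    by (simp only: mult_minus_right[symmetric] eta3_pi(2)[symmetric] mult_scaleR_right)
  then show "da' = - (\<mu> *\<^sub>R (g * nm)) - (\<mu>\<^sup>2 * \<kappa>) *\<^sub>R (a' * n3)"
    by (simp add: pi_values pi_values(1)[unfolded One_nat_def] nfB expand_simps h_unit mu_nz power2_eq_square)
qed

lemma d_rel_bimodule:
  assumes "bimodule_rels \<mu> t k \<subseteq> calculus_rels \<mu>" "par t = - t" "k \<noteq> 0"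
  shows "d_rel (h t) (h (free_d t)) k a da" "d_rel (h t) (h (free_d t)) k g dg"
    "d_rel (h t) (h (free_d t)) (1 / k) a' da'" "d_rel (h t) (h (free_d t)) (1 / k) g' dg'"
proof -
  have "h (free_d r) = 0" if "r \<in> bimodule_rels \<mu> t k" for r
    using that assms(1) phi_rels_mem(3)[THEN h_rel] by blast
  from this[OF bimodule_rels_mem] have *: "h (free_d (t * fund \<mu> i j - (\<Sum>l\<in>{1, 2}. fund \<mu> i l * (rscal (inv_act k l j) * t)))) = 0"
    if "i \<in> {1, 2}" "j \<in> {1, 2}" for i j using that by blast
  show "d_rel (h t) (h (free_d t)) k a da" "d_rel (h t) (h (free_d t)) k g dg"
    "d_rel (h t) (h (free_d t)) (1 / k) a' da'"
    using *[of 1 1] *[of 2 1] *[of 2 2] assms(3)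
    by (simp_all add: d_rel_def fund_def inv_act_def hs free_d_simps par_simps assms(2) h_unit expand_simps
        del: of_real_power of_real_mult of_real_divide)
  have "\<mu> *\<^sub>R (h (free_d t) * g' - h t * dg' - (1 / k) *\<^sub>R (dg' * h t + g' * h (free_d t))) = 0"
    using *[of 1 2] assms(3)
    by (simp add: fund_def inv_act_def hs free_d_simps par_simps assms(2) h_unit expand_simps algebra_simps
        del: of_real_power of_real_mult of_real_divide)
  then show "d_rel (h t) (h (free_d t)) (1 / k) g' dg'"
    by (simp add: d_rel_def)
qed

lemma quad: "np * np = 0" "nm * nm = 0" "np * nm = - (\<mu>\<^sup>2 *\<^sub>R (nm * np))"
proof -
  have cp: "bimodule_rels \<mu> (free_eta_plus \<mu>) (1 / \<mu>) \<subseteq> calculus_rels \<mu>"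
    "bimodule_rels \<mu> (free_eta_minus \<mu>) (1 / \<mu>) \<subseteq> calculus_rels \<mu>"
    by (auto simp: calculus_rels_def)
  have mu: "1 / \<mu> \<noteq> 0" by simp
  note P = d_rel_bimodule[OF cp(1) par_eta(1) mu] and N = d_rel_bimodule[OF cp(2) par_eta(2) mu, simplified]
  have dnp: "h (free_d (free_eta_plus \<mu>)) = - (\<mu> *\<^sub>R (dg * da)) + da * dg"
    by (simp add: free_eta_plus_def pi_fund_def fund_def star_simps free_d_simps par_simps hs expand_simps)
  have dnm: "h (free_d (free_eta_minus \<mu>)) = da' * dg' - (1 / \<mu>) *\<^sub>R (dg' * da')"
    by (simp add: free_eta_minus_def pi_fund_def fund_def star_simps free_d_simps par_simps hs expand_simps
        del: of_real_power of_real_mult of_real_divide)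
  show "np * np = 0" by (rule np_squared[OF dnp P(1,2)])
  show "np * nm = - (\<mu>\<^sup>2 *\<^sub>R (nm * np))"
    by (rule np_nm[OF dnm]) (use N in simp_all)
  show "nm * nm = 0"
    by (rule nm_squared[OF dnm]) (use N in simp_all)
qed

end

section \<open>A representation detecting the volume form\<close>

context muq begin

text \<open>In the basis \<open>1, \<eta>\<^sub>-, \<eta>\<^sub>+, \<eta>\<^sub>-\<eta>\<^sub>+\<close> of the exterior algebra, \<open>\<alpha>\<close> acts diagonally with the weights
  below, \<open>\<gamma>\<close> and \<open>\<eta>\<^sub>3\<close> by zero and \<open>\<eta>\<^sub>\<plusminus>\<close> by left multiplication (\<open>op_p\<close>, \<open>op_m\<close>).\<close>

definition wt :: "nat \<Rightarrow> complex" where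
  "wt i = (if i = 3 then m\<^sup>2 else if i = 1 \<or> i = 2 then m else 1)"

lemma wt_nz [simp]: "wt i \<noteq> 0" by (simp add: wt_def)

definition op_a :: "(nat \<Rightarrow> complex) \<Rightarrow> nat \<Rightarrow> complex" where "op_a v = (\<lambda>i. wt i * v i)"
definition op_a' :: "(nat \<Rightarrow> complex) \<Rightarrow> nat \<Rightarrow> complex" where "op_a' v = (\<lambda>i. v i / wt i)"
definition op_p :: "(nat \<Rightarrow> complex) \<Rightarrow> nat \<Rightarrow> complex" where
  "op_p v = (\<lambda>i. if i = 2 then v 0 else if i = 3 then - (m\<^sup>2 * v 1) else 0)"
definition op_m :: "(nat \<Rightarrow> complex) \<Rightarrow> nat \<Rightarrow> complex" where
  "op_m v = (\<lambda>i. if i = 1 then v 0 else if i = 3 then v 2 else 0)"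

text \<open>With \<gamma>, its adjoint and \<eta>_3 acting by zero, the formulas for the
  differentials leave only \<open>DGamma\<close> as \<alpha>^* \<eta>_+ and its adjoint letter as
  \<alpha> \<eta>_-; both letters for the differential of \<alpha> act by zero.\<close>

definition rep_letter :: "phi_gen letter \<Rightarrow> (nat \<Rightarrow> complex) \<Rightarrow> nat \<Rightarrow> complex" where
  "rep_letter l = (if l = Gen Alpha then op_a else if l = Adj Alpha then op_a'
     else if l = Gen DGamma then op_a' \<circ> op_p else if l = Adj DGamma then op_a \<circ> op_m
     else (\<lambda>_ _. 0))"

abbreviation "EN \<equiv> end_alg (fun_vec :: (complex, nat \<Rightarrow> complex) module)"

lemmas op_defs = op_a_def op_a'_def op_p_def op_m_def

sublocale EN: letter_map EN rep_letter
proof -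
  interpret F: cvec "fun_vec :: (complex, nat \<Rightarrow> complex) module" by (rule cvec_fun_vec)
  show "letter_map EN rep_letter"
  proof (intro letter_map.intro F.calg_end letter_map_axioms.intro)
    show "rep_letter l \<in> carrier EN" for l :: "phi_gen letter"
      by (auto simp: end_alg_def linear_maps_def rep_letter_def op_defs fun_eq_iff field_simps)
  qed
qed

abbreviation "rp \<equiv> fhom EN rep_letter"

lemma rp_apply:
  "rp (x * y) v = rp x (rp y v)" "rp (x + y) v = (\<lambda>i. rp x v i + rp y v i)" "rp 1 v = v" "rp 0 v = (\<lambda>_. 0)"
  "rp (scal c) v = (\<lambda>i. c * v i)" "rp (mon [l]) v = rep_letter l v" "rp (- x) v = (\<lambda>i. - rp x v i)"
  "rp (x - y) v = (\<lambda>i. rp x v i - rp y v i)"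
proof -
  interpret F: cvec "fun_vec :: (complex, nat \<Rightarrow> complex) module" by (rule cvec_fun_vec)
  have mul: "rp (x * y) v = rp x (rp y v)" for x y v by (simp add: EN.fhom_mult)
  have sc: "rp (scal c) v = (\<lambda>i. c * v i)" for c v by (simp add: EN.fhom_scalar)
  have add: "rp (x + y) v = (\<lambda>i. rp x v i + rp y v i)" for x y v by (simp add: EN.fhom_add)
  have "rp (- 1) v = (\<lambda>i. - v i)" for v
    using sc[of "-1" v] by (simp add: scal_uminus)
  then have um: "rp (- x) v = (\<lambda>i. - rp x v i)" for x v
    using mul[of "- 1" x v] by simp
  show "rp (x * y) v = rp x (rp y v)" "rp (x + y) v = (\<lambda>i. rp x v i + rp y v i)" "rp 1 v = v" "rp 0 v = (\<lambda>_. 0)"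
  "rp (scal c) v = (\<lambda>i. c * v i)" "rp (mon [l]) v = rep_letter l v" "rp (- x) v = (\<lambda>i. - rp x v i)"
  "rp (x - y) v = (\<lambda>i. rp x v i - rp y v i)"
    using add[of x "- y" v] by (simp_all add: mul add sc um EN.fhom_one EN.fhom_zero EN.fhom_letter)
qed

definition "KN = {f. rp f = \<zero>\<^bsub>EN\<^esub>}"

lemma KN_ideal: "ideal KN free_alg"
  unfolding KN_def by (rule EN.fhom_kernel)

lemma emb_KN_eq: "(\<And>v. rp x v = rp y v) \<Longrightarrow> emb KN x = emb KN y"
proof -
  assume "\<And>v. rp x v = rp y v"
  then have "rp (x - y) v = \<zero>\<^bsub>EN\<^esub> v" for v
    by (simp add: rp_apply cvec.end_alg_apply[OF cvec_fun_vec])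
  then have "x - y \<in> KN" by (auto simp: KN_def fun_eq_iff)
  then show ?thesis using emb_eq_0_iff[OF KN_ideal, of "x - y"] by (simp add: emb_simps)
qed

lemma emb_rscal: "emb J (rscal r) = r *\<^sub>R emb J 1"
  using emb_simps(6)[of J r 1] by simp

lemma emb_unit: "emb J 1 * emb J x = emb J x" "emb J x * emb J 1 = emb J x"
  by (simp_all add: emb_simps(4)[symmetric])

text \<open>The relations need not be multiplied out on vectors: the quotient by the kernel of the
  representation is an instance of \<open>hor_hom\<close> with \<gamma> = 0, and only the few
  hypotheses of that locale are checked on operators.\<close>

lemma KN_rels: "phi_rels \<mu> \<subseteq> KN"
proof
  let ?h = "emb KN"
  let ?np = "?h (gen Alpha * gen DGamma)" and ?nm = "?h (adj Alpha * adj DGamma)"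
  note rs = rp_apply rep_letter_def op_defs fun_eq_iff
  have z: "?h (gen Gamma) = 0" "?h (adj Gamma) = 0" "?h (gen DAlpha) = 0" "?h (adj DAlpha) = 0"
    using emb_KN_eq[of _ 0] by (simp_all add: emb_simps rs)
  have inv: "?h (gen Alpha) * ?h (adj Alpha) = ?h 1" "?h (adj Alpha) * ?h (gen Alpha) = ?h 1"
    unfolding emb_simps(4)[symmetric] by (rule emb_KN_eq; simp add: rs)+
  interpret su2_rel \<mu> "?h 1" "?h (gen Alpha)" "?h (adj Alpha)" "?h (gen Gamma)" "?h (adj Gamma)"
    by unfold_locales (simp_all add: emb_unit z inv)
  have sc: "r *\<^sub>R ?h x = ?h (rscal r * x)" for r x by (rule emb_simps(6)[symmetric])
  have F: "?np * ?h (gen Alpha) = (1 / \<mu>) *\<^sub>R (?h (gen Alpha) * ?np)"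
    "?np * ?h (adj Alpha) = (1 / (1 / \<mu>)) *\<^sub>R (?h (adj Alpha) * ?np)"
    "?nm * ?h (gen Alpha) = (1 / \<mu>) *\<^sub>R (?h (gen Alpha) * ?nm)"
    "?nm * ?h (adj Alpha) = (1 / (1 / \<mu>)) *\<^sub>R (?h (adj Alpha) * ?nm)"
    unfolding sc emb_simps(4)[symmetric]
    by (rule emb_KN_eq; simp add: rs wt_def field_simps power2_eq_square)+
  interpret hor_hom \<mu> "?h 1" "?h (gen Alpha)" "?h (adj Alpha)" "?h (gen Gamma)" "?h (adj Gamma)" ?np ?nm ?h
  proof
    show "form (1 / \<mu>) ?np" "form (1 / \<mu>) ?nm"
      unfolding form_def by (simp_all only: F emb_unit) (simp_all add: z)
    show "?np * ?np = 0" "?nm * ?nm = 0"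
      unfolding emb_simps(4)[symmetric] emb_simps(5)[of KN, symmetric] by (rule emb_KN_eq; simp add: rs)+
    show "?np * ?nm = - (\<mu>\<^sup>2 *\<^sub>R (?nm * ?np))"
      unfolding emb_simps(4)[symmetric] sc emb_simps(3)[symmetric] by (rule emb_KN_eq; simp add: rs)
    show "?h (gen DGamma) = ?h (adj Alpha) * ?np" "?h (adj DGamma) = ?h (gen Alpha) * ?nm"
      unfolding emb_simps(4)[symmetric] by (rule emb_KN_eq; simp add: rs)+
  qed (simp_all add: emb_simps(1-5) emb_rscal z)
  fix r assume "r \<in> phi_rels \<mu>"
  from h_phi_rels[OF this] show "r \<in> KN" using emb_eq_0_iff[OF KN_ideal] by simp
qed

sublocale RP: presented_map EN rep_letter "phi_rels \<mu>"
  by unfold_locales (use KN_rels in \<open>auto simp: KN_def\<close>)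

text \<open>A matrix coefficient: the component along \<eta>_- \<eta>_+, index 3, of the operator
  applied to the basis vector 1, index 0.\<close>

definition vol :: "phi_gen falg set \<Rightarrow> complex" where
  "vol x = phom EN rep_letter x (\<lambda>i. if i = 0 then 1 else 0) 3"

lemma vol_linear: "vol \<in> linear_maps (Phi \<mu>) complex_alg"
  unfolding Phi_def
  by (rule linear_mapsI)
    (simp_all add: vol_def alg_homsD[OF RP.phom_hom] cvec.end_alg_apply[OF cvec_fun_vec])

lemma vol_eta: "vol (cls (phi_rels \<mu>) (free_eta_minus \<mu> * free_eta_plus \<mu>)) = 1"
  by (simp add: vol_def RP.phom_cls rp_apply free_eta_minus_def free_eta_plus_def pi_fund_def fund_def
      star_simps free_d_simps par_simps rep_letter_def op_defs wt_def field_simps power2_eq_square)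

end


section \<open>Horizontal forms\<close>

context muq begin

abbreviation "PI \<equiv> rel_ideal (phi_rels \<mu>)"

sublocale PH: phi_ideal \<mu> PI
  by (intro phi_ideal.intro muq_axioms phi_ideal_axioms.intro rel_ideal_ideal)
    (auto intro: rel_ideal_base)

abbreviation "PP \<equiv> Phi \<mu>"
abbreviation "HH \<equiv> hor \<mu>"
abbreviation "hgens \<equiv> {al \<mu>, al_st \<mu>, ga \<mu>, ga_st \<mu>, eta_plus \<mu>, eta_minus \<mu>}"
abbreviation "ph \<equiv> cls (phi_rels \<mu>)"

lemma ph_eq_iff: "ph x = ph y \<longleftrightarrow> emb PI x = emb PI y"
  using emb_eq_0_iff[OF rel_ideal_ideal, of "phi_rels \<mu>" "x - y"] by (simp add: cls_eq_iff emb_simps)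

sublocale PP: calg PP
  by (simp add: Phi_def calg_presented)

lemmas ph_simps = cls_simps[of "phi_rels \<mu>", folded Phi_def] cls_minus[of "phi_rels \<mu>", folded Phi_def]

lemmas hgen_defs = al_def al_st_def ga_def ga_st_def eta_plus_def eta_minus_def

lemma hgens_sub: "hgens \<subseteq> carrier PP"
  by (simp add: hgen_defs ph_simps)

lemma hor_simps [simp]:
  "carrier HH = subalg_gen PP hgens" "add HH = add PP" "mult HH = mult PP" "zero HH = zero PP"
  "one HH = one PP" "module.smult HH = module.smult PP"
  by (simp_all add: hor_def)

lemma HH_sub: "subalg_gen PP hgens \<subseteq> carrier PP"
  by (rule subalg_gen_closed[OF PP.calg_axioms hgens_sub])

lemmas HH_mem = subsetD[OF HH_sub]

end

lemma presented_gen_letters: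
  assumes "\<And>l. cls R (mon [l]) \<in> subalg_gen (presented R) S"
  shows "carrier (presented R) \<subseteq> subalg_gen (presented R) S"
proof
  fix X assume "X \<in> carrier (presented R)"
  then show "X \<in> subalg_gen (presented R) S"
    by (induction rule: presented_induct) (use assms in \<open>auto intro: subalg_gen.intros(2-)\<close>)
qed

lemma calg_subalg:
  assumes "calg M" "S \<subseteq> carrier M"
  shows "calg (M\<lparr>carrier := subalg_gen M S\<rparr>)" (is "calg ?N")
proof -
  interpret calg M by fact
  note sub = subsetD[OF subalg_gen_closed[OF assms]] and cl = subalg_gen.intros(2-)[where M = M and S = S]
  have zero: "\<zero>\<^bsub>M\<^esub> \<in> subalg_gen M S" using cl(4)[OF cl(1), of 0] by simp
  have inv: "\<exists>y\<in>subalg_gen M S. y \<oplus>\<^bsub>M\<^esub> x = \<zero>\<^bsub>M\<^esub>" if "x \<in> subalg_gen M S" for x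
    using cl(4)[OF that, of "-1"] sub[OF that] by (intro bexI[of _ "(-1) \<odot>\<^bsub>M\<^esub> x"]) (simp_all add: smult_minus_one l_neg)
  interpret N: abelian_group ?N
    by (rule abelian_groupI) (use inv in \<open>simp_all add: cl zero sub a_ac\<close>)
  interpret N: ring ?N
    by (rule ringI[OF N.abelian_group_axioms]; (rule monoidI)?) (simp_all add: cl sub m_assoc l_distr r_distr)
  show ?thesis
    by unfold_locales
      (simp_all add: cl sub smult_add_left smult_add_right smult_smult smult_mult_left smult_mult_right)
qed

context muq begin

sublocale HH: calg HH
  unfolding hor_def by (rule calg_subalg[OF PP.calg_axioms hgens_sub])

text \<open>The projection annihilating \<open>\<eta>\<^sub>3\<close> replaces the differentials of the generators by their
  horizontal parts.\<close>

definition sub_letter :: "phi_gen letter \<Rightarrow> phi_gen falg" where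
  "sub_letter l = (if l = Gen DAlpha then - (rscal \<mu> * (adj Gamma * free_eta_plus \<mu>))
     else if l = Gen DGamma then adj Alpha * free_eta_plus \<mu>
     else if l = Adj DAlpha then - (rscal \<mu> * (gen Gamma * free_eta_minus \<mu>))
     else if l = Adj DGamma then gen Alpha * free_eta_minus \<mu> else mon [l])"

sublocale SB: letter_map free_alg sub_letter
  by (intro letter_map.intro calg_free_alg letter_map_axioms.intro) simp

abbreviation "sb \<equiv> fhom free_alg sub_letter"

lemmas sb_simps = SB.fhom_simps[simplified]

text \<open>With h the substitution followed by the quotient map, \<open>h_phi_rels\<close> says
  that the substitution carries relations into the relation ideal, so it descends to
  \<open>Phi\<close>.\<close>

sublocale HM: hor_hom \<mu> PH.e PH.a PH.a' PH.g PH.g' PH.np PH.nm "\<lambda>f. emb PI (sb f)"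
  by unfold_locales
    (simp_all add: PH.forms PH.quad sb_simps PH.hs SB.fhom_letter sub_letter_def)

lemma sb_eta: "ph (sb (free_eta_plus \<mu>)) = eta_plus \<mu>" "ph (sb (free_eta_minus \<mu>)) = eta_minus \<mu>"
  "ph (sb (free_eta3 \<mu>)) = \<zero>\<^bsub>PP\<^esub>"
  by (simp_all add: eta_plus_def eta_minus_def ph_simps ph_eq_iff HM.h_eta emb_simps)

definition hl :: "phi_gen letter \<Rightarrow> phi_gen falg set" where "hl l = ph (sub_letter l)"

lemma hgens_mem: "ph (gen Alpha) \<in> carrier HH" "ph (adj Alpha) \<in> carrier HH" "ph (gen Gamma) \<in> carrier HH"
  "ph (adj Gamma) \<in> carrier HH" "ph (free_eta_plus \<mu>) \<in> carrier HH" "ph (free_eta_minus \<mu>) \<in> carrier HH"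
  by (auto simp: hgen_defs[symmetric] intro: subalg_gen.gen)

lemma hl_closed: "hl l \<in> carrier HH"
proof -
  have mul: "ph (x * y) \<in> carrier HH" if "ph x \<in> carrier HH" "ph y \<in> carrier HH" for x y
    using HH.m_closed[OF that] by (simp add: ph_simps)
  have neg: "ph (- (scal c * x)) \<in> carrier HH" if "ph x \<in> carrier HH" for x c
    using HH.smult_closed[OF that, of "- c"] by (simp add: ph_simps scal_uminus)
  show ?thesis
    by (rule letter_cases[of _ l]; simp add: hl_def sub_letter_def del: hor_simps; intro mul neg hgens_mem)
qed

sublocale HL: letter_map HH hl
  by unfold_locales (rule hl_closed)

lemma sb_mem: "ph (sb f) \<in> carrier HH"
proof (induction f rule: falg_induct)
  case (add f g)
  then show ?case using HH.add.m_closed[OF add] by (simp add: SB.fhom_add[simplified] ph_simps)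
next
  case (mon c xs)
  have "ph (sb (mon xs)) \<in> carrier HH"
  proof (induction xs)
    case Nil
    then show ?case using HH.one_closed by (simp add: SB.fhom_one[simplified] ph_simps)
  next
    case (Cons x xs)
    then show ?case using HH.m_closed[OF hl_closed Cons, of x]
      by (simp add: mon_Cons[of x xs] SB.fhom_mult[simplified] SB.fhom_letter hl_def ph_simps)
  qed
  from HH.smult_closed[OF this, of c] show ?case
    by (simp add: SB.fhom_scal[simplified] ph_simps)
qed

lemma fhom_hl: "fhom HH hl f = ph (sb f)"
proof (rule HL.fhom_unique[symmetric])
  show "(\<lambda>f. ph (sb f)) \<in> alg_homs free_alg HH"
    by (rule alg_homsI, rule sb_mem) (simp_all add: sb_simps SB.fhom_scal[simplified] ph_simps)
qed (simp add: SB.fhom_letter hl_def)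

sublocale HL: presented_map HH hl "phi_rels \<mu>"
proof unfold_locales
  fix r assume "r \<in> phi_rels \<mu>"
  from HM.h_phi_rels[OF this] show "fhom HH hl r = \<zero>\<^bsub>HH\<^esub>"
    by (simp add: fhom_hl ph_simps ph_eq_iff emb_simps)
qed

abbreviation "hp \<equiv> phom HH hl"

lemma hp_cls: "hp (ph f) = ph (sb f)"
  by (simp add: HL.phom_cls fhom_hl)

lemma hp_hom: "hp \<in> alg_homs PP HH"
  unfolding Phi_def by (rule HL.phom_hom)

text \<open>The substitution fixes the letters of functions, and it fixes \<eta>_+ and \<eta>_-
  modulo the relations; these are the generators of the horizontal forms.\<close>

lemma hp_id:
  assumes "x \<in> carrier HH" shows "hp x = x"
proof (rule alg_homs_eq_on_gen[OF PP.calg_axioms hgens_sub, of hp PP "\<lambda>x. x"])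
  show "hp \<in> alg_homs PP PP"
    using alg_homsD[OF hp_hom] HH_mem by (intro alg_homsI) simp_all
  show "(\<lambda>x. x) \<in> alg_homs PP PP" by (rule alg_homsI) simp_all
  show "x \<in> subalg_gen PP hgens" using assms by simp
  show "hp y = y" if "y \<in> hgens" for y
    using that
    by (auto simp: sb_eta[unfolded eta_plus_def eta_minus_def] hgen_defs hp_cls SB.fhom_letter sub_letter_def)
qed

text \<open>Existence is \<open>hp_hom\<close>. Uniqueness holds because horizontal forms and
  \<open>eta3\<close> generate \<open>Phi\<close>: the equations D below express each differential
  of a generator through them.\<close>

lemma hor_proj_eq: "hor_proj \<mu> = restrict hp (carrier PP)"
  unfolding hor_proj_def
proof (rule alg_ext_eq[OF PP.calg_axioms hp_hom])
  let ?V = "insert (eta3 \<mu>, \<zero>\<^bsub>HH\<^esub>) {(x, x) | x. x \<in> carrier HH}"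
  show "x \<in> carrier PP \<and> hp x = y" if "(x, y) \<in> ?V" for x y
    using that hp_id HH_mem by (auto simp: eta3_def hp_cls sb_eta ph_simps)
  have V: "fst ` ?V = insert (eta3 \<mu>) (carrier HH)" by force
  let ?G = "subalg_gen PP (insert (eta3 \<mu>) (carrier HH))"
  note cl = subalg_gen.intros[where M = PP and S = "insert (eta3 \<mu>) (carrier HH)"]
  have mem: "ph x \<in> ?G" if "ph x \<in> carrier HH" for x using that cl(1) by blast
  have n3: "ph (free_eta3 \<mu>) \<in> ?G" using cl(1)[of "eta3 \<mu>"] by (simp add: eta3_def)
  have mul: "ph (x * y) \<in> ?G" if "ph x \<in> ?G" "ph y \<in> ?G" for x y
    using cl(4)[OF that] by (simp add: ph_simps)
  have add: "ph (x + y) \<in> ?G" if "ph x \<in> ?G" "ph y \<in> ?G" for x y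
    using cl(3)[OF that] by (simp add: ph_simps)
  have sm: "ph (scal c * x) \<in> ?G" if "ph x \<in> ?G" for x c
    using cl(5)[OF that, of c] by (simp add: ph_simps)
  note G = mem[OF hgens_mem(1)] mem[OF hgens_mem(2)] mem[OF hgens_mem(3)] mem[OF hgens_mem(4)]
    mem[OF hgens_mem(5)] mem[OF hgens_mem(6)] n3
  have D: "ph (gen DAlpha) = ph (rscal PH.\<kappa> * (gen Alpha * free_eta3 \<mu>) + rscal (- \<mu>) * (adj Gamma * free_eta_plus \<mu>))"
    "ph (gen DGamma) = ph (rscal PH.\<kappa> * (gen Gamma * free_eta3 \<mu>) + adj Alpha * free_eta_plus \<mu>)"
    "ph (adj DGamma) = ph (gen Alpha * free_eta_minus \<mu> + rscal (- (\<mu>\<^sup>2 * PH.\<kappa>)) * (adj Gamma * free_eta3 \<mu>))"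
    "ph (adj DAlpha) = ph (rscal (- \<mu>) * (gen Gamma * free_eta_minus \<mu>) + rscal (- (\<mu>\<^sup>2 * PH.\<kappa>)) * (adj Alpha * free_eta3 \<mu>))"
    unfolding ph_eq_iff
    by (subst PH.d_defs, simp add: emb_simps(1-5) emb_rscal emb_unit PH.h_unit2 del: of_real_mult of_real_power of_real_minus of_real_divide)+
  have "ph (mon [l]) \<in> ?G" for l
    by (rule letter_cases[of _ l]; (unfold D)?; intro add mul sm G)
  then show "carrier PP \<subseteq> subalg_gen PP (fst ` ?V)"
    unfolding V unfolding Phi_def by (rule presented_gen_letters)
qed


subsection \<open>The differential and the projected differential\<close>

text \<open>The differential descends to \<open>Phi\<close>. Leibniz applied to a product r x of a
  relation r leaves a term with \<open>par r\<close>, so the ideal ?J has to be stable under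
  \<open>par\<close> as well. Every relation is even or odd, so \<open>par\<close> only changes its
  sign, and the differentials among the relations are closed.\<close>

lemma free_d_ideal: "x \<in> PI \<Longrightarrow> free_d x \<in> PI"
proof -
  note I = ideal_free_simps[OF rel_ideal_ideal[of "phi_rels \<mu>"]]
  let ?J = "{x. x \<in> PI \<and> free_d x \<in> PI \<and> par x \<in> PI}"
  have id: "ideal ?J free_alg"
    by (rule free_idealI) (auto simp: free_d_simps par_simps intro: I)
  have par_su2: "par r = r" if "r \<in> su2_rels \<mu>" for r
    using that unfolding su2_rels_def by (elim insertE emptyE) (simp_all add: par_simps)
  have par_bi: "par r = - r" if r: "r \<in> bimodule_rels \<mu> t k" and t: "par t = - t" for r t k
  proof -
    obtain i j where "r = t * fund \<mu> i j - (\<Sum>l\<in>{1, 2}. fund \<mu> i l * (rscal (inv_act k l j) * t))"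
      using r by (auto simp: bimodule_rels_def)
    moreover have "par (fund \<mu> i j) = fund \<mu> i j" for i j by (simp add: fund_def par_simps)
    ultimately show ?thesis by (simp add: par_simps t)
  qed
  have "par (pi_fund \<mu> i j) = - pi_fund \<mu> i j" for i j
    by (simp add: pi_fund_def fund_def star_simps free_d_simps par_simps)
  then have par_last: "par (pi_fund \<mu> 2 2 + rscal (\<mu>\<^sup>2) * pi_fund \<mu> 1 1) = - (pi_fund \<mu> 2 2 + rscal (\<mu>\<^sup>2) * pi_fund \<mu> 1 1)"
    by (simp add: par_simps)
  have par0: "par r = r \<or> par r = - r" if "r \<in> su2_rels \<mu> \<union> calculus_rels \<mu>" for r
    using that par_su2 par_bi par_eta(1-3) par_last unfolding calculus_rels_def by blast
  have par_star: "par (star r) = star (par r)" for r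
  proof (induction r rule: falg_induct)
    case (mon c xs)
    have "par (star (mon xs)) = star (par (mon xs))"
    proof (induction xs)
      case (Cons x xs)
      have "par (mon [letter_star x]) = star (par (mon [x]))"
        by (rule letter_cases[of _ x]) (simp_all add: par_simps star_simps)
      then show ?case by (simp only: mon_Cons[of x xs] star_mult par_simps star_letter Cons)
    qed (simp add: star_one par_simps)
    then show ?case by (simp only: star_mult par_simps star_scal)
  qed (simp add: star_add par_simps)
  have "phi_rels \<mu> \<subseteq> ?J"
  proof
    fix r assume r: "r \<in> phi_rels \<mu>"
    then have rI: "r \<in> PI" by (rule rel_ideal_base)
    let ?R = "star_closure (su2_rels \<mu> \<union> calculus_rels \<mu>)"
    have parR: "par r = r \<or> par r = - r" if r: "r \<in> ?R" for r
    proof (cases "r \<in> su2_rels \<mu> \<union> calculus_rels \<mu>")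
      case False
      then obtain x where x: "x \<in> su2_rels \<mu> \<union> calculus_rels \<mu>" "r = star x"
        using r False unfolding star_closure_def by blast
      from par0[OF x(1)] have "star (par x) = star x \<or> star (par x) = - star x" by (auto simp: star_uminus)
      then show ?thesis by (simp only: x par_star)
    qed (rule par0)
    have "r \<in> ?R \<or> (\<exists>s\<in>?R. r = free_d s)" using r by (auto simp: phi_rels_def Let_def)
    then have "free_d r \<in> PI \<and> (par r = r \<or> par r = - r)"
    proof
      assume "r \<in> ?R"
      then show ?thesis using parR rel_ideal_base[of "free_d r" "phi_rels \<mu>"] by (auto simp: phi_rels_def Let_def)
    next
      assume "\<exists>s\<in>?R. r = free_d s"
      then show ?thesis
        using parR ideal_free_simps(1)[OF rel_ideal_ideal] by (force simp: free_d_d par_free_d free_d_uminus)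
    qed
    then show "r \<in> ?J" using rI ideal_free_simps(4)[OF rel_ideal_ideal] by auto
  qed
  from rel_ideal_least[OF id this] show "x \<in> PI \<Longrightarrow> free_d x \<in> PI" by blast
qed

lemma Phi_d_cls: "Phi_d \<mu> (ph f) = ph (free_d f)"
proof -
  have "ph (free_d x) = ph (free_d f)" if "x \<in> ph f" for x
    using that free_d_ideal[of "x - f"] by (simp add: cls_mem_iff cls_eq_iff free_d_simps)
  moreover have "f \<in> ph f" by (simp add: cls_mem_iff)
  ultimately have "(\<lambda>x. ph (free_d x)) ` ph f = {ph (free_d f)}"
    by (intro image_constant_eq[of f])
  then show ?thesis by (simp add: Phi_d_def)
qed

lemma hor_nabla_cls: "hor_nabla \<mu> (ph f) = ph (sb (free_d f))"
  by (simp add: hor_nabla_def Phi_d_cls hor_proj_eq hp_cls ph_simps)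

lemma hor_nabla_gens:
  "hor_nabla \<mu> (al \<mu>) = (- m) \<odot>\<^bsub>HH\<^esub> (ga_st \<mu> \<otimes>\<^bsub>HH\<^esub> eta_plus \<mu>)"
  "hor_nabla \<mu> (ga \<mu>) = al_st \<mu> \<otimes>\<^bsub>HH\<^esub> eta_plus \<mu>"
  "hor_nabla \<mu> (al_st \<mu>) = (- m) \<odot>\<^bsub>HH\<^esub> (ga \<mu> \<otimes>\<^bsub>HH\<^esub> eta_minus \<mu>)"
  "hor_nabla \<mu> (ga_st \<mu>) = al \<mu> \<otimes>\<^bsub>HH\<^esub> eta_minus \<mu>"
  "hor_nabla \<mu> (eta_plus \<mu>) = \<zero>\<^bsub>HH\<^esub>" "hor_nabla \<mu> (eta_minus \<mu>) = \<zero>\<^bsub>HH\<^esub>"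
  by (simp_all add: hgen_defs hor_nabla_cls ph_simps ph_eq_iff free_d_simps HM.h_simps HM.h_eta emb_simps(1-5)
      emb_rscal emb_unit PH.h_unit2 scal_uminus)

end

subsection \<open>The U(1)-grading\<close>

text \<open>The degree for the U(1)-coaction, not the form degree. The differential preserves it, so
  the letters of d\<alpha> and d\<gamma> have degree 1 like \<alpha> and \<gamma>.\<close>

primrec ldeg :: "phi_gen letter \<Rightarrow> int" where
  "ldeg (Gen x) = 1"
| "ldeg (Adj x) = - 1"

text \<open>A relation instead of a function, since zero belongs to every degree and elements are
  given by expressions and not by words.\<close>

inductive hdeg :: "int \<Rightarrow> phi_gen falg \<Rightarrow> bool" where
  hdeg_letter: "hdeg (ldeg l) (mon [l])"
| hdeg_scal: "hdeg 0 (scal c)"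
| hdeg_zero: "hdeg n 0"
| hdeg_add: "hdeg n f \<Longrightarrow> hdeg n g \<Longrightarrow> hdeg n (f + g)"
| hdeg_mult: "hdeg n f \<Longrightarrow> hdeg k g \<Longrightarrow> hdeg (n + k) (f * g)"

lemma hdeg_scal_mult: "hdeg n f \<Longrightarrow> hdeg n (scal c * f)"
  using hdeg_mult[OF hdeg_scal, of n f c] by simp

lemma hdeg_one: "hdeg 0 1"
  using hdeg_scal[of 1] by simp

lemma hdeg_uminus: "hdeg n f \<Longrightarrow> hdeg n (- f)"
  using hdeg_scal_mult[of n f "-1"] by (simp add: scal_uminus)

lemma hdeg_diff: "hdeg n f \<Longrightarrow> hdeg n g \<Longrightarrow> hdeg n (f - g)"
  using hdeg_add[OF _ hdeg_uminus, of n f g] by simp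

lemma hdeg_letterI: "ldeg l = n \<Longrightarrow> hdeg n (mon [l])"
  using hdeg_letter by blast

lemma hdeg_multI: "hdeg i f \<Longrightarrow> hdeg j g \<Longrightarrow> i + j = n \<Longrightarrow> hdeg n (f * g)"
  using hdeg_mult by blast

lemma hdeg_par: "hdeg n f \<Longrightarrow> hdeg n (par f)"
proof (induction rule: hdeg.induct)
  case (hdeg_letter l)
  show ?case by (rule letter_cases[of _ l]) (simp_all add: par_simps hdeg_letterI hdeg_uminus)
qed (auto simp: par_simps intro: hdeg.intros)

lemma hdeg_free_d: "hdeg n f \<Longrightarrow> hdeg n (free_d f)"
proof (induction rule: hdeg.induct)
  case (hdeg_letter l)
  show ?case
    by (rule letter_cases[of _ l]) (simp_all add: free_d_simps hdeg_letterI hdeg_zero)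
qed (auto simp: free_d_simps intro: hdeg.intros hdeg_par)

lemma hdeg_star: "hdeg n f \<Longrightarrow> hdeg (- n) (star f)"
proof (induction rule: hdeg.induct)
  case (hdeg_letter l)
  show ?case by (cases l) (simp_all add: star_simps hdeg_letterI)
next
  case (hdeg_zero n)
  have "star (0 :: phi_gen falg) = 0" using star_scal[of 0] by simp
  then show ?case by (simp add: hdeg.hdeg_zero)
next
  case (hdeg_mult n f k g)
  then show ?case by (auto simp: star_simps intro: hdeg_multI)
qed (auto simp: star_simps intro: hdeg.intros)

text \<open>The degree of a matrix entry u_ij depends on its column only, because the coaction
  multiplies u from the right.\<close>

definition fdeg :: "nat \<Rightarrow> int" where "fdeg j = (if j = 1 then 1 else - 1)"

lemma hdeg_fund: "hdeg (fdeg j) (fund \<mu> i j)"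
  by (auto simp: fund_def fdeg_def intro!: hdeg_letterI hdeg_uminus hdeg_scal_mult)

lemma hdeg_pi_fund: "hdeg (fdeg j - fdeg i) (pi_fund \<mu> i j)"
  unfolding pi_fund_def
  by (simp, intro hdeg_add hdeg_multI[OF hdeg_star[OF hdeg_fund] hdeg_free_d[OF hdeg_fund]]) simp_all

lemma hdeg_eta: "hdeg 0 (free_eta3 \<mu>)" "hdeg 2 (free_eta_plus \<mu>)" "hdeg (- 2) (free_eta_minus \<mu>)"
  using hdeg_pi_fund[of 1 1 \<mu>] hdeg_pi_fund[of 2 2 \<mu>] hdeg_pi_fund[of 1 2 \<mu>] hdeg_pi_fund[of 2 1 \<mu>]
  by (auto simp: free_eta3_def free_eta_plus_def free_eta_minus_def fdeg_def
      intro!: hdeg_diff hdeg_uminus hdeg_scal_mult)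

text \<open>A homogeneous relation r goes to r tensored with one power of U, hence to zero. This is
  the reason why the coaction respects the presentation.\<close>

lemma hdeg_phi_rels:
  assumes "r \<in> phi_rels \<mu>" shows "\<exists>n. hdeg n r"
proof -
  have bi: "\<exists>n. hdeg n r" if r: "r \<in> bimodule_rels \<mu> t k" and t: "hdeg d t" for r t k d
  proof -
    obtain i j where r: "r = t * fund \<mu> i j - (\<Sum>l\<in>{1, 2}. fund \<mu> i l * (rscal (inv_act k l j) * t))"
      and j: "j \<in> {1, 2}"
      using r by (auto simp: bimodule_rels_def)
    have 1: "hdeg (d + fdeg j) (fund \<mu> i l * (rscal (inv_act k l j) * t))" if "l \<in> {1, 2}" for l
    proof (cases "l = j")
      case True
      then show ?thesis by (auto intro: hdeg_multI[OF hdeg_fund hdeg_scal_mult[OF t]])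
    next
      case False
      then show ?thesis using that j by (auto simp: inv_act_def hdeg_zero)
    qed
    show ?thesis
      unfolding r
      by (rule exI[of _ "d + fdeg j"], rule hdeg_diff, rule hdeg_mult[OF t hdeg_fund])
        (use 1[of 1] 1[of 2] in \<open>simp add: hdeg_add\<close>)
  qed
  have base: "\<exists>n. hdeg n r" if "r \<in> su2_rels \<mu> \<union> calculus_rels \<mu>" for r
  proof -
    have su: "\<exists>n. hdeg n r" if "r \<in> su2_rels \<mu>"
    proof -
      have L: "hdeg 1 (gen x)" "hdeg (- 1) (adj x)" for x by (simp_all add: hdeg_letterI)
      have A: "hdeg 0 (gen x * adj y)" "hdeg 0 (adj x * gen y)" "hdeg 2 (gen x * gen y)" for x y
        using hdeg_mult[OF L(1) L(2)] hdeg_mult[OF L(2) L(1)] hdeg_mult[OF L(1) L(1)] by simp_all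
      show ?thesis
        using that unfolding su2_rels_def
        by (elim insertE emptyE)
          (auto intro!: exI[of _ 0] hdeg_diff hdeg_add A hdeg_scal_mult hdeg_one; fail |
           auto intro!: exI[of _ 2] hdeg_diff hdeg_add A hdeg_scal_mult hdeg_one; fail)+
    qed
    have last: "hdeg 0 (pi_fund \<mu> 2 2 + rscal (\<mu>\<^sup>2) * pi_fund \<mu> 1 1)"
      using hdeg_pi_fund[of 1 1 \<mu>] hdeg_pi_fund[of 2 2 \<mu>] by (intro hdeg_add hdeg_scal_mult) simp_all
    show ?thesis
      using that su bi[OF _ hdeg_eta(1)] bi[OF _ hdeg_eta(2)] bi[OF _ hdeg_eta(3)] last
      unfolding calculus_rels_def by blast
  qed
  then have "\<exists>n. hdeg n r" if "r \<in> star_closure (su2_rels \<mu> \<union> calculus_rels \<mu>)" for r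
    using that hdeg_star unfolding star_closure_def by blast
  then show ?thesis
    using assms hdeg_free_d unfolding phi_rels_def Let_def by blast
qed


subsection \<open>The coaction on horizontal forms\<close>

context muq begin

sublocale HU: tensor2 HH Ualg by unfold_locales

abbreviation "TU \<equiv> tensor_alg HH Ualg"

text \<open>The horizontal forms are a subalgebra and carry no presentation of their own. The
  coaction is therefore built on the presented algebra \<open>Phi\<close>, with the projection to
  \<open>HH\<close> included in the values on letters, and restricted afterwards.\<close>

definition cl :: "phi_gen letter \<Rightarrow> ((phi_gen falg set \<times> u1_gen falg set) \<Rightarrow>\<^sub>0 complex) set" where
  "cl l = tens HH Ualg (hl l) (uu (ldeg l))"

sublocale CL: letter_map TU cl
  by unfold_locales (simp add: cl_def hl_closed del: hor_simps)

lemma fhom_cl: "hdeg n f \<Longrightarrow> fhom TU cl f = tens HH Ualg (ph (sb f)) (uu n)"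
proof (induction rule: hdeg.induct)
  case (hdeg_letter l)
  show ?case unfolding CL.fhom_letter SB.fhom_letter by (simp only: cl_def hl_def)
next
  case (hdeg_scal c)
  have "ph (sb (scal c)) = c \<odot>\<^bsub>HH\<^esub> \<one>\<^bsub>HH\<^esub>"
    by (simp add: SB.fhom_scalar[simplified] ph_simps)
  then show ?case
    using HU.tens_smult_left[OF HH.one_closed Ua.one_closed, of c] by (simp add: CL.fhom_scalar del: hor_simps)
next
  case (hdeg_zero n)
  have "ph (sb 0) = \<zero>\<^bsub>HH\<^esub>" by (simp add: SB.fhom_zero[simplified] ph_simps)
  then show ?case
    using HU.tens_smult_left[OF HH.zero_closed Ua.up_closed, of 0 n] by (simp add: CL.fhom_zero del: hor_simps)
next
  case (hdeg_add n f g)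
  have "ph (sb (f + g)) = ph (sb f) \<oplus>\<^bsub>HH\<^esub> ph (sb g)" by (simp add: SB.fhom_add[simplified] ph_simps)
  then show ?case
    using HU.tens_add_left[OF sb_mem sb_mem Ua.up_closed] by (simp add: CL.fhom_add hdeg_add del: hor_simps)
next
  case (hdeg_mult n f k g)
  have "ph (sb (f * g)) = ph (sb f) \<otimes>\<^bsub>HH\<^esub> ph (sb g)" by (simp add: SB.fhom_mult[simplified] ph_simps)
  then show ?case
    using HU.TA_mult[OF sb_mem Ua.up_closed sb_mem Ua.up_closed] by (simp add: CL.fhom_mult hdeg_mult Ua.up_add del: hor_simps)
qed

sublocale CL: presented_map TU cl "phi_rels \<mu>"
proof unfold_locales
  fix r assume r: "r \<in> phi_rels \<mu>"
  obtain n where n: "hdeg n r" using hdeg_phi_rels[OF r] by blast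
  have "ph (sb r) = \<zero>\<^bsub>HH\<^esub>" using HL.rels[OF r] by (simp add: fhom_hl)
  then show "fhom TU cl r = \<zero>\<^bsub>TU\<^esub>"
    using HU.tens_smult_left[OF HH.zero_closed Ua.up_closed, of 0 n] by (simp add: fhom_cl[OF n] del: hor_simps)
qed

lemma HH_gen: "carrier HH \<subseteq> subalg_gen HH hgens"
proof
  fix x assume "x \<in> carrier HH"
  then have "x \<in> subalg_gen PP hgens" by simp
  then show "x \<in> subalg_gen HH hgens"
  proof induction
    case (gen x) then show ?case by (rule subalg_gen.gen)
  next
    case one then show ?case using subalg_gen.one[of HH hgens] by simp
  next
    case (add x y) then show ?case using subalg_gen.add[of x HH hgens y] by simp
  next
    case (mult x y) then show ?case using subalg_gen.mult[of x HH hgens y] by simp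
  next
    case (smult x c) then show ?case using subalg_gen.smult[of x HH hgens c] by simp
  qed
qed

lemma coact_hom: "phom TU cl \<in> alg_homs HH TU"
  using alg_homsD[OF CL.phom_hom, folded Phi_def] HH_mem by (intro alg_homsI) simp_all

lemma coact_ph: "hdeg n f \<Longrightarrow> phom TU cl (ph f) = tens HH Ualg (ph (sb f)) (uu n)"
  by (simp only: CL.phom_cls fhom_cl)

lemma hor_coact_eq: "hor_coact \<mu> = restrict (phom TU cl) (carrier HH)"
  unfolding hor_coact_def
proof (rule alg_ext_eq[OF HH.calg_axioms coact_hom])
  let ?V = "{(al \<mu>, tens HH Ualg (al \<mu>) Uu), (al_st \<mu>, tens HH Ualg (al_st \<mu>) Uu_st),
      (ga \<mu>, tens HH Ualg (ga \<mu>) Uu), (ga_st \<mu>, tens HH Ualg (ga_st \<mu>) Uu_st),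
      (eta_plus \<mu>, tens HH Ualg (eta_plus \<mu>) (Uu [^]\<^bsub>Ualg\<^esub> (2::nat))),
      (eta_minus \<mu>, tens HH Ualg (eta_minus \<mu>) (Uu_st [^]\<^bsub>Ualg\<^esub> (2::nat)))}"
  have L: "hdeg 1 (gen x)" "hdeg (- 1) (adj x)" for x by (simp_all add: hdeg_letterI)
  have mem: "hgens \<subseteq> carrier HH" by (auto intro: subalg_gen.gen)
  show "x \<in> carrier HH \<and> phom TU cl x = y" if "(x, y) \<in> ?V" for x y
    using that mem coact_ph[OF L(1), of Alpha] coact_ph[OF L(1), of Gamma] coact_ph[OF L(2), of Alpha]
      coact_ph[OF L(2), of Gamma] coact_ph[OF hdeg_eta(2)[of \<mu>]] coact_ph[OF hdeg_eta(3)[of \<mu>]]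
    by (auto simp: hgen_defs[symmetric] sb_eta SB.fhom_letter sub_letter_def Ua.up_1 Ua.up_m1 Ua.up_2 Ua.up_m2
        simp del: hor_simps)
  have "fst ` ?V = hgens" by auto
  then show "carrier HH \<subseteq> subalg_gen HH (fst ` ?V)" using HH_gen by simp
qed

definition hhom :: "phi_gen falg set \<Rightarrow> int \<Rightarrow> bool" where
  "hhom x n \<longleftrightarrow> x \<in> carrier HH \<and> hor_coact \<mu> x = tens HH Ualg x (uu n)"

lemma hor_coact_hom: "hor_coact \<mu> \<in> alg_homs HH TU"
  unfolding hor_coact_eq using alg_homsD[OF coact_hom] HH.ring_axioms
  by (intro alg_homsI) (simp_all add: HH.m_closed HH.add.m_closed HH.smult_closed HH.one_closed del: hor_simps)

lemma hor_coact_linear: "hor_coact \<mu> \<in> linear_maps HH HU.T"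
  by (rule linear_mapsI) (simp_all add: alg_homsD[OF hor_coact_hom, unfolded HU.TA_simps] del: hor_simps)

lemma hhom_carrier: "hhom x n \<Longrightarrow> x \<in> carrier HH"
  by (simp add: hhom_def)

lemma hhom_mult: "hhom x n \<Longrightarrow> hhom y k \<Longrightarrow> hhom (x \<otimes>\<^bsub>HH\<^esub> y) (n + k)"
  using HU.TA_mult[of x "uu n" y "uu k"]
  by (simp add: hhom_def alg_homsD[OF hor_coact_hom] HH.m_closed Ua.up_add del: hor_simps)

lemma hhom_one: "hhom \<one>\<^bsub>HH\<^esub> 0"
  by (simp add: hhom_def alg_homsD(5)[OF hor_coact_hom] HH.one_closed del: hor_simps)

lemma hdeg_sb: "hdeg n f \<Longrightarrow> hdeg n (sb f)"
proof (induction rule: hdeg.induct)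
  case (hdeg_letter l)
  have L: "hdeg 1 (gen x)" "hdeg (- 1) (adj x)" for x by (simp_all add: hdeg_letterI)
  have "hdeg (ldeg l) (sub_letter l)"
    by (rule letter_cases[of _ l];
        simp add: sub_letter_def L;
        intro hdeg_uminus hdeg_scal_mult hdeg_multI[OF L(1) hdeg_eta(3)] hdeg_multI[OF L(2) hdeg_eta(2)]; simp)
  then show ?case by (simp add: SB.fhom_letter)
qed (auto simp: sb_simps SB.fhom_scalar[simplified] intro: hdeg.intros)

lemma hhom_ph: "hdeg n f \<Longrightarrow> hhom (ph (sb f)) n"
  using coact_ph[OF hdeg_sb] hp_id[OF sb_mem[of f]]
  by (simp add: hhom_def hor_coact_eq sb_mem hp_cls del: hor_simps)

lemma hhom_gens: "hhom (al \<mu>) 1" "hhom (ga \<mu>) 1" "hhom (al_st \<mu>) (- 1)" "hhom (ga_st \<mu>) (- 1)"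
  "hhom (eta_plus \<mu>) 2" "hhom (eta_minus \<mu>) (- 2)"
proof -
  have L: "hdeg 1 (gen x)" "hdeg (- 1) (adj x)" for x by (simp_all add: hdeg_letterI)
  show "hhom (al \<mu>) 1" "hhom (ga \<mu>) 1" "hhom (al_st \<mu>) (- 1)" "hhom (ga_st \<mu>) (- 1)"
  "hhom (eta_plus \<mu>) 2" "hhom (eta_minus \<mu>) (- 2)"
    using hhom_ph[OF L(1), of Alpha] hhom_ph[OF L(1), of Gamma] hhom_ph[OF L(2), of Alpha]
      hhom_ph[OF L(2), of Gamma] hhom_ph[OF hdeg_eta(2)[of \<mu>]] hhom_ph[OF hdeg_eta(3)[of \<mu>]]
    by (simp_all add: sb_eta SB.fhom_letter sub_letter_def al_def al_st_def ga_def ga_st_def)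
qed

text \<open>Words are homogeneous, the substitution preserves degrees, and \<open>hp\<close> fixes
  horizontal forms; hence the images of words span \<open>HH\<close>.\<close>

lemma HH_induct [consumes 1, case_names add hom]:
  assumes "x \<in> carrier HH"
    "\<And>x y. x \<in> carrier HH \<Longrightarrow> y \<in> carrier HH \<Longrightarrow> P x \<Longrightarrow> P y \<Longrightarrow> P (x \<oplus>\<^bsub>HH\<^esub> y)"
    "\<And>x n. hhom x n \<Longrightarrow> P x"
  shows "P x"
proof -
  have "P (ph (sb f))" for f
  proof (induction f rule: falg_induct)
    case (add f g)
    then show ?case using assms(2)[OF sb_mem sb_mem, of f g] by (simp add: SB.fhom_add[simplified] ph_simps)
  next
    case (mon c xs)
    have "\<exists>n. hdeg n (mon xs)"
    proof (induction xs)
      case (Cons x xs)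
      then show ?case using hdeg_mult[OF hdeg_letter] by (auto simp: mon_Cons[of x xs])
    qed (auto intro: hdeg_one)
    then show ?case using assms(3) hhom_ph hdeg_scal_mult by blast
  qed
  moreover obtain f where "x = ph f" using assms(1) HH_mem by (auto simp: Phi_def presented_carrier)
  moreover have "hp x = x" by (rule hp_id[OF assms(1)])
  ultimately show ?thesis by (metis hp_cls)
qed


subsection \<open>The algebra of affine horizontal forms\<close>

sublocale HS: tensor HH SA by unfold_locales

abbreviation "hh \<equiv> ht \<mu>"

lemma ht_eq: "hh = tens HH SA" by (simp add: ht_def fun_eq_iff)

definition hq :: "phi_gen falg set \<Rightarrow> s_gen falg set \<Rightarrow> phi_gen falg set \<Rightarrow> s_gen falg set \<Rightarrow> hform" where
  "hq \<psi> \<theta> \<phi> \<eta> = tens_sum HS.T (\<lambda>\<phi>k ck. hh (\<psi> \<otimes>\<^bsub>HH\<^esub> \<phi>k) (S_act \<mu> \<theta> ck \<otimes>\<^bsub>SA\<^esub> \<eta>)) (hor_coact \<mu> \<phi>)"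

lemmas HB = bilinD[OF HS.bilin_tens, folded ht_eq]
lemmas SB' = bilinD[OF sact_bilin]

lemmas hq_simps = HB SB' S_act_eq HH.m_closed HH.l_distr HH.r_distr HH.smult_mult_left HH.smult_mult_right
  S.l_distr S.r_distr S.smult_mult_left S.smult_mult_right S.m_closed S.add.m_closed HH.add.m_closed
  S.smult_closed HH.smult_closed

lemma hq_inner: "\<psi> \<in> carrier HH \<Longrightarrow> \<theta> \<in> carrier SA \<Longrightarrow> \<eta> \<in> carrier SA \<Longrightarrow>
    bilin HH Ualg HS.T (\<lambda>\<phi>k ck. hh (\<psi> \<otimes>\<^bsub>HH\<^esub> \<phi>k) (S_act \<mu> \<theta> ck \<otimes>\<^bsub>SA\<^esub> \<eta>))"
  by (rule bilinI) (simp_all add: hq_simps del: hor_simps)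

lemma hq_bilin1:
  assumes "\<psi> \<in> carrier HH" "\<theta> \<in> carrier SA"
  shows "bilin HH SA HS.T (hq \<psi> \<theta>)"
  unfolding bilin_def
proof (intro conjI ballI)
  fix \<phi> assume p: "\<phi> \<in> carrier HH"
  show "hq \<psi> \<theta> \<phi> \<in> linear_maps SA HS.T"
    unfolding hq_def[abs_def]
    by (rule HU.tens_sum_linear_param[OF HS.T.cvec_axioms S.cvec_axioms hq_inner[OF assms]])
      (use assms alg_homsD(1)[OF hor_coact_hom p] in \<open>auto intro!: linear_mapsI simp: hq_simps simp del: hor_simps\<close>)
next
  fix \<eta> assume n: "\<eta> \<in> carrier SA"
  show "(\<lambda>\<phi>. hq \<psi> \<theta> \<phi> \<eta>) \<in> linear_maps HH HS.T"
    unfolding hq_def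
    by (rule linear_maps_comp[OF hor_coact_linear HU.tens_sum_linear[OF HS.T.cvec_axioms hq_inner[OF assms n]]])
qed

lemma hq_bilin2:
  assumes "\<phi> \<in> carrier HH" "\<eta> \<in> carrier SA"
  shows "bilin HH SA HS.T (\<lambda>\<psi> \<theta>. hq \<psi> \<theta> \<phi> \<eta>)"
  unfolding bilin_def
proof (intro conjI ballI)
  have c: "hor_coact \<mu> \<phi> \<in> carrier HU.T" using alg_homsD(1)[OF hor_coact_hom assms(1)] by simp
  fix \<psi> assume p: "\<psi> \<in> carrier HH"
  show "(\<lambda>\<theta>. hq \<psi> \<theta> \<phi> \<eta>) \<in> linear_maps SA HS.T"
    unfolding hq_def[abs_def]
    by (rule HU.tens_sum_linear_param[OF HS.T.cvec_axioms S.cvec_axioms hq_inner[OF p _ assms(2)] _ c])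
      (use assms p in \<open>auto intro!: linear_mapsI simp: hq_simps simp del: hor_simps\<close>)
next
  have c: "hor_coact \<mu> \<phi> \<in> carrier HU.T" using alg_homsD(1)[OF hor_coact_hom assms(1)] by simp
  fix \<theta> assume t: "\<theta> \<in> carrier SA"
  show "(\<lambda>\<psi>. hq \<psi> \<theta> \<phi> \<eta>) \<in> linear_maps HH HS.T"
    unfolding hq_def[abs_def]
    by (rule HU.tens_sum_linear_param[OF HS.T.cvec_axioms HH.cvec_axioms hq_inner[OF _ t assms(2)] _ c])
      (use assms t in \<open>auto intro!: linear_mapsI simp: hq_simps simp del: hor_simps\<close>)
qed

text \<open>On a homogeneous form the coaction is a single pure tensor with U^n, so the twisted
  product has one term and the twist is the scaling by \<open>m powi (- n)\<close>.\<close>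

lemma hq_hom:
  assumes "\<psi> \<in> carrier HH" "\<theta> \<in> carrier SA" "hhom \<phi> n" "\<eta> \<in> carrier SA"
  shows "hq \<psi> \<theta> \<phi> \<eta> = hh (\<psi> \<otimes>\<^bsub>HH\<^esub> \<phi>) (sg (m powi (- n)) \<theta> \<otimes>\<^bsub>SA\<^esub> \<eta>)"
  using HU.tens_sum_tens[OF HS.T.cvec_axioms hq_inner[OF assms(1,2,4)] hhom_carrier[OF assms(3)] Ua.up_closed, of n]
    assms(3)
  by (simp add: hq_def hhom_def S_act_eq sact_uu assms(2) del: hor_simps)

abbreviation "hpa \<equiv> hP \<mu>"

lemma hP_eq: "hpa = HS.T\<lparr>mult := HS.qmul hq, one := hh \<one>\<^bsub>HH\<^esub> \<one>\<^bsub>SA\<^esub>\<rparr>"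
  by (simp add: hP_def Let_def HS.qmul_def[abs_def] hq_def[abs_def] del: hor_simps)

lemma hP_simps [simp]:
  "carrier hpa = carrier HS.T" "add hpa = add HS.T" "zero hpa = zero HS.T"
  "module.smult hpa = module.smult HS.T" "one hpa = hh \<one>\<^bsub>HH\<^esub> \<one>\<^bsub>SA\<^esub>"
  by (simp_all add: hP_eq)

lemma hq_mult: "\<psi> \<in> carrier HH \<Longrightarrow> \<theta> \<in> carrier SA \<Longrightarrow> \<phi> \<in> carrier HH \<Longrightarrow> \<eta> \<in> carrier SA \<Longrightarrow>
    HS.qmul hq (hh \<psi> \<theta>) (hh \<phi> \<eta>) = hq \<psi> \<theta> \<phi> \<eta>"
  unfolding ht_eq by (rule HS.qmul_tens[OF hq_bilin1 hq_bilin2])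

lemma hq_one_left:
  assumes "\<psi> \<in> carrier HH" "\<phi> \<in> carrier HH" "\<eta> \<in> carrier SA"
  shows "hq \<psi> \<one>\<^bsub>SA\<^esub> \<phi> \<eta> = hh (\<psi> \<otimes>\<^bsub>HH\<^esub> \<phi>) \<eta>"
  using assms(2)
proof (induction rule: HH_induct)
  case (add x y)
  then show ?case
    using assms bilinD(2)[OF hq_bilin1[OF assms(1) S.one_closed]] by (simp add: hq_simps del: hor_simps)
next
  case (hom x n)
  then show ?case using assms by (simp add: hq_hom sgD del: hor_simps)
qed

text \<open>By linearity the second and third forms may be taken homogeneous. Associativity then
  says that each \<open>sg\<close> is multiplicative and that scalings compose while degrees
  add.\<close>

lemma hq_assoc:
  assumes "x \<in> carrier HH" "y \<in> carrier SA" "x' \<in> carrier HH" "y' \<in> carrier SA" "x'' \<in> carrier HH" "y'' \<in> carrier SA"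
  shows "HS.qmul hq (HS.qmul hq (hh x y) (hh x' y')) (hh x'' y'') =
    HS.qmul hq (hh x y) (HS.qmul hq (hh x' y') (hh x'' y''))"
proof -
  note B = bilinD[OF HS.qmul_bilin[OF hq_bilin1 hq_bilin2]]
  have 1: "HS.qmul hq (HS.qmul hq (hh x y) (hh x' y')) (hh x'' y'') =
    HS.qmul hq (hh x y) (HS.qmul hq (hh x' y') (hh x'' y''))" if h: "hhom x' n" for x' n
    using assms(5)
  proof (induction rule: HH_induct)
    case (add u v)
    have x': "x' \<in> carrier HH" using h by (rule hhom_carrier)
    then show ?case using add assms by (simp add: B HB del: hor_simps)
  next
    case (hom x'' k)
    have c: "x' \<in> carrier HH" "x'' \<in> carrier HH" using h hom by (auto simp: hhom_def)
    have "m powi (- (n + k)) = m powi (- k) * m powi (- n)"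
      using power_int_add[OF disjI1[OF m_nz], of "- k" "- n"] by (simp add: add.commute)
    then show ?case
      using assms c h hom hhom_mult[OF h hom]
      by (simp add: hq_mult hq_hom sgD sg_sg HH.m_closed HH.m_assoc S.m_assoc del: hor_simps)
  qed
  show ?thesis
    using assms(3)
  proof (induction rule: HH_induct)
    case (add u v)
    then show ?case using assms by (simp add: B HB del: hor_simps)
  qed (rule 1)
qed

sublocale hpa: calg hpa
  unfolding hP_eq
proof (rule HS.qmul_calg[OF hq_bilin1 hq_bilin2], unfold ht_eq[symmetric])
  show "hh \<one>\<^bsub>HH\<^esub> \<one>\<^bsub>SA\<^esub> \<in> carrier HS.T" by (intro HB HH.one_closed S.one_closed)
  show "HS.qmul hq (hh \<one>\<^bsub>HH\<^esub> \<one>\<^bsub>SA\<^esub>) (hh x y) = hh x y" if "x \<in> carrier HH" "y \<in> carrier SA" for x y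
    using that by (simp add: hq_mult hq_one_left HH.one_closed del: hor_simps)
  show "HS.qmul hq (hh x y) (hh \<one>\<^bsub>HH\<^esub> \<one>\<^bsub>SA\<^esub>) = hh x y" if "x \<in> carrier HH" "y \<in> carrier SA" for x y
    using that hhom_one by (simp add: hq_mult hq_hom HH.one_closed sg_1 del: hor_simps)
qed (assumption | rule hq_assoc)+

lemma hh_closed [simp, intro]: "x \<in> carrier HH \<Longrightarrow> t \<in> carrier SA \<Longrightarrow> hh x t \<in> carrier HS.T"
  by (rule HB(1))

lemma hP_mult_hom: "\<psi> \<in> carrier HH \<Longrightarrow> \<theta> \<in> carrier SA \<Longrightarrow> hhom \<phi> n \<Longrightarrow> \<eta> \<in> carrier SA \<Longrightarrow>
    hh \<psi> \<theta> \<otimes>\<^bsub>hpa\<^esub> hh \<phi> \<eta> = hh (\<psi> \<otimes>\<^bsub>HH\<^esub> \<phi>) (sg (m powi (- n)) \<theta> \<otimes>\<^bsub>SA\<^esub> \<eta>)"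
  by (simp add: hP_eq hq_mult hq_hom hhom_carrier del: hor_simps)

lemma hP_mult_left: "\<psi> \<in> carrier HH \<Longrightarrow> \<phi> \<in> carrier HH \<Longrightarrow> \<eta> \<in> carrier SA \<Longrightarrow>
    hh \<psi> \<one>\<^bsub>SA\<^esub> \<otimes>\<^bsub>hpa\<^esub> hh \<phi> \<eta> = hh (\<psi> \<otimes>\<^bsub>HH\<^esub> \<phi>) \<eta>"
  by (simp add: hP_eq hq_mult hq_one_left del: hor_simps)

lemma hP_mult_right: "\<psi> \<in> carrier HH \<Longrightarrow> \<theta> \<in> carrier SA \<Longrightarrow> \<eta> \<in> carrier SA \<Longrightarrow>
    hh \<psi> \<theta> \<otimes>\<^bsub>hpa\<^esub> hh \<one>\<^bsub>HH\<^esub> \<eta> = hh \<psi> (\<theta> \<otimes>\<^bsub>SA\<^esub> \<eta>)"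
  using hP_mult_hom[OF _ _ hhom_one] by (simp add: sg_1 del: hor_simps)

end

section \<open>The curvature\<close>

context muq begin

abbreviation "\<omega> \<equiv> eta_minus \<mu> \<otimes>\<^bsub>HH\<^esub> eta_plus \<mu>"

lemma hor_gens_closed: "x \<in> hgens \<Longrightarrow> x \<in> carrier HH"
  by (auto intro: subalg_gen.gen)

lemma omega_closed: "\<omega> \<in> carrier HH"
  by (intro HH.m_closed hor_gens_closed) simp_all

lemma hhom_omega: "hhom \<omega> 0"
  using hhom_mult[OF hhom_gens(6,5)] by simp

lemmas hor_compute = hgen_defs ph_simps ph_eq_iff emb_simps(1-5) emb_rscal emb_unit PH.h_unit2 PH.nf
  PH.quad PH.quad[THEN assoc_rule] scal_uminus expand_simps

text \<open>The two columns of the unitary fundamental matrix. The coefficient 1 is kept visible so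
  that both equations have the shape required by \<open>hor_cancel\<close>.\<close>

lemma hor_unitarity:
  "(al_st \<mu> \<otimes>\<^bsub>HH\<^esub> al \<mu>) \<oplus>\<^bsub>HH\<^esub> (complex_of_real 1 \<odot>\<^bsub>HH\<^esub> (ga_st \<mu> \<otimes>\<^bsub>HH\<^esub> ga \<mu>)) = \<one>\<^bsub>HH\<^esub>"
  "(al \<mu> \<otimes>\<^bsub>HH\<^esub> al_st \<mu>) \<oplus>\<^bsub>HH\<^esub> (complex_of_real (\<mu>\<^sup>2) \<odot>\<^bsub>HH\<^esub> (ga \<mu> \<otimes>\<^bsub>HH\<^esub> ga_st \<mu>)) = \<one>\<^bsub>HH\<^esub>"
  by (simp_all add: hor_compute del: of_real_power of_real_1)

lemma omega_comm:
  "\<omega> \<otimes>\<^bsub>HH\<^esub> al \<mu> = complex_of_real (1 / \<mu>\<^sup>2) \<odot>\<^bsub>HH\<^esub> (al \<mu> \<otimes>\<^bsub>HH\<^esub> \<omega>)"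
  "\<omega> \<otimes>\<^bsub>HH\<^esub> ga \<mu> = complex_of_real (1 / \<mu>\<^sup>2) \<odot>\<^bsub>HH\<^esub> (ga \<mu> \<otimes>\<^bsub>HH\<^esub> \<omega>)"
  "\<omega> \<otimes>\<^bsub>HH\<^esub> al_st \<mu> = complex_of_real (\<mu>\<^sup>2) \<odot>\<^bsub>HH\<^esub> (al_st \<mu> \<otimes>\<^bsub>HH\<^esub> \<omega>)"
  "\<omega> \<otimes>\<^bsub>HH\<^esub> ga_st \<mu> = complex_of_real (\<mu>\<^sup>2) \<odot>\<^bsub>HH\<^esub> (ga_st \<mu> \<otimes>\<^bsub>HH\<^esub> \<omega>)"
  by (simp_all add: hor_compute power2_eq_square mult.assoc del: of_real_power of_real_mult of_real_divide)

text \<open>Since d^2 = 0, only the vertical term discarded from d contributes. It is \<kappa>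
  \<alpha> \<eta>_3 for \<alpha>, giving minus \<kappa> \<alpha> times the horizontal part of
  d\<eta>_3, that is -\<mu> \<alpha> \<omega>. For the adjoints the coefficient \<kappa> becomes
  -\<mu>^2 \<kappa>, whence \<mu>^3.\<close>

lemma nabla_nabla:
  "hor_nabla \<mu> (hor_nabla \<mu> (al \<mu>)) = complex_of_real (- \<mu>) \<odot>\<^bsub>HH\<^esub> (al \<mu> \<otimes>\<^bsub>HH\<^esub> \<omega>)"
  "hor_nabla \<mu> (hor_nabla \<mu> (ga \<mu>)) = complex_of_real (- \<mu>) \<odot>\<^bsub>HH\<^esub> (ga \<mu> \<otimes>\<^bsub>HH\<^esub> \<omega>)"
  "hor_nabla \<mu> (hor_nabla \<mu> (al_st \<mu>)) = complex_of_real (\<mu> ^ 3) \<odot>\<^bsub>HH\<^esub> (al_st \<mu> \<otimes>\<^bsub>HH\<^esub> \<omega>)"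
  "hor_nabla \<mu> (hor_nabla \<mu> (ga_st \<mu>)) = complex_of_real (\<mu> ^ 3) \<odot>\<^bsub>HH\<^esub> (ga_st \<mu> \<otimes>\<^bsub>HH\<^esub> \<omega>)"
  by (simp_all add: hor_nabla_cls free_d_simps HM.h_simps HM.h_eta SB.fhom_letter sub_letter_def
      par_simps hor_compute power2_eq_square power3_eq_cube mult.assoc del: of_real_power of_real_mult of_real_minus)

end

locale affine_curvature = muq +
  fixes H :: "hform \<Rightarrow> ((hform \<times> aff_gen falg set) \<Rightarrow>\<^sub>0 complex) set"
    and D :: "hform \<Rightarrow> hform" and \<rho> :: "aff_gen falg set \<Rightarrow> hform"
  assumes H_coaction: "affine_coaction \<mu> H" and D_derivative: "affine_derivative \<mu> D"
    and rho_curvature: "curvature_map \<mu> H D \<rho>"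
begin

declare hP_simps [simp del] hor_simps [simp del]

sublocale HA: tensor2 hpa AA by unfold_locales

abbreviation "tn \<equiv> tens hpa AA"

lemma hh_mem [simp, intro]: "x \<in> carrier HH \<Longrightarrow> t \<in> carrier SA \<Longrightarrow> hh x t \<in> carrier hpa"
  by (simp add: hP_simps)

lemma hh_smult: "x \<in> carrier HH \<Longrightarrow> t \<in> carrier SA \<Longrightarrow> hh (c \<odot>\<^bsub>HH\<^esub> x) t = c \<odot>\<^bsub>hpa\<^esub> hh x t"
  "x \<in> carrier HH \<Longrightarrow> t \<in> carrier SA \<Longrightarrow> hh x (c \<odot>\<^bsub>SA\<^esub> t) = c \<odot>\<^bsub>hpa\<^esub> hh x t"
  by (simp_all add: hP_simps HB)

lemma hh_add: "x \<in> carrier HH \<Longrightarrow> y \<in> carrier HH \<Longrightarrow> t \<in> carrier SA \<Longrightarrow> hh (x \<oplus>\<^bsub>HH\<^esub> y) t = hh x t \<oplus>\<^bsub>hpa\<^esub> hh y t"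
  by (simp add: hP_simps HB)

lemma hh_linear: "x \<in> carrier HH \<Longrightarrow> hh x \<in> linear_maps SA hpa"
  by (rule linear_mapsI) (simp_all add: hP_simps HB)

lemma hh_bilin: "bilin HH SA hpa hh"
  by (rule bilinI) (simp_all add: hP_simps HB)

lemma hh_one: "\<one>\<^bsub>hpa\<^esub> = hh \<one>\<^bsub>HH\<^esub> \<one>\<^bsub>SA\<^esub>"
  by (simp add: hP_simps)

lemmas H_hom = H_coaction[unfolded affine_coaction_def, THEN conjunct1]
lemmas HD = alg_homsD[OF H_hom, unfolded HA.TA_simps]

lemma H_hor: "hhom x n \<Longrightarrow> H (hh x \<one>\<^bsub>SA\<^esub>) = tn (hh x \<one>\<^bsub>SA\<^esub>) (au n)"
proof -
  assume x: "hhom x n"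
  have bl: "bilin HH Ualg HA.TA (\<lambda>y c. tn (hh y \<one>\<^bsub>SA\<^esub>) (U_in_Aff \<mu> c))"
    by (rule bilinI)
      (simp_all add: linear_mapsD[OF U_in_Aff_linear] bilinD[OF HA.bilin_tens] bilinD[OF hh_bilin])
  have "H (hh x \<one>\<^bsub>SA\<^esub>) = tens_sum HA.TA (\<lambda>y c. tn (hh y \<one>\<^bsub>SA\<^esub>) (U_in_Aff \<mu> c)) (hor_coact \<mu> x)"
    using H_coaction hhom_carrier[OF x] by (simp add: affine_coaction_def)
  also have "\<dots> = tn (hh x \<one>\<^bsub>SA\<^esub>) (au n)"
    using x HU.tens_sum_tens[OF HA.TA.cvec_axioms bl hhom_carrier[OF x] Ua.up_closed]
    by (simp add: hhom_def U_in_Aff_uu)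
  finally show ?thesis .
qed

lemma H_S: "H (hh \<one>\<^bsub>HH\<^esub> X) = tn \<one>\<^bsub>hpa\<^esub> aX \<oplus>\<^bsub>HA.T\<^esub> tn (hh \<one>\<^bsub>HH\<^esub> X) (au 2)"
  "H (hh \<one>\<^bsub>HH\<^esub> Y) = tn \<one>\<^bsub>hpa\<^esub> aY \<oplus>\<^bsub>HA.T\<^esub> tn (hh \<one>\<^bsub>HH\<^esub> Y) (au (- 2))"
proof -
  have bl: "bilin SA AA HA.TA (\<lambda>s a. tn (hh \<one>\<^bsub>HH\<^esub> s) a)"
    by (rule bilinI) (simp_all add: bilinD[OF HA.bilin_tens] bilinD[OF hh_bilin])
  note T = SAT.tens_sum_tens[OF HA.TA.cvec_axioms bl] and L = SAT.tens_sum_linear[OF HA.TA.cvec_axioms bl]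
  have "H (hh \<one>\<^bsub>HH\<^esub> t) = tens_sum HA.TA (\<lambda>s a. tn (hh \<one>\<^bsub>HH\<^esub> s) a) (S_coprod \<mu> t)" if "t \<in> carrier SA" for t
    using H_coaction that by (simp add: affine_coaction_def)
  then show "H (hh \<one>\<^bsub>HH\<^esub> X) = tn \<one>\<^bsub>hpa\<^esub> aX \<oplus>\<^bsub>HA.T\<^esub> tn (hh \<one>\<^bsub>HH\<^esub> X) (au 2)"
    "H (hh \<one>\<^bsub>HH\<^esub> Y) = tn \<one>\<^bsub>hpa\<^esub> aY \<oplus>\<^bsub>HA.T\<^esub> tn (hh \<one>\<^bsub>HH\<^esub> Y) (au (- 2))"
    by (simp_all add: S_coprod_gen linear_mapsD(2)[OF L] T hh_one)
qed


subsection \<open>The square of the derivative\<close>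

lemma D_linear: "D \<in> linear_maps hpa hpa" and D_deg: "x \<in> hP_deg \<mu> k \<Longrightarrow> D x \<in> hP_deg \<mu> (Suc k)"
  and D_leibniz: "x \<in> hP_deg \<mu> k \<Longrightarrow> y \<in> carrier hpa \<Longrightarrow>
    D (x \<otimes>\<^bsub>hpa\<^esub> y) = (D x \<otimes>\<^bsub>hpa\<^esub> y) \<oplus>\<^bsub>hpa\<^esub> ((-1) ^ k \<odot>\<^bsub>hpa\<^esub> (x \<otimes>\<^bsub>hpa\<^esub> D y))"
  using D_derivative by (auto simp: affine_derivative_def antiderivation_def)

lemmas DD = linear_mapsD[OF D_linear]

lemma D_hor: "x \<in> carrier HH \<Longrightarrow> D (hh x \<one>\<^bsub>SA\<^esub>) = hh (hor_nabla \<mu> x) \<one>\<^bsub>SA\<^esub>"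
  using D_derivative by (simp add: affine_derivative_def)

text \<open>As D x has degree one, its Leibniz rule contributes minus the product of D x and D y,
  which cancels the cross term from x times D y.\<close>

lemma D2_leibniz:
  assumes "x \<in> hP_deg \<mu> 0" "x \<in> carrier hpa" "y \<in> carrier hpa"
  shows "D (D (x \<otimes>\<^bsub>hpa\<^esub> y)) = (D (D x) \<otimes>\<^bsub>hpa\<^esub> y) \<oplus>\<^bsub>hpa\<^esub> (x \<otimes>\<^bsub>hpa\<^esub> D (D y))"
proof -
  have "D (D (x \<otimes>\<^bsub>hpa\<^esub> y)) = D (D x \<otimes>\<^bsub>hpa\<^esub> y) \<oplus>\<^bsub>hpa\<^esub> D (x \<otimes>\<^bsub>hpa\<^esub> D y)"
    using assms by (simp add: D_leibniz[OF assms(1,3)] DD)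
  also have "\<dots> = ((D (D x) \<otimes>\<^bsub>hpa\<^esub> y) \<oplus>\<^bsub>hpa\<^esub> (\<ominus>\<^bsub>hpa\<^esub> (D x \<otimes>\<^bsub>hpa\<^esub> D y))) \<oplus>\<^bsub>hpa\<^esub>
      ((D x \<otimes>\<^bsub>hpa\<^esub> D y) \<oplus>\<^bsub>hpa\<^esub> (x \<otimes>\<^bsub>hpa\<^esub> D (D y)))"
    using assms D_leibniz[OF D_deg[OF assms(1)] assms(3)] D_leibniz[OF assms(1), of "D y"]
    by (simp add: DD hpa.smult_minus_one)
  also have "\<dots> = (D (D x) \<otimes>\<^bsub>hpa\<^esub> y) \<oplus>\<^bsub>hpa\<^esub> (x \<otimes>\<^bsub>hpa\<^esub> D (D y))"
    using assms by (simp add: DD hpa.a_assoc hpa.r_neg1)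
  finally show ?thesis .
qed

lemma Phi_deg_letter: "letter_deg l = k \<Longrightarrow> ph (mon [l]) \<in> Phi_deg \<mu> k"
  unfolding Phi_deg_def by (auto simp: mon_def word_deg_def)

lemma hP_deg_hor: "x \<in> {al \<mu>, al_st \<mu>, ga \<mu>, ga_st \<mu>} \<Longrightarrow> hh x \<one>\<^bsub>SA\<^esub> \<in> hP_deg \<mu> 0"
  and hP_deg_S: "t \<in> carrier SA \<Longrightarrow> hh \<one>\<^bsub>HH\<^esub> t \<in> hP_deg \<mu> 0"
proof -
  have sub: "{hh x t | x t. x \<in> hor_deg \<mu> 0 \<and> t \<in> carrier SA} \<subseteq> carrier hpa"
    by (auto simp: hor_deg_def)
  note base = hpa.lin_span_base[OF sub, folded hP_deg_def]
  show "hh x \<one>\<^bsub>SA\<^esub> \<in> hP_deg \<mu> 0" if "x \<in> {al \<mu>, al_st \<mu>, ga \<mu>, ga_st \<mu>}"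
  proof (rule base)
    have "x \<in> Phi_deg \<mu> 0" using that Phi_deg_letter[of _ 0] by (auto simp: hgen_defs)
    then show "hh x \<one>\<^bsub>SA\<^esub> \<in> {hh x t | x t. x \<in> hor_deg \<mu> 0 \<and> t \<in> carrier SA}"
      using that hor_gens_closed[of x] by (auto simp: hor_deg_def)
  qed
  have "\<one>\<^bsub>HH\<^esub> \<in> Phi_deg \<mu> 0"
    unfolding Phi_deg_def by (rule CollectI, rule exI[of _ 1]) (simp add: ph_simps hor_simps word_deg_def zero_word_def)
  then show "hh \<one>\<^bsub>HH\<^esub> t \<in> hP_deg \<mu> 0" if "t \<in> carrier SA"
    using that by (intro base) (auto simp: hor_deg_def)
qed

text \<open>The generators go to multiples of \<eta>_+ and \<eta>_-, on which \<nabla> vanishes;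
  elements of S(V) have degree zero, so the derivation property of \<open>D2_leibniz\<close> extends
  this to all products.\<close>

lemma D2_S: assumes "t \<in> carrier SA" shows "D (D (hh \<one>\<^bsub>HH\<^esub> t)) = \<zero>\<^bsub>hpa\<^esub>"
proof -
  have Z: "hh \<zero>\<^bsub>HH\<^esub> \<one>\<^bsub>SA\<^esub> = \<zero>\<^bsub>hpa\<^esub>"
    using hh_smult(1)[OF HH.zero_closed S.one_closed, of 0] by simp
  have nz: "hor_nabla \<mu> \<zero>\<^bsub>HH\<^esub> = \<zero>\<^bsub>HH\<^esub>" "hor_nabla \<mu> \<one>\<^bsub>HH\<^esub> = \<zero>\<^bsub>HH\<^esub>"
    using hor_nabla_cls[of 0] hor_nabla_cls[of 1]
    by (simp_all add: ph_simps hor_simps free_d_simps HL.fhom_zero SB.fhom_zero[simplified])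
  have ge: "eta_plus \<mu> \<in> carrier HH" "eta_minus \<mu> \<in> carrier HH" by (rule hor_gens_closed, simp)+
  have DXY: "D (hh \<one>\<^bsub>HH\<^esub> X) = hh (eta_plus \<mu>) \<one>\<^bsub>SA\<^esub>" "D (hh \<one>\<^bsub>HH\<^esub> Y) = m \<odot>\<^bsub>hpa\<^esub> hh (eta_minus \<mu>) \<one>\<^bsub>SA\<^esub>"
    using D_derivative by (simp_all add: affine_derivative_def hh_smult ge)
  have D0: "D \<zero>\<^bsub>hpa\<^esub> = \<zero>\<^bsub>hpa\<^esub>" by (rule linear_maps_zero[OF D_linear hpa.cvec_axioms hpa.cvec_axioms])
  have XY: "D (D (hh \<one>\<^bsub>HH\<^esub> X)) = \<zero>\<^bsub>hpa\<^esub>" "D (D (hh \<one>\<^bsub>HH\<^esub> Y)) = \<zero>\<^bsub>hpa\<^esub>"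
    by (simp_all add: DXY DD ge D_hor hor_nabla_gens Z)
  have mul: "D (D (hh \<one>\<^bsub>HH\<^esub> (s \<otimes>\<^bsub>SA\<^esub> t))) = \<zero>\<^bsub>hpa\<^esub>"
    if "s \<in> carrier SA" "t \<in> carrier SA" "D (D (hh \<one>\<^bsub>HH\<^esub> s)) = \<zero>\<^bsub>hpa\<^esub>" "D (D (hh \<one>\<^bsub>HH\<^esub> t)) = \<zero>\<^bsub>hpa\<^esub>" for s t
    using D2_leibniz[OF hP_deg_S[OF that(1)], of "hh \<one>\<^bsub>HH\<^esub> t"] that by (simp add: hP_mult_right)
  have one: "D (D (hh \<one>\<^bsub>HH\<^esub> \<one>\<^bsub>SA\<^esub>)) = \<zero>\<^bsub>hpa\<^esub>" by (simp add: D_hor nz Z D0)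
  have pow: "D (D (hh \<one>\<^bsub>HH\<^esub> (z [^]\<^bsub>SA\<^esub> (n::nat)))) = \<zero>\<^bsub>hpa\<^esub>" if "z \<in> {X, Y}" for z n
    using that one mul XY by (induction n) auto
  show ?thesis
  proof (rule S_linear_eq[OF hpa.cvec_axioms _ _ _ assms])
    show "(\<lambda>t. D (D (hh \<one>\<^bsub>HH\<^esub> t))) \<in> linear_maps SA hpa"
      by (rule linear_maps_comp[OF linear_maps_comp[OF hh_linear[OF HH.one_closed] D_linear] D_linear])
    show "(\<lambda>t. \<zero>\<^bsub>hpa\<^esub>) \<in> linear_maps SA hpa"
      by (rule linear_mapsI) simp_all
    show "D (D (hh \<one>\<^bsub>HH\<^esub> (smon (p, q)))) = \<zero>\<^bsub>hpa\<^esub>" for p q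
      by (simp add: smon_def mul pow)
  qed
qed


subsection \<open>The curvature on the powers of U\<close>

lemma rho_linear: "\<rho> \<in> linear_maps AA hpa"
  and D2_rho: "x \<in> carrier hpa \<Longrightarrow> D (D x) = \<ominus>\<^bsub>hpa\<^esub> tens_sum hpa (\<lambda>y c. y \<otimes>\<^bsub>hpa\<^esub> \<rho> c) (H x)"
  using rho_curvature by (auto simp: curvature_map_def)

text \<open>The right-hand side of the curvature equation with \<open>\<rho>\<close> translated by \<open>b\<close>: as \<open>H\<close> is multiplicative,
  a left factor of \<open>x\<close> can be traded for a right factor of \<open>b\<close>.\<close>

definition crv :: "aff_gen falg set \<Rightarrow> hform \<Rightarrow> hform" where
  "crv b x = tens_sum hpa (\<lambda>y c. y \<otimes>\<^bsub>hpa\<^esub> \<rho> (b \<otimes>\<^bsub>AA\<^esub> c)) (H x)"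

lemma crv_bilin: "b \<in> carrier AA \<Longrightarrow> bilin hpa AA hpa (\<lambda>y c. y \<otimes>\<^bsub>hpa\<^esub> \<rho> (b \<otimes>\<^bsub>AA\<^esub> c))"
  by (rule bilinI)
    (simp_all add: linear_mapsD[OF rho_linear] hpa.l_distr hpa.r_distr hpa.smult_mult_left hpa.smult_mult_right
      A.r_distr A.smult_mult_right)

lemma crv_closed: "b \<in> carrier AA \<Longrightarrow> x \<in> carrier hpa \<Longrightarrow> crv b x \<in> carrier hpa"
  unfolding crv_def by (rule linear_mapsD(1)[OF HA.tens_sum_linear[OF hpa.cvec_axioms crv_bilin]]) (simp_all add: HD)

lemma crv_tens:
  assumes "b \<in> carrier AA" "z \<in> carrier hpa" "e \<in> carrier AA" "T \<in> carrier HA.T"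
  shows "tens_sum hpa (\<lambda>y c. y \<otimes>\<^bsub>hpa\<^esub> \<rho> (b \<otimes>\<^bsub>AA\<^esub> c)) (tn z e \<otimes>\<^bsub>HA.TA\<^esub> T) =
    z \<otimes>\<^bsub>hpa\<^esub> tens_sum hpa (\<lambda>y c. y \<otimes>\<^bsub>hpa\<^esub> \<rho> ((b \<otimes>\<^bsub>AA\<^esub> e) \<otimes>\<^bsub>AA\<^esub> c)) T"
proof (rule HA.linear_maps_eq_on_tens[OF _ _ hpa.cvec_axioms assms(4)])
  note L = HA.tens_sum_linear[OF hpa.cvec_axioms crv_bilin]
  have mult: "(\<lambda>T. tn z e \<otimes>\<^bsub>HA.TA\<^esub> T) \<in> linear_maps HA.T HA.T"
    using assms by (intro linear_mapsI)
      (simp_all add: HA.TA.m_closed[simplified] HA.TA.r_distr[simplified] HA.TA.smult_mult_right[simplified])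
  show "(\<lambda>T. tens_sum hpa (\<lambda>y c. y \<otimes>\<^bsub>hpa\<^esub> \<rho> (b \<otimes>\<^bsub>AA\<^esub> c)) (tn z e \<otimes>\<^bsub>HA.TA\<^esub> T)) \<in> linear_maps HA.T hpa"
    by (rule linear_maps_comp[OF mult L[OF assms(1)]])
  have mult': "(\<lambda>x. z \<otimes>\<^bsub>hpa\<^esub> x) \<in> linear_maps hpa hpa"
    using assms by (intro linear_mapsI) (simp_all add: hpa.r_distr hpa.smult_mult_right)
  show "(\<lambda>T. z \<otimes>\<^bsub>hpa\<^esub> tens_sum hpa (\<lambda>y c. y \<otimes>\<^bsub>hpa\<^esub> \<rho> ((b \<otimes>\<^bsub>AA\<^esub> e) \<otimes>\<^bsub>AA\<^esub> c)) T) \<in> linear_maps HA.T hpa"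
    using assms by (intro linear_maps_comp[OF L mult']) simp
  show "tens_sum hpa (\<lambda>y c. y \<otimes>\<^bsub>hpa\<^esub> \<rho> (b \<otimes>\<^bsub>AA\<^esub> c)) (tn z e \<otimes>\<^bsub>HA.TA\<^esub> tn x c) =
    z \<otimes>\<^bsub>hpa\<^esub> tens_sum hpa (\<lambda>y c. y \<otimes>\<^bsub>hpa\<^esub> \<rho> ((b \<otimes>\<^bsub>AA\<^esub> e) \<otimes>\<^bsub>AA\<^esub> c)) (tn x c)"
    if "x \<in> carrier hpa" "c \<in> carrier AA" for x c
    using assms that
    by (simp add: HA.TA_mult HA.tens_sum_tens[OF hpa.cvec_axioms crv_bilin] linear_mapsD[OF rho_linear]
        hpa.m_assoc A.m_assoc)
qed

lemma crv_hor:
  assumes "hhom a d" "b \<in> carrier AA" "x \<in> carrier hpa"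
  shows "crv b (hh a \<one>\<^bsub>SA\<^esub> \<otimes>\<^bsub>hpa\<^esub> x) = hh a \<one>\<^bsub>SA\<^esub> \<otimes>\<^bsub>hpa\<^esub> crv (b \<otimes>\<^bsub>AA\<^esub> au d) x"
  using assms hhom_carrier[OF assms(1)] by (simp add: crv_def HD H_hor crv_tens)

lemma crv_S:
  assumes "b \<in> carrier AA" "x \<in> carrier hpa"
  shows "crv b (hh \<one>\<^bsub>HH\<^esub> X \<otimes>\<^bsub>hpa\<^esub> x) = crv (b \<otimes>\<^bsub>AA\<^esub> aX) x \<oplus>\<^bsub>hpa\<^esub> (hh \<one>\<^bsub>HH\<^esub> X \<otimes>\<^bsub>hpa\<^esub> crv (b \<otimes>\<^bsub>AA\<^esub> au 2) x)"
    "crv b (hh \<one>\<^bsub>HH\<^esub> Y \<otimes>\<^bsub>hpa\<^esub> x) = crv (b \<otimes>\<^bsub>AA\<^esub> aY) x \<oplus>\<^bsub>hpa\<^esub> (hh \<one>\<^bsub>HH\<^esub> Y \<otimes>\<^bsub>hpa\<^esub> crv (b \<otimes>\<^bsub>AA\<^esub> au (- 2)) x)"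
  using assms crv_closed[of _ x]
  by (simp_all add: crv_def HD H_S HA.TA.l_distr[simplified] HA.TA.m_closed[simplified] crv_tens
      linear_mapsD(2)[OF HA.tens_sum_linear[OF hpa.cvec_axioms crv_bilin]])

lemma crv_smult: "b \<in> carrier AA \<Longrightarrow> x \<in> carrier hpa \<Longrightarrow> crv (r \<odot>\<^bsub>AA\<^esub> b) x = r \<odot>\<^bsub>hpa\<^esub> crv b x"
proof -
  assume b: "b \<in> carrier AA" and x: "x \<in> carrier hpa"
  note L = HA.tens_sum_linear[OF hpa.cvec_axioms crv_bilin]
  have sm: "(\<lambda>x. r \<odot>\<^bsub>hpa\<^esub> x) \<in> linear_maps hpa hpa"
    by (rule linear_mapsI) (simp_all add: hpa.smult_add_right hpa.smult_smult mult.commute)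
  show ?thesis
    unfolding crv_def
    by (rule HA.linear_maps_eq_on_tens[OF L linear_maps_comp[OF L sm] hpa.cvec_axioms HD(1)[OF x]])
      (use b in \<open>simp_all add: HA.tens_sum_tens[OF hpa.cvec_axioms crv_bilin] A.smult_mult_left
        linear_mapsD[OF rho_linear] hpa.smult_mult_right\<close>)
qed

lemma crv_one: "b \<in> carrier AA \<Longrightarrow> crv b \<one>\<^bsub>hpa\<^esub> = \<rho> b"
  by (simp add: crv_def HD HA.tens_sum_tens[OF hpa.cvec_axioms crv_bilin] linear_mapsD[OF rho_linear])

lemma crv_D2: "x \<in> carrier hpa \<Longrightarrow> crv \<one>\<^bsub>AA\<^esub> x = \<ominus>\<^bsub>hpa\<^esub> D (D x)"
proof -
  assume x: "x \<in> carrier hpa"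
  have "crv \<one>\<^bsub>AA\<^esub> x = tens_sum hpa (\<lambda>y c. y \<otimes>\<^bsub>hpa\<^esub> \<rho> c) (H x)"
    unfolding crv_def
  proof (rule HA.linear_maps_eq_on_tens[OF _ _ hpa.cvec_axioms])
    have bl: "bilin hpa AA hpa (\<lambda>y c. y \<otimes>\<^bsub>hpa\<^esub> \<rho> c)"
      by (rule bilinI)
        (simp_all add: linear_mapsD[OF rho_linear] hpa.l_distr hpa.r_distr hpa.smult_mult_left hpa.smult_mult_right)
    note L = HA.tens_sum_linear[OF hpa.cvec_axioms bl] HA.tens_sum_linear[OF hpa.cvec_axioms crv_bilin[OF A.one_closed]]
    show "tens_sum hpa (\<lambda>y c. y \<otimes>\<^bsub>hpa\<^esub> \<rho> (\<one>\<^bsub>AA\<^esub> \<otimes>\<^bsub>AA\<^esub> c)) \<in> linear_maps HA.T hpa"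
      "tens_sum hpa (\<lambda>y c. y \<otimes>\<^bsub>hpa\<^esub> \<rho> c) \<in> linear_maps HA.T hpa" by (rule L)+
    show "tens_sum hpa (\<lambda>y c. y \<otimes>\<^bsub>hpa\<^esub> \<rho> (\<one>\<^bsub>AA\<^esub> \<otimes>\<^bsub>AA\<^esub> c)) (tn x c) = tens_sum hpa (\<lambda>y c. y \<otimes>\<^bsub>hpa\<^esub> \<rho> c) (tn x c)"
      if "x \<in> carrier hpa" "c \<in> carrier AA" for x c
      using that HA.tens_sum_tens[OF hpa.cvec_axioms bl] HA.tens_sum_tens[OF hpa.cvec_axioms crv_bilin[OF A.one_closed]]
      by simp
    show "H x \<in> carrier HA.T" using x by (rule HD(1))
  qed
  then show ?thesis
    using x crv_closed[OF A.one_closed x] by (simp add: D2_rho)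
qed

abbreviation "vol_hp \<equiv> hh \<omega> \<one>\<^bsub>SA\<^esub>"

definition W :: complex where "W = m ^ 3 / (1 - m\<^sup>2)"

lemma m2_ne1: "1 - m\<^sup>2 \<noteq> 0"
proof -
  have "\<mu>\<^sup>2 < 1" using mu_pow_lt1[of 2] by simp
  then have "complex_of_real (1 - \<mu>\<^sup>2) \<noteq> 0" unfolding of_real_eq_0_iff by simp
  then show ?thesis by simp
qed

lemma W_nz: "W \<noteq> 0"
  using m2_ne1 by (simp add: W_def)

lemma (in cvec) shift_smult:
  assumes "A \<in> carrier M" "B \<in> carrier M" "V \<in> carrier M" "A \<oplus> ((- s) \<odot> V \<oplus> B) = t \<odot> V"
  shows "A \<oplus> B = (t + s) \<odot> V"
proof -
  have "(- s) \<odot> V \<oplus> s \<odot> V = \<zero>" using smult_add_left[of V "- s" s] assms(3) by simp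
  then have "A \<oplus> (B \<oplus> ((- s) \<odot> V \<oplus> s \<odot> V)) = A \<oplus> B" using assms(1-3) by simp
  then have "A \<oplus> B = (A \<oplus> ((- s) \<odot> V \<oplus> B)) \<oplus> s \<odot> V" using assms(1-3) by (simp add: a_ac)
  then show ?thesis unfolding assms(4) using assms(3) by (simp add: smult_add_left)
qed

text \<open>Columns of the fundamental matrix can be cancelled on the left, by unitarity.\<close>

lemma hor_cancel:
  assumes "a' \<in> carrier HH" "a \<in> carrier HH" "b' \<in> carrier HH" "b \<in> carrier HH"
    and u: "(a' \<otimes>\<^bsub>HH\<^esub> a) \<oplus>\<^bsub>HH\<^esub> (c \<odot>\<^bsub>HH\<^esub> (b' \<otimes>\<^bsub>HH\<^esub> b)) = \<one>\<^bsub>HH\<^esub>"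
    and z: "z \<in> carrier hpa" "z' \<in> carrier hpa"
      "\<And>y. y \<in> {a, b} \<Longrightarrow> hh y \<one>\<^bsub>SA\<^esub> \<otimes>\<^bsub>hpa\<^esub> z = hh y \<one>\<^bsub>SA\<^esub> \<otimes>\<^bsub>hpa\<^esub> z'"
  shows "z = z'"
proof -
  have *: "z = (hh a' \<one>\<^bsub>SA\<^esub> \<otimes>\<^bsub>hpa\<^esub> (hh a \<one>\<^bsub>SA\<^esub> \<otimes>\<^bsub>hpa\<^esub> z)) \<oplus>\<^bsub>hpa\<^esub>
      (c \<odot>\<^bsub>hpa\<^esub> (hh b' \<one>\<^bsub>SA\<^esub> \<otimes>\<^bsub>hpa\<^esub> (hh b \<one>\<^bsub>SA\<^esub> \<otimes>\<^bsub>hpa\<^esub> z)))" if z: "z \<in> carrier hpa" for z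
  proof -
    have "z = hh ((a' \<otimes>\<^bsub>HH\<^esub> a) \<oplus>\<^bsub>HH\<^esub> (c \<odot>\<^bsub>HH\<^esub> (b' \<otimes>\<^bsub>HH\<^esub> b))) \<one>\<^bsub>SA\<^esub> \<otimes>\<^bsub>hpa\<^esub> z"
      using z unfolding u by (simp add: hh_one[symmetric])
    then show ?thesis
      using assms(1-4) z by (simp add: hh_add hh_smult hpa.l_distr hpa.smult_mult_left hP_mult_left[symmetric] hpa.m_assoc)
  qed
  have "hh a \<one>\<^bsub>SA\<^esub> \<otimes>\<^bsub>hpa\<^esub> z = hh a \<one>\<^bsub>SA\<^esub> \<otimes>\<^bsub>hpa\<^esub> z'" "hh b \<one>\<^bsub>SA\<^esub> \<otimes>\<^bsub>hpa\<^esub> z = hh b \<one>\<^bsub>SA\<^esub> \<otimes>\<^bsub>hpa\<^esub> z'"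
    using z(3) by simp_all
  then show ?thesis using *[OF z(1)] *[OF z(2)] by simp
qed

text \<open>The formula for U^n is applied to y x. On the left, \<open>crv_hor\<close> pulls y out
  and raises n by its degree d, and the square of D leaves the extra term -s y \<omega> x; on the
  right, \<omega> y = k y \<omega>. Cancelling y gives r k + s. The pair (k, s) is (1/\<mu>^2,
  \<mu>) for \<alpha> and \<gamma>, and (\<mu>^2, -\<mu>^3) for their adjoints.\<close>

lemma crv_step:
  assumes "a' \<in> carrier HH" "b' \<in> carrier HH" "(a' \<otimes>\<^bsub>HH\<^esub> a) \<oplus>\<^bsub>HH\<^esub> (c \<odot>\<^bsub>HH\<^esub> (b' \<otimes>\<^bsub>HH\<^esub> b)) = \<one>\<^bsub>HH\<^esub>"
    and y: "\<And>y. y \<in> {a, b} \<Longrightarrow> hhom y d" "\<And>y. y \<in> {a, b} \<Longrightarrow> \<omega> \<otimes>\<^bsub>HH\<^esub> y = k \<odot>\<^bsub>HH\<^esub> (y \<otimes>\<^bsub>HH\<^esub> \<omega>)"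
      "\<And>y. y \<in> {a, b} \<Longrightarrow> hor_nabla \<mu> (hor_nabla \<mu> y) = (- s) \<odot>\<^bsub>HH\<^esub> (y \<otimes>\<^bsub>HH\<^esub> \<omega>)"
      "\<And>y. y \<in> {a, b} \<Longrightarrow> hor_nabla \<mu> y \<in> carrier HH" "\<And>y. y \<in> {a, b} \<Longrightarrow> hh y \<one>\<^bsub>SA\<^esub> \<in> hP_deg \<mu> 0"
    and IH: "\<And>x. x \<in> carrier hpa \<Longrightarrow> crv (au n) x \<oplus>\<^bsub>hpa\<^esub> D (D x) = r \<odot>\<^bsub>hpa\<^esub> (vol_hp \<otimes>\<^bsub>hpa\<^esub> x)"
    and x: "x \<in> carrier hpa"
  shows "crv (au (n + d)) x \<oplus>\<^bsub>hpa\<^esub> D (D x) = (r * k + s) \<odot>\<^bsub>hpa\<^esub> (vol_hp \<otimes>\<^bsub>hpa\<^esub> x)"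
proof (rule hor_cancel[OF assms(1) _ assms(2) _ assms(3)])
  have yc: "y \<in> carrier HH" if "y \<in> {a, b}" for y using y(1)[OF that] by (rule hhom_carrier)
  then show "a \<in> carrier HH" "b \<in> carrier HH" by simp_all
  have oc: "vol_hp \<in> carrier hpa" using omega_closed by simp
  have cc: "crv (au (n + d)) x \<in> carrier hpa" using x by (simp add: crv_closed)
  show "crv (au (n + d)) x \<oplus>\<^bsub>hpa\<^esub> D (D x) \<in> carrier hpa" "(r * k + s) \<odot>\<^bsub>hpa\<^esub> (vol_hp \<otimes>\<^bsub>hpa\<^esub> x) \<in> carrier hpa"
    using x oc cc by (simp_all add: DD)
  fix y assume yab: "y \<in> {a, b}"
  note yy = y[OF yab] and yc = yc[OF yab]
  let ?y = "hh y \<one>\<^bsub>SA\<^esub>"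
  have yh: "?y \<in> carrier hpa" using yc by simp
  have D2y: "D (D ?y) = (- s) \<odot>\<^bsub>hpa\<^esub> (?y \<otimes>\<^bsub>hpa\<^esub> vol_hp)"
    using yy yc omega_closed by (simp add: D_hor hh_smult hP_mult_left)
  have oy: "vol_hp \<otimes>\<^bsub>hpa\<^esub> ?y = k \<odot>\<^bsub>hpa\<^esub> (?y \<otimes>\<^bsub>hpa\<^esub> vol_hp)"
    using yy yc omega_closed by (simp add: hh_smult hP_mult_left)
  have "crv (au n) (?y \<otimes>\<^bsub>hpa\<^esub> x) \<oplus>\<^bsub>hpa\<^esub> D (D (?y \<otimes>\<^bsub>hpa\<^esub> x)) = r \<odot>\<^bsub>hpa\<^esub> ((vol_hp \<otimes>\<^bsub>hpa\<^esub> ?y) \<otimes>\<^bsub>hpa\<^esub> x)"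
    using IH[of "?y \<otimes>\<^bsub>hpa\<^esub> x"] yh x oc by (simp add: hpa.m_assoc)
  then have "(?y \<otimes>\<^bsub>hpa\<^esub> crv (au (n + d)) x) \<oplus>\<^bsub>hpa\<^esub>
      ((- s) \<odot>\<^bsub>hpa\<^esub> (?y \<otimes>\<^bsub>hpa\<^esub> (vol_hp \<otimes>\<^bsub>hpa\<^esub> x)) \<oplus>\<^bsub>hpa\<^esub> (?y \<otimes>\<^bsub>hpa\<^esub> D (D x))) =
      (r * k) \<odot>\<^bsub>hpa\<^esub> (?y \<otimes>\<^bsub>hpa\<^esub> (vol_hp \<otimes>\<^bsub>hpa\<^esub> x))"
    using yh x oc
    by (simp add: crv_hor[OF yy(1)] A.up_add D2_leibniz[OF yy(5)] D2y oy hpa.smult_mult_left hpa.m_assoc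
        hpa.smult_smult)
  from hpa.shift_smult[OF _ _ _ this]
  show "?y \<otimes>\<^bsub>hpa\<^esub> (crv (au (n + d)) x \<oplus>\<^bsub>hpa\<^esub> D (D x)) = ?y \<otimes>\<^bsub>hpa\<^esub> ((r * k + s) \<odot>\<^bsub>hpa\<^esub> (vol_hp \<otimes>\<^bsub>hpa\<^esub> x))"
    using yh x oc cc by (simp add: DD hpa.r_distr hpa.smult_mult_right)
qed

text \<open>Adding the square of D makes the left-hand side vanish at n = 0, by the curvature
  equation. From there the induction goes upwards with \<alpha>, \<gamma> and downwards with their
  adjoints.\<close>

lemma crv_au: "x \<in> carrier hpa \<Longrightarrow>
  crv (au n) x \<oplus>\<^bsub>hpa\<^esub> D (D x) = (W * (m powi (- 2 * n) - 1)) \<odot>\<^bsub>hpa\<^esub> (vol_hp \<otimes>\<^bsub>hpa\<^esub> x)"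
proof (induction n arbitrary: x rule: int_induct[where k = 0])
  case base
  then show ?case using omega_closed by (simp add: crv_D2 DD hpa.l_neg)
next
  case (step1 i)
  have gc: "al \<mu> \<in> carrier HH" "al_st \<mu> \<in> carrier HH" "ga \<mu> \<in> carrier HH" "ga_st \<mu> \<in> carrier HH"
    "eta_plus \<mu> \<in> carrier HH" "eta_minus \<mu> \<in> carrier HH"
    by (rule hor_gens_closed, simp)+
  have nn: "hor_nabla \<mu> (hor_nabla \<mu> y) = (- complex_of_real \<mu>) \<odot>\<^bsub>HH\<^esub> (y \<otimes>\<^bsub>HH\<^esub> \<omega>)" if "y \<in> {al \<mu>, ga \<mu>}" for y
    using that nabla_nabla by auto
  have "crv (au (i + 1)) x \<oplus>\<^bsub>hpa\<^esub> D (D x) =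
    ((W * (m powi (- 2 * i) - 1)) * complex_of_real (1 / \<mu>\<^sup>2) + complex_of_real \<mu>) \<odot>\<^bsub>hpa\<^esub> (vol_hp \<otimes>\<^bsub>hpa\<^esub> x)"
    by (rule crv_step[OF gc(2,4) hor_unitarity(1) _ _ nn _ _ step1.IH step1.prems])
      (auto simp: hhom_gens omega_comm hor_nabla_gens gc intro: hP_deg_hor)
  \<comment> \<open>After cancelling the terms with powers of n this is W(1 - \<mu>^2) = \<mu>^3,
    the equation that determines W; the downward step rests on the same equation.\<close>
  moreover have "(W * (m powi (- 2 * i) - 1)) * complex_of_real (1 / \<mu>\<^sup>2) + complex_of_real \<mu> =
      W * (m powi (- 2 * (i + 1)) - 1)"
  proof -
    have "m powi (- 2 * (i + 1)) = m powi (- 2 * i) / m\<^sup>2"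
      using power_int_add[OF disjI1[OF m_nz], of "- 2 * i" "- 2"] by (simp add: power_int_minus field_simps)
    moreover have "W * (1 - m\<^sup>2) = m ^ 3" using m2_ne1 by (simp add: W_def)
    ultimately show ?thesis
      using m_nz by (simp add: field_simps power2_eq_square power3_eq_cube) algebra
  qed
  ultimately show ?case by simp
next
  case (step2 i)
  have gc: "al \<mu> \<in> carrier HH" "al_st \<mu> \<in> carrier HH" "ga \<mu> \<in> carrier HH" "ga_st \<mu> \<in> carrier HH"
    "eta_plus \<mu> \<in> carrier HH" "eta_minus \<mu> \<in> carrier HH"
    by (rule hor_gens_closed, simp)+
  have nn: "hor_nabla \<mu> (hor_nabla \<mu> y) = (- (- complex_of_real (\<mu> ^ 3))) \<odot>\<^bsub>HH\<^esub> (y \<otimes>\<^bsub>HH\<^esub> \<omega>)" if "y \<in> {al_st \<mu>, ga_st \<mu>}" for y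
    using that nabla_nabla by auto
  have "crv (au (i + - 1)) x \<oplus>\<^bsub>hpa\<^esub> D (D x) =
    ((W * (m powi (- 2 * i) - 1)) * complex_of_real (\<mu>\<^sup>2) + (- complex_of_real (\<mu> ^ 3))) \<odot>\<^bsub>hpa\<^esub> (vol_hp \<otimes>\<^bsub>hpa\<^esub> x)"
    by (rule crv_step[OF gc(1,3) hor_unitarity(2) _ _ nn _ _ step2.IH step2.prems])
      (auto simp: hhom_gens omega_comm hor_nabla_gens gc intro: hP_deg_hor)
  moreover have "(W * (m powi (- 2 * i) - 1)) * complex_of_real (\<mu>\<^sup>2) + (- complex_of_real (\<mu> ^ 3)) =
      W * (m powi (- 2 * (i - 1)) - 1)"
  proof -
    have "m powi (- 2 * (i - 1)) = m powi (- 2 * i) * m\<^sup>2"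
      using power_int_add[OF disjI1[OF m_nz], of "- 2 * i" "2"] by (simp add: algebra_simps)
    moreover have "W * (1 - m\<^sup>2) = m ^ 3" using m2_ne1 by (simp add: W_def)
    ultimately show ?thesis by (simp add: algebra_simps) algebra
  qed
  ultimately show ?case by simp
qed


subsection \<open>The curvature on the monomials\<close>

definition cc :: "nat \<Rightarrow> nat \<Rightarrow> real" where
  "cc p q = (\<Prod>i=1..p. 1 - 1 / \<mu> ^ (2 * i + 2)) * (\<Prod>j=1..q. 1 - \<mu> ^ (2 * j + 2))"

lemma cc_simps: "cc 0 0 = 1" "cc (Suc p) 0 = (1 - 1 / \<mu> ^ (2 * p + 4)) * cc p 0"
  "cc p (Suc q) = (1 - \<mu> ^ (2 * q + 4)) * cc p q"
  by (simp_all add: cc_def numeral_eq_Suc mult_ac)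

lemma cc_nz: "cc p q \<noteq> 0"
proof -
  have "1 - 1 / \<mu> ^ (2 * i + 2) \<noteq> 0" "1 - \<mu> ^ (2 * i + 2) \<noteq> 0" for i
    using mu_pow_ne1[of "2 * i + 2"] by (auto simp: field_simps)
  then show ?thesis unfolding cc_def by (simp only: mult_eq_0_iff prod_zero_iff finite_atLeastAtMost) blast
qed

text \<open>The subtracted constant occurs for p = q = 0 only: the first factor \<xi> or its adjoint
  takes a plain difference of values at two exponents n, in which it cancels.\<close>

definition KK :: "int \<Rightarrow> nat \<Rightarrow> nat \<Rightarrow> complex" where
  "KK n p q = W * (m powi (- 2 * n) * complex_of_real (cc p q) - (if p = 0 \<and> q = 0 then 1 else 0))"

text \<open>The hypothesis \<open>k * i = i\<close> covers both situations at once: either the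
  constant i is already gone, or p = q = 0, where the coefficient k is a zeroth power and equals
  1.\<close>

lemma KK_rec: "a' = a - k * b \<Longrightarrow> i' = 0 \<Longrightarrow> k * i = i \<Longrightarrow> W * (a' - i') = W * (a - i) - k * (W * (b - i))"
  by (auto simp: algebra_simps)

lemma KK_simps: "KK n (Suc p) 0 = KK n p 0 - (m powi (- 2)) ^ p * KK (n + 2) p 0"
  "KK n p (Suc q) = KK n p q - (m powi 2) ^ q * KK (n - 2) p q"
proof -
  have e: "m powi (- 2 * (n + 2)) = m powi (- 2 * n) / m ^ 4" "m powi (- 2 * (n - 2)) = m powi (- 2 * n) * m ^ 4"
    using power_int_add[OF disjI1[OF m_nz], of "- 2 * n" "- 4"] power_int_add[OF disjI1[OF m_nz], of "- 2 * n" "4"]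
    by (simp_all add: power_int_minus field_simps)
  have 1: "(m powi (- 2)) ^ p / m ^ 4 = 1 / m ^ (2 * p + 4)" "(m powi 2) ^ q * m ^ 4 = m ^ (2 * q + 4)"
    by (simp_all add: power_int_minus power_mult[symmetric] power_add field_simps power_inverse)
  have "m powi (- 2 * n) * complex_of_real (cc (Suc p) 0) = m powi (- 2 * n) * complex_of_real (cc p 0) -
    (m powi (- 2)) ^ p * (m powi (- 2 * (n + 2)) * complex_of_real (cc p 0))"
    unfolding cc_simps e of_real_mult of_real_diff of_real_divide of_real_power of_real_1 1(1)[symmetric]
    by (simp add: algebra_simps)
  note rule = KK_rec[OF this]
  show "KK n (Suc p) 0 = KK n p 0 - (m powi (- 2)) ^ p * KK (n + 2) p 0"
    unfolding KK_def by (rule rule) auto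
  have "m powi (- 2 * n) * complex_of_real (cc p (Suc q)) = m powi (- 2 * n) * complex_of_real (cc p q) -
    (m powi 2) ^ q * (m powi (- 2 * (n - 2)) * complex_of_real (cc p q))"
    unfolding cc_simps e of_real_mult of_real_diff of_real_divide of_real_power of_real_1 1(2)[symmetric]
    by (simp add: algebra_simps)
  note rule = KK_rec[OF this]
  show "KK n p (Suc q) = KK n p q - (m powi 2) ^ q * KK (n - 2) p q"
    unfolding KK_def by (rule rule) auto
qed

lemma (in cvec) minus_smult: "V \<in> carrier M \<Longrightarrow> A \<in> carrier M \<Longrightarrow> r \<odot> V = A \<oplus> s \<odot> V \<Longrightarrow> A = (r - s) \<odot> V"
  using shift_smult[of A "\<zero>" V "- s" r] by simp

text \<open>The volume form has U(1)-degree zero, so elements of S(V) pass it without a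
  twist.\<close>

lemma S_hh: "s \<in> carrier SA \<Longrightarrow> t \<in> carrier SA \<Longrightarrow> hh \<one>\<^bsub>HH\<^esub> s \<otimes>\<^bsub>hpa\<^esub> hh \<omega> t = hh \<omega> (s \<otimes>\<^bsub>SA\<^esub> t)"
  using hP_mult_hom[OF HH.one_closed _ hhom_omega] omega_closed by (simp add: sg_1)

lemma smon_X: "smon (p, 0) \<otimes>\<^bsub>SA\<^esub> X = smon (Suc p, 0)"
  and smon_Y: "smon (p, q) \<otimes>\<^bsub>SA\<^esub> Y = smon (p, Suc q)"
  by (simp_all add: smon_def S.m_assoc)

text \<open>On S(V) the square of D vanishes, so \<open>crv_au\<close> gives the case p = q = 0.
  Afterwards \<open>crv_S\<close> is solved for the term with the longer monomial: the value at b
  \<xi> is the value at b on \<xi> t minus \<xi> times the value at b U^2 on t. The element t is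
  arbitrary because the induction replaces it by \<xi> t. All factors \<xi> are added first and then
  their adjoints, which keeps the monomials ordered.\<close>

lemma crv_amon: "t \<in> carrier SA \<Longrightarrow>
  crv (amon n p q) (hh \<one>\<^bsub>HH\<^esub> t) = KK n p q \<odot>\<^bsub>hpa\<^esub> hh \<omega> (smon (p, q) \<otimes>\<^bsub>SA\<^esub> t)"
proof (induction q arbitrary: n t)
  case 0
  then show ?case
  proof (induction p arbitrary: n t)
    case 0
    have "amon n 0 0 = au n" by (simp add: amon_def)
    moreover have "crv (au n) (hh \<one>\<^bsub>HH\<^esub> t) = (W * (m powi (- 2 * n) - 1)) \<odot>\<^bsub>hpa\<^esub> hh \<omega> t"
      using crv_au[of "hh \<one>\<^bsub>HH\<^esub> t" n] 0 omega_closed crv_closed[OF A.up_closed, of "hh \<one>\<^bsub>HH\<^esub> t" n]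
      by (simp add: D2_S hP_mult_right)
    ultimately show ?case using 0 by (simp add: KK_def cc_simps smon_def)
  next
    case (Suc p)
    let ?V = "hh \<omega> (smon (Suc p, 0) \<otimes>\<^bsub>SA\<^esub> t)"
    have V: "?V \<in> carrier hpa" using Suc.prems omega_closed by simp
    have c: "crv (amon n (Suc p) 0) (hh \<one>\<^bsub>HH\<^esub> t) \<in> carrier hpa"
      using Suc.prems by (simp add: crv_closed)
    have "crv (amon n p 0) (hh \<one>\<^bsub>HH\<^esub> X \<otimes>\<^bsub>hpa\<^esub> hh \<one>\<^bsub>HH\<^esub> t) = KK n p 0 \<odot>\<^bsub>hpa\<^esub> ?V"
      using Suc.IH[of "X \<otimes>\<^bsub>SA\<^esub> t" n] Suc.prems
      by (simp add: hP_mult_right smon_X[symmetric] S.m_assoc)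
    moreover have "crv (amon n p 0 \<otimes>\<^bsub>AA\<^esub> aX) (hh \<one>\<^bsub>HH\<^esub> t) = crv (amon n (Suc p) 0) (hh \<one>\<^bsub>HH\<^esub> t)"
      by (simp add: amon_aX)
    moreover have "hh \<one>\<^bsub>HH\<^esub> X \<otimes>\<^bsub>hpa\<^esub> crv (amon n p 0 \<otimes>\<^bsub>AA\<^esub> au 2) (hh \<one>\<^bsub>HH\<^esub> t) =
        ((m powi (- 2)) ^ p * KK (n + 2) p 0) \<odot>\<^bsub>hpa\<^esub> ?V"
      using Suc.IH[of t "n + 2"] Suc.prems omega_closed
      by (simp add: au_amon crv_smult hpa.smult_mult_right hpa.smult_smult S_hh S.m_assoc[symmetric] X_smon)
    ultimately have "KK n p 0 \<odot>\<^bsub>hpa\<^esub> ?V = crv (amon n (Suc p) 0) (hh \<one>\<^bsub>HH\<^esub> t) \<oplus>\<^bsub>hpa\<^esub>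
        ((m powi (- 2)) ^ p * KK (n + 2) p 0) \<odot>\<^bsub>hpa\<^esub> ?V"
      using crv_S(1)[OF amon_closed, of "hh \<one>\<^bsub>HH\<^esub> t" n p 0] Suc.prems by simp
    from hpa.minus_smult[OF V c this] show ?case by (simp only: KK_simps)
  qed
next
  case (Suc q)
  let ?V = "hh \<omega> (smon (p, Suc q) \<otimes>\<^bsub>SA\<^esub> t)"
  have V: "?V \<in> carrier hpa" using Suc.prems omega_closed by simp
  have c: "crv (amon n p (Suc q)) (hh \<one>\<^bsub>HH\<^esub> t) \<in> carrier hpa"
    using Suc.prems by (simp add: crv_closed)
  have "crv (amon n p q) (hh \<one>\<^bsub>HH\<^esub> Y \<otimes>\<^bsub>hpa\<^esub> hh \<one>\<^bsub>HH\<^esub> t) = KK n p q \<odot>\<^bsub>hpa\<^esub> ?V"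
    using Suc.IH[of "Y \<otimes>\<^bsub>SA\<^esub> t" n] Suc.prems
    by (simp add: hP_mult_right smon_Y[symmetric] S.m_assoc)
  moreover have "crv (amon n p q \<otimes>\<^bsub>AA\<^esub> aY) (hh \<one>\<^bsub>HH\<^esub> t) = crv (amon n p (Suc q)) (hh \<one>\<^bsub>HH\<^esub> t)"
    by (simp add: amon_aY)
  moreover have "hh \<one>\<^bsub>HH\<^esub> Y \<otimes>\<^bsub>hpa\<^esub> crv (amon n p q \<otimes>\<^bsub>AA\<^esub> au (- 2)) (hh \<one>\<^bsub>HH\<^esub> t) =
      ((m powi 2) ^ q * KK (n - 2) p q) \<odot>\<^bsub>hpa\<^esub> ?V"
  proof -
    \<comment> \<open>Moving U^(-2) out of the monomial costs \<mu>^2 for each of its p + q letters;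
      moving the new adjoint of \<xi> past the p letters \<xi> gives back \<mu>^(-2) for each of
      these.\<close>
    have "(m powi 2) ^ (p + q) * (1 / m\<^sup>2) ^ p = (m powi 2) ^ q"
      by (simp add: power_add power_divide)
    then show ?thesis
      using Suc.IH[of t "n - 2"] Suc.prems omega_closed
      by (simp add: au_amon crv_smult hpa.smult_mult_right hpa.smult_smult S_hh S.m_assoc[symmetric] Y_smon
          S.smult_mult_left hh_smult mult_ac)
  qed
  ultimately have "KK n p q \<odot>\<^bsub>hpa\<^esub> ?V = crv (amon n p (Suc q)) (hh \<one>\<^bsub>HH\<^esub> t) \<oplus>\<^bsub>hpa\<^esub>
      ((m powi 2) ^ q * KK (n - 2) p q) \<odot>\<^bsub>hpa\<^esub> ?V"
    using crv_S(2)[OF amon_closed, of "hh \<one>\<^bsub>HH\<^esub> t" n p q] Suc.prems by simp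
  from hpa.minus_smult[OF V c this] show ?case by (simp only: KK_simps)
qed

lemma rho_amon: "\<rho> (amon n p q) = KK n p q \<odot>\<^bsub>hpa\<^esub> hh \<omega> (smon (p, q))"
  using crv_amon[of "\<one>\<^bsub>SA\<^esub>" n p q] crv_one[of "amon n p q"] by (simp add: hh_one)

end

section \<open>Bases of quotients\<close>

lemma pm_scale_pointwise: "\<exists>g. \<forall>i. lookup g i = r i * lookup f i" for f :: "'i \<Rightarrow>\<^sub>0 complex"
proof -
  obtain g where g: "keys g \<subseteq> keys f" "\<forall>i\<in>keys f. lookup g i = r i * lookup f i"
    using ex_pm[of "keys f" "\<lambda>i. r i * lookup f i"] by auto
  then have "lookup g i = r i * lookup f i" for i
    by (cases "i \<in> keys f") (auto simp: in_keys_iff)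
  then show ?thesis by blast
qed

text \<open>The linear algebra behind the basis: finitely supported coordinates with kernel exactly
  N, and vectors whose coordinates are nonzero multiples of the unit vectors, which therefore
  represent a basis of the quotient.\<close>

locale coord_quot = csub +
  fixes \<kappa> :: "'a \<Rightarrow> 'i \<Rightarrow> complex" and b :: "'i \<Rightarrow> 'a" and c :: "'i \<Rightarrow> complex"
  assumes k_linear: "\<kappa> \<in> linear_maps M fun_vec"
    and k_kernel: "x \<in> carrier M \<Longrightarrow> x \<in> N \<longleftrightarrow> \<kappa> x = (\<lambda>_. 0)"
    and b_closed: "b i \<in> carrier M" and k_b: "\<kappa> (b i) = (\<lambda>j. if j = i then c i else 0)" and c_nz: "c i \<noteq> 0"
    and k_finite: "x \<in> carrier M \<Longrightarrow> \<exists>f :: 'i \<Rightarrow>\<^sub>0 complex. \<kappa> x = lookup f"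
begin

abbreviation "Q \<equiv> quot_mod M N"

interpretation Q: cvec Q by (rule cvec_quot)

lemma k_simps: "x \<in> carrier M \<Longrightarrow> y \<in> carrier M \<Longrightarrow> \<kappa> (x \<oplus> y) = (\<lambda>i. \<kappa> x i + \<kappa> y i)"
  "x \<in> carrier M \<Longrightarrow> \<kappa> (s \<odot> x) = (\<lambda>i. s * \<kappa> x i)" "\<kappa> \<zero> = (\<lambda>_. 0)"
  using linear_mapsD(2,3)[OF k_linear] linear_maps_zero[OF k_linear cvec_axioms cvec_fun_vec] by simp_all

lemma coset_eq_k: "x \<in> carrier M \<Longrightarrow> y \<in> carrier M \<Longrightarrow> N +> x = N +> y \<longleftrightarrow> \<kappa> x = \<kappa> y"
  by (simp add: coset_eq_iff k_kernel a_minus_def smult_minus_one[symmetric] k_simps fun_eq_iff)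

lemma k_sum: "\<kappa> (pm_sum M b f) = (\<lambda>i. c i * lookup f i)"
proof -
  have "keys f \<subseteq> UNIV" by simp
  then show ?thesis
  proof (induction rule: pm_induct)
    case (add f g)
    then show ?case
      by (simp add: pm_sum_add pm_sum_closed b_closed k_simps lookup_add algebra_simps)
  next
    case (single i s)
    then show ?case
      by (auto simp: pm_sum_single b_closed k_simps k_b lookup_single when_def fun_eq_iff)
  qed (simp add: k_simps)
qed

lemma sum_coset: "pm_sum Q (\<lambda>i. N +> b i) f = N +> pm_sum M b f"
  using linear_maps_pm_sum[OF quot_linear cvec_axioms cvec_quot, of b f] b_closed by auto

lemma basis_quot: "basis_family Q (\<lambda>i. N +> b i)"
  unfolding basis_family_def pm_sum_def[symmetric] sum_coset
proof (intro conjI allI ballI)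
  show "N +> b i \<in> carrier Q" for i using b_closed by simp
  fix x assume "x \<in> carrier Q"
  then obtain a where a: "a \<in> carrier M" "x = N +> a" by auto
  have eq: "x = N +> pm_sum M b f \<longleftrightarrow> (\<forall>i. \<kappa> a i = c i * lookup f i)" for f
    using a by (simp add: coset_eq_k pm_sum_closed b_closed k_sum fun_eq_iff)
  obtain g where "\<kappa> a = lookup g" using k_finite a by blast
  then obtain f where f: "\<And>i. lookup f i = \<kappa> a i / c i"
    using pm_scale_pointwise[of "\<lambda>i. 1 / c i" g] by auto
  show "\<exists>!f. x = N +> pm_sum M b f"
    unfolding eq
  proof (rule ex1I[of _ f])
    show "\<forall>i. \<kappa> a i = c i * lookup f i" by (simp add: f c_nz)
    show "h = f" if "\<forall>i. \<kappa> a i = c i * lookup h i" for h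
      using that c_nz by (intro poly_mapping_eqI) (simp add: f)
  qed
qed

text \<open>Finitely many classes involve finitely many coordinates altogether. Some further
  coordinate i vanishes on their whole span, yet not on the class of \<open>b i\<close>.\<close>

lemma infinite_dimensional_quot:
  assumes "infinite (UNIV :: 'i set)" shows "\<not> finite_dimensional Q"
proof
  assume "finite_dimensional Q"
  then obtain K where K: "finite K" "K \<subseteq> carrier Q" "lin_span Q K = carrier Q"
    by (auto simp: finite_dimensional_def)
  have "\<exists>F. finite F \<and> (\<forall>i. i \<notin> F \<longrightarrow> (\<exists>a\<in>carrier M. x = N +> a \<and> \<kappa> a i = 0))" if x: "x \<in> K" for x
  proof -
    obtain a where a: "a \<in> carrier M" "x = N +> a" using subsetD[OF K(2) x] by auto
    obtain f where "\<kappa> a = lookup f" using k_finite a by blast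
    then show ?thesis using a by (intro exI[of _ "keys f"]) (auto simp: in_keys_iff)
  qed
  then obtain F where F: "\<And>x. x \<in> K \<Longrightarrow> finite (F x)"
    "\<And>x i. x \<in> K \<Longrightarrow> i \<notin> F x \<Longrightarrow> \<exists>a\<in>carrier M. x = N +> a \<and> \<kappa> a i = 0"
    by metis
  have "finite (\<Union>x\<in>K. F x)" using F K by blast
  then obtain i where i: "i \<notin> (\<Union>x\<in>K. F x)" using assms ex_new_if_finite by blast
  have "N +> b i \<in> lin_span Q K" using K(3) b_closed by simp
  then have "\<exists>a\<in>carrier M. N +> b i = N +> a \<and> \<kappa> a i = 0"
  proof (rule Q.lin_span_induct[OF _ K(2)])
    show "\<exists>a\<in>carrier M. \<zero>\<^bsub>Q\<^esub> = N +> a \<and> \<kappa> a i = 0"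
      by (rule bexI[of _ \<zero>]) (simp_all add: k_simps)
    show "\<exists>a\<in>carrier M. x \<oplus>\<^bsub>Q\<^esub> y = N +> a \<and> \<kappa> a i = 0"
      if h: "\<exists>a\<in>carrier M. x = N +> a \<and> \<kappa> a i = 0" "\<exists>a\<in>carrier M. y = N +> a \<and> \<kappa> a i = 0" for x y
    proof -
      obtain a a' where "a \<in> carrier M" "x = N +> a" "\<kappa> a i = 0" "a' \<in> carrier M" "y = N +> a'" "\<kappa> a' i = 0"
        using h by blast
      then show ?thesis
        by (intro bexI[of _ "a \<oplus> a'"]) (simp_all add: k_simps a_rcos_sum)
    qed
    show "\<exists>a\<in>carrier M. s \<odot>\<^bsub>Q\<^esub> x = N +> a \<and> \<kappa> a i = 0" if x: "x \<in> K" for s x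
    proof -
      obtain a where a: "a \<in> carrier M" "x = N +> a" "\<kappa> a i = 0"
        using F(2)[OF x, of i] i x by blast
      then show ?thesis
        using linear_mapsD(3)[OF quot_linear, of a s] by (intro bexI[of _ "s \<odot> a"]) (simp_all add: k_simps)
    qed
  qed
  then obtain a where "a \<in> carrier M" "N +> b i = N +> a" "\<kappa> a i = 0" by blast
  then have "\<kappa> (b i) i = 0" using coset_eq_k[OF b_closed] by simp
  then show False by (simp add: k_b c_nz)
qed

end


section \<open>The calculus\<close>

context affine_curvature begin

text \<open>The form factor is contracted with \<open>vol\<close>, which takes the value 1 on
  \<omega>; what remains are the coefficients of the S(V) factor.\<close>

definition hco :: "hform \<Rightarrow> nat \<times> nat \<Rightarrow> complex" where
  "hco z i = tens_sum complex_alg (\<lambda>x t. vol x * scoef t i) z"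

lemma hco_bilin: "bilin HH SA complex_alg (\<lambda>x t. vol x * scoef t i)"
proof (rule bilinI)
  have v: "vol (x \<oplus>\<^bsub>HH\<^esub> y) = vol x + vol y" "vol (s \<odot>\<^bsub>HH\<^esub> x) = s * vol x"
    if "x \<in> carrier HH" "y \<in> carrier HH" for x y s
    using that HH_mem linear_mapsD(2,3)[OF vol_linear] by (simp_all add: hor_simps)
  fix x x' t t' r assume "x \<in> carrier HH" "x' \<in> carrier HH" "t \<in> carrier SA" "t' \<in> carrier SA"
  then show "vol (x \<oplus>\<^bsub>HH\<^esub> x') * scoef t i = vol x * scoef t i \<oplus>\<^bsub>complex_alg\<^esub> vol x' * scoef t i"
    "vol x * scoef (t \<oplus>\<^bsub>SA\<^esub> t') i = vol x * scoef t i \<oplus>\<^bsub>complex_alg\<^esub> vol x * scoef t' i"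
    "vol (r \<odot>\<^bsub>HH\<^esub> x) * scoef t i = r \<odot>\<^bsub>complex_alg\<^esub> (vol x * scoef t i)"
    "vol x * scoef (r \<odot>\<^bsub>SA\<^esub> t) i = r \<odot>\<^bsub>complex_alg\<^esub> (vol x * scoef t i)"
    using linear_mapsD(2,3)[OF scoef_linear] by (simp_all add: v algebra_simps)
qed simp

lemma hco_linear: "hco \<in> linear_maps hpa fun_vec"
proof -
  interpret C: calg complex_alg by (rule calg_complex)
  note L = linear_mapsD[OF HS.tens_sum_linear[OF C.cvec_axioms hco_bilin]]
  show ?thesis by (rule linear_mapsI) (simp_all add: hco_def fun_eq_iff L hP_simps)
qed

lemma vol_omega: "vol \<omega> = 1"
  using vol_eta by (simp add: hgen_defs hor_simps ph_simps)

lemma hco_omega: "t \<in> carrier SA \<Longrightarrow> hco (hh \<omega> t) = scoef t"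
proof -
  interpret C: calg complex_alg by (rule calg_complex)
  assume "t \<in> carrier SA"
  then show ?thesis
    using HS.tens_sum_tens[OF C.cvec_axioms hco_bilin omega_closed]
    by (simp add: hco_def fun_eq_iff ht_eq vol_omega)
qed

text \<open>The counit term cancels the constant in \<open>KK\<close>, so that \<open>crd\<close> is
  diagonal on all monomials, including the powers of U. On the kernel of the counit it consists of
  the coefficients of \<rho> divided by W.\<close>

definition crd :: "aff_gen falg set \<Rightarrow> nat \<times> nat \<Rightarrow> complex" where
  "crd a i = hco (\<rho> a) i / W + Aff_counit \<mu> a * delta (0, 0) i"

lemma crd_linear: "crd \<in> linear_maps AA fun_vec"
  by (rule linear_mapsI)
    (simp_all add: crd_def fun_eq_iff linear_mapsD[OF rho_linear] linear_mapsD(2,3)[OF hco_linear] counitD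
      add_divide_distrib algebra_simps)

lemmas crdD = linear_mapsD(2,3)[OF crd_linear, simplified]

lemma crd_amon: "crd (amon n p q) = (\<lambda>i. m powi (- 2 * n) * complex_of_real (cc p q) * delta (p, q) i)"
  using W_nz omega_closed
  by (auto simp: crd_def fun_eq_iff rho_amon linear_mapsD(3)[OF hco_linear] hco_omega scoef_smon counit_amon
      KK_def delta_def)

text \<open>Coordinates see only the \<omega>-component of an element. This inclusion of the range
  is what allows vanishing coordinates to force \<rho> to vanish.\<close>

lemma rho_range: "a \<in> carrier AA \<Longrightarrow> \<exists>t\<in>carrier SA. \<rho> a = hh \<omega> t"
proof -
  assume "a \<in> carrier AA"
  then have "a \<in> lin_span AA (range (\<lambda>(n, p, q). amon n p q))" using A_span by simp
  then show ?thesis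
  proof (rule A.lin_span_induct)
    have "\<rho> \<zero>\<^bsub>AA\<^esub> = \<zero>\<^bsub>hpa\<^esub>" by (rule linear_maps_zero[OF rho_linear A.cvec_axioms hpa.cvec_axioms])
    moreover have "hh \<omega> \<zero>\<^bsub>SA\<^esub> = \<zero>\<^bsub>hpa\<^esub>"
      by (rule linear_maps_zero[OF hh_linear[OF omega_closed] S.cvec_axioms hpa.cvec_axioms])
    ultimately show "\<exists>t\<in>carrier SA. \<rho> \<zero>\<^bsub>AA\<^esub> = hh \<omega> t" by (intro bexI[of _ "\<zero>\<^bsub>SA\<^esub>"]) simp_all
    show "\<exists>t\<in>carrier SA. \<rho> (x \<oplus>\<^bsub>AA\<^esub> y) = hh \<omega> t"
      if xy: "x \<in> carrier AA" "y \<in> carrier AA" "\<exists>t\<in>carrier SA. \<rho> x = hh \<omega> t" "\<exists>t\<in>carrier SA. \<rho> y = hh \<omega> t" for x y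
    proof -
      obtain s t where "s \<in> carrier SA" "t \<in> carrier SA" "\<rho> x = hh \<omega> s" "\<rho> y = hh \<omega> t" using xy by blast
      then show ?thesis
        using xy linear_mapsD(2)[OF hh_linear[OF omega_closed]]
        by (intro bexI[of _ "s \<oplus>\<^bsub>SA\<^esub> t"]) (simp_all add: linear_mapsD[OF rho_linear])
    qed
    show "\<exists>t\<in>carrier SA. \<rho> (r \<odot>\<^bsub>AA\<^esub> x) = hh \<omega> t" if "x \<in> range (\<lambda>(n, p, q). amon n p q)" for r x
    proof -
      obtain n p q where x: "x = amon n p q" using \<open>x \<in> _\<close> by auto
      have "\<rho> (r \<odot>\<^bsub>AA\<^esub> x) = hh \<omega> ((r * KK n p q) \<odot>\<^bsub>SA\<^esub> smon (p, q))"
        using omega_closed by (simp add: x linear_mapsD[OF rho_linear] rho_amon hh_smult hpa.smult_smult)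
      then show ?thesis by blast
    qed
  qed auto
qed

lemma crd_kernel:
  assumes "a \<in> carrier AA" "Aff_counit \<mu> a = 0"
  shows "\<rho> a = \<zero>\<^bsub>hpa\<^esub> \<longleftrightarrow> crd a = (\<lambda>_. 0)"
proof
  assume "\<rho> a = \<zero>\<^bsub>hpa\<^esub>"
  then show "crd a = (\<lambda>_. 0)"
    using linear_maps_zero[OF hco_linear hpa.cvec_axioms cvec_fun_vec] assms by (simp add: crd_def fun_eq_iff)
next
  assume c: "crd a = (\<lambda>_. 0)"
  obtain t where t: "t \<in> carrier SA" "\<rho> a = hh \<omega> t" using rho_range assms by blast
  have "scoef t = (\<lambda>_. 0)"
    using c W_nz assms(2) by (simp add: crd_def fun_eq_iff t hco_omega)
  then have "t = \<zero>\<^bsub>SA\<^esub>" using scoef_inj t by blast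
  then show "\<rho> a = \<zero>\<^bsub>hpa\<^esub>"
    using t linear_maps_zero[OF hh_linear[OF omega_closed] S.cvec_axioms hpa.cvec_axioms] by simp
qed

lemma crd_finite: "a \<in> carrier AA \<Longrightarrow> \<exists>f :: nat \<times> nat \<Rightarrow>\<^sub>0 complex. crd a = lookup f"
proof -
  assume a: "a \<in> carrier AA"
  obtain t where t: "t \<in> carrier SA" "\<rho> a = hh \<omega> t" using rho_range a by blast
  obtain f where f: "scoef t = lookup f" using S_expand[OF t(1)] by blast
  obtain g where g: "\<And>i. lookup g i = 1 / W * lookup f i"
    using pm_scale_pointwise[of "\<lambda>_. 1 / W" f] by auto
  have "crd a = lookup (g + Poly_Mapping.single (0, 0) (Aff_counit \<mu> a))"
    by (rule ext)
      (simp add: crd_def t(2) hco_omega[OF t(1)] f lookup_add g lookup_single when_def delta_def)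
  then show ?thesis by (rule exI)
qed

abbreviation "CK \<equiv> counit_ker \<mu>"
abbreviation "RI \<equiv> calc_ideal \<mu> \<rho>"

lemma CK_simps [simp]:
  "carrier CK = {a \<in> carrier AA. Aff_counit \<mu> a = 0}" "add CK = add AA" "zero CK = zero AA"
  "module.smult CK = module.smult AA"
  by (simp_all add: counit_ker_def)

lemma counit_zero: "Aff_counit \<mu> \<zero>\<^bsub>AA\<^esub> = 0"
  using counitD(3)[OF A.zero_closed, of 0] by simp

lemma cvec_CK: "cvec CK"
proof -
  have inv: "\<exists>y\<in>carrier CK. y \<oplus>\<^bsub>CK\<^esub> x = \<zero>\<^bsub>CK\<^esub>" if "x \<in> carrier CK" for x
  proof -
    have "(- 1) \<odot>\<^bsub>AA\<^esub> x \<oplus>\<^bsub>AA\<^esub> x = \<zero>\<^bsub>AA\<^esub>" using that by (simp add: A.smult_minus_one A.l_neg)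
    then show ?thesis using that by (intro bexI[of _ "(- 1) \<odot>\<^bsub>AA\<^esub> x"]) (simp_all add: counitD)
  qed
  interpret abelian_group CK
    by (rule abelian_groupI) (use inv in \<open>simp_all add: counitD counit_zero A.a_ac\<close>)
  show ?thesis
    by unfold_locales (simp_all add: counitD A.smult_add_left A.smult_add_right A.smult_smult)
qed

abbreviation "U_diff \<equiv> aU \<mu> \<ominus>\<^bsub>AA\<^esub> aU_st \<mu>"

lemma U_diff_closed: "U_diff \<in> carrier AA" and counit_U_diff: "Aff_counit \<mu> U_diff = 0"
  by (simp_all add: a_minus_def A.smult_minus_one[symmetric] counitD)

definition z0 :: complex where "z0 = m powi (- 2) - m\<^sup>2"

lemma z0_nz: "z0 \<noteq> 0"
proof
  assume "z0 = 0"
  then have "m ^ 4 = 1" by (simp add: z0_def power_int_minus field_simps power_numeral_reduce)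
  then have "complex_of_real (\<mu> ^ 4) = complex_of_real 1" by simp
  then have "\<mu> ^ 4 = 1" unfolding of_real_eq_iff .
  then show False using mu_pow_ne1[of 4] by simp
qed

lemma crd_U_diff: "crd U_diff = (\<lambda>i. z0 * delta (0, 0) i)"
proof -
  have "aU \<mu> = amon 1 0 0" "aU_st \<mu> = amon (- 1) 0 0" by (simp_all add: amon_def A.up_1 A.up_m1)
  then show ?thesis
    by (simp add: a_minus_def A.smult_minus_one[symmetric] crdD crd_amon cc_simps z0_def fun_eq_iff algebra_simps)
qed

definition bb :: "nat \<times> nat \<Rightarrow> aff_gen falg set" where
  "bb i = (if i = (0, 0) then U_diff else amon 0 (fst i) (snd i))"

sublocale CQ: coord_quot CK RI crd bb "\<lambda>i. if i = (0, 0) then z0 else complex_of_real (cc (fst i) (snd i))"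
proof -
  interpret CK: cvec CK by (rule cvec_CK)
  show "coord_quot CK RI crd bb (\<lambda>i. if i = (0, 0) then z0 else complex_of_real (cc (fst i) (snd i)))"
  proof unfold_locales
    have "\<rho> \<zero>\<^bsub>AA\<^esub> = \<zero>\<^bsub>hpa\<^esub>" by (rule linear_maps_zero[OF rho_linear A.cvec_axioms hpa.cvec_axioms])
    then show "RI \<subseteq> carrier CK" "\<zero>\<^bsub>CK\<^esub> \<in> RI"
      "x \<in> RI \<Longrightarrow> y \<in> RI \<Longrightarrow> x \<oplus>\<^bsub>CK\<^esub> y \<in> RI" "x \<in> RI \<Longrightarrow> r \<odot>\<^bsub>CK\<^esub> x \<in> RI" for x y r
      by (auto simp: calc_ideal_def counitD counit_zero linear_mapsD[OF rho_linear])
    show "crd \<in> linear_maps CK fun_vec"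
      by (rule linear_mapsI) (simp_all add: crdD)
    show "x \<in> RI \<longleftrightarrow> crd x = (\<lambda>_. 0)" if "x \<in> carrier CK" for x
      using that crd_kernel by (simp add: calc_ideal_def)
    show "bb i \<in> carrier CK" for i
      by (cases i) (auto simp: bb_def U_diff_closed counit_U_diff counit_amon)
    show "crd (bb i) = (\<lambda>j. if j = i then (if i = (0, 0) then z0 else complex_of_real (cc (fst i) (snd i))) else 0)" for i
      by (auto simp: bb_def crd_U_diff crd_amon delta_def fun_eq_iff)
    show "(if i = (0, 0) then z0 else complex_of_real (cc (fst i) (snd i))) \<noteq> 0" for i
      using z0_nz cc_nz by simp
    show "\<exists>f :: nat \<times> nat \<Rightarrow>\<^sub>0 complex. crd x = lookup f" if "x \<in> carrier CK" for x
      using that crd_finite by simp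
  qed
qed

lemma coset_CK: "RI +>\<^bsub>AA\<^esub> a = RI +>\<^bsub>CK\<^esub> a"
  by (simp add: a_r_coset_def r_coset_def)

lemma pi_hat_ker: "a \<in> carrier AA \<Longrightarrow> Aff_counit \<mu> a = 0 \<Longrightarrow> pi_hat \<mu> \<rho> a = RI +>\<^bsub>CK\<^esub> a"
  by (simp add: pi_hat_def coset_CK a_minus_def)

lemma zeta_eq: "zeta \<mu> \<rho> = RI +>\<^bsub>CK\<^esub> U_diff"
  by (simp add: zeta_def pi_hat_ker U_diff_closed counit_U_diff)

lemma Ups_eq: "Ups_inv \<mu> \<rho> = CQ.Q"
  by (simp add: Ups_inv_def)

lemma basis_eq: "(\<lambda>(p, q). if p = 0 \<and> q = 0 then zeta \<mu> \<rho>
    else pi_hat \<mu> \<rho> ((aX [^]\<^bsub>AA\<^esub> p) \<otimes>\<^bsub>AA\<^esub> (aY [^]\<^bsub>AA\<^esub> q))) = (\<lambda>i. RI +>\<^bsub>CK\<^esub> bb i)"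
proof -
  have a: "(aX [^]\<^bsub>AA\<^esub> p) \<otimes>\<^bsub>AA\<^esub> (aY [^]\<^bsub>AA\<^esub> q) = amon 0 p q" for p q :: nat
    by (simp add: amon_def)
  show ?thesis
    by (auto simp: fun_eq_iff a bb_def zeta_eq pi_hat_ker counit_amon)
qed


subsection \<open>The action of S(V)\<close>

lemma amon_smon: "amon n p q \<otimes>\<^bsub>AA\<^esub> amon 0 i j = (1 / m\<^sup>2) ^ (q * i) \<odot>\<^bsub>AA\<^esub> amon n (p + i) (q + j)"
proof -
  have 1: "amon n p q \<otimes>\<^bsub>AA\<^esub> (aX [^]\<^bsub>AA\<^esub> i) = (1 / m\<^sup>2) ^ (q * i) \<odot>\<^bsub>AA\<^esub> amon n (p + i) q"
  proof (induction i)
    case (Suc i)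
    have "amon n p q \<otimes>\<^bsub>AA\<^esub> (aX [^]\<^bsub>AA\<^esub> Suc i) = (amon n p q \<otimes>\<^bsub>AA\<^esub> (aX [^]\<^bsub>AA\<^esub> i)) \<otimes>\<^bsub>AA\<^esub> aX"
      by (simp add: A.m_assoc)
    then show ?case
      by (simp add: Suc A.smult_mult_left amon_aX A.smult_smult power_add mult.commute)
  qed simp
  have 2: "amon n p q \<otimes>\<^bsub>AA\<^esub> (aY [^]\<^bsub>AA\<^esub> j) = amon n p (q + j)" for p q
  proof (induction j)
    case (Suc j)
    have "amon n p q \<otimes>\<^bsub>AA\<^esub> (aY [^]\<^bsub>AA\<^esub> Suc j) = (amon n p q \<otimes>\<^bsub>AA\<^esub> (aY [^]\<^bsub>AA\<^esub> j)) \<otimes>\<^bsub>AA\<^esub> aY"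
      by (simp add: A.m_assoc)
    then show ?case by (simp add: Suc amon_aY)
  qed simp
  have "amon n p q \<otimes>\<^bsub>AA\<^esub> amon 0 i j = (amon n p q \<otimes>\<^bsub>AA\<^esub> (aX [^]\<^bsub>AA\<^esub> i)) \<otimes>\<^bsub>AA\<^esub> (aY [^]\<^bsub>AA\<^esub> j)"
    by (simp add: amon_def[of 0] A.m_assoc)
  then show ?thesis by (simp add: 1 2 A.smult_mult_left)
qed

text \<open>Right multiplication by \<xi>^i and the j-th power of its adjoint in coordinates. The
  power of 1/\<mu>^2 comes from reordering, the quotient of constants replaces the diagonal
  coefficient of the source by that of the target, and the guards exclude truncated
  subtraction.\<close>

definition rmul :: "nat \<Rightarrow> nat \<Rightarrow> (nat \<times> nat \<Rightarrow> complex) \<Rightarrow> nat \<times> nat \<Rightarrow> complex" where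
  "rmul i j v = (\<lambda>(p, q). if i \<le> p \<and> j \<le> q then
     (1 / m\<^sup>2) ^ ((q - j) * i) * complex_of_real (cc p q / cc (p - i) (q - j)) * v (p - i, q - j) else 0)"

text \<open>The coordinates of the product depend on a only through \<open>crd a\<close>: the power
  of U enters both sides by the same factor. Hence the action of S(V) is well defined on the
  quotient.\<close>

lemma crd_mult_smon: "a \<in> carrier AA \<Longrightarrow> crd (a \<otimes>\<^bsub>AA\<^esub> amon 0 i j) = rmul i j (crd a)"
proof (rule A_linear_eq[OF cvec_fun_vec])
  have "(\<lambda>a. a \<otimes>\<^bsub>AA\<^esub> amon 0 i j) \<in> linear_maps AA AA"
    by (rule linear_mapsI) (simp_all add: A.l_distr A.smult_mult_left)
  then show "(\<lambda>a. crd (a \<otimes>\<^bsub>AA\<^esub> amon 0 i j)) \<in> linear_maps AA fun_vec"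
    by (rule linear_maps_comp[OF _ crd_linear])
  show "(\<lambda>a. rmul i j (crd a)) \<in> linear_maps AA fun_vec"
    by (rule linear_mapsI) (auto simp: crdD rmul_def fun_eq_iff algebra_simps add_divide_distrib)
  fix n p q
  show "crd (amon n p q \<otimes>\<^bsub>AA\<^esub> amon 0 i j) = rmul i j (crd (amon n p q))"
  proof (rule ext, clarify)
    fix p' q'
    show "crd (amon n p q \<otimes>\<^bsub>AA\<^esub> amon 0 i j) (p', q') = rmul i j (crd (amon n p q)) (p', q')"
      using cc_nz by (auto simp: amon_smon crdD crd_amon rmul_def delta_def)
  qed
qed

text \<open>When only the coordinate at the origin is present, \<open>rmul\<close> moves it to (i,
  j) without a reordering factor and multiplies it by \<open>cc i j / cc 0 0\<close>, where
  \<open>cc 0 0 = 1\<close>. Linearity extends this from monomials to S(V).\<close>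

lemma crd_mult_S:
  assumes "a \<in> carrier AA" "\<theta> \<in> carrier SA"
  shows "crd a = (\<lambda>i. s * delta (0, 0) i) \<Longrightarrow>
    crd (a \<otimes>\<^bsub>AA\<^esub> S_in_Aff \<mu> \<theta>) = (\<lambda>i. s * complex_of_real (cc (fst i) (snd i)) * scoef \<theta> i)"
proof (rule S_linear_eq[OF cvec_fun_vec _ _ _ assms(2)])
  have "(\<lambda>x. a \<otimes>\<^bsub>AA\<^esub> x) \<in> linear_maps AA AA"
    using assms by (intro linear_mapsI) (simp_all add: A.r_distr A.smult_mult_right)
  then show "(\<lambda>\<theta>. crd (a \<otimes>\<^bsub>AA\<^esub> S_in_Aff \<mu> \<theta>)) \<in> linear_maps SA fun_vec"
    by (intro linear_maps_comp[OF alg_homs_linear[OF S_in_Aff_hom] linear_maps_comp[OF _ crd_linear]])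
  show "(\<lambda>\<theta> i. s * complex_of_real (cc (fst i) (snd i)) * scoef \<theta> i) \<in> linear_maps SA fun_vec"
    using linear_mapsD(2,3)[OF scoef_linear] by (intro linear_mapsI) (auto simp: fun_eq_iff algebra_simps)
  assume c: "crd a = (\<lambda>i. s * delta (0, 0) i)"
  show "crd (a \<otimes>\<^bsub>AA\<^esub> S_in_Aff \<mu> (smon (p, q))) = (\<lambda>i. s * complex_of_real (cc (fst i) (snd i)) * scoef (smon (p, q)) i)"
    for p q
  proof (rule ext, clarify)
    fix p' q'
    show "crd (a \<otimes>\<^bsub>AA\<^esub> S_in_Aff \<mu> (smon (p, q))) (p', q') =
        s * complex_of_real (cc (fst (p', q')) (snd (p', q'))) * scoef (smon (p, q)) (p', q')"
      using assms(1) by (auto simp: S_in_Aff_smon crd_mult_smon c rmul_def delta_def scoef_smon cc_simps)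
  qed
qed

lemma S_in_Aff_closed: "\<theta> \<in> carrier SA \<Longrightarrow> S_in_Aff \<mu> \<theta> \<in> carrier AA"
  by (rule alg_homsD(1)[OF S_in_Aff_hom])

lemma counit_mult_S: "a \<in> carrier AA \<Longrightarrow> \<theta> \<in> carrier SA \<Longrightarrow> Aff_counit \<mu> a = 0 \<Longrightarrow> Aff_counit \<mu> (a \<otimes>\<^bsub>AA\<^esub> S_in_Aff \<mu> \<theta>) = 0"
  by (simp add: counitD S_in_Aff_closed)

text \<open>\<open>Ups_act\<close> is a union over all representatives q of \<zeta>. They share the
  coordinates of U - U^*, and by \<open>crd_mult_S\<close> so do their products with S(V), so a
  single coset results.\<close>

lemma zeta_act:
  assumes "\<theta> \<in> carrier SA"
  shows "Ups_act \<mu> \<rho> (zeta \<mu> \<rho>) (S_in_Aff \<mu> \<theta>) = RI +>\<^bsub>CK\<^esub> (U_diff \<otimes>\<^bsub>AA\<^esub> S_in_Aff \<mu> \<theta>)"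
proof -
  have U: "U_diff \<in> carrier CK" by (simp add: U_diff_closed counit_U_diff)
  note S = S_in_Aff_closed[OF assms]
  have "pi_hat \<mu> \<rho> (q \<otimes>\<^bsub>AA\<^esub> S_in_Aff \<mu> \<theta>) = RI +>\<^bsub>CK\<^esub> (U_diff \<otimes>\<^bsub>AA\<^esub> S_in_Aff \<mu> \<theta>)"
    if "q \<in> zeta \<mu> \<rho>" for q
  proof -
    have q: "q \<in> carrier CK" "RI +>\<^bsub>CK\<^esub> q = RI +>\<^bsub>CK\<^esub> U_diff"
      using CQ.coset_memD[OF that[unfolded zeta_eq] U] by blast+
    have "crd q = crd U_diff" using q CQ.coset_eq_k[OF q(1) U] by blast
    then have "crd (q \<otimes>\<^bsub>AA\<^esub> S_in_Aff \<mu> \<theta>) = crd (U_diff \<otimes>\<^bsub>AA\<^esub> S_in_Aff \<mu> \<theta>)"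
      using q(1) assms crd_mult_S U_diff_closed by (simp add: crd_U_diff)
    then have "RI +>\<^bsub>CK\<^esub> (q \<otimes>\<^bsub>AA\<^esub> S_in_Aff \<mu> \<theta>) = RI +>\<^bsub>CK\<^esub> (U_diff \<otimes>\<^bsub>AA\<^esub> S_in_Aff \<mu> \<theta>)"
      using q(1) assms S by (subst CQ.coset_eq_k) (simp_all add: counit_mult_S U_diff_closed counit_U_diff)
    then show ?thesis using q(1) assms S by (simp add: pi_hat_ker counit_mult_S)
  qed
  then have "(\<lambda>q. pi_hat \<mu> \<rho> (q \<otimes>\<^bsub>AA\<^esub> S_in_Aff \<mu> \<theta>)) ` zeta \<mu> \<rho> = {RI +>\<^bsub>CK\<^esub> (U_diff \<otimes>\<^bsub>AA\<^esub> S_in_Aff \<mu> \<theta>)}"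
    by (intro image_constant_eq[of U_diff]) (simp_all add: zeta_eq CQ.coset_self[OF U])
  from arg_cong[OF this, of Union] show ?thesis unfolding Ups_act_def by (simp only: Sup_insert Sup_empty sup_bot_right)
qed

text \<open>Acting on \<zeta> with a combination of monomials multiplies each coefficient by the
  nonzero number \<open>z0 * cc p q\<close>. Dividing the coordinates of a given class by these
  numbers produces the required element of S(V).\<close>

lemma zeta_cyclic: "{Ups_act \<mu> \<rho> (zeta \<mu> \<rho>) (S_in_Aff \<mu> \<theta>) | \<theta>. \<theta> \<in> carrier SA} = carrier CQ.Q"
proof (intro equalityI subsetI)
  fix x assume "x \<in> {Ups_act \<mu> \<rho> (zeta \<mu> \<rho>) (S_in_Aff \<mu> \<theta>) | \<theta>. \<theta> \<in> carrier SA}"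
  then obtain \<theta> where t: "\<theta> \<in> carrier SA" "x = RI +>\<^bsub>CK\<^esub> (U_diff \<otimes>\<^bsub>AA\<^esub> S_in_Aff \<mu> \<theta>)"
    using zeta_act by auto
  have "U_diff \<otimes>\<^bsub>AA\<^esub> S_in_Aff \<mu> \<theta> \<in> carrier CK"
    using t(1) by (simp add: S_in_Aff_closed counit_mult_S U_diff_closed counit_U_diff)
  then show "x \<in> carrier CQ.Q" unfolding t(2) CQ.quot_simps by (rule imageI)
next
  fix x assume "x \<in> carrier CQ.Q"
  then obtain a where a: "a \<in> carrier CK" "x = RI +>\<^bsub>CK\<^esub> a" unfolding CQ.quot_simps by blast
  obtain g where g: "crd a = lookup g" using CQ.k_finite[OF a(1)] by blast
  obtain f where f: "\<And>i. lookup f i = 1 / (z0 * complex_of_real (cc (fst i) (snd i))) * lookup g i"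
    using pm_scale_pointwise[of "\<lambda>i. 1 / (z0 * complex_of_real (cc (fst i) (snd i)))" g] by blast
  let ?t = "pm_sum SA smon f"
  have t: "?t \<in> carrier SA" by (rule S.pm_sum_closed) simp
  have "crd (U_diff \<otimes>\<^bsub>AA\<^esub> S_in_Aff \<mu> ?t) = crd a"
    unfolding crd_mult_S[OF U_diff_closed t crd_U_diff] scoef_pm_sum f g
    using z0_nz cc_nz by (simp add: fun_eq_iff)
  moreover have "U_diff \<otimes>\<^bsub>AA\<^esub> S_in_Aff \<mu> ?t \<in> carrier CK"
    using t by (simp add: S_in_Aff_closed counit_mult_S U_diff_closed counit_U_diff)
  ultimately have "x = Ups_act \<mu> \<rho> (zeta \<mu> \<rho>) (S_in_Aff \<mu> ?t)"
    using a t CQ.coset_eq_k by (simp only: zeta_act)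
  then show "x \<in> {Ups_act \<mu> \<rho> (zeta \<mu> \<rho>) (S_in_Aff \<mu> \<theta>) | \<theta>. \<theta> \<in> carrier SA}" using t by blast
qed

lemma zeta_separating:
  assumes "\<theta> \<in> carrier SA" "Ups_act \<mu> \<rho> (zeta \<mu> \<rho>) (S_in_Aff \<mu> \<theta>) = \<zero>\<^bsub>CQ.Q\<^esub>"
  shows "\<theta> = \<zero>\<^bsub>SA\<^esub>"
proof -
  have U: "U_diff \<otimes>\<^bsub>AA\<^esub> S_in_Aff \<mu> \<theta> \<in> carrier CK"
    using assms(1) by (simp add: S_in_Aff_closed counit_mult_S U_diff_closed counit_U_diff)
  then have "crd (U_diff \<otimes>\<^bsub>AA\<^esub> S_in_Aff \<mu> \<theta>) = (\<lambda>_. 0)"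
    using assms(2) CQ.coset_eq_N_iff[OF U] CQ.k_kernel[OF U] by (simp only: zeta_act assms(1) CQ.quot_simps)
  then have "scoef \<theta> = (\<lambda>_. 0)"
    using z0_nz cc_nz unfolding crd_mult_S[OF U_diff_closed assms(1) crd_U_diff] by (simp add: fun_eq_iff)
  then show ?thesis using scoef_inj assms(1) by blast
qed

lemma rho_formula:
  assumes "p + q > 0"
  shows "\<rho> ((aX [^]\<^bsub>AA\<^esub> p) \<otimes>\<^bsub>AA\<^esub> (aY [^]\<^bsub>AA\<^esub> q)) = complex_of_real (cc p q) \<odot>\<^bsub>hpa\<^esub>
    hh (complex_of_real (\<mu> ^ 3 / (1 - \<mu>\<^sup>2)) \<odot>\<^bsub>HH\<^esub> \<omega>) ((X [^]\<^bsub>SA\<^esub> p) \<otimes>\<^bsub>SA\<^esub> (Y [^]\<^bsub>SA\<^esub> q))"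
proof -
  have "(aX [^]\<^bsub>AA\<^esub> p) \<otimes>\<^bsub>AA\<^esub> (aY [^]\<^bsub>AA\<^esub> q) = amon 0 p q" by (simp add: amon_def)
  moreover have "(X [^]\<^bsub>SA\<^esub> p) \<otimes>\<^bsub>SA\<^esub> (Y [^]\<^bsub>SA\<^esub> q) = smon (p, q)" by (simp add: smon_def)
  moreover have "KK 0 p q = complex_of_real (cc p q) * complex_of_real (\<mu> ^ 3 / (1 - \<mu>\<^sup>2))"
    using assms by (auto simp: KK_def W_def)
  ultimately show ?thesis
    using omega_closed by (simp only: rho_amon hh_smult smon_closed hpa.smult_smult hh_mem)
qed

end

theorem proposition4p1:
  fixes \<mu> :: real
    and H :: "hform \<Rightarrow> ((hform \<times> aff_gen falg set) \<Rightarrow>\<^sub>0 complex) set"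
    and nabla :: "hform \<Rightarrow> hform"
    and \<rho> :: "aff_gen falg set \<Rightarrow> hform"
  assumes "-1 < \<mu>" and "\<mu> < 1" and "\<mu> \<noteq> 0"
    and "affine_coaction \<mu> H"
    and "affine_derivative \<mu> nabla"
    and "curvature_map \<mu> H nabla \<rho>"
  shows "(\<forall>p q :: nat. p + q > 0 \<longrightarrow>
            \<rho> ((axi \<mu> [^]\<^bsub>Aff \<mu>\<^esub> p) \<otimes>\<^bsub>Aff \<mu>\<^esub> (axi_st \<mu> [^]\<^bsub>Aff \<mu>\<^esub> q)) =
              complex_of_real ((\<Prod>i=1..p. 1 - 1 / \<mu> ^ (2 * i + 2)) * (\<Prod>j=1..q. 1 - \<mu> ^ (2 * j + 2)))
              \<odot>\<^bsub>hP \<mu>\<^esub>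
              ht \<mu> (complex_of_real (\<mu> ^ 3 / (1 - \<mu>\<^sup>2))
                       \<odot>\<^bsub>hor \<mu>\<^esub> (eta_minus \<mu> \<otimes>\<^bsub>hor \<mu>\<^esub> eta_plus \<mu>))
                   ((xi \<mu> [^]\<^bsub>Salg \<mu>\<^esub> p) \<otimes>\<^bsub>Salg \<mu>\<^esub> (xi_st \<mu> [^]\<^bsub>Salg \<mu>\<^esub> q)))
       \<and> \<not> finite_dimensional (Ups_inv \<mu> \<rho>)
       \<and> basis_family (Ups_inv \<mu> \<rho>)
            (\<lambda>(p :: nat, q :: nat).
               if p = 0 \<and> q = 0 then zeta \<mu> \<rho>
               else pi_hat \<mu> \<rho> ((axi \<mu> [^]\<^bsub>Aff \<mu>\<^esub> p) \<otimes>\<^bsub>Aff \<mu>\<^esub> (axi_st \<mu> [^]\<^bsub>Aff \<mu>\<^esub> q)))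
       \<and> {Ups_act \<mu> \<rho> (zeta \<mu> \<rho>) (S_in_Aff \<mu> \<theta>) | \<theta>. \<theta> \<in> carrier (Salg \<mu>)} = carrier (Ups_inv \<mu> \<rho>)
       \<and> (\<forall>\<theta>\<in>carrier (Salg \<mu>).
            Ups_act \<mu> \<rho> (zeta \<mu> \<rho>) (S_in_Aff \<mu> \<theta>) = \<zero>\<^bsub>Ups_inv \<mu> \<rho>\<^esub> \<longrightarrow> \<theta> = \<zero>\<^bsub>Salg \<mu>\<^esub>)"
proof -
  interpret affine_curvature \<mu> H nabla \<rho>
    using assms by (intro affine_curvature.intro muq.intro affine_curvature_axioms.intro)
  have inf: "infinite (UNIV :: (nat \<times> nat) set)" by (simp add: finite_prod)
  show ?thesis
    unfolding basis_eq cc_def[symmetric] Ups_eq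
    by (intro conjI allI impI ballI rho_formula CQ.infinite_dimensional_quot[OF inf] CQ.basis_quot
        zeta_cyclic zeta_separating)
qed

end
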